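(* Let $G$ be a torsion-free abelian group of finite rank, $k$ a field, $F$ a $G$-graded field over $k$, and $r$ a positive integer. Then: (1) There is a $G$-graded field $F'$ over $k$ with $F'^r\cong F$ (as $G$-graded $k$-algebras). (2) Every class in $H^2_S(G,k^* )$ is $r$-divisible. (3) There is a $\mathbb{Q}^*$-action on $H^2_S(G,k^* )/\operatorname{Tor}(H^2_S(G,k^* ))$ which makes it a $\mathbb{Q}$-vector space. (4) If $G$ is not finitely generated, then the set of Noetherian classes in $H^2_S(G,k^* )$ is a union of cosets of the subgroup $\operatorname{Tor}(H^2_S(G,k^* ))$. Moreover, the image of the set of Noetherian classes in the $\mathbb{Q}$-vector space $H^2_S(G,k^* )/\operatorname{Tor}(H^2_S(G,k^* ))$ is a union of lines with the origin removed, i.e. of sets $L\setminus\{0\}$ with $L$ a one-dimensional $\mathbb{Q}$-subspace.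
   Context: The rank of $G$ is $\dim_{\mathbb{Q}}(\mathbb{Q}\otimes_{\mathbb{Z}}G)$. A $G$-graded field over $k$ is a commutative $G$-graded ring $F=\bigoplus_{g\in G}F_g$ with $F_0=k$, $F_g\neq 0$ for all $g\in G$, in which every nonzero homogeneous element is invertible; then each $F_g$ is one-dimensional over $k$. For a nonzero integer $r$, $F^r$ denotes the $G$-graded field whose underlying ring is the subring $F_{rG}=\bigoplus_{g\in rG}F_g$ of $F$, with $(F^r)_g=F_{rg}$ for $g\in G$. Let $A$ be an abelian group (written additively) with trivial $G$-action. $Z^2(G,A)$ is the group of functions $\varphi:G\times G\to A$ with $\varphi(g,h)-\varphi(f+g,h)+\varphi(f,g+h)-\varphi(f,g)=0$ for all $f,g,h\in G$; $B^2(G,A)\subset Z^2(G,A)$ is the subgroup of functions $(f,g)\mapsto\beta(g)-\beta(f+g)+\beta(f)$ with $\beta:G\to A$ any function; $H^2(G,A)=Z^2(G,A)/B^2(G,A)$. $Z^2_S(G,A)$ and $B^2_S(G,A)$ are the subgroups of those $\varphi$ in $Z^2(G,A)$, respectively $B^2(G,A)$, with $\varphi(g,h)=\varphi(h,g)$ for all $g,h$, and $H^2_S(G,A)=Z^2_S(G,A)/B^2_S(G,A)$, a subgroup of $H^2(G,A)$. Here $A=k^*$ is the multiplicative group of $k$ with trivial $G$-action. For $c\in H^2_S(G,k^* )$ represented by $\tilde c\in Z^2_S(G,k^* )$, $k[G,c]$ is the $G$-graded field over $k$ given by $\bigoplus_{g\in G}kx_g$ with $k$-bilinear multiplication $x_gx_h=\tilde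 c(g,h)x_{g+h}$; up to isomorphism it depends only on $c$. A class $c\in H^2_S(G,k^* )$ is Noetherian if $k[G,c]$ is a Noetherian ring. For an abelian group $H$, $\operatorname{Tor}(H)$ is its torsion subgroup; a class is $r$-divisible if it is $r$ times some element. *)

theory Defs
  imports "HOL-Algebra.Algebra" "HOL-Algebra.Algebraic_Closure_Type"
begin

section \<open>Vector spaces and the rank of an abelian group\<close>

abbreviation rat_field :: "rat ring"
  where "rat_field \<equiv> ring_of_type_algebra"

text \<open>\<open>has_dimension R M n\<close>: the \<open>R\<close>-module \<open>M\<close> has a basis consisting of \<open>n\<close> elements.
  Coefficient families are extensional, so that \<open>\<exists>!\<close> expresses linear independence.\<close>

definition has_dimension ::
    "('r, 'a) ring_scheme \<Rightarrow> ('r, 'm, 'b) module_scheme \<Rightarrow> nat \<Rightarrow> bool"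
  where "has_dimension R M n \<longleftrightarrow>
    (\<exists>B. B \<subseteq> carrier M \<and> finite B \<and> card B = n \<and>
      (\<forall>x\<in>carrier M. \<exists>!a. a \<in> B \<rightarrow>\<^sub>E carrier R \<and> x = (\<Oplus>\<^bsub>M\<^esub>b\<in>B. a b \<odot>\<^bsub>M\<^esub> b)))"

text \<open>Abelian groups \<open>G\<close> are \<open>comm_group\<close>s and hence written multiplicatively: \<open>g \<otimes> h\<close> stands for
  \<open>g + h\<close>, \<open>\<one>\<close> for \<open>0\<close>, and \<open>g [^] n\<close> for \<open>n g\<close>.

  \<open>extend_scalars R G\<close> is the \<open>R\<close>-module \<open>R \<otimes>\<^sub>\<int> G\<close>: the free abelian group on the pairs
  \<open>(p, g)\<close> modulo the biadditivity relations, where \<open>r\<close> acts by \<open>p \<otimes> g \<mapsto> (r p) \<otimes> g\<close>.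
  Its elements are cosets; since the image of a coset under this map need not be a full coset,
  the relations are added to it again. The \<open>mult\<close> and \<open>one\<close> fields are irrelevant for modules.\<close>

definition pairs_group ::
    "('r, 'a) ring_scheme \<Rightarrow> ('g, 'b) monoid_scheme \<Rightarrow> ('r \<times> 'g \<Rightarrow>\<^sub>0 int) monoid"
  where "pairs_group R G = free_Abelian_group (carrier R \<times> carrier G)"

definition tensor_relations ::
    "('r, 'a) ring_scheme \<Rightarrow> ('g, 'b) monoid_scheme \<Rightarrow> ('r \<times> 'g \<Rightarrow>\<^sub>0 int) set"
  where "tensor_relations R G = generate (pairs_group R G)
    ({frag_of (p \<oplus>\<^bsub>R\<^esub> q, g) - frag_of (p, g) - frag_of (q, g) | p q g.
        p \<in> carrier R \<and> q \<in> carrier R \<and> g \<in> carrier G} \<union>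
     {frag_of (p, g \<otimes>\<^bsub>G\<^esub> h) - frag_of (p, g) - frag_of (p, h) | p g h.
        p \<in> carrier R \<and> g \<in> carrier G \<and> h \<in> carrier G})"

definition extend_scalars ::
    "('r, 'a) ring_scheme \<Rightarrow> ('g, 'b) monoid_scheme \<Rightarrow> ('r, ('r \<times> 'g \<Rightarrow>\<^sub>0 int) set) module"
  where "extend_scalars R G =
    (let T = pairs_group R G Mod tensor_relations R G in
     \<lparr>carrier = carrier T, monoid.mult = monoid.mult T, one = one T, ring.zero = one T, add = monoid.mult T,
      module.smult = (\<lambda>r Y. tensor_relations R G <#>\<^bsub>pairs_group R G\<^esub>
                 frag_extend (\<lambda>(p, g). frag_of (r \<otimes>\<^bsub>R\<^esub> p, g)) ` Y)\<rparr>)"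

definition finite_rank :: "('g, 'b) monoid_scheme \<Rightarrow> bool"
  where "finite_rank G \<longleftrightarrow> (\<exists>n. has_dimension rat_field (extend_scalars rat_field G) n)"

definition torsion :: "('g, 'b) monoid_scheme \<Rightarrow> 'g set"
  where "torsion G = {x \<in> carrier G. \<exists>n::nat. n > 0 \<and> x [^]\<^bsub>G\<^esub> n = \<one>\<^bsub>G\<^esub>}"

definition torsion_free :: "('g, 'b) monoid_scheme \<Rightarrow> bool"
  where "torsion_free G \<longleftrightarrow> torsion G = {\<one>\<^bsub>G\<^esub>}"

definition finitely_generated :: "('g, 'b) monoid_scheme \<Rightarrow> bool"
  where "finitely_generated G \<longleftrightarrow> (\<exists>S \<subseteq> carrier G. finite S \<and> generate G S = carrier G)"

definition divisible_by :: "('g, 'b) monoid_scheme \<Rightarrow> nat \<Rightarrow> 'g \<Rightarrow> bool"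
  where "divisible_by G r x \<longleftrightarrow> (\<exists>y\<in>carrier G. x = y [^]\<^bsub>G\<^esub> r)"

text \<open>The abelian group \<open>H\<close>, written additively, with scalars \<open>q \<noteq> 0\<close> acting through \<open>\<phi>\<close> and
  \<open>0\<close> acting as zero.\<close>

definition module_of_action ::
    "('a, 'b) monoid_scheme \<Rightarrow> (rat \<Rightarrow> 'a \<Rightarrow> 'a) \<Rightarrow> (rat, 'a) module"
  where "module_of_action H \<phi> =
    \<lparr>carrier = carrier H, monoid.mult = monoid.mult H, one = one H, ring.zero = one H, add = monoid.mult H,
     module.smult = (\<lambda>q x. if q = 0 then \<one>\<^bsub>H\<^esub> else \<phi> q x)\<rparr>"

definition vector_space_action ::
    "('a, 'b) monoid_scheme \<Rightarrow> (rat \<Rightarrow> 'a \<Rightarrow> 'a) \<Rightarrow> bool"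
  where "vector_space_action H \<phi> \<longleftrightarrow>
    group_action (units_of rat_field) (carrier H) \<phi> \<and>
    module rat_field (module_of_action H \<phi>)"

definition line :: "(rat, 'a, 'b) module_scheme \<Rightarrow> 'a set \<Rightarrow> bool"
  where "line V L \<longleftrightarrow> submodule L rat_field V \<and> has_dimension rat_field (V\<lparr>carrier := L\<rparr>) 1"


section \<open>Graded fields\<close>

record ('k, 'f, 'g) graded_algebra = "('k, 'f) module" +
  component :: "'g \<Rightarrow> 'f set"

text \<open>The identification \<open>F\<^sub>0 = k\<close> is made through the structure map \<open>c \<mapsto> c \<odot> \<one>\<close> of the
  \<open>k\<close>-algebra \<open>F\<close>.\<close>

locale graded_field =
  G: comm_group G + K: field K + algebra K F
  for G :: "('g, 'a) monoid_scheme" and K :: "('k, 'b) ring_scheme"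
    and F :: "('k, 'f, 'g, 'c) graded_algebra_scheme" +
  assumes component_subgroup:
      "g \<in> carrier G \<Longrightarrow> additive_subgroup (component F g) F"
    and component_mult:
      "\<lbrakk>g \<in> carrier G; h \<in> carrier G; x \<in> component F g; y \<in> component F h\<rbrakk>
        \<Longrightarrow> x \<otimes>\<^bsub>F\<^esub> y \<in> component F (g \<otimes>\<^bsub>G\<^esub> h)"
    and direct_sum:
      "x \<in> carrier F \<Longrightarrow>
        \<exists>!a. a \<in> (\<Pi>\<^sub>E g\<in>carrier G. component F g) \<and>
             finite {g \<in> carrier G. a g \<noteq> \<zero>\<^bsub>F\<^esub>} \<and>
             x = (\<Oplus>\<^bsub>F\<^esub>g\<in>{g \<in> carrier G. a g \<noteq> \<zero>\<^bsub>F\<^esub>}. a g)"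
    and component_zero:
      "bij_betw (\<lambda>c. c \<odot>\<^bsub>F\<^esub> \<one>\<^bsub>F\<^esub>) (carrier K) (component F \<one>\<^bsub>G\<^esub>)"
    and component_nonzero:
      "g \<in> carrier G \<Longrightarrow> component F g \<noteq> {\<zero>\<^bsub>F\<^esub>}"
    and homogeneous_invertible:
      "\<lbrakk>g \<in> carrier G; x \<in> component F g; x \<noteq> \<zero>\<^bsub>F\<^esub>\<rbrakk> \<Longrightarrow> x \<in> Units F"

definition graded_algebra_iso ::
    "('g, 'a) monoid_scheme \<Rightarrow> ('k, 'b) ring_scheme \<Rightarrow> ('k, 'e, 'g, 'c) graded_algebra_scheme \<Rightarrow>
     ('k, 'f, 'g, 'd) graded_algebra_scheme \<Rightarrow> ('e \<Rightarrow> 'f) set"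
  where "graded_algebra_iso G K E F =
    {\<phi> \<in> ring_iso E F.
      (\<forall>c\<in>carrier K. \<forall>x\<in>carrier E. \<phi> (c \<odot>\<^bsub>E\<^esub> x) = c \<odot>\<^bsub>F\<^esub> \<phi> x) \<and>
      (\<forall>g\<in>carrier G. \<phi> ` component E g = component F g)}"

text \<open>\<open>graded_power G r F\<close> is \<open>F\<^sup>r\<close>: the subring \<open>\<Oplus>\<^bsub>g \<in> rG\<^esub> F\<^sub>g\<close>, regraded by
  \<open>(F\<^sup>r)\<^sub>g = F\<^bsub>rg\<^esub>\<close>.\<close>

definition graded_power ::
    "('g, 'a) monoid_scheme \<Rightarrow> int \<Rightarrow> ('k, 'f, 'g) graded_algebra \<Rightarrow> ('k, 'f, 'g) graded_algebra"
  where "graded_power G r F = F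
    \<lparr>carrier := {\<Oplus>\<^bsub>F\<^esub>g\<in>S. a g | S a. finite S \<and> S \<subseteq> (\<lambda>g. g [^]\<^bsub>G\<^esub> r) ` carrier G \<and>
                   a \<in> (\<Pi> g\<in>S. component F g)},
     component := (\<lambda>g. component F (g [^]\<^bsub>G\<^esub> r))\<rparr>"


section \<open>Symmetric 2-cocycles\<close>

text \<open>The coefficient group \<open>A\<close> is written multiplicatively and carries the trivial action.\<close>

definition cochains2 ::
    "('g, 'a) monoid_scheme \<Rightarrow> ('m, 'b) monoid_scheme \<Rightarrow> ('g \<times> 'g \<Rightarrow> 'm) monoid"
  where "cochains2 G A = product_group (carrier G \<times> carrier G) (\<lambda>_. A)"

definition Z2 :: "('g, 'a) monoid_scheme \<Rightarrow> ('m, 'b) monoid_scheme \<Rightarrow> ('g \<times> 'g \<Rightarrow> 'm) set"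
  where "Z2 G A = {\<phi> \<in> carrier (cochains2 G A).
    \<forall>f\<in>carrier G. \<forall>g\<in>carrier G. \<forall>h\<in>carrier G.
      \<phi> (g, h) \<otimes>\<^bsub>A\<^esub> inv\<^bsub>A\<^esub> \<phi> (f \<otimes>\<^bsub>G\<^esub> g, h) \<otimes>\<^bsub>A\<^esub> \<phi> (f, g \<otimes>\<^bsub>G\<^esub> h) \<otimes>\<^bsub>A\<^esub> inv\<^bsub>A\<^esub> \<phi> (f, g) = \<one>\<^bsub>A\<^esub>}"

definition B2 :: "('g, 'a) monoid_scheme \<Rightarrow> ('m, 'b) monoid_scheme \<Rightarrow> ('g \<times> 'g \<Rightarrow> 'm) set"
  where "B2 G A = {\<phi> \<in> carrier (cochains2 G A).
    \<exists>\<beta>\<in>carrier G \<rightarrow> carrier A. \<forall>f\<in>carrier G. \<forall>g\<in>carrier G.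
      \<phi> (f, g) = \<beta> g \<otimes>\<^bsub>A\<^esub> inv\<^bsub>A\<^esub> \<beta> (f \<otimes>\<^bsub>G\<^esub> g) \<otimes>\<^bsub>A\<^esub> \<beta> f}"

definition symmetric_cochains2 ::
    "('g, 'a) monoid_scheme \<Rightarrow> ('m, 'b) monoid_scheme \<Rightarrow> ('g \<times> 'g \<Rightarrow> 'm) set"
  where "symmetric_cochains2 G A = {\<phi> \<in> carrier (cochains2 G A).
    \<forall>g\<in>carrier G. \<forall>h\<in>carrier G. \<phi> (g, h) = \<phi> (h, g)}"

definition Z2S :: "('g, 'a) monoid_scheme \<Rightarrow> ('m, 'b) monoid_scheme \<Rightarrow> ('g \<times> 'g \<Rightarrow> 'm) set"
  where "Z2S G A = Z2 G A \<inter> symmetric_cochains2 G A"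

definition B2S :: "('g, 'a) monoid_scheme \<Rightarrow> ('m, 'b) monoid_scheme \<Rightarrow> ('g \<times> 'g \<Rightarrow> 'm) set"
  where "B2S G A = B2 G A \<inter> symmetric_cochains2 G A"

definition H2S ::
    "('g, 'a) monoid_scheme \<Rightarrow> ('m, 'b) monoid_scheme \<Rightarrow> ('g \<times> 'g \<Rightarrow> 'm) set monoid"
  where "H2S G A = (cochains2 G A)\<lparr>carrier := Z2S G A\<rparr> Mod B2S G A"


section \<open>Noetherian classes\<close>

text \<open>\<open>k[G,c] = \<Oplus>\<^sub>g k x\<^sub>g\<close> with \<open>x\<^sub>g x\<^sub>h = c(g,h) x\<^bsub>g+h\<^esub>\<close>: the element \<open>\<Sum>\<^sub>g a\<^sub>g x\<^sub>g\<close> is represented by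
  the finitely supported function \<open>a\<close>. Cocycles are not assumed normalized; by the cocycle
  identity \<open>c(0,g) = c(0,0)\<close>, so the unit is \<open>c(0,0)\<^sup>-\<^sup>1 x\<^sub>0\<close>.\<close>

definition twisted_carrier ::
    "('g, 'a) monoid_scheme \<Rightarrow> ('k, 'b) ring_scheme \<Rightarrow> ('g \<Rightarrow> 'k) set"
  where "twisted_carrier G K =
    {a \<in> carrier G \<rightarrow>\<^sub>E carrier K. finite {g \<in> carrier G. a g \<noteq> \<zero>\<^bsub>K\<^esub>}}"

definition twisted_group_algebra ::
    "('g, 'a) monoid_scheme \<Rightarrow> ('k, 'b) ring_scheme \<Rightarrow> ('g \<times> 'g \<Rightarrow> 'k) \<Rightarrow>
     ('k, 'g \<Rightarrow> 'k, 'g) graded_algebra"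
  where "twisted_group_algebra G K c =
    \<lparr>carrier = twisted_carrier G K,
     monoid.mult = (\<lambda>a b. \<lambda>f\<in>carrier G.
       \<Oplus>\<^bsub>K\<^esub>u \<in> {u \<in> carrier G \<times> carrier G.
                a (fst u) \<noteq> \<zero>\<^bsub>K\<^esub> \<and> b (snd u) \<noteq> \<zero>\<^bsub>K\<^esub> \<and> fst u \<otimes>\<^bsub>G\<^esub> snd u = f}.
         c u \<otimes>\<^bsub>K\<^esub> (a (fst u) \<otimes>\<^bsub>K\<^esub> b (snd u))),
     one = (\<lambda>g\<in>carrier G. if g = \<one>\<^bsub>G\<^esub> then inv\<^bsub>K\<^esub> c (\<one>\<^bsub>G\<^esub>, \<one>\<^bsub>G\<^esub>) else \<zero>\<^bsub>K\<^esub>),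
     ring.zero = (\<lambda>g\<in>carrier G. \<zero>\<^bsub>K\<^esub>),
     add = (\<lambda>a b. \<lambda>g\<in>carrier G. a g \<oplus>\<^bsub>K\<^esub> b g),
     module.smult = (\<lambda>s a. \<lambda>g\<in>carrier G. s \<otimes>\<^bsub>K\<^esub> a g),
     component = (\<lambda>g. {a \<in> twisted_carrier G K. \<forall>h\<in>carrier G. h \<noteq> g \<longrightarrow> a h = \<zero>\<^bsub>K\<^esub>})\<rparr>"

text \<open>An element \<open>C\<close> of \<open>H2S\<close> is a coset, i.e. the set of its representing cocycles. Up to
  isomorphism the algebra does not depend on the representative, so any one may be used.\<close>

definition noetherian_classes ::
    "('g, 'a) monoid_scheme \<Rightarrow> ('k, 'b) ring_scheme \<Rightarrow> ('g \<times> 'g \<Rightarrow> 'k) set set"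
  where "noetherian_classes G K =
    {C \<in> carrier (H2S G (units_of K)). \<exists>c\<in>C. noetherian_ring (twisted_group_algebra G K c)}"

end

theory Submission
  imports Defs
begin

text \<open>Embed \<open>k\<^sup>*\<close> into the divisible group \<open>D\<close> of units of an algebraic closure. Over \<open>D\<close> every symmetric
  cocycle \<open>c\<close> is the coboundary of some \<open>\<beta> : G \<rightarrow> D\<close>, and \<open>c\<close> takes values in \<open>k\<^sup>*\<close> exactly when \<open>\<beta>\<close> is a
  homomorphism modulo \<open>k\<^sup>*\<close>. As \<open>G\<close> is torsion-free, \<open>r g \<mapsto> \<beta> g\<close> is a well-defined homomorphism
  \<open>r G \<rightarrow> D/k\<^sup>*\<close>; it extends to \<open>G\<close> because \<open>D/k\<^sup>*\<close> is divisible, and a lift of the extension defines a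
  cocycle \<open>d\<close> with \<open>d (r g, r h) = c (g, h)\<close>. This gives the \<open>r\<close>-th root of a graded field. Since
  \<open>\<beta> (r g) \<equiv> r \<beta> g\<close> modulo \<open>k\<^sup>*\<close>, pullback along multiplication by \<open>r\<close> acts on cohomology as multiplication
  by \<open>r\<close>, so \<open>H\<^sup>2\<^sub>S\<close> is divisible and its torsion-free quotient is a rational vector space.

  For the Noetherian classes, \<open>k[G, r c]\<close> is isomorphic to the subring \<open>R\<close> of \<open>k[G, c]\<close> supported on \<open>r G\<close>.
  Finite rank makes \<open>G/r G\<close> finite, so \<open>k[G, c]\<close> is a finite \<open>R\<close>-module, and \<open>R\<close> is an \<open>R\<close>-linear retract
  of it. Hence \<open>c\<close> is Noetherian iff \<open>r c\<close> is, for every \<open>r \<noteq> 0\<close>. Finally \<open>0\<close> is not Noetherian, because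
  generators of the augmentation ideal of a Noetherian group algebra \<open>k[G]\<close> involve finitely many elements of
  \<open>G\<close>, and these generate \<open>G\<close>.\<close>

section \<open>Homomorphisms into divisible groups\<close>

text \<open>The unit group A of k is in general not divisible, so homomorphisms into it need not
  extend. The quotient D/A is divisible, and the exact sequence A, D, D/A presents the symmetric
  classes, which form Ext(G, A), as the cokernel of Hom(G, D) in Hom(G, D/A), because Ext(G, D)
  vanishes. Cocycles are not normalised, hence the recurring factors c(0,0). Finite rank is given
  through the tensor product with the rationals and enters only through the finiteness of G/rG. To
  get there, G is embedded into that tensor product by clearing the denominators of a given
  relation, and then the size of subsets of G that are independent modulo a prime is bounded. Any
  action that makes the torsion-free quotient a vector space has its scalars forced by integer
  powers, so the description by lines holds for every such action. The class 0 must be excluded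
  separately: a torsion class among the Noetherian ones would put 0 among them. Part (1) becomes a
  statement on cocycles once F is written as the twisted group algebra of its structure
  constants.\<close>

definition divisible_group :: "('a, 'b) monoid_scheme \<Rightarrow> bool"
  where "divisible_group D \<longleftrightarrow> (\<forall>n>0. \<forall>x\<in>carrier D. divisible_by D n x)"

lemma divisible_groupD:
  fixes n :: nat
  assumes "divisible_group D" "n > 0" "x \<in> carrier D"
  obtains y where "y \<in> carrier D" "y [^]\<^bsub>D\<^esub> n = x"
proof -
  have "divisible_by D n x" using assms by (simp add: divisible_group_def)
  then show thesis using that unfolding divisible_by_def by auto
qed

lemma DirProd_nat_pow:
  "(x, y) [^]\<^bsub>G \<times>\<times> H\<^esub> (n::nat) = (x [^]\<^bsub>G\<^esub> n, y [^]\<^bsub>H\<^esub> n)"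
  by (induction n) auto

lemma DirProd_int_pow:
  assumes "group G" "group H" "x \<in> carrier G" "y \<in> carrier H"
  shows "(x, y) [^]\<^bsub>G \<times>\<times> H\<^esub> (n::int) = (x [^]\<^bsub>G\<^esub> n, y [^]\<^bsub>H\<^esub> n)"
proof -
  interpret G: group G by fact
  interpret H: group H by fact
  have "inv\<^bsub>G \<times>\<times> H\<^esub> (x [^]\<^bsub>G\<^esub> k, y [^]\<^bsub>H\<^esub> k) = (inv\<^bsub>G\<^esub> (x [^]\<^bsub>G\<^esub> k), inv\<^bsub>H\<^esub> (y [^]\<^bsub>H\<^esub> k))" for k :: nat
    by (rule inv_DirProd) (use assms in auto)
  then show ?thesis
    unfolding int_pow_def2 DirProd_nat_pow by (cases "n < 0") (simp_all only: if_True if_False)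
qed

text \<open>This is the subgroup generated by \<open>H\<close> and \<open>x\<close>. It is used with
  \<open>H\<close> the graph of a partial homomorphism, enlarged by one pair.\<close>

lemma (in comm_group) subgroup_powers_mult:
  assumes "subgroup H G" "x \<in> carrier G"
  shows "subgroup {h \<otimes> x [^] (n::int) | h n. h \<in> H} G"
proof -
  interpret H: subgroup H G by fact
  show ?thesis
  proof (rule subgroupI)
    show "{h \<otimes> x [^] (n::int) | h n. h \<in> H} \<subseteq> carrier G" using assms by auto
    show "{h \<otimes> x [^] (n::int) | h n. h \<in> H} \<noteq> {}" using H.one_closed by blast
  next
    fix a assume "a \<in> {h \<otimes> x [^] (n::int) | h n. h \<in> H}"
    then obtain h n where "h \<in> H" "a = h \<otimes> x [^] (n::int)" by blast
    moreover from this have "inv a = inv h \<otimes> x [^] (-n)"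
      using assms by (simp add: inv_mult int_pow_neg)
    ultimately show "inv a \<in> {h \<otimes> x [^] (n::int) | h n. h \<in> H}"
      using H.m_inv_closed by blast
  next
    fix a b assume "a \<in> {h \<otimes> x [^] (n::int) | h n. h \<in> H}" "b \<in> {h \<otimes> x [^] (n::int) | h n. h \<in> H}"
    then obtain h n k m where *: "h \<in> H" "a = h \<otimes> x [^] (n::int)" "k \<in> H" "b = k \<otimes> x [^] (m::int)" by blast
    then have "a \<otimes> b = (h \<otimes> k) \<otimes> x [^] (n + m)"
      using assms by (simp add: int_pow_mult m_ac)
    with * show "a \<otimes> b \<in> {h \<otimes> x [^] (n::int) | h n. h \<in> H}"
      using H.m_closed by blast
  qed
qed

lemma (in comm_group) subset_subgroup_powers_mult:
  assumes "subgroup H G" "x \<in> carrier G"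
  shows "H \<subseteq> {h \<otimes> x [^] (n::int) | h n. h \<in> H}" "x \<in> {h \<otimes> x [^] (n::int) | h n. h \<in> H}"
proof -
  have "h = h \<otimes> x [^] (0::int)" if "h \<in> H" for h
    using that assms subgroup.mem_carrier by fastforce
  then show "H \<subseteq> {h \<otimes> x [^] (n::int) | h n. h \<in> H}" by blast
  have "x = \<one> \<otimes> x [^] (1::int)" using assms by simp
  then show "x \<in> {h \<otimes> x [^] (n::int) | h n. h \<in> H}"
    using subgroup.one_closed[OF assms(1)] by blast
qed

text \<open>Divisible abelian groups are injective. Zorn's lemma gives a maximal partial extension.
  For \<open>x\<close> outside its domain, the only constraint on a value at \<open>x\<close> comes
  from the least positive multiple of \<open>x\<close> inside the domain, and divisibility of
  \<open>D\<close> satisfies it, against maximality.\<close>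

theorem extend_hom_to_divisible:
  assumes "comm_group G" "comm_group D" "divisible_group D" "subgroup H G"
    and f: "f \<in> hom (G\<lparr>carrier := H\<rparr>) D"
  obtains f' where "f' \<in> hom G D" "\<And>h. h \<in> H \<Longrightarrow> f' h = f h"
proof -
  interpret G: comm_group G by fact
  interpret D: comm_group D by fact
  interpret H: subgroup H G by fact
  interpret P: group "G \<times>\<times> D" by (simp add: DirProd_group G.is_group D.is_group)
  interpret P: comm_group "G \<times>\<times> D"
    by (rule P.group_comm_groupI) (auto simp: G.m_comm D.m_comm)
  interpret GH: group "G\<lparr>carrier := H\<rparr>" by (rule H.subgroup_is_group[OF G.is_group])
  interpret f: group_hom "G\<lparr>carrier := H\<rparr>" D f
    by (simp add: D.is_group GH.is_group f group_hom.intro group_hom_axioms.intro)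
  have inv_pair: "inv\<^bsub>G \<times>\<times> D\<^esub> (x, y) = (inv\<^bsub>G\<^esub> x, inv\<^bsub>D\<^esub> y)"
    if "x \<in> carrier G" "y \<in> carrier D" for x y
    using that by (simp add: inv_DirProd G.is_group D.is_group)
  \<comment> \<open>Partial homomorphisms are identified with their graphs, subgroups of \<open>G \<times> D\<close>.\<close>
  define \<G> where "\<G> = {\<Gamma>. subgroup \<Gamma> (G \<times>\<times> D) \<and> (\<forall>d. (\<one>\<^bsub>G\<^esub>, d) \<in> \<Gamma> \<longrightarrow> d = \<one>\<^bsub>D\<^esub>) \<and> (\<forall>h\<in>H. (h, f h) \<in> \<Gamma>)}"
  define \<Gamma>\<^sub>0 where "\<Gamma>\<^sub>0 = (\<lambda>h. (h, f h)) ` H"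
  have f_car: "f h \<in> carrier D" if "h \<in> H" for h using that f.hom_closed by simp
  have f_mult: "f (g \<otimes>\<^bsub>G\<^esub> h) = f g \<otimes>\<^bsub>D\<^esub> f h" if "g \<in> H" "h \<in> H" for g h using that f.hom_mult by simp
  have f_one: "f \<one>\<^bsub>G\<^esub> = \<one>\<^bsub>D\<^esub>" using f.hom_one by simp
  have f_inv: "f (inv\<^bsub>G\<^esub> h) = inv\<^bsub>D\<^esub> (f h)" if "h \<in> H" for h
    using f.hom_inv[of h] that G.m_inv_consistent[OF H.subgroup_axioms that] by simp
  have "subgroup \<Gamma>\<^sub>0 (G \<times>\<times> D)"
  proof (rule P.subgroupI)
    show "\<Gamma>\<^sub>0 \<subseteq> carrier (G \<times>\<times> D)" using f_car by (auto simp: \<Gamma>\<^sub>0_def)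
    show "\<Gamma>\<^sub>0 \<noteq> {}" using subgroup.one_closed[OF \<open>subgroup H G\<close>] unfolding \<Gamma>\<^sub>0_def by blast
    show "inv\<^bsub>G \<times>\<times> D\<^esub> a \<in> \<Gamma>\<^sub>0" if "a \<in> \<Gamma>\<^sub>0" for a
      using that f_car H.m_inv_closed by (auto simp: \<Gamma>\<^sub>0_def inv_pair simp flip: f_inv)
    show "a \<otimes>\<^bsub>G \<times>\<times> D\<^esub> b \<in> \<Gamma>\<^sub>0" if "a \<in> \<Gamma>\<^sub>0" "b \<in> \<Gamma>\<^sub>0" for a b
      using that H.m_closed by (auto simp: \<Gamma>\<^sub>0_def simp flip: f_mult)
  qed
  then have "\<Gamma>\<^sub>0 \<in> \<G>" using f_one by (auto simp: \<G>_def \<Gamma>\<^sub>0_def)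
  have "\<exists>M\<in>\<G>. \<forall>Z\<in>\<G>. M \<subseteq> Z \<longrightarrow> Z = M"
  proof (rule subset_Zorn_nonempty)
    show "\<G> \<noteq> {}" using \<open>\<Gamma>\<^sub>0 \<in> \<G>\<close> by auto
  next
    fix \<C> assume "\<C> \<noteq> {}" and chain: "subset.chain \<G> \<C>"
    then have sub: "\<C> \<subseteq> \<G>" and lin: "\<And>Z Y. Z \<in> \<C> \<Longrightarrow> Y \<in> \<C> \<Longrightarrow> Z \<subseteq> Y \<or> Y \<subseteq> Z"
      unfolding pred_on.chain_def by auto
    have sub': "subgroup Z (G \<times>\<times> D)" if "Z \<in> \<C>" for Z
      using that sub by (auto simp: \<G>_def)
    have "subgroup (\<Union>\<C>) (G \<times>\<times> D)"
    proof (rule P.subgroupI)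
      show "\<Union>\<C> \<subseteq> carrier (G \<times>\<times> D)" using subgroup.subset[OF sub'] by blast
      show "\<Union>\<C> \<noteq> {}" using \<open>\<C> \<noteq> {}\<close> subgroup.one_closed[OF sub'] by blast
      show "inv\<^bsub>G \<times>\<times> D\<^esub> a \<in> \<Union>\<C>" if "a \<in> \<Union>\<C>" for a
        using that subgroup.m_inv_closed[OF sub'] by blast
      show "a \<otimes>\<^bsub>G \<times>\<times> D\<^esub> b \<in> \<Union>\<C>" if "a \<in> \<Union>\<C>" "b \<in> \<Union>\<C>" for a b
      proof -
        from that lin obtain Z where Z: "Z \<in> \<C>" "a \<in> Z" "b \<in> Z" by blast
        then show ?thesis using subgroup.m_closed[OF sub'] by blast
      qed
    qed
    moreover have "\<exists>Z\<in>\<C>. \<forall>h\<in>H. (h, f h) \<in> Z" "\<forall>Z\<in>\<C>. \<forall>d. (\<one>\<^bsub>G\<^esub>, d) \<in> Z \<longrightarrow> d = \<one>\<^bsub>D\<^esub>"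
      using sub \<open>\<C> \<noteq> {}\<close> unfolding \<G>_def by blast+
    ultimately show "\<Union>\<C> \<in> \<G>" unfolding \<G>_def by blast
  qed
  then obtain M where M: "M \<in> \<G>" and max: "\<And>Z. Z \<in> \<G> \<Longrightarrow> M \<subseteq> Z \<Longrightarrow> Z = M" by blast
  have M_sub: "subgroup M (G \<times>\<times> D)" and M_fun: "\<And>d. (\<one>\<^bsub>G\<^esub>, d) \<in> M \<Longrightarrow> d = \<one>\<^bsub>D\<^esub>"
    and M_f: "\<And>h. h \<in> H \<Longrightarrow> (h, f h) \<in> M"
    using M by (auto simp: \<G>_def)
  interpret M: subgroup M "G \<times>\<times> D" by fact
  have M_car: "x \<in> carrier G \<and> y \<in> carrier D" if "(x, y) \<in> M" for x y
    using M.mem_carrier[OF that] by auto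
  have M_mult: "(x \<otimes>\<^bsub>G\<^esub> x', y \<otimes>\<^bsub>D\<^esub> y') \<in> M" if "(x, y) \<in> M" "(x', y') \<in> M" for x y x' y'
    using M.m_closed[OF that] by simp
  have M_inv: "(inv\<^bsub>G\<^esub> x, inv\<^bsub>D\<^esub> y) \<in> M" if "(x, y) \<in> M" for x y
    using M.m_inv_closed[OF that] M_car[OF that] by (simp add: inv_pair)
  have M_pow: "(x [^]\<^bsub>G\<^esub> n, y [^]\<^bsub>D\<^esub> n) \<in> M" if "(x, y) \<in> M" for x y and n :: int
    using P.subgroup_int_pow_closed[OF M_sub that, of n] M_car[OF that]
    by (simp add: DirProd_int_pow G.is_group D.is_group)
  \<comment> \<open>Single-valuedness was demanded only over the identity. For a subgroup this
    suffices, since the quotient of two pairs over \<open>x\<close> is a pair over the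
    identity.\<close>
  have M_unique: "y = y'" if "(x, y) \<in> M" "(x, y') \<in> M" for x y y'
  proof -
    have "(\<one>\<^bsub>G\<^esub>, y \<otimes>\<^bsub>D\<^esub> inv\<^bsub>D\<^esub> y') \<in> M"
      using M_mult[OF that(1) M_inv[OF that(2)]] M_car[OF that(2)] by simp
    from M_fun[OF this] have "inv\<^bsub>D\<^esub> (inv\<^bsub>D\<^esub> y') = y"
      using M_car[OF that(1)] M_car[OF that(2)] by (intro D.inv_equality) auto
    then show ?thesis using M_car[OF that(2)] by simp
  qed
  have total: "\<exists>d. (x, d) \<in> M" if x: "x \<in> carrier G" for x
  proof -
    \<comment> \<open>A value \<open>d\<close> at \<open>x\<close> is admissible when it agrees with
      \<open>M\<close> at every power of \<open>x\<close> that is already in the domain.\<close>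
    have "\<exists>d\<in>carrier D. \<forall>n::int. (\<exists>e. (x [^]\<^bsub>G\<^esub> n, e) \<in> M) \<longrightarrow> (x [^]\<^bsub>G\<^esub> n, d [^]\<^bsub>D\<^esub> n) \<in> M"
    proof (cases "\<exists>n::nat. n > 0 \<and> (\<exists>e. (x [^]\<^bsub>G\<^esub> n, e) \<in> M)")
      case True
      \<comment> \<open>The exponents \<open>n\<close> with \<open>x [^] n\<close> in the domain
        form a subgroup of the integers, generated by its least positive element \<open>m\<close>.
        One \<open>m\<close>-th root of the value at \<open>x [^] m\<close> therefore serves all of
        them; division with remainder below shows this.\<close>
      define m where "m = (LEAST n::nat. n > 0 \<and> (\<exists>e. (x [^]\<^bsub>G\<^esub> n, e) \<in> M))"
      have "m > 0 \<and> (\<exists>e. (x [^]\<^bsub>G\<^esub> m, e) \<in> M)"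
        unfolding m_def by (rule LeastI_ex) (use True in blast)
      then obtain e where "m > 0" and e: "(x [^]\<^bsub>G\<^esub> m, e) \<in> M" by blast
      have least: "\<not> (\<exists>e. (x [^]\<^bsub>G\<^esub> k, e) \<in> M)" if "0 < k" "k < m" for k :: nat
        using not_less_Least[of k "\<lambda>n. n > 0 \<and> (\<exists>e. (x [^]\<^bsub>G\<^esub> n, e) \<in> M)"] that unfolding m_def by blast
      obtain d where d: "d \<in> carrier D" "d [^]\<^bsub>D\<^esub> m = e"
        using divisible_groupD[OF \<open>divisible_group D\<close> \<open>m > 0\<close>] M_car[OF e] by metis
      have "(x [^]\<^bsub>G\<^esub> n, d [^]\<^bsub>D\<^esub> n) \<in> M" if ex: "\<exists>e. (x [^]\<^bsub>G\<^esub> n, e) \<in> M" for n :: int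
      proof -
        obtain a where a: "(x [^]\<^bsub>G\<^esub> n, a) \<in> M" using ex by blast
        have qM: "(x [^]\<^bsub>G\<^esub> (int m * k), d [^]\<^bsub>D\<^esub> (int m * k)) \<in> M" for k :: int
        proof -
          have "x [^]\<^bsub>G\<^esub> (int m * k) = (x [^]\<^bsub>G\<^esub> m) [^]\<^bsub>G\<^esub> k"
            using x by (metis G.int_pow_pow int_pow_int)
          moreover have "d [^]\<^bsub>D\<^esub> (int m * k) = e [^]\<^bsub>D\<^esub> k"
            using d by (metis D.int_pow_pow int_pow_int)
          ultimately show ?thesis using M_pow[OF e, of k] by simp
        qed
        define q where "q = n div int m"
        define s where "s = nat (n mod int m)"
        have s: "int s = n - int m * q" "s < m"
          using \<open>m > 0\<close> by (auto simp: s_def q_def minus_mult_div_eq_mod nat_less_iff)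
        have "x [^]\<^bsub>G\<^esub> s = x [^]\<^bsub>G\<^esub> n \<otimes>\<^bsub>G\<^esub> inv\<^bsub>G\<^esub> (x [^]\<^bsub>G\<^esub> (int m * q))"
          using G.int_pow_diff[OF x, of n "int m * q"] by (simp add: int_pow_int flip: s(1))
        then have "\<exists>e. (x [^]\<^bsub>G\<^esub> s, e) \<in> M"
          using M_mult[OF a M_inv[OF qM[of q]]] by auto
        then have "s = 0" using least s(2) by blast
        then have "n = int m * q" using s(1) by simp
        then show ?thesis using qM by simp
      qed
      then show ?thesis using d by blast
    next
      case False
      \<comment> \<open>No nonzero power of \<open>x\<close> is in the domain (negative ones reduce
        to positive ones by inversion), so every value at \<open>x\<close> is admissible, and the
        identity is taken.\<close>
      have "n = 0" if e: "(x [^]\<^bsub>G\<^esub> n, e) \<in> M" for n :: int and e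
      proof (rule ccontr)
        assume "n \<noteq> 0"
        show False
        proof (cases "n > 0")
          case True
          then show False using False e by (metis int_pow_int zero_less_imp_eq_int)
        next
          case neg: False
          have "(x [^]\<^bsub>G\<^esub> (- n), inv\<^bsub>D\<^esub> e) \<in> M" using M_inv[OF e] x by (simp add: G.int_pow_neg)
          moreover have "- n > 0" using neg \<open>n \<noteq> 0\<close> by simp
          ultimately show False using False by (metis int_pow_int zero_less_imp_eq_int)
        qed
      qed
      moreover have "(x [^]\<^bsub>G\<^esub> (0::int), \<one>\<^bsub>D\<^esub> [^]\<^bsub>D\<^esub> (0::int)) \<in> M"
        using M.one_closed by simp
      ultimately show ?thesis by (metis D.one_closed)
    qed
    then obtain d where d: "d \<in> carrier D"
      and pow_d: "\<And>(n::int) e. (x [^]\<^bsub>G\<^esub> n, e) \<in> M \<Longrightarrow> (x [^]\<^bsub>G\<^esub> n, d [^]\<^bsub>D\<^esub> n) \<in> M" by blast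
    define M' where "M' = {z \<otimes>\<^bsub>G \<times>\<times> D\<^esub> (x, d) [^]\<^bsub>G \<times>\<times> D\<^esub> (n::int) | z n. z \<in> M}"
    have xd: "(x, d) \<in> carrier (G \<times>\<times> D)" using x d by simp
    have M'_sub: "subgroup M' (G \<times>\<times> D)" unfolding M'_def by (rule P.subgroup_powers_mult[OF M_sub xd])
    have "M \<subseteq> M'" "(x, d) \<in> M'"
      unfolding M'_def using P.subset_subgroup_powers_mult[OF M_sub xd] by blast+
    \<comment> \<open>An element of \<open>M'\<close> over the identity expresses a power of
      \<open>x\<close> as the inverse of an element of the domain of \<open>M\<close>; there
      \<open>d\<close> is compatible with \<open>M\<close> by its choice.\<close>
    have "d' = \<one>\<^bsub>D\<^esub>" if in_M': "(\<one>\<^bsub>G\<^esub>, d') \<in> M'" for d'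
    proof -
      from in_M' obtain g a n where ga: "(g, a) \<in> M"
        and eq: "(\<one>\<^bsub>G\<^esub>, d') = (g, a) \<otimes>\<^bsub>G \<times>\<times> D\<^esub> (x, d) [^]\<^bsub>G \<times>\<times> D\<^esub> (n::int)" unfolding M'_def by auto
      then have 1: "\<one>\<^bsub>G\<^esub> = g \<otimes>\<^bsub>G\<^esub> x [^]\<^bsub>G\<^esub> n" "d' = a \<otimes>\<^bsub>D\<^esub> d [^]\<^bsub>D\<^esub> n"
        using x d by (auto simp: DirProd_int_pow G.is_group D.is_group)
      have "inv\<^bsub>G\<^esub> (x [^]\<^bsub>G\<^esub> n) = g"
        using M_car[OF ga] x by (intro G.inv_equality 1(1)[symmetric]) auto
      then have "inv\<^bsub>G\<^esub> g = x [^]\<^bsub>G\<^esub> n" using x by force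
      with M_inv[OF ga] have "(x [^]\<^bsub>G\<^esub> n, d [^]\<^bsub>D\<^esub> n) \<in> M" using pow_d by simp
      from M_mult[OF ga this] 1 M_fun show ?thesis by simp
    qed
    then have "M' \<in> \<G>" using M'_sub \<open>M \<subseteq> M'\<close> M_f by (auto simp: \<G>_def)
    then have "M' = M" using max \<open>M \<subseteq> M'\<close> by blast
    then show ?thesis using \<open>(x, d) \<in> M'\<close> by blast
  qed
  define f' where "f' x = (THE d. (x, d) \<in> M)" for x
  have f': "(x, f' x) \<in> M" if "x \<in> carrier G" for x
    unfolding f'_def using total[OF that] M_unique by (metis the_equality)
  have f'_eq: "f' x = d" if "(x, d) \<in> M" for x d
    using that f' M_unique M_car by blast
  show thesis
  proof
    show "f' \<in> hom G D"
    proof (rule homI)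
      show "f' x \<in> carrier D" if "x \<in> carrier G" for x using f'[OF that] M_car by blast
      show "f' (x \<otimes>\<^bsub>G\<^esub> y) = f' x \<otimes>\<^bsub>D\<^esub> f' y" if "x \<in> carrier G" "y \<in> carrier G" for x y
        using f'_eq M_mult f' that by blast
    qed
    show "f' h = f h" if "h \<in> H" for h using f'_eq M_f that by blast
  qed
qed

section \<open>Torsion and rational powers\<close>

lemma rat_field_simps [simp]:
  "carrier rat_field = UNIV" "monoid.mult rat_field = (*)" "one rat_field = 1"
  "ring.zero rat_field = 0" "add rat_field = (+)"
  by (auto simp: ring_of_type_algebra_def)

lemma carrier_units_of_rat_field: "carrier (units_of rat_field) = {q. q \<noteq> 0}"
proof -
  have "q \<in> Units rat_field" if "q \<noteq> 0" for q :: rat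
    unfolding Units_def using that by (auto intro!: exI[of _ "inverse q"])
  then show ?thesis by (auto simp: units_of_def Units_def)
qed

lemma (in comm_group) subgroup_torsion: "subgroup (torsion G) G"
proof (rule subgroupI)
  show "torsion G \<subseteq> carrier G" by (auto simp: torsion_def)
  have "\<one> \<in> torsion G" unfolding torsion_def by (auto intro!: exI[of _ 1])
  then show "torsion G \<noteq> {}" by blast
next
  fix a assume "a \<in> torsion G"
  then show "inv a \<in> torsion G" unfolding torsion_def by (auto simp: nat_pow_inv)
next
  fix a b assume "a \<in> torsion G" "b \<in> torsion G"
  then obtain n m :: nat where ab: "a \<in> carrier G" "b \<in> carrier G" "n > 0" "m > 0" "a [^] n = \<one>" "b [^] m = \<one>"
    unfolding torsion_def by blast
  then have "a [^] (n * m) = \<one>" "b [^] (n * m) = \<one>"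
    by (metis nat_pow_pow nat_pow_one, metis nat_pow_pow nat_pow_one mult.commute)
  then have "(a \<otimes> b) [^] (n * m) = \<one>" using ab by (simp add: nat_pow_distrib)
  then show "a \<otimes> b \<in> torsion G"
    using ab unfolding torsion_def by (auto intro!: exI[of _ "n * m"])
qed

lemma (in comm_group) torsion_int_powD:
  assumes "x \<in> carrier G" "n \<noteq> 0" "x [^] (n::int) = \<one>"
  shows "x \<in> torsion G"
proof -
  have "x [^] (nat \<bar>n\<bar>) = \<one>"
  proof (cases "n > 0")
    case True
    then show ?thesis using assms by (metis abs_of_pos int_pow_int pos_int_cases nat_int)
  next
    case False
    then have "x [^] (- n) = \<one>" using assms by (simp add: int_pow_neg)
    with False show ?thesis using assms
      by (metis abs_of_nonpos int_pow_int linorder_not_less nat_0_le neg_0_le_iff_le)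
  qed
  then show ?thesis using assms unfolding torsion_def by (auto intro!: exI[of _ "nat \<bar>n\<bar>"])
qed

lemma (in comm_group) torsion_free_cancel_int_pow:
  assumes "torsion_free G" "x \<in> carrier G" "y \<in> carrier G" "n \<noteq> 0" "x [^] (n::int) = y [^] n"
  shows "x = y"
proof -
  have "(x \<otimes> inv y) [^] n = \<one>"
    using assms by (simp add: int_pow_distrib int_pow_inv)
  then have "x \<otimes> inv y = \<one>"
    using torsion_int_powD[of "x \<otimes> inv y" n] assms by (auto simp: torsion_free_def)
  then have "inv (inv y) = x" using assms by (intro inv_equality) auto
  then show ?thesis using assms by simp
qed

text \<open>This is meaningful in a torsion-free divisible group: divisibility gives a solution
  \<open>y\<close>, torsion-freeness makes it unique. \<open>quotient_of\<close> only fixes one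
  fraction; by \<open>rat_pow_int_pow\<close> every fraction with positive denominator gives the
  same value.\<close>

definition rat_pow :: "('a, 'b) monoid_scheme \<Rightarrow> rat \<Rightarrow> 'a \<Rightarrow> 'a"
  where "rat_pow V q x = (THE y. y \<in> carrier V \<and>
    y [^]\<^bsub>V\<^esub> snd (quotient_of q) = x [^]\<^bsub>V\<^esub> fst (quotient_of q))"

lemma rat_fraction:
  fixes q :: rat
  obtains m n where "q = of_int m / of_int n" "(n::int) > 0"
  using quotient_of_div[of q] quotient_of_denom_pos[of q] by (metis prod.exhaust)

context
  fixes V :: "('a, 'b) monoid_scheme" (structure)
  assumes comm: "comm_group V" and tf: "torsion_free V" and divisible: "divisible_group V"
begin

interpretation comm_group V by (rule comm)

lemma rat_pow_ex:
  assumes x: "x \<in> carrier V"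
  shows "rat_pow V q x \<in> carrier V \<and>
    rat_pow V q x [^] snd (quotient_of q) = x [^] fst (quotient_of q)"
proof -
  obtain a b where ab: "quotient_of q = (a, b)" by force
  have "b > 0" using quotient_of_denom_pos[OF ab] .
  then obtain y where y: "y \<in> carrier V" "y [^] nat b = x [^] a"
    using divisible_groupD[OF divisible, of "nat b" "x [^] a"] x by auto
  then have yb: "y [^] b = x [^] a" using \<open>b > 0\<close> int_pow_int[of V y "nat b"] by simp
  have "\<exists>!y. y \<in> carrier V \<and> y [^] b = x [^] a"
    using y(1) yb torsion_free_cancel_int_pow[OF tf] \<open>b > 0\<close> by (metis less_irrefl)
  from theI'[OF this] show ?thesis unfolding rat_pow_def ab by simp
qed

lemma rat_pow_closed [simp]: "x \<in> carrier V \<Longrightarrow> rat_pow V q x \<in> carrier V"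
  using rat_pow_ex by blast

text \<open>Independence of the chosen fraction: after raising both sides to the reduced denominator
  \<open>b\<close>, the identity \<open>a * n = m * b\<close> applies, and \<open>b\<close> is
  cancelled by torsion-freeness.\<close>

lemma rat_pow_int_pow:
  assumes "x \<in> carrier V" "n > 0" "q = of_int m / of_int n"
  shows "rat_pow V q x [^] n = x [^] m"
proof -
  obtain a b where ab: "quotient_of q = (a, b)" by force
  have "b > 0" using quotient_of_denom_pos[OF ab] .
  have "of_int a / of_int b = (of_int m / of_int n :: rat)"
    using quotient_of_div[OF ab] assms by simp
  then have eq: "a * n = m * b"
    using \<open>b > 0\<close> \<open>n > 0\<close> by (simp add: frac_eq_eq flip: of_int_mult)
  have r: "rat_pow V q x [^] b = x [^] a" using rat_pow_ex[OF assms(1), of q] ab by simp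
  have "(rat_pow V q x [^] n) [^] b = (rat_pow V q x [^] b) [^] n"
    using assms(1) by (simp add: int_pow_pow mult.commute)
  also have "\<dots> = (x [^] m) [^] b" using assms(1) eq by (simp add: r int_pow_pow)
  finally show ?thesis
    using torsion_free_cancel_int_pow[OF tf, of "rat_pow V q x [^] n" "x [^] m" b] assms(1) \<open>b > 0\<close> by auto
qed

text \<open>Each law of the rational action is derived from this criterion, by checking it after
  multiplication with a common denominator.\<close>

lemma rat_pow_eqI:
  assumes "x \<in> carrier V" "y \<in> carrier V" "n > 0" "q = of_int m / of_int n" "y [^] n = x [^] m"
  shows "rat_pow V q x = y"
  using torsion_free_cancel_int_pow[OF tf, of "rat_pow V q x" y n] rat_pow_int_pow[of x n q m] assms by auto

lemma rat_pow_mult: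
  assumes "x \<in> carrier V" "y \<in> carrier V"
  shows "rat_pow V q (x \<otimes> y) = rat_pow V q x \<otimes> rat_pow V q y"
proof -
  obtain m n where q: "q = of_int m / of_int n" "(n::int) > 0" using rat_fraction .
  show ?thesis
    by (rule rat_pow_eqI[OF _ _ q(2,1)])
      (use assms q in \<open>auto simp: int_pow_distrib rat_pow_int_pow\<close>)
qed

lemma rat_pow_add:
  assumes x: "x \<in> carrier V"
  shows "rat_pow V (p + q) x = rat_pow V p x \<otimes> rat_pow V q x"
proof -
  obtain a b where p: "p = of_int a / of_int b" "(b::int) > 0" using rat_fraction .
  obtain c d where q: "q = of_int c / of_int d" "(d::int) > 0" using rat_fraction .
  have pq: "p + q = of_int (a * d + c * b) / of_int (b * d)" using p q by (simp add: field_simps)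
  have 1: "rat_pow V p x [^] (b * d) = x [^] (a * d)"
    using x rat_pow_int_pow[OF x p(2,1)] by (simp flip: int_pow_pow)
  have "rat_pow V q x [^] (b * d) = rat_pow V q x [^] (d * b)" by (simp add: mult.commute)
  also have "\<dots> = x [^] (c * b)"
    using x rat_pow_int_pow[OF x q(2,1)] by (simp flip: int_pow_pow)
  finally have 2: "rat_pow V q x [^] (b * d) = x [^] (c * b)" .
  show ?thesis
    by (rule rat_pow_eqI[OF _ _ _ pq]) (use x p q 1 2 in \<open>auto simp: int_pow_distrib int_pow_mult\<close>)
qed

lemma rat_pow_pow:
  assumes x: "x \<in> carrier V"
  shows "rat_pow V (p * q) x = rat_pow V p (rat_pow V q x)"
proof -
  obtain a b where p: "p = of_int a / of_int b" "(b::int) > 0" using rat_fraction .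
  obtain c d where q: "q = of_int c / of_int d" "(d::int) > 0" using rat_fraction .
  have pq: "p * q = of_int (c * a) / of_int (b * d)" using p q by (simp add: field_simps)
  let ?v = "rat_pow V q x"
  have "rat_pow V p ?v [^] (b * d) = (?v [^] a) [^] d"
    using x rat_pow_int_pow[OF _ p(2,1), of ?v] by (simp flip: int_pow_pow)
  also have "\<dots> = (?v [^] d) [^] a" using x by (simp add: int_pow_pow mult.commute)
  also have "\<dots> = x [^] (c * a)" using x rat_pow_int_pow[OF x q(2,1)] by (simp flip: int_pow_pow)
  finally have 1: "rat_pow V p ?v [^] (b * d) = x [^] (c * a)" .
  show ?thesis
    by (rule rat_pow_eqI[OF _ _ _ pq 1]) (use x p q in auto)
qed

lemma rat_pow_one: "x \<in> carrier V \<Longrightarrow> rat_pow V 1 x = x"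
  by (rule rat_pow_eqI[of x x 1 1 1]) auto

lemma rat_pow_zero: "x \<in> carrier V \<Longrightarrow> rat_pow V 0 x = \<one>"
  by (rule rat_pow_eqI[of x \<one> 1 0 0]) auto

text \<open>The maps are restricted to the carrier because the elements of \<open>BijGroup\<close>
  are extensional functions. The action of \<open>q\<close> is bijective since that of
  \<open>inverse q\<close> undoes it.\<close>

theorem vector_space_action_rat_pow:
  "vector_space_action V (\<lambda>q. \<lambda>x\<in>carrier V. rat_pow V q x)"
proof -
  let ?\<phi> = "\<lambda>q. \<lambda>x\<in>carrier V. rat_pow V q x"
  let ?M = "module_of_action V ?\<phi>"
  have inverse: "rat_pow V p (rat_pow V q x) = x" if "p * q = 1" "x \<in> carrier V" for p q x
    using that rat_pow_pow[of x p q] rat_pow_one by simp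
  have Bij: "?\<phi> q \<in> Bij (carrier V)" if "q \<noteq> 0" for q
  proof -
    have "bij_betw (rat_pow V q) (carrier V) (carrier V)"
      by (rule bij_betwI[where g = "rat_pow V (inverse q)"]) (use that inverse in auto)
    then have "bij_betw (?\<phi> q) (carrier V) (carrier V)"
      by (subst bij_betw_cong[of _ _ "rat_pow V q"]) auto
    then show ?thesis by (simp add: Bij_def)
  qed
  have smult: "q \<odot>\<^bsub>?M\<^esub> x = rat_pow V q x" if "x \<in> carrier V" for q x
    using that by (simp add: module_of_action_def rat_pow_zero)
  have carrier_M: "carrier ?M = carrier V" and add_M: "add ?M = monoid.mult V"
    by (auto simp: module_of_action_def)
  have "group_hom (units_of rat_field) (BijGroup (carrier V)) ?\<phi>"
  proof (intro group_hom.intro group_hom_axioms.intro homI)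
    show "group (units_of rat_field)"
      using monoid.units_group[of rat_field] field_from_type_algebra field.is_ring ring.is_monoid by blast
    show "group (BijGroup (carrier V))" by (rule group_BijGroup)
    show "?\<phi> q \<in> carrier (BijGroup (carrier V))" if "q \<in> carrier (units_of rat_field)" for q
      using that Bij by (simp add: BijGroup_def carrier_units_of_rat_field)
    show "?\<phi> (p \<otimes>\<^bsub>units_of rat_field\<^esub> q) = ?\<phi> p \<otimes>\<^bsub>BijGroup (carrier V)\<^esub> ?\<phi> q"
      if "p \<in> carrier (units_of rat_field)" "q \<in> carrier (units_of rat_field)" for p q
      using that Bij[of p] Bij[of q]
      by (auto simp: BijGroup_def carrier_units_of_rat_field units_of_mult compose_def rat_pow_pow fun_eq_iff)
  qed
  moreover have "module rat_field ?M"
  proof (rule moduleI)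
    show "cring rat_field" by (rule cring_from_type_algebra)
    show "abelian_group ?M"
    proof (rule abelian_groupI)
      fix x assume "x \<in> carrier ?M"
      then show "\<exists>y\<in>carrier ?M. y \<oplus>\<^bsub>?M\<^esub> x = \<zero>\<^bsub>?M\<^esub>"
        by (auto simp: module_of_action_def intro!: bexI[of _ "inv x"])
    qed (auto simp: module_of_action_def m_ac)
  qed (use smult in \<open>auto simp: carrier_M add_M rat_pow_add rat_pow_mult rat_pow_pow rat_pow_one\<close>)
  ultimately show ?thesis
    unfolding vector_space_action_def group_action_def by blast
qed

end

section \<open>Sets stable under powers in a divisible group\<close>

text \<open>If a power of a representative is torsion, then so is the representative, with the
  product of the two exponents. Roots in the second quotient are images of roots in the
  group.\<close>

lemma (in comm_group) torsion_free_Mod_torsion: "torsion_free (G Mod torsion G)"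
  and divisible_Mod: "divisible_group G \<Longrightarrow> subgroup N G \<Longrightarrow> divisible_group (G Mod N)"
proof -
  interpret T: normal "torsion G" G
    using subgroup_torsion by (simp add: normal_iff_subgroup)
  interpret Q: group "G Mod torsion G" by (rule T.factorgroup_is_group)
  have "torsion (G Mod torsion G) \<subseteq> {\<one>\<^bsub>G Mod torsion G\<^esub>}"
  proof
    fix y assume "y \<in> torsion (G Mod torsion G)"
    then obtain x and n :: nat where x: "x \<in> carrier G" "y = torsion G #> x" "n > 0"
      "y [^]\<^bsub>G Mod torsion G\<^esub> n = torsion G"
      unfolding torsion_def[of "G Mod torsion G"] by (auto simp: carrier_FactGroup)
    then have "torsion G #> (x [^] n) = torsion G" by (simp add: T.FactGroup_pow)
    then have "x [^] n \<in> torsion G"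
      using x by (metis nat_pow_closed rcos_self subgroup_torsion)
    then obtain m :: nat where "m > 0" "(x [^] n) [^] m = \<one>" unfolding torsion_def by blast
    then have "x \<in> torsion G"
      using x unfolding torsion_def by (auto simp: nat_pow_pow intro!: exI[of _ "n * m"])
    then show "y \<in> {\<one>\<^bsub>G Mod torsion G\<^esub>}" using x by (simp add: T.rcos_const)
  qed
  moreover have "\<one>\<^bsub>G Mod torsion G\<^esub> \<in> torsion (G Mod torsion G)"
    unfolding torsion_def[of "G Mod torsion G"] using Q.one_closed Q.nat_pow_one[of 1] by blast
  ultimately show "torsion_free (G Mod torsion G)" unfolding torsion_free_def by blast
next
  assume G: "divisible_group G" and N: "subgroup N G"
  interpret N: normal N G using N by (simp add: normal_iff_subgroup)
  show "divisible_group (G Mod N)"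
    unfolding divisible_group_def
  proof (intro allI impI ballI)
    fix n :: nat and y assume "n > 0" "y \<in> carrier (G Mod N)"
    then obtain x where x: "x \<in> carrier G" "y = N #> x" by (auto simp: carrier_FactGroup)
    obtain z where "z \<in> carrier G" "z [^] n = x" using divisible_groupD[OF G \<open>n > 0\<close> x(1)] .
    then show "divisible_by (G Mod N) n y"
      unfolding divisible_by_def using x
      by (auto simp: carrier_FactGroup N.FactGroup_pow intro!: bexI[of _ "N #> z"])
  qed
qed

text \<open>\<open>N\<close> will be the set of Noetherian classes in \<open>H\<close>. Stability
  under nonzero integer powers holds in both directions, and this alone yields both the cosets and
  the lines.\<close>

context
  fixes H :: "('a, 'b) monoid_scheme" (structure) and N
  assumes comm: "comm_group H"
    and N_carrier: "N \<subseteq> carrier H"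
    and N_pow: "\<And>x r. x \<in> carrier H \<Longrightarrow> (r::int) \<noteq> 0 \<Longrightarrow> x [^] r \<in> N \<longleftrightarrow> x \<in> N"
begin

interpretation comm_group H by (rule comm)

interpretation T: normal "torsion H" H
  using subgroup_torsion by (simp add: normal_iff_subgroup)

text \<open>\<open>x\<close> and \<open>t \<otimes> x\<close> have a common positive power, and
  membership in \<open>N\<close> can be tested on powers.\<close>

lemma mult_torsion_in_iff:
  assumes "x \<in> carrier H" "t \<in> torsion H"
  shows "t \<otimes> x \<in> N \<longleftrightarrow> x \<in> N"
proof -
  obtain n :: nat where "n > 0" "t [^] n = \<one>" "t \<in> carrier H" using assms unfolding torsion_def by blast
  then have "(t \<otimes> x) [^] int n = x [^] int n" using assms by (simp add: int_pow_int nat_pow_distrib)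
  then show ?thesis
    using N_pow[of x "int n"] N_pow[of "t \<otimes> x" "int n"] assms \<open>n > 0\<close> \<open>t \<in> carrier H\<close> by simp
qed

lemma union_of_torsion_cosets: "\<exists>\<C> \<subseteq> rcosets (torsion H). N = \<Union>\<C>"
proof (intro exI conjI)
  show "(\<lambda>x. torsion H #> x) ` N \<subseteq> rcosets (torsion H)" using N_carrier by (auto simp: RCOSETS_def)
  show "N = \<Union>((\<lambda>x. torsion H #> x) ` N)"
  proof
    show "N \<subseteq> \<Union>((\<lambda>x. torsion H #> x) ` N)"
      using N_carrier rcos_self subgroup_torsion by blast
    show "\<Union>((\<lambda>x. torsion H #> x) ` N) \<subseteq> N"
      using N_carrier mult_torsion_in_iff by (auto simp: r_coset_def)
  qed
qed

lemma not_torsion_if_one_notin: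
  assumes "\<one> \<notin> N" "x \<in> N"
  shows "x \<notin> torsion H"
proof
  assume "x \<in> torsion H"
  then obtain n :: nat where "n > 0" "x [^] int n = \<one>" unfolding torsion_def by (auto simp: int_pow_int)
  then show False using N_pow[of x "int n"] assms N_carrier by auto
qed

text \<open>The line through the image of each \<open>x\<close> in \<open>N\<close> is formed. Its
  nonzero points are the images of elements some nonzero power of which agrees, up to torsion, with
  a nonzero power of \<open>x\<close>; such elements lie in \<open>N\<close>. The zero point is
  missed because \<open>N\<close> contains no torsion element.\<close>

lemma union_of_punctured_lines:
  assumes one: "\<one> \<notin> N" and \<phi>: "vector_space_action (H Mod torsion H) \<phi>"
  shows "\<exists>\<L>. (\<forall>L\<in>\<L>. line (module_of_action (H Mod torsion H) \<phi>) L) \<and>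
    (\<lambda>x. torsion H #> x) ` N = (\<Union>L\<in>\<L>. L - {\<one>\<^bsub>H Mod torsion H\<^esub>})"
proof -
  let ?Q = "H Mod torsion H" and ?c = "\<lambda>x. torsion H #> x"
  interpret Q: comm_group ?Q by (rule abelian_FactGroup[OF subgroup_torsion])
  define V where "V = module_of_action ?Q \<phi>"
  interpret V: module rat_field V using \<phi> unfolding vector_space_action_def V_def by blast
  have V_simps: "carrier V = carrier ?Q" "add V = monoid.mult ?Q" "ring.zero V = \<one>\<^bsub>?Q\<^esub>"
    by (auto simp: V_def module_of_action_def)
  have smult_closed: "q \<odot>\<^bsub>V\<^esub> v \<in> carrier V" if "v \<in> carrier V" for q v
    using V.smult_closed[of q v] that by simp
  \<comment> \<open>For an arbitrary \<open>\<phi>\<close> the module axioms force integer scalars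
    to act as powers. This connects the scalar action with the hypothesis on powers of elements of
    \<open>N\<close>.\<close>
  have nat_smult: "of_nat n \<odot>\<^bsub>V\<^esub> v = v [^]\<^bsub>?Q\<^esub> n" if v: "v \<in> carrier V" for n v
  proof (induction n)
    case 0
    then show ?case using V.smult_l_null[OF v] by (simp add: V_simps)
  next
    case (Suc n)
    have "of_nat (Suc n) \<odot>\<^bsub>V\<^esub> v = (of_nat n \<oplus>\<^bsub>rat_field\<^esub> 1) \<odot>\<^bsub>V\<^esub> v" by (simp add: add.commute)
    also have "\<dots> = of_nat n \<odot>\<^bsub>V\<^esub> v \<oplus>\<^bsub>V\<^esub> 1 \<odot>\<^bsub>V\<^esub> v"
      by (rule V.smult_l_distr) (use v in auto)
    finally show ?case using Suc.IH V.smult_one[OF v] by (simp add: V_simps del: mult_FactGroup)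
  qed
  have int_smult: "of_int k \<odot>\<^bsub>V\<^esub> v = v [^]\<^bsub>?Q\<^esub> k" if v: "v \<in> carrier V" for k v
  proof (cases k)
    case (nonneg n)
    then show ?thesis using nat_smult[OF v] by (simp add: int_pow_int)
  next
    case (neg n)
    have "of_int k \<odot>\<^bsub>V\<^esub> v \<oplus>\<^bsub>V\<^esub> of_nat (Suc n) \<odot>\<^bsub>V\<^esub> v = (of_int k \<oplus>\<^bsub>rat_field\<^esub> of_nat (Suc n)) \<odot>\<^bsub>V\<^esub> v"
      by (rule V.smult_l_distr[symmetric]) (use v in auto)
    also have "\<dots> = \<zero>\<^bsub>V\<^esub>" using V.smult_l_null[OF v] neg by simp
    finally have "inv\<^bsub>?Q\<^esub> (v [^]\<^bsub>?Q\<^esub> Suc n) = of_int k \<odot>\<^bsub>V\<^esub> v"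
      unfolding nat_smult[OF v] using smult_closed[OF v] v
      by (intro Q.inv_equality) (auto simp: V_simps simp del: mult_FactGroup one_FactGroup)
    then show ?thesis
      using v neg by (simp add: V_simps Q.int_pow_neg int_pow_int del: of_nat_Suc int_Suc)
  qed
  have smult_assoc: "(p * q) \<odot>\<^bsub>V\<^esub> v = p \<odot>\<^bsub>V\<^esub> (q \<odot>\<^bsub>V\<^esub> v)" if "v \<in> carrier V" for p q v
    using V.smult_assoc1[of p q v] that by simp
  have smult_cancel: "q = q'" if v: "v \<in> carrier V" "v \<noteq> \<zero>\<^bsub>V\<^esub>" and eq: "q \<odot>\<^bsub>V\<^esub> v = q' \<odot>\<^bsub>V\<^esub> v" for q q' v
  proof (rule ccontr)
    assume "q \<noteq> q'"
    have "(q \<oplus>\<^bsub>rat_field\<^esub> (- q')) \<odot>\<^bsub>V\<^esub> v = q \<odot>\<^bsub>V\<^esub> v \<oplus>\<^bsub>V\<^esub> (- q') \<odot>\<^bsub>V\<^esub> v"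
      by (rule V.smult_l_distr) (use v in auto)
    also have "\<dots> = (q' \<oplus>\<^bsub>rat_field\<^esub> (- q')) \<odot>\<^bsub>V\<^esub> v"
      unfolding eq by (rule V.smult_l_distr[symmetric]) (use v in auto)
    finally have "(q - q') \<odot>\<^bsub>V\<^esub> v = \<zero>\<^bsub>V\<^esub>" using V.smult_l_null[OF v(1)] by simp
    then have "inverse (q - q') \<odot>\<^bsub>V\<^esub> ((q - q') \<odot>\<^bsub>V\<^esub> v) = \<zero>\<^bsub>V\<^esub>" using V.smult_r_null by simp
    then have "(inverse (q - q') * (q - q')) \<odot>\<^bsub>V\<^esub> v = \<zero>\<^bsub>V\<^esub>" using smult_assoc[OF v(1)] by simp
    then show False using V.smult_one[OF v(1)] v(2) \<open>q \<noteq> q'\<close> by simp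
  qed
  have c_carrier: "?c x \<in> carrier V" if "x \<in> carrier H" for x
    using that by (auto simp: V_simps carrier_FactGroup)
  have c_zero: "?c x = \<zero>\<^bsub>V\<^esub> \<longleftrightarrow> x \<in> torsion H" if "x \<in> carrier H" for x
    using that T.rcos_const rcos_self[OF that subgroup_torsion] by (auto simp: V_simps)
  define L where "L x = (\<lambda>q. q \<odot>\<^bsub>V\<^esub> ?c x) ` UNIV" for x
  have line: "line V (L x)" if x: "x \<in> N" for x
  proof -
    let ?v = "?c x"
    have v: "?v \<in> carrier V" "?v \<noteq> \<zero>\<^bsub>V\<^esub>"
      using x N_carrier c_carrier c_zero not_torsion_if_one_notin[OF one x] by auto
    have sub: "submodule (L x) rat_field V"
    proof (rule V.submoduleI)
      show "L x \<subseteq> carrier V" unfolding L_def using smult_closed[OF v(1)] by auto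
      have "\<zero>\<^bsub>V\<^esub> = 0 \<odot>\<^bsub>V\<^esub> ?v" using V.smult_l_null[OF v(1)] by simp
      then show "\<zero>\<^bsub>V\<^esub> \<in> L x" unfolding L_def by blast
      show "\<ominus>\<^bsub>V\<^esub> a \<in> L x" if "a \<in> L x" for a
      proof -
        from that obtain q where "a = q \<odot>\<^bsub>V\<^esub> ?v" unfolding L_def by blast
        then have "\<ominus>\<^bsub>V\<^esub> a = (\<ominus>\<^bsub>rat_field\<^esub> q) \<odot>\<^bsub>V\<^esub> ?v" using V.smult_l_minus[of q ?v] v by simp
        then show ?thesis unfolding L_def by blast
      qed
      show "a \<oplus>\<^bsub>V\<^esub> b \<in> L x" if "a \<in> L x" "b \<in> L x" for a b
      proof -
        from that obtain q p where "a = q \<odot>\<^bsub>V\<^esub> ?v" "b = p \<odot>\<^bsub>V\<^esub> ?v" unfolding L_def by blast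
        then have "a \<oplus>\<^bsub>V\<^esub> b = (q \<oplus>\<^bsub>rat_field\<^esub> p) \<odot>\<^bsub>V\<^esub> ?v" using V.smult_l_distr[of q p ?v] v by simp
        then show ?thesis unfolding L_def by blast
      qed
      show "a \<odot>\<^bsub>V\<^esub> b \<in> L x" if "a \<in> carrier rat_field" "b \<in> L x" for a b
        using that smult_assoc[OF v(1)] unfolding L_def by (auto simp flip: smult_assoc)
    qed
    then interpret S: module rat_field "V\<lparr>carrier := L x\<rparr>"
      by (rule submodule.submodule_is_module) (rule V.module_axioms)
    have "?v \<in> L x" unfolding L_def using V.smult_one[OF v(1)] by (metis rangeI rat_field_simps(3))
    have finsum: "(\<Oplus>\<^bsub>V\<lparr>carrier := L x\<rparr>\<^esub>b\<in>{?v}. a b \<odot>\<^bsub>V\<lparr>carrier := L x\<rparr>\<^esub> b) = a ?v \<odot>\<^bsub>V\<^esub> ?v" for a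
    proof -
      have "a ?v \<odot>\<^bsub>V\<^esub> ?v \<in> L x" unfolding L_def by blast
      then show ?thesis using S.M.finsum_insert[of "{}" ?v "\<lambda>b. a b \<odot>\<^bsub>V\<^esub> b"] S.M.r_zero[of "a ?v \<odot>\<^bsub>V\<^esub> ?v"] by simp
    qed
    have "\<exists>!a. a \<in> {?v} \<rightarrow>\<^sub>E UNIV \<and> y = a ?v \<odot>\<^bsub>V\<^esub> ?v" if "y \<in> L x" for y
    proof -
      from that obtain q where q: "y = q \<odot>\<^bsub>V\<^esub> ?v" unfolding L_def by blast
      show ?thesis
      proof (rule ex1I[of _ "\<lambda>b\<in>{?v}. q"])
        fix a assume a: "a \<in> {?v} \<rightarrow>\<^sub>E UNIV \<and> y = a ?v \<odot>\<^bsub>V\<^esub> ?v"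
        then have "a ?v = q" using q smult_cancel[OF v] by metis
        then show "a = (\<lambda>b\<in>{?v}. q)" using a by (intro PiE_ext[of a "{?v}" "\<lambda>_. UNIV"]) auto
      qed (use q in auto)
    qed
    then have "has_dimension rat_field (V\<lparr>carrier := L x\<rparr>) 1"
      unfolding has_dimension_def using \<open>?v \<in> L x\<close>
      by (intro exI[of _ "{?v}"] conjI ballI) (simp_all only: finsum rat_field_simps, auto)
    then show ?thesis using sub unfolding line_def by simp
  qed
  have "?c ` N = (\<Union>x\<in>N. L x - {\<one>\<^bsub>?Q\<^esub>})"
  proof
    show "?c ` N \<subseteq> (\<Union>x\<in>N. L x - {\<one>\<^bsub>?Q\<^esub>})"
    proof
      fix y assume "y \<in> ?c ` N"
      then obtain x where x: "x \<in> N" "y = ?c x" by blast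
      then have "x \<in> carrier H" using N_carrier by blast
      then have "y = 1 \<odot>\<^bsub>V\<^esub> ?c x" "y \<noteq> \<zero>\<^bsub>V\<^esub>"
        using V.smult_one[OF c_carrier] x not_torsion_if_one_notin[OF one x(1)] c_zero by auto
      then show "y \<in> (\<Union>x\<in>N. L x - {\<one>\<^bsub>?Q\<^esub>})" using x(1) unfolding L_def by (auto simp: V_simps)
    qed
  next
    show "(\<Union>x\<in>N. L x - {\<one>\<^bsub>?Q\<^esub>}) \<subseteq> ?c ` N"
    proof
      fix y assume "y \<in> (\<Union>x\<in>N. L x - {\<one>\<^bsub>?Q\<^esub>})"
      then obtain x q where x: "x \<in> N" "y = q \<odot>\<^bsub>V\<^esub> ?c x" "y \<noteq> \<zero>\<^bsub>V\<^esub>" unfolding L_def by (auto simp: V_simps)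
      have xH: "x \<in> carrier H" using x(1) N_carrier by blast
      have "q \<noteq> 0" using x V.smult_l_null[OF c_carrier[OF xH]] by auto
      obtain m n where mn: "q = of_int m / of_int n" "(n::int) > 0" using rat_fraction .
      then have "m \<noteq> 0" using \<open>q \<noteq> 0\<close> by auto
      have yV: "y \<in> carrier V" using x smult_closed c_carrier[OF xH] by simp
      then obtain z where z: "z \<in> carrier H" "y = ?c z" by (auto simp: V_simps carrier_FactGroup)
      \<comment> \<open>Clearing the denominator of \<open>q\<close> turns the scalar relation
        between \<open>y\<close> and \<open>?c x\<close> into an equality of integer powers, which
        lifts to \<open>H\<close> up to a torsion factor \<open>t\<close>.\<close>
      have "of_int n \<odot>\<^bsub>V\<^esub> y = of_int m \<odot>\<^bsub>V\<^esub> ?c x"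
        unfolding x(2) smult_assoc[OF c_carrier[OF xH], symmetric] using mn by simp
      then have "y [^]\<^bsub>?Q\<^esub> n = ?c x [^]\<^bsub>?Q\<^esub> m"
        unfolding int_smult[OF yV] int_smult[OF c_carrier[OF xH]] .
      then have "?c (z [^] n) = ?c (x [^] m)"
        unfolding z(2) using z xH by (simp add: T.FactGroup_int_pow)
      then obtain t where "t \<in> torsion H" "z [^] n = t \<otimes> x [^] m"
        using rcos_self[OF _ subgroup_torsion, of "z [^] n"] z(1) by (auto simp: r_coset_def)
      then have "z [^] n \<in> N" using mult_torsion_in_iff[of "x [^] m" t] N_pow[OF xH \<open>m \<noteq> 0\<close>] x(1) xH by simp
      then have "z \<in> N" using N_pow[OF z(1), of n] mn(2) by simp
      then show "y \<in> ?c ` N" using z(2) by blast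
    qed
  qed
  then show ?thesis using line unfolding V_def by (intro exI[of _ "L ` N"]) auto
qed

end

section \<open>Ascent and descent of Noetherianity\<close>

text \<open>In each of the three transfers below, a monotone map sends a chain of ideals to a chain
  in a ring known to be Noetherian. The union of the image chain is then one of its members, which
  singles out a member of the original chain.\<close>

lemma subset_chain_image:
  assumes "subset.chain \<A> \<C>" "\<And>A. A \<in> \<C> \<Longrightarrow> f A \<in> \<B>" "\<And>A A'. A \<subseteq> A' \<Longrightarrow> f A \<subseteq> f A'"
  shows "subset.chain \<B> (f ` \<C>)"
  using assms unfolding subset_chain_def by (metis (no_types, lifting) image_iff image_subsetI)

lemma noetherian_ring_iso:
  assumes R: "noetherian_ring R" and S: "ring S" and h: "h \<in> ring_iso R S"
  shows "noetherian_ring S"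
proof -
  interpret R: noetherian_ring R by (rule R)
  interpret S: ring S by (rule S)
  interpret h: ring_hom_ring R S h
    using h by (intro ring_hom_ringI2 R.ring_axioms S) (auto simp: ring_iso_def)
  have bij: "bij_betw h (carrier R) (carrier S)" using h by (simp add: ring_iso_def)
  let ?p = "\<lambda>J. {x \<in> carrier R. h x \<in> J}"
  have image: "h ` ?p J = J" if "ideal J S" for J
    using bij ideal.Icarr[OF that] unfolding bij_betw_def by auto
  show ?thesis
  proof (rule S.trivial_ideal_chain_imp_noetherian)
    fix \<C> assume \<C>: "\<C> \<noteq> {}" "subset.chain {J. ideal J S} \<C>"
    then have id: "ideal J S" if "J \<in> \<C>" for J using that unfolding pred_on.chain_def by blast
    have "subset.chain {I. ideal I R} (?p ` \<C>)"
      using id h.ideal_vimage by (intro subset_chain_image[OF \<C>(2)]) auto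
    then have "\<Union>(?p ` \<C>) \<in> ?p ` \<C>" using \<C>(1) by (intro R.ideal_chain_is_trivial) auto
    then obtain J where J: "J \<in> \<C>" "\<Union>(?p ` \<C>) = ?p J" by blast
    have "J' \<subseteq> J" if "J' \<in> \<C>" for J'
    proof -
      have "?p J' \<subseteq> ?p J" using J(2) that by blast
      then have "h ` ?p J' \<subseteq> h ` ?p J" by blast
      then show ?thesis using image[OF id] that J(1) by metis
    qed
    then have "\<Union>\<C> = J" using J(1) by blast
    then show "\<Union>\<C> \<in> \<C>" using J(1) by simp
  qed
qed

text \<open>An ideal \<open>I\<close> of \<open>R\<close> can be recovered from the ideal
  \<open>J I\<close> of \<open>F\<close>: the two meet \<open>R\<close> in the same set, because
  \<open>\<pi>\<close> is \<open>R\<close>-linear and fixes \<open>R\<close>. So a chain in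
  \<open>R\<close> attains its union as soon as its image in \<open>F\<close> does.\<close>

lemma noetherian_retract:
  assumes F: "noetherian_ring F" and "cring F" and R: "subring R F"
    and \<pi>_closed: "\<And>x. x \<in> carrier F \<Longrightarrow> \<pi> x \<in> R"
    and \<pi>_add: "\<And>x y. x \<in> carrier F \<Longrightarrow> y \<in> carrier F \<Longrightarrow> \<pi> (x \<oplus>\<^bsub>F\<^esub> y) = \<pi> x \<oplus>\<^bsub>F\<^esub> \<pi> y"
    and \<pi>_mult: "\<And>a x. a \<in> R \<Longrightarrow> x \<in> carrier F \<Longrightarrow> \<pi> (a \<otimes>\<^bsub>F\<^esub> x) = a \<otimes>\<^bsub>F\<^esub> \<pi> x"
    and \<pi>_id: "\<And>a. a \<in> R \<Longrightarrow> \<pi> a = a"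
  shows "noetherian_ring (F\<lparr>carrier := R\<rparr>)"
proof -
  interpret F: noetherian_ring F by (rule F)
  interpret F: cring F by fact
  let ?R = "F\<lparr>carrier := R\<rparr>"
  interpret R: ring ?R using R by (rule F.subring_is_ring)
  have R_sub: "R \<subseteq> carrier F" using subringE(1)[OF R] .
  \<comment> \<open>\<open>J I\<close> is the extended ideal \<open>I F\<close>, cut out by the condition that is evidently monotone in \<open>I\<close>.\<close>
  define J where "J I = {x \<in> carrier F. \<forall>y\<in>carrier F. \<pi> (x \<otimes>\<^bsub>F\<^esub> y) \<in> I}" for I
  have J_ideal: "ideal (J I) F" if I: "ideal I ?R" for I
  proof -
    interpret I: ideal I ?R by (rule I)
    have I0: "\<zero>\<^bsub>F\<^esub> \<in> I" using I.zero_closed by simp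
    have \<pi>0: "\<pi> \<zero>\<^bsub>F\<^esub> = \<zero>\<^bsub>F\<^esub>" using \<pi>_id subringE(2)[OF R] by blast
    \<comment> \<open>Negation in \<open>?R\<close> is taken with respect to its own carrier, so its
      minus one has to be identified with that of \<open>F\<close> before the ideal property can be
      applied to it.\<close>
    have I_neg: "\<ominus>\<^bsub>F\<^esub> a \<in> I" if "a \<in> I" for a
    proof -
      have "\<ominus>\<^bsub>?R\<^esub> \<one>\<^bsub>F\<^esub> \<otimes>\<^bsub>F\<^esub> a \<in> I"
        using I.I_l_closed[OF that, of "\<ominus>\<^bsub>?R\<^esub> \<one>\<^bsub>F\<^esub>"] R.a_inv_closed[of "\<one>\<^bsub>F\<^esub>"] subringE(3)[OF R] by simp
      moreover have "\<ominus>\<^bsub>?R\<^esub> \<one>\<^bsub>F\<^esub> = \<ominus>\<^bsub>F\<^esub> \<one>\<^bsub>F\<^esub>"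
        using R.l_neg[of "\<one>\<^bsub>F\<^esub>"] R.a_inv_closed[of "\<one>\<^bsub>F\<^esub>"] subringE(3)[OF R] R_sub
        by (intro F.minus_equality[symmetric]) auto
      moreover have "a \<in> carrier F" using I.Icarr[OF that] R_sub by auto
      ultimately show ?thesis by (simp add: F.l_minus)
    qed
    have \<pi>_neg: "\<pi> (\<ominus>\<^bsub>F\<^esub> x) = \<ominus>\<^bsub>F\<^esub> \<pi> x" if "x \<in> carrier F" for x
    proof -
      have "\<pi> (\<ominus>\<^bsub>F\<^esub> x) \<oplus>\<^bsub>F\<^esub> \<pi> x = \<zero>\<^bsub>F\<^esub>"
        using \<pi>_add[of "\<ominus>\<^bsub>F\<^esub> x" x] that \<pi>0 by (simp add: F.l_neg)
      then show ?thesis using that \<pi>_closed R_sub by (intro F.minus_equality[symmetric]) auto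
    qed
    show ?thesis
    proof (rule idealI[OF F.ring_axioms])
      show "subgroup (J I) (add_monoid F)"
      proof (rule F.add.subgroupI)
        show "J I \<subseteq> carrier F" by (auto simp: J_def)
        have "\<zero>\<^bsub>F\<^esub> \<in> J I" using I0 \<pi>0 by (auto simp: J_def)
        then show "J I \<noteq> {}" by blast
        show "\<ominus>\<^bsub>F\<^esub> a \<in> J I" if "a \<in> J I" for a
          using that I_neg by (auto simp: J_def \<pi>_neg F.l_minus)
        show "a \<oplus>\<^bsub>F\<^esub> b \<in> J I" if "a \<in> J I" "b \<in> J I" for a b
          using that I.a_closed by (auto simp: J_def \<pi>_add F.l_distr)
      qed
      show "x \<otimes>\<^bsub>F\<^esub> a \<in> J I" "a \<otimes>\<^bsub>F\<^esub> x \<in> J I" if "a \<in> J I" "x \<in> carrier F" for a x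
        using that by (auto simp: J_def F.m_assoc F.m_comm[of x a])
    qed
  qed
  have J_Int: "J I \<inter> R = I" if I: "ideal I ?R" for I
  proof -
    interpret I: ideal I ?R by (rule I)
    have "x \<in> J I" if "x \<in> I" for x
      using that I.Icarr[OF that] R_sub \<pi>_closed I.I_r_closed[OF that] by (auto simp: J_def \<pi>_mult)
    moreover have "x \<in> I" if "x \<in> J I" "x \<in> R" for x
    proof -
      have "\<pi> (x \<otimes>\<^bsub>F\<^esub> \<one>\<^bsub>F\<^esub>) \<in> I" using that(1) F.one_closed unfolding J_def by blast
      then show ?thesis using that R_sub \<pi>_id by auto
    qed
    ultimately show ?thesis using I.Icarr by auto
  qed
  have J_mono: "J I \<subseteq> J I'" if "I \<subseteq> I'" for I I' using that by (auto simp: J_def)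
  show ?thesis
  proof (rule R.trivial_ideal_chain_imp_noetherian)
    fix \<C> assume \<C>: "\<C> \<noteq> {}" "subset.chain {I. ideal I ?R} \<C>"
    then have id: "ideal I ?R" if "I \<in> \<C>" for I using that unfolding pred_on.chain_def by blast
    have "subset.chain {I. ideal I F} (J ` \<C>)"
      using id by (intro subset_chain_image[OF \<C>(2)]) (auto simp: J_ideal dest: J_mono)
    then have "\<Union>(J ` \<C>) \<in> J ` \<C>" using \<C>(1) by (intro F.ideal_chain_is_trivial) auto
    then obtain I where I: "I \<in> \<C>" "\<Union>(J ` \<C>) = J I" by blast
    have "I' \<subseteq> I" if "I' \<in> \<C>" for I'
    proof -
      have "J I' \<inter> R \<subseteq> J I \<inter> R" using I(2) that by blast
      then show ?thesis using J_Int[OF id] that I(1) by metis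
    qed
    then have "\<Union>\<C> = I" using I(1) by blast
    then show "\<Union>\<C> \<in> \<C>" using I(1) by simp
  qed
qed

text \<open>This is the argument that finitely generated modules over a Noetherian ring are
  Noetherian, phrased for ideals of \<open>F\<close> cut down to \<open>R\<close>-spans of subsets
  of \<open>Y\<close>. Two nested ideals that agree on \<open>span S\<close> and have the same
  coefficients at a further generator \<open>y\<close> agree on
  \<open>span (insert y S)\<close>.\<close>

lemma noetherian_finite_extension:
  assumes "cring F" and R: "subring R F" and noeth: "noetherian_ring (F\<lparr>carrier := R\<rparr>)"
    and Y: "finite Y" "Y \<subseteq> carrier F"
    and span: "\<And>x. x \<in> carrier F \<Longrightarrow> \<exists>a \<in> Y \<rightarrow> R. x = (\<Oplus>\<^bsub>F\<^esub>y\<in>Y. a y \<otimes>\<^bsub>F\<^esub> y)"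
  shows "noetherian_ring F"
proof -
  interpret F: cring F by fact
  let ?R = "F\<lparr>carrier := R\<rparr>"
  interpret R: noetherian_ring ?R by (rule noeth)
  have R_sub: "R \<subseteq> carrier F" using subringE(1)[OF R] .
  define span where "span S = {(\<Oplus>\<^bsub>F\<^esub>y\<in>S. a y \<otimes>\<^bsub>F\<^esub> y) | a. a \<in> S \<rightarrow> R}" for S
  have R_minus: "a \<ominus>\<^bsub>F\<^esub> b \<in> R" if "a \<in> R" "b \<in> R" for a b
    unfolding a_minus_def using that subringE(5,7)[OF R] by blast
  have summand: "a y \<otimes>\<^bsub>F\<^esub> y \<in> carrier F" if "a \<in> S \<rightarrow> R" "y \<in> S" "S \<subseteq> carrier F" for a S y
    using that R_sub by (intro F.m_closed) auto
  have span_closed: "span S \<subseteq> carrier F" if "S \<subseteq> carrier F" for S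
    using that R_sub unfolding span_def by (auto intro!: F.finsum_closed)
  have span_minus: "s \<ominus>\<^bsub>F\<^esub> t \<in> span S" if st: "s \<in> span S" "t \<in> span S" and S: "S \<subseteq> carrier F" "finite S" for s t S
  proof -
    obtain a b where ab: "a \<in> S \<rightarrow> R" "b \<in> S \<rightarrow> R"
      "s = (\<Oplus>\<^bsub>F\<^esub>y\<in>S. a y \<otimes>\<^bsub>F\<^esub> y)" "t = (\<Oplus>\<^bsub>F\<^esub>y\<in>S. b y \<otimes>\<^bsub>F\<^esub> y)" using st unfolding span_def by blast
    let ?u = "\<Oplus>\<^bsub>F\<^esub>y\<in>S. (a y \<ominus>\<^bsub>F\<^esub> b y) \<otimes>\<^bsub>F\<^esub> y"
    have c: "a y \<in> carrier F" "b y \<in> carrier F" "y \<in> carrier F" if "y \<in> S" for y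
      using that ab S R_sub by auto
    have "?u \<oplus>\<^bsub>F\<^esub> t = (\<Oplus>\<^bsub>F\<^esub>y\<in>S. (a y \<ominus>\<^bsub>F\<^esub> b y) \<otimes>\<^bsub>F\<^esub> y \<oplus>\<^bsub>F\<^esub> b y \<otimes>\<^bsub>F\<^esub> y)"
      unfolding ab(4) using c by (intro F.finsum_addf[symmetric]) auto
    also have "\<dots> = s"
      unfolding ab(3)
    proof (rule F.finsum_cong')
      fix y assume "y \<in> S"
      from c[OF this] show "(a y \<ominus>\<^bsub>F\<^esub> b y) \<otimes>\<^bsub>F\<^esub> y \<oplus>\<^bsub>F\<^esub> b y \<otimes>\<^bsub>F\<^esub> y = a y \<otimes>\<^bsub>F\<^esub> y" by algebra
    qed (use c in auto)
    finally have "?u \<oplus>\<^bsub>F\<^esub> t = s" .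
    moreover have "?u \<in> carrier F" "t \<in> carrier F" unfolding ab(4) using c by (auto intro!: F.finsum_closed)
    moreover have "(u \<oplus>\<^bsub>F\<^esub> t) \<ominus>\<^bsub>F\<^esub> t = u" if "u \<in> carrier F" "t \<in> carrier F" for u t
      using that by algebra
    ultimately have "s \<ominus>\<^bsub>F\<^esub> t = ?u" by metis
    moreover have "?u \<in> span S" unfolding span_def
      by (intro CollectI exI[of _ "\<lambda>y. a y \<ominus>\<^bsub>F\<^esub> b y"] conjI refl) (use ab R_minus in auto)
    ultimately show ?thesis by simp
  qed
  have span_insert: "\<exists>s\<in>span S. \<exists>c\<in>R. x = s \<oplus>\<^bsub>F\<^esub> c \<otimes>\<^bsub>F\<^esub> y"
    if x: "x \<in> span (insert y S)" and S: "finite S" "y \<notin> S" "insert y S \<subseteq> carrier F" for x y S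
  proof -
    obtain a where a: "a \<in> insert y S \<rightarrow> R" "x = (\<Oplus>\<^bsub>F\<^esub>y\<in>insert y S. a y \<otimes>\<^bsub>F\<^esub> y)"
      using x unfolding span_def by blast
    have "x = a y \<otimes>\<^bsub>F\<^esub> y \<oplus>\<^bsub>F\<^esub> (\<Oplus>\<^bsub>F\<^esub>y\<in>S. a y \<otimes>\<^bsub>F\<^esub> y)"
      unfolding a(2) using S summand[OF a(1)] by (intro F.finsum_insert) auto
    moreover have "(\<Oplus>\<^bsub>F\<^esub>y\<in>S. a y \<otimes>\<^bsub>F\<^esub> y) \<in> span S" using a(1) unfolding span_def by blast
    moreover have "a y \<otimes>\<^bsub>F\<^esub> y \<in> carrier F" using summand[OF a(1)] S by blast
    moreover have "a y \<in> R" using a(1) by blast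
    moreover have "(\<Oplus>\<^bsub>F\<^esub>y\<in>S. a y \<otimes>\<^bsub>F\<^esub> y) \<in> carrier F" using summand[OF a(1)] S by (intro F.finsum_closed) auto
    ultimately show ?thesis using F.a_comm by metis
  qed
  \<comment> \<open>Restricting the ideals to the span of \<open>S\<close> makes an induction over
    the generators possible; the case \<open>S = Y\<close> is the claim, as \<open>Y\<close> spans
    \<open>F\<close>.\<close>
  have chain_bound: "\<exists>M\<in>\<C>. \<forall>J\<in>\<C>. J \<inter> span S \<subseteq> M"
    if "finite S" "S \<subseteq> carrier F" and \<C>: "\<C> \<noteq> {}" "subset.chain {J. ideal J F} \<C>" for S \<C>
    using that(1,2)
  proof (induction S)
    case empty
    obtain M where "M \<in> \<C>" using \<C> by blast
    then have "ideal M F" using \<C> unfolding pred_on.chain_def by blast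
    then have "\<zero>\<^bsub>F\<^esub> \<in> M" by (rule additive_subgroup.zero_closed[OF ideal.axioms(1)])
    then show ?case using \<open>M \<in> \<C>\<close> unfolding span_def by auto
  next
    case (insert y S)
    have id: "ideal J F" if "J \<in> \<C>" for J using that \<C>(2) unfolding pred_on.chain_def by blast
    have lin: "J \<subseteq> J' \<or> J' \<subseteq> J" if "J \<in> \<C>" "J' \<in> \<C>" for J J'
      using that \<C>(2) unfolding pred_on.chain_def by blast
    have y: "y \<in> carrier F" and S: "S \<subseteq> carrier F" using insert.prems by auto
    obtain M\<^sub>0 where M\<^sub>0: "M\<^sub>0 \<in> \<C>" "\<And>J. J \<in> \<C> \<Longrightarrow> J \<inter> span S \<subseteq> M\<^sub>0" using insert by auto
    \<comment> \<open>These are the leading coefficients with respect to \<open>y\<close>. They form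
      an ideal of \<open>R\<close>, so along the chain they attain their union at some member
      \<open>M\<^sub>1\<close>.\<close>
    define I where "I J = {c \<in> R. \<exists>s\<in>span S. s \<oplus>\<^bsub>F\<^esub> c \<otimes>\<^bsub>F\<^esub> y \<in> J}" for J
    have span_mult: "c \<otimes>\<^bsub>F\<^esub> s \<in> span S" if c: "c \<in> R" and s: "s \<in> span S" for c s
    proof -
      obtain a where a: "a \<in> S \<rightarrow> R" "s = (\<Oplus>\<^bsub>F\<^esub>y\<in>S. a y \<otimes>\<^bsub>F\<^esub> y)" using s unfolding span_def by blast
      have "c \<otimes>\<^bsub>F\<^esub> s = (\<Oplus>\<^bsub>F\<^esub>y\<in>S. c \<otimes>\<^bsub>F\<^esub> (a y \<otimes>\<^bsub>F\<^esub> y))"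
        unfolding a(2) using c R_sub summand[OF a(1) _ S] insert.hyps by (intro F.finsum_rdistr) auto
      also have "\<dots> = (\<Oplus>\<^bsub>F\<^esub>y\<in>S. (c \<otimes>\<^bsub>F\<^esub> a y) \<otimes>\<^bsub>F\<^esub> y)"
        using c R_sub S a(1) by (intro F.finsum_cong') (auto simp: F.m_assoc Pi_iff subset_iff)
      finally show ?thesis unfolding span_def
        by (intro CollectI exI[of _ "\<lambda>y. c \<otimes>\<^bsub>F\<^esub> a y"] conjI) (use c a(1) subringE(6)[OF R] in auto)
    qed
    have "(\<Oplus>\<^bsub>F\<^esub>y\<in>S. \<zero>\<^bsub>F\<^esub> \<otimes>\<^bsub>F\<^esub> y) = \<zero>\<^bsub>F\<^esub>"
      using S by (intro F.add.finprod_one_eqI) auto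
    then have zero_span: "\<zero>\<^bsub>F\<^esub> \<in> span S"
      unfolding span_def using subringE(2)[OF R] by (intro CollectI exI[of _ "\<lambda>_. \<zero>\<^bsub>F\<^esub>"]) auto
    have I_ideal: "ideal (I J) ?R" if J: "J \<in> \<C>" for J
    proof -
      interpret J: ideal J F using id[OF J] .
      show ?thesis
      proof (rule idealI[OF R.ring_axioms])
        show "subgroup (I J) (add_monoid ?R)"
        proof (rule R.add.subgroupI)
          show "I J \<subseteq> carrier ?R" by (auto simp: I_def)
          have "\<zero>\<^bsub>F\<^esub> \<in> I J" unfolding I_def
            using zero_span subringE(2)[OF R] J.zero_closed y by (auto intro!: bexI[of _ "\<zero>\<^bsub>F\<^esub>"])
          then show "I J \<noteq> {}" by blast
        next
          fix a assume "a \<in> I J"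
          then obtain s where s: "a \<in> R" "s \<in> span S" "s \<oplus>\<^bsub>F\<^esub> a \<otimes>\<^bsub>F\<^esub> y \<in> J" unfolding I_def by blast
          have car: "a \<in> carrier F" "s \<in> carrier F" using s span_closed[OF S] R_sub by auto
          have "\<ominus>\<^bsub>F\<^esub> (s \<oplus>\<^bsub>F\<^esub> a \<otimes>\<^bsub>F\<^esub> y) \<in> J" using s(3) by (rule J.a_inv_closed)
          also have "\<ominus>\<^bsub>F\<^esub> (s \<oplus>\<^bsub>F\<^esub> a \<otimes>\<^bsub>F\<^esub> y) = (\<zero>\<^bsub>F\<^esub> \<ominus>\<^bsub>F\<^esub> s) \<oplus>\<^bsub>F\<^esub> (\<ominus>\<^bsub>F\<^esub> a) \<otimes>\<^bsub>F\<^esub> y" using car y by algebra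
          finally have "\<ominus>\<^bsub>F\<^esub> a \<in> I J" unfolding I_def
            using s span_minus[OF zero_span s(2) S insert.hyps(1)] subringE(5)[OF R] by blast
          moreover have "\<ominus>\<^bsub>?R\<^esub> a = \<ominus>\<^bsub>F\<^esub> a"
            using R.l_neg[of a] R.a_inv_closed[of a] s(1) R_sub
            by (intro F.minus_equality[symmetric]) auto
          ultimately show "\<ominus>\<^bsub>?R\<^esub> a \<in> I J" by simp
        next
          fix a b assume "a \<in> I J" "b \<in> I J"
          then obtain s t where s: "a \<in> R" "s \<in> span S" "s \<oplus>\<^bsub>F\<^esub> a \<otimes>\<^bsub>F\<^esub> y \<in> J"
            and t: "b \<in> R" "t \<in> span S" "t \<oplus>\<^bsub>F\<^esub> b \<otimes>\<^bsub>F\<^esub> y \<in> J" unfolding I_def by blast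
          have car: "a \<in> carrier F" "s \<in> carrier F" "b \<in> carrier F" "t \<in> carrier F"
            using s t span_closed[OF S] R_sub by auto
          have "(s \<oplus>\<^bsub>F\<^esub> a \<otimes>\<^bsub>F\<^esub> y) \<oplus>\<^bsub>F\<^esub> (t \<oplus>\<^bsub>F\<^esub> b \<otimes>\<^bsub>F\<^esub> y) \<in> J" using s(3) t(3) by (rule J.a_closed)
          also have "(s \<oplus>\<^bsub>F\<^esub> a \<otimes>\<^bsub>F\<^esub> y) \<oplus>\<^bsub>F\<^esub> (t \<oplus>\<^bsub>F\<^esub> b \<otimes>\<^bsub>F\<^esub> y)
              = (s \<ominus>\<^bsub>F\<^esub> (\<zero>\<^bsub>F\<^esub> \<ominus>\<^bsub>F\<^esub> t)) \<oplus>\<^bsub>F\<^esub> (a \<oplus>\<^bsub>F\<^esub> b) \<otimes>\<^bsub>F\<^esub> y" using car y by algebra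
          finally show "a \<oplus>\<^bsub>?R\<^esub> b \<in> I J" unfolding I_def
            using s t span_minus[OF s(2) span_minus[OF zero_span t(2) S insert.hyps(1)] S insert.hyps(1)]
              subringE(7)[OF R] by auto
        qed
      next
        fix a x assume "a \<in> I J" "x \<in> carrier ?R"
        then obtain s where s: "a \<in> R" "s \<in> span S" "s \<oplus>\<^bsub>F\<^esub> a \<otimes>\<^bsub>F\<^esub> y \<in> J" and x: "x \<in> R"
          unfolding I_def by auto
        have car: "a \<in> carrier F" "s \<in> carrier F" "x \<in> carrier F" using s x span_closed[OF S] R_sub by auto
        have "x \<otimes>\<^bsub>F\<^esub> (s \<oplus>\<^bsub>F\<^esub> a \<otimes>\<^bsub>F\<^esub> y) \<in> J" using s(3) car(3) by (rule J.I_l_closed)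
        also have "x \<otimes>\<^bsub>F\<^esub> (s \<oplus>\<^bsub>F\<^esub> a \<otimes>\<^bsub>F\<^esub> y) = x \<otimes>\<^bsub>F\<^esub> s \<oplus>\<^bsub>F\<^esub> (x \<otimes>\<^bsub>F\<^esub> a) \<otimes>\<^bsub>F\<^esub> y" using car y by algebra
        finally have "x \<otimes>\<^bsub>F\<^esub> a \<in> I J" unfolding I_def
          using span_mult[OF x s(2)] subringE(6)[OF R x s(1)] by blast
        then show "x \<otimes>\<^bsub>?R\<^esub> a \<in> I J" "a \<otimes>\<^bsub>?R\<^esub> x \<in> I J" using F.m_comm[of x a] car by auto
      qed
    qed
    have "subset.chain {I. ideal I ?R} (I ` \<C>)"
      by (rule subset_chain_image[OF \<C>(2)]) (use I_ideal in \<open>auto simp: I_def\<close>)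
    then have "\<Union>(I ` \<C>) \<in> I ` \<C>" using \<C>(1) by (intro R.ideal_chain_is_trivial) auto
    then obtain M\<^sub>1 where M\<^sub>1: "M\<^sub>1 \<in> \<C>" "\<Union>(I ` \<C>) = I M\<^sub>1" by blast
    obtain M where M: "M \<in> \<C>" "M\<^sub>0 \<subseteq> M" "M\<^sub>1 \<subseteq> M" using lin[OF M\<^sub>0(1) M\<^sub>1(1)] M\<^sub>0(1) M\<^sub>1(1) by (metis order_refl)
    have "x \<in> M" if J: "J \<in> \<C>" "x \<in> J" "x \<in> span (insert y S)" for J x
    proof (cases "J \<subseteq> M")
      case False
      then have "M \<subseteq> J" using lin[OF M(1) J(1)] by blast
      interpret J: ideal J F using id[OF J(1)] .
      interpret M: ideal M F using id[OF M(1)] .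
      obtain s c where s: "s \<in> span S" "c \<in> R" "x = s \<oplus>\<^bsub>F\<^esub> c \<otimes>\<^bsub>F\<^esub> y"
        using span_insert[OF J(3) insert.hyps insert.prems] by blast
      then have "c \<in> I J" using J(2) unfolding I_def by blast
      then have "c \<in> I M\<^sub>1" using M\<^sub>1(2) J(1) by blast
      \<comment> \<open>\<open>M\<close> contains an element with the same coefficient at
        \<open>y\<close> as \<open>x\<close>. Their difference \<open>s \<ominus> t\<close> lies in
        \<open>J\<close> and in \<open>span S\<close>, hence in \<open>M\<close> by the induction
        hypothesis, and so \<open>x\<close> lies in \<open>M\<close>.\<close>
      then obtain t where t: "t \<in> span S" "t \<oplus>\<^bsub>F\<^esub> c \<otimes>\<^bsub>F\<^esub> y \<in> M" using M(3) unfolding I_def by blast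
      have car: "s \<in> carrier F" "t \<in> carrier F" "c \<in> carrier F" using s t span_closed[OF S] R_sub by auto
      have "x \<ominus>\<^bsub>F\<^esub> (t \<oplus>\<^bsub>F\<^esub> c \<otimes>\<^bsub>F\<^esub> y) \<in> J"
        unfolding a_minus_def using t(2) \<open>M \<subseteq> J\<close> by (intro J.a_closed[OF J(2) J.a_inv_closed]) blast
      also have "x \<ominus>\<^bsub>F\<^esub> (t \<oplus>\<^bsub>F\<^esub> c \<otimes>\<^bsub>F\<^esub> y) = s \<ominus>\<^bsub>F\<^esub> t" unfolding s(3) using car y by algebra
      finally have "s \<ominus>\<^bsub>F\<^esub> t \<in> M"
        using M\<^sub>0(2)[OF J(1)] span_minus[OF s(1) t(1) S insert.hyps(1)] M(2) by blast
      then have "(s \<ominus>\<^bsub>F\<^esub> t) \<oplus>\<^bsub>F\<^esub> (t \<oplus>\<^bsub>F\<^esub> c \<otimes>\<^bsub>F\<^esub> y) \<in> M" using t(2) by (rule M.a_closed)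
      also have "(s \<ominus>\<^bsub>F\<^esub> t) \<oplus>\<^bsub>F\<^esub> (t \<oplus>\<^bsub>F\<^esub> c \<otimes>\<^bsub>F\<^esub> y) = x" unfolding s(3) using car y by algebra
      finally show ?thesis .
    qed (use J in blast)
    then show ?case using M(1) by blast
  qed
  show ?thesis
  proof (rule F.trivial_ideal_chain_imp_noetherian)
    fix \<C> assume \<C>: "\<C> \<noteq> {}" "subset.chain {J. ideal J F} \<C>"
    obtain M where M: "M \<in> \<C>" "\<And>J. J \<in> \<C> \<Longrightarrow> J \<inter> span Y \<subseteq> M" using chain_bound[OF Y \<C>] by blast
    have "J \<subseteq> M" if "J \<in> \<C>" for J
    proof
      fix x assume "x \<in> J"
      have "ideal J F" using that \<C>(2) unfolding pred_on.chain_def by blast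
      then have "x \<in> span Y" using ideal.Icarr[OF _ \<open>x \<in> J\<close>] assms(6) unfolding span_def by blast
      then show "x \<in> M" using M(2)[OF that] \<open>x \<in> J\<close> by blast
    qed
    then have "\<Union>\<C> = M" using M(1) by blast
    then show "\<Union>\<C> \<in> \<C>" using M(1) by simp
  qed
qed

section \<open>Finite rank\<close>

text \<open>Gaussian elimination over the index set \<open>B\<close>. If some row \<open>t\<close>
  has a nonzero entry at \<open>b\<close>, it serves as a pivot that clears this entry from the
  other rows; the induction hypothesis is applied to the rows that remain.\<close>

lemma linear_dependence:
  fixes a :: "'s \<Rightarrow> 'b \<Rightarrow> 'k::field"
  assumes "finite B" "finite S" "card S > card B"
  obtains q where "\<exists>s\<in>S. q s \<noteq> 0" "\<And>b. b \<in> B \<Longrightarrow> (\<Sum>s\<in>S. q s * a s b) = 0"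
proof -
  have "\<exists>q. (\<exists>s\<in>S. q s \<noteq> 0) \<and> (\<forall>b\<in>B. (\<Sum>s\<in>S. q s * a s b) = 0)"
    using assms
  proof (induction B arbitrary: S a)
    case empty
    then have "S \<noteq> {}" by auto
    then show ?case by (intro exI[of _ "\<lambda>_. 1"]) auto
  next
    case (insert b B)
    show ?case
    proof (cases "\<forall>s\<in>S. a s b = 0")
      case True
      have "card S > card B" using insert by simp
      then obtain q where "\<exists>s\<in>S. q s \<noteq> 0" "\<forall>b\<in>B. (\<Sum>s\<in>S. q s * a s b) = 0"
        using insert.IH[of S a] insert.prems by blast
      then show ?thesis using True by (intro exI[of _ q]) (auto intro: sum.neutral)
    next
      case False
      then obtain t where t: "t \<in> S" "a t b \<noteq> 0" by blast
      let ?a = "\<lambda>s b'. a s b' - a s b / a t b * a t b'"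
      have "card (S - {t}) > card B" using insert t by simp
      then obtain q where q: "\<exists>s\<in>S - {t}. q s \<noteq> 0" "\<forall>b'\<in>B. (\<Sum>s\<in>S - {t}. q s * ?a s b') = 0"
        using insert.IH[of "S - {t}" ?a] insert.prems by blast
      \<comment> \<open>The coefficient \<open>- u\<close> of the pivot row collects the multiples
        of row \<open>t\<close> that were subtracted from the others, so the combination of the
        original rows equals that of the reduced ones. The reduced rows vanish at
        \<open>b\<close>.\<close>
      define u where "u = (\<Sum>s\<in>S - {t}. q s * (a s b / a t b))"
      have split: "(\<Sum>s\<in>S. (q(t := - u)) s * a s b') = (\<Sum>s\<in>S - {t}. q s * ?a s b')" for b'
      proof -
        have "(\<Sum>s\<in>S. (q(t := - u)) s * a s b') = - u * a t b' + (\<Sum>s\<in>S - {t}. q s * a s b')"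
          using t insert.prems by (subst sum.remove[of _ t]) auto
        also have "\<dots> = (\<Sum>s\<in>S - {t}. q s * ?a s b')"
          by (simp add: u_def sum_distrib_right right_diff_distrib sum_subtractf mult.assoc)
        finally show ?thesis .
      qed
      have "(\<Sum>s\<in>S. (q(t := - u)) s * a s b') = 0" if "b' \<in> insert b B" for b'
        unfolding split using that q(2) t by (cases "b' = b") auto
      moreover have "\<exists>s\<in>S. (q(t := - u)) s \<noteq> 0" using q(1) by auto
      ultimately show ?thesis by blast
    qed
  qed
  then show thesis using that by blast
qed

lemma common_denominator:
  fixes q :: "'s \<Rightarrow> rat"
  assumes "finite S"
  obtains d :: int and m where "d > 0" "\<And>s. s \<in> S \<Longrightarrow> of_int d * q s = of_int (m s)"
proof -
  have "\<exists>d::int. d > 0 \<and> (\<forall>s\<in>S. \<exists>m. of_int d * q s = of_int m)"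
    using assms
  proof (induction S)
    case (insert s S)
    then obtain d :: int where d: "d > 0" "\<forall>s\<in>S. \<exists>m. of_int d * q s = of_int m" by blast
    obtain a b where ab: "q s = of_int a / of_int b" "(b::int) > 0" using rat_fraction .
    have "\<exists>m. of_int (b * d) * q t = of_int m" if t: "t \<in> insert s S" for t
    proof (cases "t = s")
      case True
      then show ?thesis using ab by (intro exI[of _ "d * a"]) simp
    next
      case False
      then obtain m where "of_int d * q t = of_int m" using d t by auto
      then show ?thesis by (intro exI[of _ "b * m"]) (simp add: mult.assoc)
    qed
    then show ?case using d ab by (intro exI[of _ "b * d"]) auto
  qed (intro exI[of _ 1], simp)
  then show thesis using that by metis
qed

lemma integer_linear_dependence:
  fixes a :: "'s \<Rightarrow> 'b \<Rightarrow> rat"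
  assumes "finite B" "finite S" "card S > card B"
  obtains q :: "'s \<Rightarrow> int" where "\<exists>s\<in>S. q s \<noteq> 0" "\<And>b. b \<in> B \<Longrightarrow> (\<Sum>s\<in>S. of_int (q s) * a s b) = 0"
proof -
  obtain q where q: "\<exists>s\<in>S. q s \<noteq> 0" "\<And>b. b \<in> B \<Longrightarrow> (\<Sum>s\<in>S. q s * a s b) = 0"
    using linear_dependence[OF assms, of a] by blast
  obtain d m where d: "(d::int) > 0" "\<And>s. s \<in> S \<Longrightarrow> of_int d * q s = of_int (m s)"
    using common_denominator[OF assms(2), of q] by blast
  have "\<exists>s\<in>S. m s \<noteq> 0" using q(1) d by (metis mult_eq_0_iff of_int_eq_0_iff less_irrefl of_int_0)
  moreover have "(\<Sum>s\<in>S. of_int (m s) * a s b) = 0" if "b \<in> B" for b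
  proof -
    have "(\<Sum>s\<in>S. of_int (m s) * a s b) = of_int d * (\<Sum>s\<in>S. q s * a s b)"
      unfolding sum_distrib_left using d(2) by (intro sum.cong) (auto simp flip: mult.assoc)
    then show ?thesis using q(2)[OF that] by simp
  qed
  ultimately show thesis using that by blast
qed

section \<open>The embedding of a torsion-free group into its tensor product with the
  rationals\<close>

context
  fixes G :: "('g, 'a) monoid_scheme" (structure)
  assumes comm: "comm_group G"
begin

interpretation comm_group G by (rule comm)

private abbreviation (input) tensors where "tensors \<equiv> pairs_group rat_field G"
private abbreviation (input) relations where "relations \<equiv> tensor_relations rat_field G"
private abbreviation (input) elem where "elem p g \<equiv> frag_of (p::rat, g)"
private abbreviation (input) scale where "scale r \<equiv> frag_extend (\<lambda>(p, g). frag_of (r * p :: rat, g :: 'g))"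

interpretation tensors: comm_group tensors
  unfolding pairs_group_def by (rule abelian_free_Abelian_group)

lemma carrier_tensors: "x \<in> carrier tensors \<longleftrightarrow> Poly_Mapping.keys x \<subseteq> UNIV \<times> carrier G"
  by (simp add: pairs_group_def)

lemma tensors_simps: "x \<otimes>\<^bsub>tensors\<^esub> y = x + y" "\<one>\<^bsub>tensors\<^esub> = 0"
  by (simp_all add: pairs_group_def)

lemma elem_closed: "g \<in> carrier G \<Longrightarrow> elem p g \<in> carrier tensors"
  by (simp add: carrier_tensors)

lemma inv_tensors: "x \<in> carrier tensors \<Longrightarrow> inv\<^bsub>tensors\<^esub> x = - x"
  by (simp add: pairs_group_def)

lemma diff_closed: "x \<in> carrier tensors \<Longrightarrow> y \<in> carrier tensors \<Longrightarrow> x - y \<in> carrier tensors"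
  using tensors.m_closed[of x "inv\<^bsub>tensors\<^esub> y"] tensors.inv_closed[of y] by (simp add: inv_tensors tensors_simps)

definition relators where "relators = {elem (p + q) g - elem p g - elem q g | p q g. g \<in> carrier G} \<union>
  {elem p (g \<otimes> h) - elem p g - elem p h | p g h. g \<in> carrier G \<and> h \<in> carrier G}"

lemma relations_eq: "relations = generate tensors relators"
  unfolding tensor_relations_def relators_def by simp

lemma relators_closed: "relators \<subseteq> carrier tensors"
  unfolding relators_def by (auto intro!: diff_closed elem_closed simp del: frag_of_in_free_Abelian_group)

lemma subgroup_relations: "subgroup relations tensors"
  unfolding relations_eq by (rule tensors.generate_is_subgroup[OF relators_closed])

interpretation relations: normal relations tensors
  using subgroup_relations by (simp add: tensors.normal_iff_subgroup)

lemma scale_hom: "scale r \<in> hom tensors tensors"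
proof (rule homI)
  fix x assume x: "x \<in> carrier tensors"
  show "scale r x \<in> carrier tensors"
  proof -
    have "Poly_Mapping.keys (case z of (p, g) \<Rightarrow> frag_of (r * p, g)) \<subseteq> UNIV \<times> carrier G"
      if "z \<in> Poly_Mapping.keys x" for z
      using that x by (auto simp: carrier_tensors)
    then show ?thesis
      using order_trans[OF keys_frag_extend[of "\<lambda>(p, g). frag_of (r * p, g)" x] UN_least]
      unfolding carrier_tensors by blast
  qed
qed (simp add: tensors_simps frag_extend_add)

text \<open>Scaling sends a relator to a relator of the same kind, hence the generated subgroup into
  itself. This makes scaling well defined on cosets.\<close>

lemma scale_relations: "x \<in> relations \<Longrightarrow> scale r x \<in> relations"
  unfolding relations_eq
proof (induction rule: generate.induct)
  case one
  then show ?case using generate.one[of tensors relators] by (simp add: tensors_simps)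
next
  case (incl x)
  then have "scale r x \<in> relators"
    unfolding relators_def by (fastforce simp: frag_extend_diff distrib_left)
  then show ?case by (rule generate.incl)
next
  case (inv x)
  then have "scale r x \<in> relators"
    unfolding relators_def by (fastforce simp: frag_extend_diff distrib_left)
  moreover have "inv\<^bsub>tensors\<^esub> x = - x" "inv\<^bsub>tensors\<^esub> (scale r x) = - scale r x"
    using inv relators_closed calculation by (auto intro: inv_tensors)
  ultimately show ?case using generate.inv[of "scale r x" relators tensors] by (simp add: frag_extend_minus)
next
  case (eng x y)
  then show ?case using generate.eng by (fastforce simp: tensors_simps frag_extend_add)
qed

private abbreviation (input) V where "V \<equiv> extend_scalars rat_field G"
private abbreviation (input) Q where "Q \<equiv> tensors Mod relations"
private abbreviation (input) cls where "cls x \<equiv> relations #>\<^bsub>tensors\<^esub> x"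

interpretation Q: comm_group Q by (rule tensors.abelian_FactGroup[OF subgroup_relations])

lemma carrier_V: "carrier V = carrier Q" and finsum_V: "finsum V f B = finprod Q f B"
  by (simp_all add: extend_scalars_def Let_def FactGroup_def finsum_def finprod_def)

text \<open>By \<open>scale_relations\<close> the scaled coset lies inside one coset, and adding the
  relation subgroup, as \<open>extend_scalars\<close> does, fills that coset up.\<close>

lemma smult_cls:
  assumes x: "x \<in> carrier tensors"
  shows "r \<odot>\<^bsub>V\<^esub> cls x = cls (scale r x)"
proof -
  have "relations <#>\<^bsub>tensors\<^esub> (scale r ` cls x) = cls (scale r x)"
  proof
    show "relations <#>\<^bsub>tensors\<^esub> (scale r ` cls x) \<subseteq> cls (scale r x)"
    proof
      fix z assume "z \<in> relations <#>\<^bsub>tensors\<^esub> (scale r ` cls x)"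
      then obtain t t' where t: "t \<in> relations" "t' \<in> relations" "z = t + scale r (t' + x)"
        by (auto simp: set_mult_def r_coset_def tensors_simps)
      then have "z = (t + scale r t') + scale r x" by (simp add: frag_extend_add)
      moreover have "t + scale r t' \<in> relations"
        using relations.m_closed[OF t(1) scale_relations[OF t(2), of r]] by (simp add: tensors_simps)
      ultimately show "z \<in> cls (scale r x)" by (auto simp: r_coset_def tensors_simps)
    qed
    show "cls (scale r x) \<subseteq> relations <#>\<^bsub>tensors\<^esub> (scale r ` cls x)"
    proof
      fix z assume "z \<in> cls (scale r x)"
      then obtain t where t: "t \<in> relations" "z = t \<otimes>\<^bsub>tensors\<^esub> scale r x" unfolding r_coset_def by blast
      have "scale r x \<in> scale r ` cls x" using tensors.rcos_self[OF x subgroup_relations] by (rule imageI)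
      with t show "z \<in> relations <#>\<^bsub>tensors\<^esub> (scale r ` cls x)" unfolding set_mult_def by blast
    qed
  qed
  then show ?thesis by (simp add: extend_scalars_def Let_def)
qed

lemma cls_eqI:
  assumes "x \<in> carrier tensors" "y \<in> carrier tensors" "x - y \<in> relations"
  shows "cls x = cls y"
proof -
  have "x = (x - y) + y" by simp
  then have "x \<in> cls y" using assms(3) unfolding r_coset_def tensors_simps by blast
  then show ?thesis using tensors.repr_independence[OF _ assms(2) subgroup_relations] by simp
qed

lemma cls_mult: "x \<in> carrier tensors \<Longrightarrow> y \<in> carrier tensors \<Longrightarrow> cls x \<otimes>\<^bsub>Q\<^esub> cls y = cls (x + y)"
  by (simp add: relations.rcos_sum tensors_simps)

text \<open>On a generator of the free group the difference is a relator of the first kind. The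
  expression is additive in \<open>x\<close>, so induction over the free abelian group settles the
  general case.\<close>

lemma scale_add_relations:
  assumes x: "x \<in> carrier tensors"
  shows "scale (p + q) x - (scale p x + scale q x) \<in> relations"
proof -
  have "Poly_Mapping.keys x \<subseteq> UNIV \<times> carrier G" using x by (simp add: carrier_tensors)
  then show ?thesis
  proof (rule free_Abelian_group_induct)
    show "scale (p + q) 0 - (scale p 0 + scale q 0) \<in> relations"
      using relations.one_closed by (simp add: tensors_simps)
  next
    fix x y
    let ?d = "\<lambda>x. scale (p + q) x - (scale p x + scale q x)"
    assume d: "?d x \<in> relations" "?d y \<in> relations"
    have "?d (x - y) = ?d x + - ?d y" by (simp add: frag_extend_diff algebra_simps)
    moreover have "- ?d y \<in> relations"
      using relations.m_inv_closed[OF d(2)] relations.mem_carrier[OF d(2)] by (simp add: inv_tensors)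
    ultimately show "?d (x - y) \<in> relations"
      using relations.m_closed[OF d(1)] by (simp add: tensors_simps)
  next
    fix z :: "rat \<times> 'g" assume "z \<in> UNIV \<times> carrier G"
    then obtain s g where "z = (s, g)" "g \<in> carrier G" by auto
    then have "scale (p + q) (frag_of z) - (scale p (frag_of z) + scale q (frag_of z)) \<in> relators"
      unfolding relators_def by (auto simp: distrib_right diff_diff_eq)
    then show "scale (p + q) (frag_of z) - (scale p (frag_of z) + scale q (frag_of z)) \<in> relations"
      unfolding relations_eq by (rule generate.incl)
  qed
qed

lemma smult_closed: "v \<in> carrier Q \<Longrightarrow> r \<odot>\<^bsub>V\<^esub> v \<in> carrier Q"
  using hom_in_carrier[OF scale_hom] by (auto simp: carrier_FactGroup smult_cls)

lemma smult_add:
  assumes "v \<in> carrier Q"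
  shows "(p + q) \<odot>\<^bsub>V\<^esub> v = (p \<odot>\<^bsub>V\<^esub> v) \<otimes>\<^bsub>Q\<^esub> (q \<odot>\<^bsub>V\<^esub> v)"
proof -
  obtain x where x: "x \<in> carrier tensors" "v = cls x" using assms by (auto simp: carrier_FactGroup)
  have "cls (scale (p + q) x) = cls (scale p x + scale q x)"
    using scale_add_relations[OF x(1)] hom_in_carrier[OF scale_hom x(1)] tensors.m_closed
    by (intro cls_eqI) (auto simp: tensors_simps)
  then show ?thesis using x hom_in_carrier[OF scale_hom x(1)] by (simp add: smult_cls cls_mult del: mult_FactGroup)
qed

lemma smult_zero:
  assumes v: "v \<in> carrier Q"
  shows "0 \<odot>\<^bsub>V\<^esub> v = \<one>\<^bsub>Q\<^esub>"
  using smult_add[OF v, of 0 0] smult_closed[OF v, of 0] Q.l_cancel_one' by (simp del: mult_FactGroup one_FactGroup)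

text \<open>The linear combination with coefficients \<open>c\<close>, written as a product because
  the factor group \<open>Q\<close> is multiplicative; \<open>finsum_V\<close> identifies it with
  the sum in \<open>V\<close>.\<close>

definition comb where "comb B c = finprod Q (\<lambda>b. c b \<odot>\<^bsub>V\<^esub> b) B"

lemma comb_closed: "B \<subseteq> carrier Q \<Longrightarrow> comb B c \<in> carrier Q"
  unfolding comb_def using smult_closed by (intro Q.finprod_closed) auto

lemma comb_add:
  assumes B: "B \<subseteq> carrier Q"
  shows "comb B (\<lambda>b. c b + d b) = comb B c \<otimes>\<^bsub>Q\<^esub> comb B d"
proof -
  have closed: "r \<odot>\<^bsub>V\<^esub> b \<in> carrier Q" if "b \<in> B" for r b using that B smult_closed by blast
  have "comb B (\<lambda>b. c b + d b) = finprod Q (\<lambda>b. (c b \<odot>\<^bsub>V\<^esub> b) \<otimes>\<^bsub>Q\<^esub> (d b \<odot>\<^bsub>V\<^esub> b)) B"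
    unfolding comb_def by (rule Q.finprod_cong') (use B closed in \<open>auto simp: smult_add subset_iff simp del: mult_FactGroup\<close>)
  also have "\<dots> = comb B c \<otimes>\<^bsub>Q\<^esub> comb B d"
    unfolding comb_def using closed by (intro Q.finprod_multf) auto
  finally show ?thesis .
qed

lemma comb_zero: "B \<subseteq> carrier Q \<Longrightarrow> comb B (\<lambda>_. 0) = \<one>\<^bsub>Q\<^esub>"
  unfolding comb_def using smult_zero by (intro Q.finprod_one_eqI) auto

text \<open>This follows from additivity in the coefficients by induction on \<open>k\<close>.
  Integer factors are enough because \<open>integer_linear_dependence\<close> provides integer
  coefficients.\<close>

lemma comb_int:
  assumes B: "B \<subseteq> carrier Q"
  shows "comb B (\<lambda>b. of_int k * c b) = comb B c [^]\<^bsub>Q\<^esub> (k::int)"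
proof (induction k rule: int_induct[where k = 0])
  case base
  then show ?case using comb_zero[OF B] by simp
next
  case (step1 i)
  have "comb B (\<lambda>b. of_int (i + 1) * c b) = comb B (\<lambda>b. of_int i * c b) \<otimes>\<^bsub>Q\<^esub> comb B c"
    unfolding comb_add[OF B, symmetric] by (simp add: distrib_right)
  then show ?case using step1 comb_closed[OF B] Q.int_pow_mult[of "comb B c" i 1] by (simp del: mult_FactGroup)
next
  case (step2 i)
  have "comb B (\<lambda>b. of_int i * c b) = comb B (\<lambda>b. of_int (i - 1) * c b) \<otimes>\<^bsub>Q\<^esub> comb B c"
    unfolding comb_add[OF B, symmetric] by (simp add: algebra_simps)
  moreover have "comb B c [^]\<^bsub>Q\<^esub> i = comb B c [^]\<^bsub>Q\<^esub> (i - 1) \<otimes>\<^bsub>Q\<^esub> comb B c"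
    using comb_closed[OF B] Q.int_pow_mult[of "comb B c" "i - 1" 1] by (simp del: mult_FactGroup)
  ultimately show ?case using step2 comb_closed[OF B] Q.r_cancel by (metis Q.int_pow_closed)
qed

lemma cls_elem_hom: "(\<lambda>g. cls (elem 1 g)) \<in> hom G Q"
proof (rule homI)
  show "cls (elem 1 g) \<in> carrier Q" if "g \<in> carrier G" for g
    using that by (auto simp: carrier_FactGroup elem_closed)
  show "cls (elem 1 (g \<otimes> h)) = cls (elem 1 g) \<otimes>\<^bsub>Q\<^esub> cls (elem 1 h)" if "g \<in> carrier G" "h \<in> carrier G" for g h
  proof -
    have "elem 1 (g \<otimes> h) - (elem 1 g + elem 1 h) \<in> relators"
      unfolding relators_def diff_diff_eq[symmetric] using that by blast
    then have "elem 1 (g \<otimes> h) - (elem 1 g + elem 1 h) \<in> relations" unfolding relations_eq by (rule generate.incl)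
    moreover have "elem 1 g + elem 1 h \<in> carrier tensors"
      using tensors.m_closed[OF elem_closed elem_closed] that by (simp add: tensors_simps)
    ultimately show ?thesis using that by (simp add: cls_mult cls_eqI elem_closed del: mult_FactGroup)
  qed
qed

text \<open>An element of the relation subgroup involves finitely many rationals; clearing all their
  denominators by \<open>M\<close> sends \<open>p \<otimes> g\<close> to \<open>(M p) g\<close> in \<open>G\<close> and respects the relations.\<close>

lemma relations_clear_denominators:
  assumes "x \<in> relations"
  shows "\<exists>N::int. N > 0 \<and> (\<forall>M h. N dvd M \<longrightarrow> h \<in> hom tensors G \<longrightarrow>
    (\<forall>p. \<forall>g\<in>carrier G. h (elem p g) = g [^] \<lfloor>of_int M * p\<rfloor>) \<longrightarrow> h x = \<one>)"
proof -
  have hom_diff: "h (x - y) = h x \<otimes> inv (h y)"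
    if h: "h \<in> hom tensors G" and x: "x \<in> carrier tensors" and y: "y \<in> carrier tensors" for h x y
  proof -
    interpret h: group_hom tensors G h using h by (simp add: group_hom.intro group_hom_axioms.intro is_group tensors.is_group)
    have "x - y = x \<otimes>\<^bsub>tensors\<^esub> inv\<^bsub>tensors\<^esub> y" using y by (simp add: inv_tensors tensors_simps)
    then show ?thesis using x y by simp
  qed
  have relator: "\<exists>N::int. N > 0 \<and> (\<forall>M h. N dvd M \<longrightarrow> h \<in> hom tensors G \<longrightarrow>
    (\<forall>p. \<forall>g\<in>carrier G. h (elem p g) = g [^] \<lfloor>of_int M * p\<rfloor>) \<longrightarrow> h x = \<one>)" if rel: "x \<in> relators" for x
    using rel unfolding relators_def
  proof (elim UnE)
    assume "x \<in> {elem (p + q) g - elem p g - elem q g | p q g. g \<in> carrier G}"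
    then obtain p q g where x: "x = elem (p + q) g - elem p g - elem q g" "g \<in> carrier G" by blast
    obtain a b where p: "p = of_int a / of_int b" "(b::int) > 0" using rat_fraction .
    obtain c d where q: "q = of_int c / of_int d" "(d::int) > 0" using rat_fraction .
    have "h x = \<one>" if M: "b * d dvd M" and h: "h \<in> hom tensors G"
      "\<forall>p. \<forall>g\<in>carrier G. h (elem p g) = g [^] \<lfloor>of_int M * p\<rfloor>" for M h
    proof -
      obtain k where k: "M = b * d * k" using M by blast
      have 1: "of_int M * p = of_int (d * k * a)" "of_int M * q = of_int (b * k * c)"
        using p q k by simp_all
      then have 2: "of_int M * (p + q) = of_int (d * k * a + b * k * c)" by (simp add: distrib_left)
      have "h x = g [^] (d * k * a + b * k * c) \<otimes> inv (g [^] (d * k * a)) \<otimes> inv (g [^] (b * k * c))"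
        unfolding x(1) using x(2) h by (simp only: hom_diff diff_closed elem_closed 1 2 floor_of_int)
      then show ?thesis using x(2) by (simp add: int_pow_mult m_ac inv_mult)
    qed
    then show ?thesis using p q by (intro exI[of _ "b * d"]) auto
  next
    assume "x \<in> {elem p (g \<otimes> h) - elem p g - elem p h | p g h. g \<in> carrier G \<and> h \<in> carrier G}"
    then obtain p g g' where x: "x = elem p (g \<otimes> g') - elem p g - elem p g'" "g \<in> carrier G" "g' \<in> carrier G" by blast
    have "h x = \<one>" if h: "h \<in> hom tensors G"
      "\<forall>p. \<forall>g\<in>carrier G. h (elem p g) = g [^] \<lfloor>of_int M * p\<rfloor>" for M :: int and h
    proof -
      \<comment> \<open>Here there is no denominator to clear: the three terms carry the same
        integer exponent \<open>?k\<close>, whatever \<open>M\<close> is.\<close>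
      let ?k = "\<lfloor>of_int M * p\<rfloor>"
      have "h x = (g \<otimes> g') [^] ?k \<otimes> inv (g [^] ?k) \<otimes> inv (g' [^] ?k)"
        unfolding x(1) using x(2,3) h by (simp only: hom_diff diff_closed elem_closed m_closed)
      then show ?thesis using x(2,3) by (simp add: int_pow_distrib m_ac inv_mult)
    qed
    then show ?thesis by (intro exI[of _ 1]) auto
  qed
  show ?thesis
    using assms unfolding relations_eq
  proof (induction rule: generate.induct)
    case one
    have "h \<one>\<^bsub>tensors\<^esub> = \<one>" if "h \<in> hom tensors G" for h
      using hom_one[OF that tensors.is_group is_group] .
    then show ?case by (intro exI[of _ 1]) auto
  next
    case (incl x)
    then show ?case by (rule relator)
  next
    case (inv x)
    then have x: "x \<in> carrier tensors" using relators_closed by blast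
    have "h (inv\<^bsub>tensors\<^esub> x) = inv (h x)" if "h \<in> hom tensors G" for h
      using group_hom.hom_inv[of tensors G h x] that x
      by (simp add: group_hom.intro group_hom_axioms.intro is_group tensors.is_group)
    then show ?case using relator[OF inv] by (metis inv_one)
  next
    case (eng x y)
    obtain N\<^sub>1 N\<^sub>2 :: int where N: "N\<^sub>1 > 0" "N\<^sub>2 > 0"
      "\<And>M h. N\<^sub>1 dvd M \<Longrightarrow> h \<in> hom tensors G \<Longrightarrow>
        \<forall>p. \<forall>g\<in>carrier G. h (elem p g) = g [^] \<lfloor>of_int M * p\<rfloor> \<Longrightarrow> h x = \<one>"
      "\<And>M h. N\<^sub>2 dvd M \<Longrightarrow> h \<in> hom tensors G \<Longrightarrow>
        \<forall>p. \<forall>g\<in>carrier G. h (elem p g) = g [^] \<lfloor>of_int M * p\<rfloor> \<Longrightarrow> h y = \<one>"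
      using eng.IH by blast
    have xy: "x \<in> carrier tensors" "y \<in> carrier tensors"
      using eng.hyps tensors.generate_in_carrier[OF relators_closed] by auto
    \<comment> \<open>The claim is made for all multiples of \<open>N\<close>, not just for
      \<open>N\<close> itself, so that the product of the two bounds serves both factors.\<close>
    have "h (x \<otimes>\<^bsub>tensors\<^esub> y) = \<one>" if "N\<^sub>1 * N\<^sub>2 dvd M" "h \<in> hom tensors G"
      "\<forall>p. \<forall>g\<in>carrier G. h (elem p g) = g [^] \<lfloor>of_int M * p\<rfloor>" for M h
      using N(3)[OF dvd_mult_left[OF that(1)] that(2,3)] N(4)[OF dvd_mult_right[OF that(1)] that(2,3)]
        hom_mult[OF that(2) xy] by simp
    then show ?case using N(1,2) by (intro exI[of _ "N\<^sub>1 * N\<^sub>2"]) auto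
  qed
qed

text \<open>If \<open>elem 1 g\<close> is a relation, then for a suitable \<open>N\<close> the
  denominator-clearing homomorphism with \<open>M = N\<close> kills it. That homomorphism sends it
  to \<open>g [^] N\<close>, so \<open>g\<close> is torsion and therefore trivial.\<close>

lemma cls_elem_injective:
  assumes "torsion_free G" "g \<in> carrier G" "cls (elem 1 g) = \<one>\<^bsub>Q\<^esub>"
  shows "g = \<one>"
proof -
  have "elem 1 g \<in> relations"
    using assms tensors.rcos_self[OF elem_closed[OF assms(2), of 1] subgroup_relations] by simp
  then obtain N :: int where N: "N > 0" "\<And>h. h \<in> hom tensors G \<Longrightarrow>
    \<forall>p. \<forall>g\<in>carrier G. h (elem p g) = g [^] \<lfloor>of_int N * p\<rfloor> \<Longrightarrow> h (elem 1 g) = \<one>"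
    using relations_clear_denominators dvd_refl by metis
  have "(\<lambda>(p, g). g [^] \<lfloor>of_int N * p\<rfloor>) ` (carrier rat_field \<times> carrier G) \<subseteq> carrier G" by auto
  then obtain h where h: "h \<in> hom tensors G"
    "\<And>z. z \<in> carrier rat_field \<times> carrier G \<Longrightarrow> h (frag_of z) = (\<lambda>(p, g). g [^] \<lfloor>of_int N * p\<rfloor>) z"
    unfolding pairs_group_def using free_Abelian_group_universal by blast
  have "\<forall>p. \<forall>g\<in>carrier G. h (elem p g) = g [^] \<lfloor>of_int N * p\<rfloor>" using h(2) by auto
  then have "g [^] N = \<one> [^] N" using N(2)[OF h(1)] h(2)[of "(1, g)"] assms(2) by simp
  then show ?thesis using torsion_free_cancel_int_pow[OF assms(1,2) one_closed, of N] N(1) by simp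
qed

text \<open>The bound is the dimension. More elements than that have linearly dependent images in
  the tensor product; an integer dependence among these comes from a relation in \<open>G\<close>,
  by injectivity of the map into the tensor product. The rank is used later only in this
  form.\<close>

theorem finite_rank_relation:
  assumes tf: "torsion_free G" and "finite_rank G"
  shows "\<exists>n. \<forall>S \<subseteq> carrier G. finite S \<longrightarrow> card S > n \<longrightarrow>
    (\<exists>q::'g \<Rightarrow> int. (\<exists>s\<in>S. q s \<noteq> 0) \<and> (\<Otimes>s\<in>S. s [^] q s) = \<one>)"
proof -
  obtain B where B: "B \<subseteq> carrier V" "finite B"
    and basis: "\<forall>x\<in>carrier V. \<exists>!a. a \<in> B \<rightarrow>\<^sub>E carrier rat_field \<and> x = (\<Oplus>\<^bsub>V\<^esub>b\<in>B. a b \<odot>\<^bsub>V\<^esub> b)"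
    using \<open>finite_rank G\<close> unfolding finite_rank_def has_dimension_def by (elim exE conjE)
  have B: "B \<subseteq> carrier Q" "finite B" using B unfolding carrier_V .
  have span: "\<exists>a. v = comb B a" if "v \<in> carrier Q" for v
    using ex1_implies_ex[OF bspec[OF basis, of v]] that unfolding carrier_V finsum_V comb_def by auto
  have "\<exists>q::'g \<Rightarrow> int. (\<exists>s\<in>S. q s \<noteq> 0) \<and> (\<Otimes>s\<in>S. s [^] q s) = \<one>"
    if S: "S \<subseteq> carrier G" "finite S" "card S > card B" for S
  proof -
    have "\<exists>a. cls (elem 1 s) = comb B a" if "s \<in> S" for s
      using that S by (intro span) (auto simp: carrier_FactGroup elem_closed)
    then obtain a where a: "\<And>s. s \<in> S \<Longrightarrow> cls (elem 1 s) = comb B (a s)" by metis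
    obtain q :: "'g \<Rightarrow> int" where q: "\<exists>s\<in>S. q s \<noteq> 0"
      "\<And>b. b \<in> B \<Longrightarrow> (\<Sum>s\<in>S. of_int (q s) * a s b) = 0"
      using integer_linear_dependence[OF B(2) S(2,3), of a] by blast
    interpret e: group_hom G Q "\<lambda>g. cls (elem 1 g)"
      by (simp add: group_hom.intro group_hom_axioms.intro is_group Q.is_group cls_elem_hom)
    have "cls (elem 1 (\<Otimes>s\<in>T. s [^] q s)) = comb B (\<lambda>b. \<Sum>s\<in>T. of_int (q s) * a s b)" if "T \<subseteq> S" for T
      using finite_subset[OF that S(2)] that
    proof (induction T)
      case empty
      then show ?case using e.hom_one comb_zero[OF B(1)] by simp
    next
      case (insert t T)
      have t: "t \<in> carrier G" "T \<subseteq> carrier G" using insert S by auto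
      have fin: "(\<Otimes>s\<in>T. s [^] q s) \<in> carrier G" using t by (intro finprod_closed) auto
      have "(\<Otimes>s\<in>insert t T. s [^] q s) = t [^] q t \<otimes> (\<Otimes>s\<in>T. s [^] q s)"
        using insert t by (intro finprod_insert) auto
      then have "cls (elem 1 (\<Otimes>s\<in>insert t T. s [^] q s))
          = comb B (a t) [^]\<^bsub>Q\<^esub> q t \<otimes>\<^bsub>Q\<^esub> comb B (\<lambda>b. \<Sum>s\<in>T. of_int (q s) * a s b)"
        using e.hom_mult[OF int_pow_closed[OF t(1)] fin] e.hom_int_pow[OF t(1)] a insert by (simp del: mult_FactGroup)
      also have "\<dots> = comb B (\<lambda>b. \<Sum>s\<in>insert t T. of_int (q s) * a s b)"
        unfolding comb_int[OF B(1), symmetric] comb_add[OF B(1), symmetric] using insert by simp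
      finally show ?case .
    qed
    from this[OF order_refl] have "cls (elem 1 (\<Otimes>s\<in>S. s [^] q s)) = comb B (\<lambda>b. \<Sum>s\<in>S. of_int (q s) * a s b)" .
    also have "\<dots> = comb B (\<lambda>_. 0)"
      unfolding comb_def using q(2) smult_closed B(1) by (intro Q.finprod_cong') auto
    finally have "(\<Otimes>s\<in>S. s [^] q s) = \<one>"
      using S comb_zero[OF B(1)] by (intro cls_elem_injective[OF tf] finprod_closed) auto
    then show ?thesis using q(1) by blast
  qed
  then show ?thesis by blast
qed

end

section \<open>Finiteness of the quotient of \<open>G\<close> by its \<open>r\<close>-fold
  multiples\<close>

context comm_group
begin

abbreviation (input) monomial where "monomial S m \<equiv> (\<Otimes>s\<in>S. s [^] (m s :: int))"

lemma monomial_closed: "S \<subseteq> carrier G \<Longrightarrow> monomial S m \<in> carrier G"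
  by (intro finprod_closed) auto

lemma monomial_add: "S \<subseteq> carrier G \<Longrightarrow> monomial S (\<lambda>s. m s + l s) = monomial S m \<otimes> monomial S l"
  by (subst finprod_multf[symmetric]) (auto intro!: finprod_cong' simp: int_pow_mult)

lemma monomial_scale:
  assumes "finite S" "S \<subseteq> carrier G"
  shows "monomial S (\<lambda>s. k * m s) = monomial S m [^] (k::int)"
  using assms
proof (induction S)
  case (insert x S)
  have "monomial (insert x S) m' = x [^] m' x \<otimes> monomial S m'" for m'
    using insert by (intro finprod_insert) auto
  then show ?case
    using insert monomial_closed[of S m] by (simp add: int_pow_distrib int_pow_pow mult.commute)
qed simp

text \<open>Independence modulo \<open>p\<close> of the images of the elements of \<open>S\<close> in \<open>G/pG\<close>.\<close>

definition indep_mod :: "int \<Rightarrow> 'a set \<Rightarrow> bool"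
  where "indep_mod p S \<longleftrightarrow> finite S \<and> S \<subseteq> carrier G \<and>
    (\<forall>m. \<forall>h\<in>carrier G. monomial S m = h [^] p \<longrightarrow> (\<forall>s\<in>S. p dvd m s))"

text \<open>Infinite descent. Independence modulo \<open>p\<close> makes all exponents of a relation
  divisible by \<open>p\<close>, and since \<open>G\<close> is torsion-free the exponents divided by
  \<open>p\<close> form a relation again. Hence every power of \<open>p\<close> divides
  \<open>q s\<close>.\<close>

lemma indep_mod_no_relation:
  assumes "torsion_free G" "\<bar>p\<bar> > 1" "indep_mod p S" "monomial S q = \<one>" "s \<in> S"
  shows "q s = 0"
proof (rule ccontr)
  assume "q s \<noteq> 0"
  have S: "finite S" "S \<subseteq> carrier G" and indep: "\<And>m h. h \<in> carrier G \<Longrightarrow> monomial S m = h [^] p \<Longrightarrow> \<forall>s\<in>S. p dvd m s"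
    using assms(3) unfolding indep_mod_def by auto
  have "\<exists>m. q s = p ^ k * m s \<and> monomial S m = \<one>" for k
  proof (induction k)
    case 0
    then show ?case using assms(4) by (intro exI[of _ q]) auto
  next
    case (Suc k)
    then obtain m where m: "q s = p ^ k * m s" "monomial S m = \<one>" by blast
    then have "\<forall>s\<in>S. p dvd m s" using indep[OF one_closed, of m] by simp
    then have m_eq: "m s = p * (m s div p)" if "s \<in> S" for s using that by simp
    let ?l = "\<lambda>s. m s div p"
    have "monomial S m = monomial S (\<lambda>s. p * ?l s)"
      using m_eq S by (intro finprod_cong') auto
    then have "monomial S ?l [^] p = \<one> [^] p"
      unfolding int_pow_one monomial_scale[OF S, of p ?l, symmetric] m(2) by simp
    then have "monomial S ?l = \<one>"
      using torsion_free_cancel_int_pow[OF assms(1) monomial_closed[OF S(2)] one_closed, of p] assms(2) by auto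
    moreover have "q s = p ^ Suc k * ?l s" using m(1) m_eq[OF assms(5)] by (metis mult.assoc power_Suc2)
    ultimately show ?case by (intro exI[of _ ?l] conjI)
  qed
  \<comment> \<open>The exponent \<open>nat \<bar>q s\<bar>\<close> is already large enough for a
    contradiction, because a power of an integer greater than 1 exceeds its exponent.\<close>
  then obtain m where "q s = p ^ (nat \<bar>q s\<bar>) * m s" by blast
  then have "p ^ (nat \<bar>q s\<bar>) dvd q s" by (metis dvd_triv_left)
  then have "\<bar>p\<bar> ^ (nat \<bar>q s\<bar>) \<le> \<bar>q s\<bar>" using \<open>q s \<noteq> 0\<close> by (metis dvd_imp_le_int power_abs)
  moreover have "int (nat \<bar>q s\<bar>) < \<bar>p\<bar> ^ (nat \<bar>q s\<bar>)"
  proof -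
    have "nat \<bar>q s\<bar> < nat \<bar>p\<bar> ^ nat \<bar>q s\<bar>" using assms(2) by (intro power_gt_expt) auto
    then have "int (nat \<bar>q s\<bar>) < int (nat \<bar>p\<bar> ^ nat \<bar>q s\<bar>)" by (simp only: of_nat_less_iff)
    then show ?thesis by simp
  qed
  ultimately show False by simp
qed

text \<open>Sets that are independent modulo \<open>p\<close> satisfy no nontrivial integer
  relation, so finite rank bounds their size. One of maximal size spans \<open>G/pG\<close>: adding
  a further \<open>g\<close> creates a relation modulo \<open>p\<close> in which the exponent of
  \<open>g\<close> is prime to \<open>p\<close>. Monomials with exponents in \<open>{0..<p}\<close>
  then represent all cosets.\<close>

lemma finite_index_prime:
  assumes tf: "torsion_free G" and "finite_rank G" and p: "Factorial_Ring.prime (p::int)"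
  shows "\<exists>Y\<subseteq>carrier G. finite Y \<and> (\<forall>g\<in>carrier G. \<exists>y\<in>Y. \<exists>h\<in>carrier G. g = h [^] p \<otimes> y)"
proof -
  have p1: "\<bar>p\<bar> > 1" "p > 0" using p prime_gt_1_int[of p] by auto
  obtain n where n: "\<And>S. S \<subseteq> carrier G \<Longrightarrow> finite S \<Longrightarrow> card S > n \<Longrightarrow>
    \<exists>q::'a \<Rightarrow> int. (\<exists>s\<in>S. q s \<noteq> 0) \<and> monomial S q = \<one>"
    using finite_rank_relation[OF comm_group_axioms tf assms(2)] by blast
  have bound: "card S \<le> n" if S: "indep_mod p S" for S
  proof (rule ccontr)
    assume "\<not> card S \<le> n"
    then obtain q where "\<exists>s\<in>S. q s \<noteq> 0" "monomial S q = \<one>" using n[of S] S unfolding indep_mod_def by auto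
    then show False using indep_mod_no_relation[OF tf p1(1) S] by blast
  qed
  have "indep_mod p {}" by (simp add: indep_mod_def)
  define k where "k = (GREATEST k. \<exists>S. indep_mod p S \<and> card S = k)"
  have "\<exists>S. indep_mod p S \<and> card S = k" unfolding k_def
    by (rule GreatestI_ex_nat[where b = n]) (use \<open>indep_mod p {}\<close> bound in auto)
  then obtain S where indep: "indep_mod p S" and cardS: "card S = k" by blast
  have max: "card T \<le> card S" if "indep_mod p T" for T
    unfolding cardS k_def by (rule Greatest_le_nat[where b = n]) (use that bound in auto)
  have S: "finite S" "S \<subseteq> carrier G" using indep unfolding indep_mod_def by auto
  define Y where "Y = monomial S ` (S \<rightarrow>\<^sub>E {0..<p})"
  have "Y \<subseteq> carrier G" unfolding Y_def using monomial_closed[OF S(2)] by auto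
  moreover have "finite Y" unfolding Y_def using S(1) by (intro finite_imageI finite_PiE) auto
  moreover have "\<exists>y\<in>Y. \<exists>h\<in>carrier G. g = h [^] p \<otimes> y" if g: "g \<in> carrier G" for g
  proof -
    \<comment> \<open>Replacing exponents by their remainders modulo \<open>p\<close> changes a
      monomial by a \<open>p\<close>-th power only, so any monomial may stand for a
      representative.\<close>
    have reduce: "\<exists>y\<in>Y. \<exists>h\<in>carrier G. g = h [^] p \<otimes> y" if h: "h \<in> carrier G" "g = h [^] p \<otimes> monomial S m" for h m
    proof -
      let ?q = "\<lambda>s. m s div p" and ?r = "\<lambda>s\<in>S. m s mod p"
      have "monomial S m = monomial S (\<lambda>s. p * ?q s + ?r s)"
        using S by (intro finprod_cong') auto
      also have "\<dots> = monomial S ?q [^] p \<otimes> monomial S ?r"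
        using monomial_add[OF S(2), of "\<lambda>s. p * ?q s" ?r] monomial_scale[OF S, of p ?q] by simp
      finally have "g = (h \<otimes> monomial S ?q) [^] p \<otimes> monomial S ?r"
        using h monomial_closed[OF S(2)] by (simp add: int_pow_distrib m_assoc)
      moreover have "monomial S ?r \<in> Y" unfolding Y_def using p1 by (intro imageI) auto
      ultimately show ?thesis using h(1) monomial_closed[OF S(2)] by (metis m_closed)
    qed
    show ?thesis
    proof (cases "g \<in> S")
      case True
      have "monomial S (\<lambda>s. if s = g then 1 else 0) = (\<Otimes>s\<in>S. if s = g then s else \<one>)"
        using S by (intro finprod_cong') (auto simp: subset_iff)
      also have "\<dots> = g" using S True by (intro finprod_singleton_swap) auto
      finally show ?thesis using reduce[of \<one> "\<lambda>s. if s = g then 1 else 0"] g by simp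
    next
      case False
      then have "\<not> indep_mod p (insert g S)" using max[of "insert g S"] S by auto
      then obtain m h where h: "h \<in> carrier G" "monomial (insert g S) m = h [^] p" "\<not> (\<forall>s\<in>insert g S. p dvd m s)"
        unfolding indep_mod_def using S g by blast
      have "monomial (insert g S) m = g [^] m g \<otimes> monomial S m"
        using S g False by (intro finprod_insert) auto
      then have eq: "g [^] m g \<otimes> monomial S m = h [^] p" using h(2) by simp
      have M: "monomial S m \<in> carrier G" using monomial_closed[OF S(2)] .
      \<comment> \<open>Otherwise \<open>g [^] m g\<close> is a \<open>p\<close>-th power, hence so
        is \<open>monomial S m\<close>; independence of \<open>S\<close> would make all exponents
        divisible by \<open>p\<close>, against the choice of \<open>m\<close>.\<close>
      have "\<not> p dvd m g"
      proof
        assume "p dvd m g"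
        then obtain l where l: "m g = p * l" by blast
        have "monomial S m = inv (g [^] m g) \<otimes> h [^] p"
          unfolding eq[symmetric] using g M by (simp add: m_assoc[symmetric])
        also have "\<dots> = (inv (g [^] l) \<otimes> h) [^] p"
          using g h(1) by (simp add: l int_pow_distrib int_pow_inv int_pow_pow mult.commute)
        finally have "\<forall>s\<in>S. p dvd m s" using indep g h(1) unfolding indep_mod_def by blast
        then show False using h(3) \<open>p dvd m g\<close> by blast
      qed
      then have "coprime p (m g)" using p by (simp add: prime_imp_coprime)
      then obtain u v where uv: "u * m g + v * p = 1"
        using bezout_int[of "m g" p] by (metis coprime_commute coprime_imp_gcd_eq_1)
      \<comment> \<open>By the Bezout identity, \<open>g\<close> is the \<open>u\<close>-th power of
        \<open>g [^] m g\<close> up to a \<open>p\<close>-th power, and \<open>g [^] m g\<close> is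
        the inverse of a monomial in \<open>S\<close> up to a \<open>p\<close>-th power.\<close>
      have "g = g [^] (m g * u + v * p)" using uv g by (simp add: mult.commute)
      also have "\<dots> = (g [^] m g) [^] u \<otimes> (g [^] v) [^] p" using g by (simp add: int_pow_mult int_pow_pow)
      also have "g [^] m g = h [^] p \<otimes> inv (monomial S m)"
        unfolding eq[symmetric] using g M by (simp add: m_assoc)
      also have "\<dots> [^] u = (h [^] u) [^] p \<otimes> monomial S (\<lambda>s. - u * m s)"
        using h(1) M by (simp only: monomial_scale[OF S]) (simp add: int_pow_distrib int_pow_pow int_pow_inv int_pow_neg mult.commute)
      finally have "g = (h [^] u) [^] p \<otimes> monomial S (\<lambda>s. - u * m s) \<otimes> (g [^] v) [^] p" .
      then have "g = (h [^] u \<otimes> g [^] v) [^] p \<otimes> monomial S (\<lambda>s. - u * m s)"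
        using g h(1) monomial_closed[OF S(2)] by (simp add: int_pow_distrib m_ac)
      then show ?thesis by (rule reduce[rotated]) (use g h(1) in simp)
    qed
  qed
  ultimately show ?thesis by blast
qed

text \<open>In additive notation: if \<open>Y\<close> represents the cosets of \<open>nG\<close> and
  \<open>Z\<close> those of \<open>pG\<close>, then the elements \<open>n z + y\<close> represent
  the cosets of \<open>(pn)G\<close>.\<close>

lemma finite_index_nat:
  assumes "torsion_free G" "finite_rank G"
  shows "n > 0 \<Longrightarrow> \<exists>Y\<subseteq>carrier G. finite Y \<and> (\<forall>g\<in>carrier G. \<exists>y\<in>Y. \<exists>h\<in>carrier G. g = h [^] (int n) \<otimes> y)"
proof (induction n rule: prime_divisors_induct)
  case zero
  then show ?case by simp
next
  case (unit n)
  then have "n = 1" by simp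
  have "g = g [^] int n \<otimes> \<one>" if "g \<in> carrier G" for g using that \<open>n = 1\<close> by simp
  then show ?case by (intro exI[of _ "{\<one>}"]) auto
next
  case (factor p n)
  then obtain Y where Y: "Y \<subseteq> carrier G" "finite Y" "\<And>g. g \<in> carrier G \<Longrightarrow> \<exists>y\<in>Y. \<exists>h\<in>carrier G. g = h [^] (int n) \<otimes> y" by auto
  have "Factorial_Ring.prime (int p)" using factor by simp
  from finite_index_prime[OF assms this] obtain Z where Z: "Z \<subseteq> carrier G" "finite Z"
    "\<forall>g\<in>carrier G. \<exists>y\<in>Z. \<exists>h\<in>carrier G. g = h [^] (int p) \<otimes> y"
    by (elim exE conjE)
  let ?W = "(\<lambda>(z, y). z [^] int n \<otimes> y) ` (Z \<times> Y)"
  have "\<exists>w\<in>?W. \<exists>k\<in>carrier G. g = k [^] (int (p * n)) \<otimes> w" if g: "g \<in> carrier G" for g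
  proof -
    obtain y h where y: "y \<in> Y" "h \<in> carrier G" "g = h [^] (int n) \<otimes> y" using Y(3)[OF g] by blast
    obtain z k where z: "z \<in> Z" "k \<in> carrier G" "h = k [^] (int p) \<otimes> z" using bspec[OF Z(3) y(2)] by blast
    have "y \<in> carrier G" "z \<in> carrier G" using y z Y Z by auto
    then have "g = k [^] (int (p * n)) \<otimes> (z [^] int n \<otimes> y)"
      unfolding y(3) z(3) using z(2) by (simp add: int_pow_distrib int_pow_pow m_assoc)
    then show ?thesis using y(1) z(1,2) by force
  qed
  moreover have "?W \<subseteq> carrier G" using Y(1) Z(1) by auto
  ultimately show ?case using Y(2) Z(2) by (intro exI[of _ ?W]) blast
qed

theorem finite_index:
  assumes "torsion_free G" "finite_rank G" "r \<noteq> 0"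
  shows "\<exists>Y\<subseteq>carrier G. finite Y \<and> (\<forall>g\<in>carrier G. \<exists>y\<in>Y. \<exists>h\<in>carrier G. g = h [^] (r::int) \<otimes> y)"
proof -
  obtain Y where Y: "Y \<subseteq> carrier G" "finite Y"
    "\<And>g. g \<in> carrier G \<Longrightarrow> \<exists>y\<in>Y. \<exists>h\<in>carrier G. g = h [^] (int (nat \<bar>r\<bar>)) \<otimes> y"
    using finite_index_nat[OF assms(1,2), of "nat \<bar>r\<bar>"] assms(3) by auto
  have "\<exists>k\<in>carrier G. h [^] (int (nat \<bar>r\<bar>)) = k [^] r" if "h \<in> carrier G" for h
  proof (cases "r > 0")
    case False
    then show ?thesis using that by (intro bexI[of _ "inv h"]) (auto simp: int_pow_inv int_pow_neg)
  qed (use that in auto)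
  then show ?thesis using Y by metis
qed

end

section \<open>Symmetric cocycles\<close>

lemma (in comm_group) cocycle_condition_iff:
  assumes "a \<in> carrier G" "b \<in> carrier G" "c \<in> carrier G" "d \<in> carrier G"
  shows "a \<otimes> inv b \<otimes> c \<otimes> inv d = \<one> \<longleftrightarrow> a \<otimes> c = b \<otimes> d"
proof -
  have "a \<otimes> inv b \<otimes> c \<otimes> inv d = (a \<otimes> c) \<otimes> inv (b \<otimes> d)"
    using assms by (simp add: m_ac inv_mult)
  also have "\<dots> = \<one> \<longleftrightarrow> a \<otimes> c = b \<otimes> d"
    using assms by (metis inv_solve_right l_one m_closed one_closed)
  finally show ?thesis .
qed

locale group_cohomology = G: comm_group G + A: comm_group A
  for G :: "('g, 'a) monoid_scheme" and A :: "('m, 'b) monoid_scheme"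
begin

lemma carrier_cochains2: "carrier (cochains2 G A) = carrier G \<times> carrier G \<rightarrow>\<^sub>E carrier A"
  by (simp add: cochains2_def)

lemma mult_cochains2: "c \<otimes>\<^bsub>cochains2 G A\<^esub> d = (\<lambda>u\<in>carrier G \<times> carrier G. c u \<otimes>\<^bsub>A\<^esub> d u)"
  by (simp add: cochains2_def)

lemma one_cochains2: "\<one>\<^bsub>cochains2 G A\<^esub> = (\<lambda>u\<in>carrier G \<times> carrier G. \<one>\<^bsub>A\<^esub>)"
  by (simp add: cochains2_def)

sublocale C: comm_group "cochains2 G A"
proof -
  interpret group "cochains2 G A" unfolding cochains2_def by (rule product_group) (rule A.is_group)
  show "comm_group (cochains2 G A)"
    by (rule group_comm_groupI) (auto simp: mult_cochains2 carrier_cochains2 PiE_iff A.m_comm intro!: restrict_ext)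
qed

lemma inv_cochains2:
  "c \<in> carrier (cochains2 G A) \<Longrightarrow> inv\<^bsub>cochains2 G A\<^esub> c = (\<lambda>u\<in>carrier G \<times> carrier G. inv\<^bsub>A\<^esub> c u)"
  unfolding cochains2_def by (rule inv_product_group) (auto intro: A.is_group)

text \<open>The cocycle identity cleared of inverses. In this form it carries over to the twisted
  algebra, where it says that multiplication is associative.\<close>

lemma Z2S_iff: "c \<in> Z2S G A \<longleftrightarrow> c \<in> carrier G \<times> carrier G \<rightarrow>\<^sub>E carrier A \<and>
  (\<forall>f\<in>carrier G. \<forall>g\<in>carrier G. \<forall>h\<in>carrier G.
    c (g, h) \<otimes>\<^bsub>A\<^esub> c (f, g \<otimes>\<^bsub>G\<^esub> h) = c (f \<otimes>\<^bsub>G\<^esub> g, h) \<otimes>\<^bsub>A\<^esub> c (f, g)) \<and>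
  (\<forall>g\<in>carrier G. \<forall>h\<in>carrier G. c (g, h) = c (h, g))"
proof (cases "c \<in> carrier G \<times> carrier G \<rightarrow>\<^sub>E carrier A")
  case True
  then have "c (g, h) \<in> carrier A" if "g \<in> carrier G" "h \<in> carrier G" for g h using that by auto
  then show ?thesis using True
    by (simp add: Z2S_def Z2_def symmetric_cochains2_def carrier_cochains2 A.cocycle_condition_iff)
qed (simp add: Z2S_def Z2_def carrier_cochains2)

lemma Z2S_closed: "c \<in> Z2S G A \<Longrightarrow> g \<in> carrier G \<Longrightarrow> h \<in> carrier G \<Longrightarrow> c (g, h) \<in> carrier A"
  unfolding Z2S_iff by auto

lemma Z2S_cocycle: "c \<in> Z2S G A \<Longrightarrow> f \<in> carrier G \<Longrightarrow> g \<in> carrier G \<Longrightarrow> h \<in> carrier G \<Longrightarrow>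
    c (g, h) \<otimes>\<^bsub>A\<^esub> c (f, g \<otimes>\<^bsub>G\<^esub> h) = c (f \<otimes>\<^bsub>G\<^esub> g, h) \<otimes>\<^bsub>A\<^esub> c (f, g)"
  unfolding Z2S_iff by blast

lemma Z2S_sym: "c \<in> Z2S G A \<Longrightarrow> g \<in> carrier G \<Longrightarrow> h \<in> carrier G \<Longrightarrow> c (g, h) = c (h, g)"
  unfolding Z2S_iff by blast

lemma Z2S_one_left:
  assumes "c \<in> Z2S G A" "g \<in> carrier G"
  shows "c (\<one>\<^bsub>G\<^esub>, g) = c (\<one>\<^bsub>G\<^esub>, \<one>\<^bsub>G\<^esub>)"
  using Z2S_cocycle[OF assms(1), of "\<one>\<^bsub>G\<^esub>" "\<one>\<^bsub>G\<^esub>" g] Z2S_closed[OF assms(1)] assms(2) by simp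

text \<open>Commutativity of \<open>G\<close> and \<open>A\<close> makes every coboundary symmetric;
  the defining equation is cleared of inverses by moving \<open>\<beta> (f \<otimes> g)\<close> to
  the other side.\<close>

lemma B2S_iff: "c \<in> B2S G A \<longleftrightarrow> c \<in> carrier G \<times> carrier G \<rightarrow>\<^sub>E carrier A \<and>
  (\<exists>\<beta>\<in>carrier G \<rightarrow> carrier A. \<forall>f\<in>carrier G. \<forall>g\<in>carrier G. c (f, g) \<otimes>\<^bsub>A\<^esub> \<beta> (f \<otimes>\<^bsub>G\<^esub> g) = \<beta> f \<otimes>\<^bsub>A\<^esub> \<beta> g)"
proof -
  have eq: "c (f, g) = \<beta> g \<otimes>\<^bsub>A\<^esub> inv\<^bsub>A\<^esub> \<beta> (f \<otimes>\<^bsub>G\<^esub> g) \<otimes>\<^bsub>A\<^esub> \<beta> f \<longleftrightarrow>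
      c (f, g) \<otimes>\<^bsub>A\<^esub> \<beta> (f \<otimes>\<^bsub>G\<^esub> g) = \<beta> f \<otimes>\<^bsub>A\<^esub> \<beta> g"
    if "c \<in> carrier G \<times> carrier G \<rightarrow>\<^sub>E carrier A" "\<beta> \<in> carrier G \<rightarrow> carrier A" "f \<in> carrier G" "g \<in> carrier G" for \<beta> f g
  proof -
    have car: "c (f, g) \<in> carrier A" "\<beta> f \<in> carrier A" "\<beta> g \<in> carrier A" "\<beta> (f \<otimes>\<^bsub>G\<^esub> g) \<in> carrier A"
      using that by auto
    then have "\<beta> g \<otimes>\<^bsub>A\<^esub> inv\<^bsub>A\<^esub> \<beta> (f \<otimes>\<^bsub>G\<^esub> g) \<otimes>\<^bsub>A\<^esub> \<beta> f = (\<beta> f \<otimes>\<^bsub>A\<^esub> \<beta> g) \<otimes>\<^bsub>A\<^esub> inv\<^bsub>A\<^esub> \<beta> (f \<otimes>\<^bsub>G\<^esub> g)"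
      by (simp add: A.m_ac)
    moreover have "c (f, g) = (\<beta> f \<otimes>\<^bsub>A\<^esub> \<beta> g) \<otimes>\<^bsub>A\<^esub> inv\<^bsub>A\<^esub> \<beta> (f \<otimes>\<^bsub>G\<^esub> g) \<longleftrightarrow>
        \<beta> f \<otimes>\<^bsub>A\<^esub> \<beta> g = c (f, g) \<otimes>\<^bsub>A\<^esub> \<beta> (f \<otimes>\<^bsub>G\<^esub> g)"
      using car by (intro A.inv_solve_right) auto
    ultimately show ?thesis by argo
  qed
  have sym: "c (f, g) = c (g, f)" if "c \<in> carrier G \<times> carrier G \<rightarrow>\<^sub>E carrier A" "\<beta> \<in> carrier G \<rightarrow> carrier A"
     "\<forall>f\<in>carrier G. \<forall>g\<in>carrier G. c (f, g) \<otimes>\<^bsub>A\<^esub> \<beta> (f \<otimes>\<^bsub>G\<^esub> g) = \<beta> f \<otimes>\<^bsub>A\<^esub> \<beta> g" "f \<in> carrier G" "g \<in> carrier G" for \<beta> f g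
  proof -
    have car: "c (f, g) \<in> carrier A" "c (g, f) \<in> carrier A" "\<beta> f \<in> carrier A" "\<beta> g \<in> carrier A" "\<beta> (f \<otimes>\<^bsub>G\<^esub> g) \<in> carrier A"
      using that by auto
    have "c (f, g) \<otimes>\<^bsub>A\<^esub> \<beta> (f \<otimes>\<^bsub>G\<^esub> g) = \<beta> f \<otimes>\<^bsub>A\<^esub> \<beta> g" "c (g, f) \<otimes>\<^bsub>A\<^esub> \<beta> (g \<otimes>\<^bsub>G\<^esub> f) = \<beta> g \<otimes>\<^bsub>A\<^esub> \<beta> f"
      using that by blast+
    then show ?thesis using car that(4,5) by (metis A.m_comm A.r_cancel G.m_comm)
  qed
  show ?thesis
    unfolding B2S_def B2_def symmetric_cochains2_def carrier_cochains2 using eq sym by (simp cong: conj_cong) blast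
qed

lemma Z2S_mult:
  assumes c: "c \<in> Z2S G A" and d: "d \<in> Z2S G A"
  shows "c \<otimes>\<^bsub>cochains2 G A\<^esub> d \<in> Z2S G A"
proof -
  have "c (g, h) \<otimes>\<^bsub>A\<^esub> d (g, h) \<otimes>\<^bsub>A\<^esub> (c (f, g \<otimes>\<^bsub>G\<^esub> h) \<otimes>\<^bsub>A\<^esub> d (f, g \<otimes>\<^bsub>G\<^esub> h))
      = c (f \<otimes>\<^bsub>G\<^esub> g, h) \<otimes>\<^bsub>A\<^esub> d (f \<otimes>\<^bsub>G\<^esub> g, h) \<otimes>\<^bsub>A\<^esub> (c (f, g) \<otimes>\<^bsub>A\<^esub> d (f, g))"
    if "f \<in> carrier G" "g \<in> carrier G" "h \<in> carrier G" for f g h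
  proof -
    have "c (g, h) \<otimes>\<^bsub>A\<^esub> d (g, h) \<otimes>\<^bsub>A\<^esub> (c (f, g \<otimes>\<^bsub>G\<^esub> h) \<otimes>\<^bsub>A\<^esub> d (f, g \<otimes>\<^bsub>G\<^esub> h))
        = (c (g, h) \<otimes>\<^bsub>A\<^esub> c (f, g \<otimes>\<^bsub>G\<^esub> h)) \<otimes>\<^bsub>A\<^esub> (d (g, h) \<otimes>\<^bsub>A\<^esub> d (f, g \<otimes>\<^bsub>G\<^esub> h))"
      using that Z2S_closed[OF c] Z2S_closed[OF d] by (simp add: A.m_ac)
    also have "\<dots> = (c (f \<otimes>\<^bsub>G\<^esub> g, h) \<otimes>\<^bsub>A\<^esub> c (f, g)) \<otimes>\<^bsub>A\<^esub> (d (f \<otimes>\<^bsub>G\<^esub> g, h) \<otimes>\<^bsub>A\<^esub> d (f, g))"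
      using Z2S_cocycle[OF c that] Z2S_cocycle[OF d that] by simp
    also have "\<dots> = c (f \<otimes>\<^bsub>G\<^esub> g, h) \<otimes>\<^bsub>A\<^esub> d (f \<otimes>\<^bsub>G\<^esub> g, h) \<otimes>\<^bsub>A\<^esub> (c (f, g) \<otimes>\<^bsub>A\<^esub> d (f, g))"
      using that Z2S_closed[OF c] Z2S_closed[OF d] by (simp add: A.m_ac)
    finally show ?thesis .
  qed
  then show ?thesis
    unfolding Z2S_iff mult_cochains2 using Z2S_closed[OF c] Z2S_closed[OF d] Z2S_sym[OF c] Z2S_sym[OF d] by auto
qed

lemma Z2S_inv:
  assumes c: "c \<in> Z2S G A"
  shows "inv\<^bsub>cochains2 G A\<^esub> c \<in> Z2S G A"
proof -
  have "inv\<^bsub>A\<^esub> c (g, h) \<otimes>\<^bsub>A\<^esub> inv\<^bsub>A\<^esub> c (f, g \<otimes>\<^bsub>G\<^esub> h) = inv\<^bsub>A\<^esub> c (f \<otimes>\<^bsub>G\<^esub> g, h) \<otimes>\<^bsub>A\<^esub> inv\<^bsub>A\<^esub> c (f, g)"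
    if "f \<in> carrier G" "g \<in> carrier G" "h \<in> carrier G" for f g h
    using Z2S_cocycle[OF c that] Z2S_closed[OF c] that by (simp flip: A.inv_mult)
  moreover have "c \<in> carrier (cochains2 G A)" using c unfolding Z2S_iff carrier_cochains2 by blast
  ultimately show ?thesis
    unfolding Z2S_iff using Z2S_closed[OF c] Z2S_sym[OF c] by (auto simp: inv_cochains2)
qed

lemma subgroup_Z2S: "subgroup (Z2S G A) (cochains2 G A)"
proof (rule C.subgroupI)
  show "Z2S G A \<subseteq> carrier (cochains2 G A)" unfolding carrier_cochains2 using Z2S_iff by blast
  have "(\<lambda>u\<in>carrier G \<times> carrier G. \<one>\<^bsub>A\<^esub>) \<in> Z2S G A" unfolding Z2S_iff by auto
  then show "Z2S G A \<noteq> {}" by blast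
qed (auto intro: Z2S_mult Z2S_inv)

abbreviation "ZS \<equiv> (cochains2 G A)\<lparr>carrier := Z2S G A\<rparr>"

sublocale Z: comm_group ZS
  by (rule group.group_comm_groupI[OF C.subgroup_imp_group[OF subgroup_Z2S]])
    (use subgroup.mem_carrier[OF subgroup_Z2S] in \<open>simp add: C.m_comm\<close>)

text \<open>An inverse-free form of "differ by a coboundary", chosen to match the equation that
  compares a power of a cocycle with its pullback.\<close>

definition cohomologous :: "('g \<times> 'g \<Rightarrow> 'm) \<Rightarrow> ('g \<times> 'g \<Rightarrow> 'm) \<Rightarrow> bool"
  where "cohomologous c d \<longleftrightarrow> (\<exists>\<beta>\<in>carrier G \<rightarrow> carrier A. \<forall>f\<in>carrier G. \<forall>g\<in>carrier G.
    c (f, g) \<otimes>\<^bsub>A\<^esub> \<beta> (f \<otimes>\<^bsub>G\<^esub> g) = d (f, g) \<otimes>\<^bsub>A\<^esub> \<beta> f \<otimes>\<^bsub>A\<^esub> \<beta> g)"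

lemma inv_ZS: "c \<in> Z2S G A \<Longrightarrow> inv\<^bsub>ZS\<^esub> c = (\<lambda>u\<in>carrier G \<times> carrier G. inv\<^bsub>A\<^esub> c u)"
  using C.m_inv_consistent[OF subgroup_Z2S, of c] inv_cochains2[of c] subgroup.subset[OF subgroup_Z2S] by auto

lemma mult_ZS: "c \<otimes>\<^bsub>ZS\<^esub> d = (\<lambda>u\<in>carrier G \<times> carrier G. c u \<otimes>\<^bsub>A\<^esub> d u)"
  by (simp add: mult_cochains2)

lemma quotient_in_B2S_iff:
  assumes c: "c \<in> Z2S G A" and d: "d \<in> Z2S G A"
  shows "c \<otimes>\<^bsub>ZS\<^esub> inv\<^bsub>ZS\<^esub> d \<in> B2S G A \<longleftrightarrow> cohomologous c d"
proof -
  have "c (f, g) \<otimes>\<^bsub>A\<^esub> inv\<^bsub>A\<^esub> d (f, g) \<otimes>\<^bsub>A\<^esub> \<beta> (f \<otimes>\<^bsub>G\<^esub> g) = \<beta> f \<otimes>\<^bsub>A\<^esub> \<beta> g \<longleftrightarrow>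
     c (f, g) \<otimes>\<^bsub>A\<^esub> \<beta> (f \<otimes>\<^bsub>G\<^esub> g) = d (f, g) \<otimes>\<^bsub>A\<^esub> \<beta> f \<otimes>\<^bsub>A\<^esub> \<beta> g"
    if "\<beta> \<in> carrier G \<rightarrow> carrier A" "f \<in> carrier G" "g \<in> carrier G" for f g \<beta>
  proof -
    have car: "c (f, g) \<in> carrier A" "d (f, g) \<in> carrier A" "\<beta> f \<in> carrier A" "\<beta> g \<in> carrier A" "\<beta> (f \<otimes>\<^bsub>G\<^esub> g) \<in> carrier A"
      using that Z2S_closed[OF c] Z2S_closed[OF d] by auto
    have e1: "c (f, g) \<otimes>\<^bsub>A\<^esub> inv\<^bsub>A\<^esub> d (f, g) \<otimes>\<^bsub>A\<^esub> \<beta> (f \<otimes>\<^bsub>G\<^esub> g) = inv\<^bsub>A\<^esub> d (f, g) \<otimes>\<^bsub>A\<^esub> (c (f, g) \<otimes>\<^bsub>A\<^esub> \<beta> (f \<otimes>\<^bsub>G\<^esub> g))"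
      using car by (simp add: A.m_ac)
    have e2: "\<beta> f \<otimes>\<^bsub>A\<^esub> \<beta> g = inv\<^bsub>A\<^esub> d (f, g) \<otimes>\<^bsub>A\<^esub> (c (f, g) \<otimes>\<^bsub>A\<^esub> \<beta> (f \<otimes>\<^bsub>G\<^esub> g)) \<longleftrightarrow>
        c (f, g) \<otimes>\<^bsub>A\<^esub> \<beta> (f \<otimes>\<^bsub>G\<^esub> g) = d (f, g) \<otimes>\<^bsub>A\<^esub> (\<beta> f \<otimes>\<^bsub>A\<^esub> \<beta> g)"
      using car by (intro A.inv_solve_left) auto
    have e3: "d (f, g) \<otimes>\<^bsub>A\<^esub> (\<beta> f \<otimes>\<^bsub>A\<^esub> \<beta> g) = d (f, g) \<otimes>\<^bsub>A\<^esub> \<beta> f \<otimes>\<^bsub>A\<^esub> \<beta> g"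
      using car by (simp add: A.m_assoc)
    show ?thesis unfolding e1 e3[symmetric] e2[symmetric] by (rule eq_commute)
  qed
  then show ?thesis
    unfolding B2S_iff cohomologous_def mult_ZS inv_ZS[OF d]
    using Z2S_closed[OF c] Z2S_closed[OF d] by (auto simp: Bex_def cong: conj_cong)
qed

text \<open>Both sides of the cocycle identity, multiplied by \<open>\<beta>\<close> of the
  threefold product, equal the product of the three values of \<open>\<beta>\<close>; this common
  factor is cancelled at the end.\<close>

lemma B2S_subset: "B2S G A \<subseteq> Z2S G A"
proof
  fix c assume "c \<in> B2S G A"
  then obtain \<beta> where c: "c \<in> carrier G \<times> carrier G \<rightarrow>\<^sub>E carrier A" "c \<in> symmetric_cochains2 G A" and \<beta>: "\<beta> \<in> carrier G \<rightarrow> carrier A"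
    "\<And>f g. f \<in> carrier G \<Longrightarrow> g \<in> carrier G \<Longrightarrow> c (f, g) \<otimes>\<^bsub>A\<^esub> \<beta> (f \<otimes>\<^bsub>G\<^esub> g) = \<beta> f \<otimes>\<^bsub>A\<^esub> \<beta> g"
    using B2S_iff[of c] unfolding B2S_def by blast
  have "c (g, h) \<otimes>\<^bsub>A\<^esub> c (f, g \<otimes>\<^bsub>G\<^esub> h) = c (f \<otimes>\<^bsub>G\<^esub> g, h) \<otimes>\<^bsub>A\<^esub> c (f, g)"
    if fgh: "f \<in> carrier G" "g \<in> carrier G" "h \<in> carrier G" for f g h
  proof -
    let ?b = "\<beta> (f \<otimes>\<^bsub>G\<^esub> (g \<otimes>\<^bsub>G\<^esub> h))"
    have car: "c (x, y) \<in> carrier A" "\<beta> x \<in> carrier A" if "x \<in> carrier G" "y \<in> carrier G" for x y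
      using that c \<beta> by auto
    have "c (g, h) \<otimes>\<^bsub>A\<^esub> c (f, g \<otimes>\<^bsub>G\<^esub> h) \<otimes>\<^bsub>A\<^esub> ?b = c (g, h) \<otimes>\<^bsub>A\<^esub> \<beta> (g \<otimes>\<^bsub>G\<^esub> h) \<otimes>\<^bsub>A\<^esub> \<beta> f"
      using \<beta>(2)[of f "g \<otimes>\<^bsub>G\<^esub> h"] fgh car by (simp add: A.m_ac)
    also have "\<dots> = \<beta> f \<otimes>\<^bsub>A\<^esub> \<beta> g \<otimes>\<^bsub>A\<^esub> \<beta> h"
      using \<beta>(2)[of g h] fgh car by (simp add: A.m_ac)
    also have "\<dots> = c (f, g) \<otimes>\<^bsub>A\<^esub> (\<beta> (f \<otimes>\<^bsub>G\<^esub> g) \<otimes>\<^bsub>A\<^esub> \<beta> h)"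
      using \<beta>(2)[of f g] fgh car by (simp flip: A.m_assoc)
    also have "\<dots> = c (f \<otimes>\<^bsub>G\<^esub> g, h) \<otimes>\<^bsub>A\<^esub> c (f, g) \<otimes>\<^bsub>A\<^esub> ?b"
      using \<beta>(2)[of "f \<otimes>\<^bsub>G\<^esub> g" h] fgh car by (simp add: G.m_assoc A.m_ac flip: \<beta>(2)[of "f \<otimes>\<^bsub>G\<^esub> g" h])
    finally show ?thesis using fgh car by (simp add: A.r_cancel)
  qed
  then show "c \<in> Z2S G A" unfolding Z2S_iff using c by (auto simp: symmetric_cochains2_def)
qed

lemma subgroup_B2S: "subgroup (B2S G A) ZS"
proof (rule Z.subgroupI)
  show "B2S G A \<subseteq> carrier ZS" using B2S_subset by simp
  have "\<one>\<^bsub>ZS\<^esub> \<otimes>\<^bsub>ZS\<^esub> inv\<^bsub>ZS\<^esub> \<one>\<^bsub>ZS\<^esub> \<in> B2S G A"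
  proof (subst quotient_in_B2S_iff)
    show "cohomologous \<one>\<^bsub>ZS\<^esub> \<one>\<^bsub>ZS\<^esub>"
      unfolding cohomologous_def by (intro bexI[of _ "\<lambda>_. \<one>\<^bsub>A\<^esub>"]) (auto simp: one_cochains2)
  qed (use Z.one_closed in auto)
  then show "B2S G A \<noteq> {}" by blast
next
  fix c assume c: "c \<in> B2S G A"
  then obtain \<beta> where cE: "c \<in> carrier G \<times> carrier G \<rightarrow>\<^sub>E carrier A" and \<beta>: "\<beta> \<in> carrier G \<rightarrow> carrier A"
    "\<And>f g. f \<in> carrier G \<Longrightarrow> g \<in> carrier G \<Longrightarrow> c (f, g) \<otimes>\<^bsub>A\<^esub> \<beta> (f \<otimes>\<^bsub>G\<^esub> g) = \<beta> f \<otimes>\<^bsub>A\<^esub> \<beta> g"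
    unfolding B2S_iff by blast
  have car: "c (f, g) \<in> carrier A" "\<beta> f \<in> carrier A" if "f \<in> carrier G" "g \<in> carrier G" for f g
    using cE \<beta>(1) that by auto
  have "inv\<^bsub>A\<^esub> c (f, g) \<otimes>\<^bsub>A\<^esub> inv\<^bsub>A\<^esub> \<beta> (f \<otimes>\<^bsub>G\<^esub> g) = inv\<^bsub>A\<^esub> \<beta> f \<otimes>\<^bsub>A\<^esub> inv\<^bsub>A\<^esub> \<beta> g" if "f \<in> carrier G" "g \<in> carrier G" for f g
    using \<beta>(2)[OF that] car that by (simp flip: A.inv_mult)
  then show "inv\<^bsub>ZS\<^esub> c \<in> B2S G A"
    unfolding B2S_iff using c B2S_subset car
    by (auto simp: inv_ZS subset_iff intro!: bexI[of _ "\<lambda>g. inv\<^bsub>A\<^esub> \<beta> g"])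
next
  fix c d assume c: "c \<in> B2S G A" and d: "d \<in> B2S G A"
  obtain \<beta> where cE: "c \<in> carrier G \<times> carrier G \<rightarrow>\<^sub>E carrier A" and \<beta>: "\<beta> \<in> carrier G \<rightarrow> carrier A"
    "\<And>f g. f \<in> carrier G \<Longrightarrow> g \<in> carrier G \<Longrightarrow> c (f, g) \<otimes>\<^bsub>A\<^esub> \<beta> (f \<otimes>\<^bsub>G\<^esub> g) = \<beta> f \<otimes>\<^bsub>A\<^esub> \<beta> g"
    using c unfolding B2S_iff by blast
  obtain \<gamma> where dE: "d \<in> carrier G \<times> carrier G \<rightarrow>\<^sub>E carrier A" and \<gamma>: "\<gamma> \<in> carrier G \<rightarrow> carrier A"
    "\<And>f g. f \<in> carrier G \<Longrightarrow> g \<in> carrier G \<Longrightarrow> d (f, g) \<otimes>\<^bsub>A\<^esub> \<gamma> (f \<otimes>\<^bsub>G\<^esub> g) = \<gamma> f \<otimes>\<^bsub>A\<^esub> \<gamma> g"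
    using d unfolding B2S_iff by blast
  have car: "c (f, g) \<in> carrier A" "\<beta> f \<in> carrier A" "d (f, g) \<in> carrier A" "\<gamma> f \<in> carrier A" if "f \<in> carrier G" "g \<in> carrier G" for f g
    using cE \<beta>(1) dE \<gamma>(1) that by auto
  have "c (f, g) \<otimes>\<^bsub>A\<^esub> d (f, g) \<otimes>\<^bsub>A\<^esub> (\<beta> (f \<otimes>\<^bsub>G\<^esub> g) \<otimes>\<^bsub>A\<^esub> \<gamma> (f \<otimes>\<^bsub>G\<^esub> g)) = \<beta> f \<otimes>\<^bsub>A\<^esub> \<gamma> f \<otimes>\<^bsub>A\<^esub> (\<beta> g \<otimes>\<^bsub>A\<^esub> \<gamma> g)"
    if fg: "f \<in> carrier G" "g \<in> carrier G" for f g
  proof -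
    have "c (f, g) \<otimes>\<^bsub>A\<^esub> d (f, g) \<otimes>\<^bsub>A\<^esub> (\<beta> (f \<otimes>\<^bsub>G\<^esub> g) \<otimes>\<^bsub>A\<^esub> \<gamma> (f \<otimes>\<^bsub>G\<^esub> g))
        = (c (f, g) \<otimes>\<^bsub>A\<^esub> \<beta> (f \<otimes>\<^bsub>G\<^esub> g)) \<otimes>\<^bsub>A\<^esub> (d (f, g) \<otimes>\<^bsub>A\<^esub> \<gamma> (f \<otimes>\<^bsub>G\<^esub> g))"
      using car fg by (simp add: A.m_ac)
    then show ?thesis using \<beta>(2)[OF fg] \<gamma>(2)[OF fg] car fg by (simp add: A.m_ac)
  qed
  then show "c \<otimes>\<^bsub>ZS\<^esub> d \<in> B2S G A"
    unfolding B2S_iff mult_ZS using car by (auto intro!: bexI[of _ "\<lambda>g. \<beta> g \<otimes>\<^bsub>A\<^esub> \<gamma> g"])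
qed

abbreviation "coclass c \<equiv> B2S G A #>\<^bsub>ZS\<^esub> c"

sublocale B: normal "B2S G A" ZS
  using subgroup_B2S by (simp add: Z.normal_iff_subgroup)

sublocale H: comm_group "H2S G A"
  unfolding H2S_def by (rule Z.abelian_FactGroup[OF subgroup_B2S])

lemma carrier_H2S: "carrier (H2S G A) = coclass ` Z2S G A"
  unfolding H2S_def by (simp add: carrier_FactGroup)

lemma coclass_self: "c \<in> Z2S G A \<Longrightarrow> c \<in> coclass c"
  using Z.rcos_self[OF _ subgroup_B2S] by simp

lemma coclass_subset: "c \<in> Z2S G A \<Longrightarrow> coclass c \<subseteq> Z2S G A"
  using Z.r_coset_subset_G[OF subgroup.subset[OF subgroup_B2S]] by simp

lemma coclass_eq_iff:
  assumes c: "c \<in> Z2S G A" and d: "d \<in> Z2S G A"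
  shows "coclass c = coclass d \<longleftrightarrow> cohomologous c d"
proof -
  have "coclass c = coclass d \<longleftrightarrow> c \<in> coclass d"
    using coclass_self[OF c] Z.repr_independence[OF _ _ subgroup_B2S, of c d] d by auto
  also have "\<dots> \<longleftrightarrow> c \<otimes>\<^bsub>ZS\<^esub> inv\<^bsub>ZS\<^esub> d \<in> B2S G A"
    using B.rcos_module[OF Z.is_group, of d c] c d by simp
  finally show ?thesis using quotient_in_B2S_iff[OF c d] by simp
qed

definition cocycle_pow :: "('g \<times> 'g \<Rightarrow> 'm) \<Rightarrow> int \<Rightarrow> 'g \<times> 'g \<Rightarrow> 'm"
  where "cocycle_pow c r = (\<lambda>u\<in>carrier G \<times> carrier G. c u [^]\<^bsub>A\<^esub> r)"

lemma ZS_int_pow: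
  assumes c: "c \<in> Z2S G A"
  shows "c [^]\<^bsub>ZS\<^esub> r = cocycle_pow c r"
proof -
  have nat: "c [^]\<^bsub>ZS\<^esub> (n::nat) = (\<lambda>u\<in>carrier G \<times> carrier G. c u [^]\<^bsub>A\<^esub> n)" for n
  proof (induction n)
    case 0
    then show ?case by (simp add: one_cochains2)
  next
    case (Suc n)
    then show ?case by (auto simp: mult_cochains2 intro!: restrict_ext)
  qed
  show ?thesis
  proof (cases r)
    case (nonneg n)
    then show ?thesis unfolding cocycle_pow_def by (simp add: int_pow_int nat)
  next
    case (neg n)
    have "c [^]\<^bsub>ZS\<^esub> r = inv\<^bsub>ZS\<^esub> (c [^]\<^bsub>ZS\<^esub> Suc n)"
      using c neg Z.int_pow_neg[of c "int (Suc n)"] by (simp only: int_pow_int partial_object.simps) simp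
    also have "\<dots> = (\<lambda>u\<in>carrier G \<times> carrier G. inv\<^bsub>A\<^esub> ((\<lambda>u\<in>carrier G \<times> carrier G. c u [^]\<^bsub>A\<^esub> Suc n) u))"
      unfolding nat[symmetric] using Z.nat_pow_closed[of c "Suc n"] c by (intro inv_ZS) simp
    also have "\<dots> = cocycle_pow c r"
      unfolding cocycle_pow_def neg using Z2S_closed[OF c]
      by (intro restrict_ext) (auto simp: A.int_pow_neg int_pow_int simp del: of_nat_Suc A.nat_pow_Suc)
    finally show ?thesis .
  qed
qed

lemma H2S_int_pow: "c \<in> Z2S G A \<Longrightarrow> coclass c [^]\<^bsub>H2S G A\<^esub> (r::int) = coclass (cocycle_pow c r)"
  unfolding H2S_def using B.FactGroup_int_pow[of c r] by (simp add: ZS_int_pow)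

lemma cocycle_pow_closed: "c \<in> Z2S G A \<Longrightarrow> cocycle_pow c r \<in> Z2S G A"
  using Z.int_pow_closed[of c r] by (simp add: ZS_int_pow)

end

section \<open>Splitting of symmetric cocycles with divisible coefficients\<close>

context group_cohomology
begin

text \<open>This is the vanishing of Ext(G, A) for divisible \<open>A\<close>. The cocycle defines
  an extension of \<open>G\<close> by \<open>A\<close>, commutative because \<open>c\<close> is
  symmetric. A retraction onto \<open>A\<close> exists by divisibility, and its values at the
  elements \<open>(\<one>, g)\<close> form \<open>\<beta>\<close>.\<close>

theorem symmetric_cocycle_splits:
  assumes div: "divisible_group A" and c: "c \<in> Z2S G A"
  obtains \<beta> where "\<beta> \<in> carrier G \<rightarrow> carrier A"
    "\<And>g h. g \<in> carrier G \<Longrightarrow> h \<in> carrier G \<Longrightarrow> c (g, h) \<otimes>\<^bsub>A\<^esub> \<beta> (g \<otimes>\<^bsub>G\<^esub> h) = \<beta> g \<otimes>\<^bsub>A\<^esub> \<beta> h"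
proof -
  note c_closed = Z2S_closed[OF c] and c_one = Z2S_one_left[OF c]
  let ?e = "c (\<one>\<^bsub>G\<^esub>, \<one>\<^bsub>G\<^esub>)"
  have e: "?e \<in> carrier A" using c_closed by simp
  have c_one': "c (g, \<one>\<^bsub>G\<^esub>) = ?e" if "g \<in> carrier G" for g
    using c_one[OF that] Z2S_sym[OF c that G.one_closed] by simp
  \<comment> \<open>The extension with factor set \<open>c\<close>. Since \<open>c\<close> need not
    be normalised, its unit is \<open>(inv ?e, \<one>)\<close> rather than
    \<open>(\<one>, \<one>)\<close>.\<close>
  define E where "E = \<lparr>carrier = carrier A \<times> carrier G,
    monoid.mult = (\<lambda>x y. (fst x \<otimes>\<^bsub>A\<^esub> fst y \<otimes>\<^bsub>A\<^esub> c (snd x, snd y), snd x \<otimes>\<^bsub>G\<^esub> snd y)), one = (inv\<^bsub>A\<^esub> ?e, \<one>\<^bsub>G\<^esub>)\<rparr>"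
  have E_simps: "carrier E = carrier A \<times> carrier G" "\<one>\<^bsub>E\<^esub> = (inv\<^bsub>A\<^esub> ?e, \<one>\<^bsub>G\<^esub>)"
    "(a, g) \<otimes>\<^bsub>E\<^esub> (b, h) = (a \<otimes>\<^bsub>A\<^esub> b \<otimes>\<^bsub>A\<^esub> c (g, h), g \<otimes>\<^bsub>G\<^esub> h)" for a b g h
    by (simp_all add: E_def)
  have "comm_group E"
  proof (rule comm_groupI)
    show "x \<otimes>\<^bsub>E\<^esub> y \<in> carrier E" if "x \<in> carrier E" "y \<in> carrier E" for x y
      using that c_closed by (auto simp: E_simps)
    show "\<one>\<^bsub>E\<^esub> \<in> carrier E" using e by (simp add: E_simps)
    show "x \<otimes>\<^bsub>E\<^esub> y \<otimes>\<^bsub>E\<^esub> z = x \<otimes>\<^bsub>E\<^esub> (y \<otimes>\<^bsub>E\<^esub> z)" if "x \<in> carrier E" "y \<in> carrier E" "z \<in> carrier E" for x y z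
    proof -
      obtain x1 x2 y1 y2 z1 z2 where xyz: "x = (x1, x2)" "y = (y1, y2)" "z = (z1, z2)" by (metis prod.exhaust)
      then have car: "x1 \<in> carrier A" "y1 \<in> carrier A" "z1 \<in> carrier A" "x2 \<in> carrier G" "y2 \<in> carrier G" "z2 \<in> carrier G"
        using that by (auto simp: E_simps)
      have "x1 \<otimes>\<^bsub>A\<^esub> y1 \<otimes>\<^bsub>A\<^esub> c (x2, y2) \<otimes>\<^bsub>A\<^esub> z1 \<otimes>\<^bsub>A\<^esub> c (x2 \<otimes>\<^bsub>G\<^esub> y2, z2)
          = x1 \<otimes>\<^bsub>A\<^esub> y1 \<otimes>\<^bsub>A\<^esub> z1 \<otimes>\<^bsub>A\<^esub> (c (x2 \<otimes>\<^bsub>G\<^esub> y2, z2) \<otimes>\<^bsub>A\<^esub> c (x2, y2))"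
        using car c_closed by (simp add: A.m_ac)
      also have "\<dots> = x1 \<otimes>\<^bsub>A\<^esub> y1 \<otimes>\<^bsub>A\<^esub> z1 \<otimes>\<^bsub>A\<^esub> (c (y2, z2) \<otimes>\<^bsub>A\<^esub> c (x2, y2 \<otimes>\<^bsub>G\<^esub> z2))"
        using Z2S_cocycle[OF c car(4-6)] by simp
      also have "\<dots> = x1 \<otimes>\<^bsub>A\<^esub> (y1 \<otimes>\<^bsub>A\<^esub> z1 \<otimes>\<^bsub>A\<^esub> c (y2, z2)) \<otimes>\<^bsub>A\<^esub> c (x2, y2 \<otimes>\<^bsub>G\<^esub> z2)"
        using car c_closed by (simp add: A.m_ac)
      finally show ?thesis using car by (simp add: xyz E_simps G.m_assoc)
    qed
    show "x \<otimes>\<^bsub>E\<^esub> y = y \<otimes>\<^bsub>E\<^esub> x" if "x \<in> carrier E" "y \<in> carrier E" for x y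
      using that Z2S_sym[OF c] by (auto simp: E_simps G.m_comm A.m_comm)
    show "\<one>\<^bsub>E\<^esub> \<otimes>\<^bsub>E\<^esub> x = x" if xE: "x \<in> carrier E" for x
    proof -
      obtain a g where x: "x = (a, g)" "a \<in> carrier A" "g \<in> carrier G" using xE by (auto simp: E_simps)
      have "inv\<^bsub>A\<^esub> ?e \<otimes>\<^bsub>A\<^esub> a \<otimes>\<^bsub>A\<^esub> ?e = a \<otimes>\<^bsub>A\<^esub> (inv\<^bsub>A\<^esub> ?e \<otimes>\<^bsub>A\<^esub> ?e)" using x e by (simp only: A.m_ac A.inv_closed A.m_closed)
      then show ?thesis using x e by (simp add: E_simps c_one[OF x(3)])
    qed
    show "\<exists>y\<in>carrier E. y \<otimes>\<^bsub>E\<^esub> x = \<one>\<^bsub>E\<^esub>" if xE: "x \<in> carrier E" for x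
    proof -
      obtain a g where x: "x = (a, g)" "a \<in> carrier A" "g \<in> carrier G" using xE by (auto simp: E_simps)
      let ?b = "inv\<^bsub>A\<^esub> ?e \<otimes>\<^bsub>A\<^esub> inv\<^bsub>A\<^esub> (a \<otimes>\<^bsub>A\<^esub> c (inv\<^bsub>G\<^esub> g, g))"
      have cc: "c (inv\<^bsub>G\<^esub> g, g) \<in> carrier A" using c_closed x by simp
      have "?b \<otimes>\<^bsub>A\<^esub> a \<otimes>\<^bsub>A\<^esub> c (inv\<^bsub>G\<^esub> g, g) = inv\<^bsub>A\<^esub> ?e"
        using x e cc by (simp add: A.m_assoc del: A.inv_mult_group)
      then show ?thesis using x e cc by (intro bexI[of _ "(?b, inv\<^bsub>G\<^esub> g)"]) (simp_all add: E_simps)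
    qed
  qed
  then interpret E: comm_group E .
  let ?N = "(\<lambda>a. (a, \<one>\<^bsub>G\<^esub>)) ` carrier A"
  have N: "subgroup ?N E"
  proof (rule E.subgroupI)
    show "?N \<subseteq> carrier E" by (auto simp: E_simps)
    show "?N \<noteq> {}" using e by auto
    show "inv\<^bsub>E\<^esub> x \<in> ?N" if xN: "x \<in> ?N" for x
    proof -
      obtain a where a: "x = (a, \<one>\<^bsub>G\<^esub>)" "a \<in> carrier A" using xN by blast
      let ?b = "inv\<^bsub>A\<^esub> ?e \<otimes>\<^bsub>A\<^esub> inv\<^bsub>A\<^esub> (a \<otimes>\<^bsub>A\<^esub> ?e)"
      have "?b \<otimes>\<^bsub>A\<^esub> a \<otimes>\<^bsub>A\<^esub> ?e = inv\<^bsub>A\<^esub> ?e" using a e by (simp add: A.m_assoc del: A.inv_mult_group)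
      then have "(?b, \<one>\<^bsub>G\<^esub>) \<otimes>\<^bsub>E\<^esub> x = \<one>\<^bsub>E\<^esub>" using a by (simp add: E_simps)
      then have "inv\<^bsub>E\<^esub> x = (?b, \<one>\<^bsub>G\<^esub>)" using a e by (intro E.inv_equality) (auto simp: E_simps)
      then show ?thesis using a e by simp
    qed
    show "x \<otimes>\<^bsub>E\<^esub> y \<in> ?N" if "x \<in> ?N" "y \<in> ?N" for x y
      using that e by (auto simp: E_simps)
  qed
  \<comment> \<open>A product of two elements of \<open>?N\<close> picks up a factor
    \<open>?e\<close>, so the isomorphism of \<open>?N\<close> with \<open>A\<close> has to multiply
    the first coordinate by \<open>?e\<close>.\<close>
  have "(\<lambda>x. fst x \<otimes>\<^bsub>A\<^esub> ?e) \<in> hom (E\<lparr>carrier := ?N\<rparr>) A"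
    using e by (intro homI) (auto simp: E_simps A.m_ac)
  then obtain f where f: "f \<in> hom E A" "\<And>x. x \<in> ?N \<Longrightarrow> f x = fst x \<otimes>\<^bsub>A\<^esub> ?e"
    using extend_hom_to_divisible[OF E.comm_group_axioms A.comm_group_axioms div N] by metis
  show thesis
  proof
    show "(\<lambda>g. f (\<one>\<^bsub>A\<^esub>, g)) \<in> carrier G \<rightarrow> carrier A"
      using hom_in_carrier[OF f(1)] by (auto simp: E_simps)
    fix g h assume gh: "g \<in> carrier G" "h \<in> carrier G"
    let ?a = "c (g, h) \<otimes>\<^bsub>A\<^esub> inv\<^bsub>A\<^esub> ?e"
    have cgh: "c (g, h) \<in> carrier A" using c_closed gh by simp
    have a: "?a \<in> carrier A" using cgh e by simp
    have ae: "?a \<otimes>\<^bsub>A\<^esub> ?e = c (g, h)" using cgh e by (simp add: A.m_assoc)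
    have "f (\<one>\<^bsub>A\<^esub>, g) \<otimes>\<^bsub>A\<^esub> f (\<one>\<^bsub>A\<^esub>, h) = f ((\<one>\<^bsub>A\<^esub>, g) \<otimes>\<^bsub>E\<^esub> (\<one>\<^bsub>A\<^esub>, h))"
      using gh by (intro hom_mult[OF f(1), symmetric]) (auto simp: E_simps)
    also have "(\<one>\<^bsub>A\<^esub>, g) \<otimes>\<^bsub>E\<^esub> (\<one>\<^bsub>A\<^esub>, h) = (?a, \<one>\<^bsub>G\<^esub>) \<otimes>\<^bsub>E\<^esub> (\<one>\<^bsub>A\<^esub>, g \<otimes>\<^bsub>G\<^esub> h)"
      using gh a ae cgh by (simp add: E_simps c_one[OF G.m_closed[OF gh]])
    also have "f \<dots> = f (?a, \<one>\<^bsub>G\<^esub>) \<otimes>\<^bsub>A\<^esub> f (\<one>\<^bsub>A\<^esub>, g \<otimes>\<^bsub>G\<^esub> h)"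
      using gh a by (intro hom_mult[OF f(1)]) (auto simp: E_simps)
    also have "f (?a, \<one>\<^bsub>G\<^esub>) = c (g, h)" using f(2) a ae by simp
    finally show "c (g, h) \<otimes>\<^bsub>A\<^esub> f (\<one>\<^bsub>A\<^esub>, g \<otimes>\<^bsub>G\<^esub> h) = f (\<one>\<^bsub>A\<^esub>, g) \<otimes>\<^bsub>A\<^esub> f (\<one>\<^bsub>A\<^esub>, h)" by simp
  qed
qed

end

text \<open>Over a divisible group \<open>D\<close> containing the coefficients, every symmetric cocycle becomes the
  coboundary of some \<open>\<beta>\<close>; it is then determined by the homomorphism \<open>G \<rightarrow> D/A\<close> induced by \<open>\<beta>\<close>.\<close>

locale divisible_coefficients = group_cohomology G A + D: comm_group D
  for G :: "('g, 'a) monoid_scheme" and A :: "('m, 'b) monoid_scheme" and D :: "('d, 'c) monoid_scheme" +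
  fixes \<iota> :: "'m \<Rightarrow> 'd"
  assumes divisible: "divisible_group D" and \<iota>_hom: "\<iota> \<in> hom A D" and \<iota>_inj: "inj_on \<iota> (carrier A)"
begin

abbreviation "N \<equiv> \<iota> ` carrier A"

sublocale \<iota>: group_hom A D \<iota>
  by (simp add: group_hom.intro group_hom_axioms.intro \<iota>_hom)

lemma subgroup_N: "subgroup N D"
  using \<iota>.subgroup_img_is_subgroup[OF A.subgroup_self] .

sublocale N: normal N D
  using subgroup_N by (simp add: D.normal_iff_subgroup)

sublocale DN: comm_group "D Mod N"
  by (rule D.abelian_FactGroup[OF subgroup_N])

definition splits :: "('g \<times> 'g \<Rightarrow> 'm) \<Rightarrow> ('g \<Rightarrow> 'd) \<Rightarrow> bool"
  where "splits c \<beta> \<longleftrightarrow> \<beta> \<in> carrier G \<rightarrow> carrier D \<and>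
    (\<forall>g\<in>carrier G. \<forall>h\<in>carrier G. \<iota> (c (g, h)) \<otimes>\<^bsub>D\<^esub> \<beta> (g \<otimes>\<^bsub>G\<^esub> h) = \<beta> g \<otimes>\<^bsub>D\<^esub> \<beta> h)"

lemma splitsD:
  assumes "splits c \<beta>" "g \<in> carrier G" "h \<in> carrier G"
  shows "\<beta> g \<in> carrier D" "\<iota> (c (g, h)) \<otimes>\<^bsub>D\<^esub> \<beta> (g \<otimes>\<^bsub>G\<^esub> h) = \<beta> g \<otimes>\<^bsub>D\<^esub> \<beta> h"
  using assms unfolding splits_def by auto

lemma ex_splits:
  assumes c: "c \<in> Z2S G A"
  shows "\<exists>\<beta>. splits c \<beta>"
proof -
  interpret GD: group_cohomology G D ..
  let ?c = "\<lambda>u\<in>carrier G \<times> carrier G. \<iota> (c u)"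
  have "?c \<in> Z2S G D"
    unfolding GD.Z2S_iff using Z2S_closed[OF c] Z2S_sym[OF c] Z2S_cocycle[OF c]
    by (auto simp flip: \<iota>.hom_mult)
  then obtain \<beta> where "\<beta> \<in> carrier G \<rightarrow> carrier D"
    "\<And>g h. g \<in> carrier G \<Longrightarrow> h \<in> carrier G \<Longrightarrow> ?c (g, h) \<otimes>\<^bsub>D\<^esub> \<beta> (g \<otimes>\<^bsub>G\<^esub> h) = \<beta> g \<otimes>\<^bsub>D\<^esub> \<beta> h"
    using GD.symmetric_cocycle_splits[OF divisible] by metis
  then show ?thesis unfolding splits_def by (intro exI[of _ \<beta>]) auto
qed

lemma splits_hom:
  assumes c: "c \<in> Z2S G A" and \<beta>: "splits c \<beta>"
  shows "(\<lambda>g. N #>\<^bsub>D\<^esub> \<beta> g) \<in> hom G (D Mod N)"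
proof (rule homI)
  show "N #>\<^bsub>D\<^esub> \<beta> g \<in> carrier (D Mod N)" if "g \<in> carrier G" for g
    using splitsD[OF \<beta>] that by (auto simp: carrier_FactGroup)
  fix g h assume gh: "g \<in> carrier G" "h \<in> carrier G"
  then have "N #>\<^bsub>D\<^esub> (\<beta> g \<otimes>\<^bsub>D\<^esub> \<beta> h) = N #>\<^bsub>D\<^esub> \<beta> (g \<otimes>\<^bsub>G\<^esub> h)"
    using splitsD[OF \<beta>] Z2S_closed[OF c]
    by (intro D.repr_independence[OF _ _ subgroup_N, symmetric]) (auto simp: r_coset_def simp flip: splitsD(2)[OF \<beta>])
  then show "N #>\<^bsub>D\<^esub> \<beta> (g \<otimes>\<^bsub>G\<^esub> h) = (N #>\<^bsub>D\<^esub> \<beta> g) \<otimes>\<^bsub>D Mod N\<^esub> (N #>\<^bsub>D\<^esub> \<beta> h)"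
    using splitsD(1)[OF \<beta>] gh by (simp add: N.rcos_sum)
qed

lemma coset_eqD:
  assumes "x \<in> carrier D" "y \<in> carrier D" "N #>\<^bsub>D\<^esub> x = N #>\<^bsub>D\<^esub> y"
  shows "\<exists>a\<in>carrier A. x = \<iota> a \<otimes>\<^bsub>D\<^esub> y"
  using D.rcos_self[OF assms(1) subgroup_N] assms(3) by (auto simp: r_coset_def)

text \<open>The connecting map from Hom(G, D/A) to classes of cocycles: \<open>d\<close> measures
  how far the lift \<open>\<gamma>\<close> is from being a homomorphism. The cocycle identity and
  symmetry hold after applying \<open>\<iota>\<close>, because \<open>D\<close> is associative and
  commutative, and descend by injectivity.\<close>

lemma cocycle_of_lift:
  assumes \<gamma>: "\<gamma> \<in> carrier G \<rightarrow> carrier D" and hom: "(\<lambda>g. N #>\<^bsub>D\<^esub> \<gamma> g) \<in> hom G (D Mod N)"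
  shows "\<exists>d\<in>Z2S G A. splits d \<gamma>"
proof -
  have \<gamma>_car: "\<gamma> g \<in> carrier D" if "g \<in> carrier G" for g using \<gamma> that by auto
  have "\<exists>a\<in>carrier A. \<gamma> g \<otimes>\<^bsub>D\<^esub> \<gamma> h = \<iota> a \<otimes>\<^bsub>D\<^esub> \<gamma> (g \<otimes>\<^bsub>G\<^esub> h)" if "g \<in> carrier G" "h \<in> carrier G" for g h
    using hom_mult[OF hom that] \<gamma>_car that by (intro coset_eqD) (auto simp: N.rcos_sum)
  then obtain d\<^sub>0 where d\<^sub>0: "\<And>g h. g \<in> carrier G \<Longrightarrow> h \<in> carrier G \<Longrightarrow>
      d\<^sub>0 g h \<in> carrier A \<and> \<gamma> g \<otimes>\<^bsub>D\<^esub> \<gamma> h = \<iota> (d\<^sub>0 g h) \<otimes>\<^bsub>D\<^esub> \<gamma> (g \<otimes>\<^bsub>G\<^esub> h)" by metis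
  define d where "d = (\<lambda>(g, h)\<in>carrier G \<times> carrier G. d\<^sub>0 g h)"
  have d: "d (g, h) \<in> carrier A" "\<iota> (d (g, h)) \<otimes>\<^bsub>D\<^esub> \<gamma> (g \<otimes>\<^bsub>G\<^esub> h) = \<gamma> g \<otimes>\<^bsub>D\<^esub> \<gamma> h"
    if "g \<in> carrier G" "h \<in> carrier G" for g h using d\<^sub>0[OF that] that unfolding d_def by auto
  have "d (g, h) \<otimes>\<^bsub>A\<^esub> d (f, g \<otimes>\<^bsub>G\<^esub> h) = d (f \<otimes>\<^bsub>G\<^esub> g, h) \<otimes>\<^bsub>A\<^esub> d (f, g)"
    if fgh: "f \<in> carrier G" "g \<in> carrier G" "h \<in> carrier G" for f g h
  proof -
    let ?x = "\<gamma> (f \<otimes>\<^bsub>G\<^esub> g \<otimes>\<^bsub>G\<^esub> h)"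
    have car: "\<iota> (d (u, v)) \<in> carrier D" if "u \<in> carrier G" "v \<in> carrier G" for u v using d(1)[OF that] by simp
    have "\<iota> (d (g, h)) \<otimes>\<^bsub>D\<^esub> \<iota> (d (f, g \<otimes>\<^bsub>G\<^esub> h)) \<otimes>\<^bsub>D\<^esub> ?x = \<iota> (d (g, h)) \<otimes>\<^bsub>D\<^esub> (\<gamma> f \<otimes>\<^bsub>D\<^esub> \<gamma> (g \<otimes>\<^bsub>G\<^esub> h))"
      using d(2)[of f "g \<otimes>\<^bsub>G\<^esub> h"] fgh car \<gamma>_car by (simp add: D.m_assoc G.m_assoc)
    also have "\<dots> = \<gamma> f \<otimes>\<^bsub>D\<^esub> (\<iota> (d (g, h)) \<otimes>\<^bsub>D\<^esub> \<gamma> (g \<otimes>\<^bsub>G\<^esub> h))"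
      using fgh car \<gamma>_car by (simp add: D.m_lcomm)
    also have "\<dots> = (\<gamma> f \<otimes>\<^bsub>D\<^esub> \<gamma> g) \<otimes>\<^bsub>D\<^esub> \<gamma> h"
      using d(2)[of g h] fgh \<gamma>_car by (simp add: D.m_assoc)
    also have "\<dots> = \<iota> (d (f, g)) \<otimes>\<^bsub>D\<^esub> (\<gamma> (f \<otimes>\<^bsub>G\<^esub> g) \<otimes>\<^bsub>D\<^esub> \<gamma> h)"
      unfolding d(2)[OF fgh(1,2), symmetric] using fgh car \<gamma>_car by (simp add: D.m_assoc)
    also have "\<dots> = \<iota> (d (f \<otimes>\<^bsub>G\<^esub> g, h)) \<otimes>\<^bsub>D\<^esub> \<iota> (d (f, g)) \<otimes>\<^bsub>D\<^esub> ?x"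
      unfolding d(2)[OF G.m_closed[OF fgh(1,2)] fgh(3), symmetric] using fgh car \<gamma>_car by (simp add: D.m_ac)
    finally have "\<iota> (d (g, h)) \<otimes>\<^bsub>D\<^esub> \<iota> (d (f, g \<otimes>\<^bsub>G\<^esub> h)) = \<iota> (d (f \<otimes>\<^bsub>G\<^esub> g, h)) \<otimes>\<^bsub>D\<^esub> \<iota> (d (f, g))"
      by (rule D.r_cancel) (use fgh car \<gamma>_car in simp_all)
    then have "\<iota> (d (g, h) \<otimes>\<^bsub>A\<^esub> d (f, g \<otimes>\<^bsub>G\<^esub> h)) = \<iota> (d (f \<otimes>\<^bsub>G\<^esub> g, h) \<otimes>\<^bsub>A\<^esub> d (f, g))"
      using d(1) fgh by simp
    then show ?thesis using d(1) fgh by (intro inj_onD[OF \<iota>_inj]) auto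
  qed
  moreover have "d (g, h) = d (h, g)" if "g \<in> carrier G" "h \<in> carrier G" for g h
  proof -
    have "\<iota> (d (g, h)) \<otimes>\<^bsub>D\<^esub> \<gamma> (g \<otimes>\<^bsub>G\<^esub> h) = \<iota> (d (h, g)) \<otimes>\<^bsub>D\<^esub> \<gamma> (g \<otimes>\<^bsub>G\<^esub> h)"
      using d(2)[OF that] d(2)[OF that(2,1)] that \<gamma>_car by (simp add: D.m_comm G.m_comm)
    then have "\<iota> (d (g, h)) = \<iota> (d (h, g))" by (rule D.r_cancel) (use d(1) that \<gamma>_car in simp_all)
    then show ?thesis using d(1) that by (intro inj_onD[OF \<iota>_inj]) auto
  qed
  moreover have "d \<in> carrier G \<times> carrier G \<rightarrow>\<^sub>E carrier A" using d(1) unfolding d_def by (auto simp: PiE_iff)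
  ultimately have "d \<in> Z2S G A" unfolding Z2S_iff by blast
  then show ?thesis using d \<gamma> unfolding splits_def by blast
qed

text \<open>Multiplication by \<open>r\<close> on cohomology is pullback along multiplication by \<open>r\<close> on \<open>G\<close>.\<close>

theorem cocycle_pow_pullback:
  assumes c: "c \<in> Z2S G A"
  obtains \<mu> where "\<mu> \<in> carrier G \<rightarrow> carrier A"
    "\<And>g h. g \<in> carrier G \<Longrightarrow> h \<in> carrier G \<Longrightarrow>
      cocycle_pow c r (g, h) \<otimes>\<^bsub>A\<^esub> \<mu> (g \<otimes>\<^bsub>G\<^esub> h) = c (g [^]\<^bsub>G\<^esub> r, h [^]\<^bsub>G\<^esub> r) \<otimes>\<^bsub>A\<^esub> \<mu> g \<otimes>\<^bsub>A\<^esub> \<mu> h"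
proof -
  obtain \<beta> where \<beta>: "splits c \<beta>" using ex_splits[OF c] by blast
  note \<beta>_car = splitsD(1)[OF \<beta> _ G.one_closed]
  interpret h: group_hom G "D Mod N" "\<lambda>g. N #>\<^bsub>D\<^esub> \<beta> g"
    using splits_hom[OF c \<beta>] by (simp add: group_hom.intro group_hom_axioms.intro DN.is_group G.is_group)
  \<comment> \<open>A homomorphism commutes with powers, so \<open>\<beta> g [^] r\<close> and
    \<open>\<beta> (g [^] r)\<close> agree modulo \<open>N\<close>. The cochain \<open>\<mu>\<close>
    records the factor between them.\<close>
  have "\<exists>a\<in>carrier A. \<beta> g [^]\<^bsub>D\<^esub> r = \<iota> a \<otimes>\<^bsub>D\<^esub> \<beta> (g [^]\<^bsub>G\<^esub> r)" if "g \<in> carrier G" for g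
    using h.hom_int_pow[OF that, of r] \<beta>_car that by (intro coset_eqD) (auto simp: N.FactGroup_int_pow)
  then obtain \<mu> where \<mu>: "\<And>g. g \<in> carrier G \<Longrightarrow> \<mu> g \<in> carrier A \<and> \<beta> g [^]\<^bsub>D\<^esub> r = \<iota> (\<mu> g) \<otimes>\<^bsub>D\<^esub> \<beta> (g [^]\<^bsub>G\<^esub> r)" by metis
  show thesis
  proof
    show "\<mu> \<in> carrier G \<rightarrow> carrier A" using \<mu> by blast
    fix g h assume gh: "g \<in> carrier G" "h \<in> carrier G"
    let ?c = "c (g, h)" and ?c' = "c (g [^]\<^bsub>G\<^esub> r, h [^]\<^bsub>G\<^esub> r)" and ?b = "\<beta> ((g \<otimes>\<^bsub>G\<^esub> h) [^]\<^bsub>G\<^esub> r)"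
    have car: "?c \<in> carrier A" "?c' \<in> carrier A" "\<mu> g \<in> carrier A" "\<mu> h \<in> carrier A" "\<mu> (g \<otimes>\<^bsub>G\<^esub> h) \<in> carrier A"
      "\<beta> g \<in> carrier D" "\<beta> h \<in> carrier D" "?b \<in> carrier D" "\<beta> (g \<otimes>\<^bsub>G\<^esub> h) \<in> carrier D"
      "\<beta> (g [^]\<^bsub>G\<^esub> r) \<in> carrier D" "\<beta> (h [^]\<^bsub>G\<^esub> r) \<in> carrier D"
      using gh Z2S_closed[OF c] \<mu> \<beta>_car by auto
    have "\<iota> (?c [^]\<^bsub>A\<^esub> r \<otimes>\<^bsub>A\<^esub> \<mu> (g \<otimes>\<^bsub>G\<^esub> h)) \<otimes>\<^bsub>D\<^esub> ?b = \<iota> ?c [^]\<^bsub>D\<^esub> r \<otimes>\<^bsub>D\<^esub> \<beta> (g \<otimes>\<^bsub>G\<^esub> h) [^]\<^bsub>D\<^esub> r"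
      using \<mu>[OF G.m_closed[OF gh]] car by (simp add: D.m_assoc \<iota>.hom_int_pow)
    also have "\<dots> = (\<beta> g \<otimes>\<^bsub>D\<^esub> \<beta> h) [^]\<^bsub>D\<^esub> r"
      unfolding splitsD(2)[OF \<beta> gh, symmetric] using car by (simp add: D.int_pow_distrib)
    also have "\<dots> = (\<iota> (\<mu> g) \<otimes>\<^bsub>D\<^esub> \<beta> (g [^]\<^bsub>G\<^esub> r)) \<otimes>\<^bsub>D\<^esub> (\<iota> (\<mu> h) \<otimes>\<^bsub>D\<^esub> \<beta> (h [^]\<^bsub>G\<^esub> r))"
      using \<mu>[OF gh(1)] \<mu>[OF gh(2)] car by (simp add: D.int_pow_distrib)
    also have "\<dots> = \<iota> (\<mu> g) \<otimes>\<^bsub>D\<^esub> \<iota> (\<mu> h) \<otimes>\<^bsub>D\<^esub> (\<beta> (g [^]\<^bsub>G\<^esub> r) \<otimes>\<^bsub>D\<^esub> \<beta> (h [^]\<^bsub>G\<^esub> r))"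
      using car by (simp add: D.m_ac)
    also have "\<beta> (g [^]\<^bsub>G\<^esub> r) \<otimes>\<^bsub>D\<^esub> \<beta> (h [^]\<^bsub>G\<^esub> r) = \<iota> ?c' \<otimes>\<^bsub>D\<^esub> ?b"
      using splitsD(2)[OF \<beta>, of "g [^]\<^bsub>G\<^esub> r" "h [^]\<^bsub>G\<^esub> r"] gh by (simp add: G.int_pow_distrib)
    also have "\<iota> (\<mu> g) \<otimes>\<^bsub>D\<^esub> \<iota> (\<mu> h) \<otimes>\<^bsub>D\<^esub> (\<iota> ?c' \<otimes>\<^bsub>D\<^esub> ?b) = \<iota> (?c' \<otimes>\<^bsub>A\<^esub> \<mu> g \<otimes>\<^bsub>A\<^esub> \<mu> h) \<otimes>\<^bsub>D\<^esub> ?b"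
      using car by (simp add: D.m_ac)
    finally have "\<iota> (?c [^]\<^bsub>A\<^esub> r \<otimes>\<^bsub>A\<^esub> \<mu> (g \<otimes>\<^bsub>G\<^esub> h)) = \<iota> (?c' \<otimes>\<^bsub>A\<^esub> \<mu> g \<otimes>\<^bsub>A\<^esub> \<mu> h)"
      by (rule D.r_cancel) (use car in simp_all)
    then have "?c [^]\<^bsub>A\<^esub> r \<otimes>\<^bsub>A\<^esub> \<mu> (g \<otimes>\<^bsub>G\<^esub> h) = ?c' \<otimes>\<^bsub>A\<^esub> \<mu> g \<otimes>\<^bsub>A\<^esub> \<mu> h"
      using car by (intro inj_onD[OF \<iota>_inj]) auto
    then show "cocycle_pow c r (g, h) \<otimes>\<^bsub>A\<^esub> \<mu> (g \<otimes>\<^bsub>G\<^esub> h) = ?c' \<otimes>\<^bsub>A\<^esub> \<mu> g \<otimes>\<^bsub>A\<^esub> \<mu> h"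
      unfolding cocycle_pow_def using gh by simp
  qed
qed

text \<open>Equality of cocycles, not merely of classes, is obtained. This allows the trivial
  correcting cochain in the construction of the root of a graded field.\<close>

theorem ex_pullback_root:
  assumes tf: "torsion_free G" and r: "(r::int) \<noteq> 0" and c: "c \<in> Z2S G A"
  obtains d where "d \<in> Z2S G A"
    "\<And>g h. g \<in> carrier G \<Longrightarrow> h \<in> carrier G \<Longrightarrow> d (g [^]\<^bsub>G\<^esub> r, h [^]\<^bsub>G\<^esub> r) = c (g, h)"
proof -
  obtain \<beta> where \<beta>: "splits c \<beta>" using ex_splits[OF c] by blast
  note \<beta>_car = splitsD(1)[OF \<beta> _ G.one_closed]
  let ?p = "\<lambda>g. g [^]\<^bsub>G\<^esub> r"
  let ?R = "?p ` carrier G"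
  have inj: "inj_on ?p (carrier G)" using G.torsion_free_cancel_int_pow[OF tf] r by (auto simp: inj_on_def)
  have p_hom: "?p \<in> hom G G" by (rule homI) (auto simp: G.int_pow_distrib)
  then interpret p: group_hom G G ?p by (simp add: group_hom.intro group_hom_axioms.intro G.is_group)
  have R: "subgroup ?R G" using p.subgroup_img_is_subgroup[OF G.subgroup_self] .
  define root where "root = inv_into (carrier G) ?p"
  have root: "root (?p g) = g" if "g \<in> carrier G" for g
    unfolding root_def using inv_into_f_f[OF inj that] .
  have "(\<lambda>x. N #>\<^bsub>D\<^esub> \<beta> (root x)) \<in> hom (G\<lparr>carrier := ?R\<rparr>) (D Mod N)"
  proof (rule homI)
    fix x assume "x \<in> carrier (G\<lparr>carrier := ?R\<rparr>)"
    then show "N #>\<^bsub>D\<^esub> \<beta> (root x) \<in> carrier (D Mod N)" using root \<beta>_car by (auto simp: carrier_FactGroup)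
  next
    fix x y assume "x \<in> carrier (G\<lparr>carrier := ?R\<rparr>)" "y \<in> carrier (G\<lparr>carrier := ?R\<rparr>)"
    then obtain g h where gh: "g \<in> carrier G" "h \<in> carrier G" "x = ?p g" "y = ?p h" by auto
    then have "root (x \<otimes>\<^bsub>G\<^esub> y) = g \<otimes>\<^bsub>G\<^esub> h" using root[of "g \<otimes>\<^bsub>G\<^esub> h"] by (simp add: G.int_pow_distrib)
    then show "N #>\<^bsub>D\<^esub> \<beta> (root (x \<otimes>\<^bsub>G\<lparr>carrier := ?R\<rparr>\<^esub> y)) = (N #>\<^bsub>D\<^esub> \<beta> (root x)) \<otimes>\<^bsub>D Mod N\<^esub> (N #>\<^bsub>D\<^esub> \<beta> (root y))"
      using hom_mult[OF splits_hom[OF c \<beta>] gh(1,2)] gh root by simp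
  qed
  then obtain f where f: "f \<in> hom G (D Mod N)" "\<And>x. x \<in> ?R \<Longrightarrow> f x = N #>\<^bsub>D\<^esub> \<beta> (root x)"
    using extend_hom_to_divisible[OF G.comm_group_axioms DN.comm_group_axioms D.divisible_Mod[OF divisible subgroup_N] R] by metis
  have "\<exists>x\<in>carrier D. f g = N #>\<^bsub>D\<^esub> x" if "g \<in> carrier G" for g
    using hom_in_carrier[OF f(1) that] by (auto simp: carrier_FactGroup)
  then obtain lift where lift: "\<And>g. g \<in> carrier G \<Longrightarrow> lift g \<in> carrier D \<and> f g = N #>\<^bsub>D\<^esub> lift g" by metis
  \<comment> \<open>On \<open>?R\<close> the lift is prescribed to be \<open>\<beta>\<close> itself
    and not just some element of its coset; hence the pullback of \<open>d\<close> is exactly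
    \<open>c\<close>.\<close>
  define \<gamma> where "\<gamma> g = (if g \<in> ?R then \<beta> (root g) else lift g)" for g
  have f\<gamma>: "f g = N #>\<^bsub>D\<^esub> \<gamma> g" if "g \<in> carrier G" for g using f(2) lift[OF that] unfolding \<gamma>_def by auto
  have "\<gamma> \<in> carrier G \<rightarrow> carrier D" using lift \<beta>_car root unfolding \<gamma>_def by auto
  moreover have "(\<lambda>g. N #>\<^bsub>D\<^esub> \<gamma> g) \<in> hom G (D Mod N)"
    using f(1) f\<gamma> by (simp add: hom_def Pi_iff)
  ultimately obtain d where d: "d \<in> Z2S G A" "splits d \<gamma>" using cocycle_of_lift by blast
  have "d (?p g, ?p h) = c (g, h)" if gh: "g \<in> carrier G" "h \<in> carrier G" for g h
  proof -
    have \<gamma>: "\<gamma> (?p g) = \<beta> g" if "g \<in> carrier G" for g using that root unfolding \<gamma>_def by auto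
    have "\<iota> (d (?p g, ?p h)) \<otimes>\<^bsub>D\<^esub> \<gamma> (?p g \<otimes>\<^bsub>G\<^esub> ?p h) = \<gamma> (?p g) \<otimes>\<^bsub>D\<^esub> \<gamma> (?p h)"
      using splitsD(2)[OF d(2)] gh by simp
    then have "\<iota> (d (?p g, ?p h)) \<otimes>\<^bsub>D\<^esub> \<beta> (g \<otimes>\<^bsub>G\<^esub> h) = \<iota> (c (g, h)) \<otimes>\<^bsub>D\<^esub> \<beta> (g \<otimes>\<^bsub>G\<^esub> h)"
      using \<gamma>[OF G.m_closed[OF gh]] gh \<gamma> splitsD(2)[OF \<beta> gh] by (simp add: G.int_pow_distrib)
    then have "\<iota> (d (?p g, ?p h)) = \<iota> (c (g, h))"
      by (rule D.r_cancel) (use Z2S_closed[OF c] Z2S_closed[OF d(1)] \<beta>_car gh in simp_all)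
    then show ?thesis using Z2S_closed[OF c] Z2S_closed[OF d(1)] gh by (intro inj_onD[OF \<iota>_inj]) auto
  qed
  then show thesis using d(1) that by blast
qed

text \<open>A cocycle whose pullback along \<open>n\<close> is \<open>c\<close> is an
  \<open>n\<close>-th root of the class of \<open>c\<close>, since raising a class to the power
  \<open>n\<close> amounts to this pullback.\<close>

corollary H2S_divisible:
  assumes tf: "torsion_free G"
  shows "divisible_group (H2S G A)"
  unfolding divisible_group_def
proof (intro allI impI ballI)
  fix n :: nat and x assume "n > 0" "x \<in> carrier (H2S G A)"
  then obtain c where c: "c \<in> Z2S G A" "x = coclass c" by (auto simp: carrier_H2S)
  obtain d where d: "d \<in> Z2S G A"
    "\<And>g h. g \<in> carrier G \<Longrightarrow> h \<in> carrier G \<Longrightarrow> d (g [^]\<^bsub>G\<^esub> int n, h [^]\<^bsub>G\<^esub> int n) = c (g, h)"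
    using ex_pullback_root[OF tf _ c(1), of "int n"] \<open>n > 0\<close> by auto
  obtain \<mu> where "\<mu> \<in> carrier G \<rightarrow> carrier A"
    "\<And>g h. g \<in> carrier G \<Longrightarrow> h \<in> carrier G \<Longrightarrow>
      cocycle_pow d (int n) (g, h) \<otimes>\<^bsub>A\<^esub> \<mu> (g \<otimes>\<^bsub>G\<^esub> h) = d (g [^]\<^bsub>G\<^esub> int n, h [^]\<^bsub>G\<^esub> int n) \<otimes>\<^bsub>A\<^esub> \<mu> g \<otimes>\<^bsub>A\<^esub> \<mu> h"
    using cocycle_pow_pullback[OF d(1)] by blast
  then have "cohomologous (cocycle_pow d (int n)) c" unfolding cohomologous_def using d(2) by auto
  then have "coclass (cocycle_pow d (int n)) = coclass c"
    using coclass_eq_iff[OF cocycle_pow_closed[OF d(1)] c(1)] by blast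
  then have "x = coclass d [^]\<^bsub>H2S G A\<^esub> int n"
    unfolding c(2) H2S_int_pow[OF d(1)] by (rule sym)
  then show "divisible_by (H2S G A) n x"
    unfolding divisible_by_def carrier_H2S using d(1) by (auto simp only: int_pow_int)
qed

end

section \<open>The divisible group of units of an algebraic closure\<close>

lemma (in algebraically_closed) ex_nth_root:
  fixes n :: nat
  assumes x: "x \<in> carrier L" and n: "n > 0"
  shows "\<exists>y\<in>carrier L. y [^] n = x"
proof -
  obtain k where k: "n = Suc k" using n by (cases n) auto
  \<comment> \<open>The polynomial \<open>X^n - x\<close>, with coefficients listed from the leading
    one downwards; between the two outer coefficients there are \<open>k = n - 1\<close>
    zeros.\<close>
  define p where "p = \<one> # replicate k \<zero> @ [\<ominus> x]"
  have tail: "eval (replicate k \<zero> @ [\<ominus> x]) y = \<ominus> x" if "y \<in> carrier L" for y k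
    using that x by (induction k) auto
  have "p \<in> carrier (poly_ring L)"
    using x by (auto simp: p_def univ_poly_def polynomial_def)
  then have "splitted p" by (rule roots_over_carrier)
  moreover have "Polynomials.degree p = n" by (simp add: p_def k)
  ultimately have "roots p \<noteq> {#}" using n unfolding splitted_def by auto
  then obtain y where "y \<in># roots p" by blast
  then have "is_root p y" using roots_mem_iff_is_root[OF \<open>p \<in> carrier (poly_ring L)\<close>] by simp
  then have y: "y \<in> carrier L" "eval p y = \<zero>" by (auto simp: is_root_def)
  then have "y [^] n \<oplus> \<ominus> x = \<zero>" using tail[OF y(1), of k] by (simp add: p_def k)
  then have "y [^] n = x" using x y(1) by (metis minus_equality minus_minus a_inv_closed nat_pow_closed)
  then show ?thesis using y(1) by blast
qed

text \<open>Roots of units are again units because a power of zero with positive exponent is zero.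
  The element type of \<open>D\<close> is that of \<open>alg_closure\<close>; it is named in the
  statement since HOL does not quantify over types.\<close>

theorem (in field) ex_divisible_hull_of_units:
  obtains D :: "(('a list \<times> nat) multiset \<Rightarrow> 'a) monoid" and \<iota>
  where "comm_group D" "divisible_group D" "\<iota> \<in> hom (units_of R) D" "inj_on \<iota> (carrier (units_of R))"
proof -
  interpret L: algebraic_closure alg_closure "indexed_const ` carrier R" by (rule alg_closureE(1))
  let ?L = alg_closure
  interpret \<iota>: ring_hom_ring R ?L indexed_const
    by (rule ring_hom_ringI2[OF ring_axioms L.ring_axioms alg_closureE(2)])
  have inj: "inj_on indexed_const (carrier R)"
    by (rule indexed_const_inj_on)
  show thesis
  proof
    show "comm_group (units_of ?L)" by (rule L.units_comm_group)
    show "divisible_group (units_of ?L)"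
      unfolding divisible_group_def
    proof (intro allI impI ballI)
      fix n :: nat and x assume n: "n > 0" and "x \<in> carrier (units_of ?L)"
      then have x: "x \<in> carrier ?L" "x \<noteq> \<zero>\<^bsub>?L\<^esub>" by (auto simp: units_of_def L.field_Units)
      have "\<exists>y\<in>carrier ?L. y [^]\<^bsub>?L\<^esub> n = x" using L.ex_nth_root[OF x(1) n] .
      then obtain y where y: "y \<in> carrier ?L" "y [^]\<^bsub>?L\<^esub> n = x" by blast
      then have "y \<noteq> \<zero>\<^bsub>?L\<^esub>" using x(2) n by (auto simp: L.nat_pow_zero)
      then show "divisible_by (units_of ?L) n x"
        unfolding divisible_by_def using y
        by (intro bexI[of _ y]) (simp_all add: L.units_of_pow units_of_carrier L.field_Units)
    qed
    show "indexed_const \<in> hom (units_of R) (units_of ?L)"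
    proof (rule homI)
      fix x assume x: "x \<in> carrier (units_of R)"
      then have "x \<in> carrier R" "x \<noteq> \<zero>" by (auto simp: units_of_def field_Units)
      then have "indexed_const x \<noteq> \<zero>\<^bsub>?L\<^esub>" using inj \<iota>.hom_zero by (metis inj_onD zero_closed)
      then show "indexed_const x \<in> carrier (units_of ?L)"
        using \<open>x \<in> carrier R\<close> by (simp add: units_of_def L.field_Units)
    qed (auto simp: units_of_def Units_closed)
    show "inj_on indexed_const (carrier (units_of R))"
      using inj by (rule inj_on_subset) (auto simp: units_of_def)
  qed
qed

section \<open>Twisted group algebras\<close>

lemma (in abelian_monoid) finsum_swap:
  assumes "finite A" "finite B" "\<And>x y. x \<in> A \<Longrightarrow> y \<in> B \<Longrightarrow> f x y \<in> carrier G"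
  shows "(\<Oplus>x\<in>A. \<Oplus>y\<in>B. f x y) = (\<Oplus>y\<in>B. \<Oplus>x\<in>A. f x y)"
  using assms
proof (induction A)
  case empty
  then show ?case by (simp add: finsum_zero)
next
  case (insert x A)
  have "(\<Oplus>x\<in>insert x A. \<Oplus>y\<in>B. f x y) = (\<Oplus>y\<in>B. f x y) \<oplus> (\<Oplus>x\<in>A. \<Oplus>y\<in>B. f x y)"
    using insert by (intro finsum_insert) (auto intro!: finsum_closed)
  also have "\<dots> = (\<Oplus>y\<in>B. f x y) \<oplus> (\<Oplus>y\<in>B. \<Oplus>x\<in>A. f x y)" using insert by simp
  also have "\<dots> = (\<Oplus>y\<in>B. f x y \<oplus> (\<Oplus>x\<in>A. f x y))"
    using insert.prems by (intro finsum_addf[symmetric]) (auto intro!: finsum_closed)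
  also have "\<dots> = (\<Oplus>y\<in>B. \<Oplus>x\<in>insert x A. f x y)"
    using insert by (intro finsum_cong') (auto intro!: finsum_closed finsum_insert[symmetric])
  finally show ?case .
qed

locale twisted_algebra = G: comm_group G + K: field K
  for G :: "('g, 'a) monoid_scheme" and K :: "('k, 'b) ring_scheme" +
  fixes c :: "'g \<times> 'g \<Rightarrow> 'k"
  assumes cocycle: "c \<in> Z2S G (units_of K)"
begin

sublocale cohomology: group_cohomology G "units_of K"
  by (intro group_cohomology.intro G.comm_group_axioms K.units_comm_group)

abbreviation F where "F \<equiv> twisted_group_algebra G K c"

definition supp where "supp a = {g \<in> carrier G. a g \<noteq> \<zero>\<^bsub>K\<^esub>}"

lemma c_Units: "g \<in> carrier G \<Longrightarrow> h \<in> carrier G \<Longrightarrow> c (g, h) \<in> Units K"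
  using cohomology.Z2S_closed[OF cocycle, of g h] by (simp add: units_of_def)

lemma c_closed: "g \<in> carrier G \<Longrightarrow> h \<in> carrier G \<Longrightarrow> c (g, h) \<in> carrier K"
  using c_Units K.Units_closed by blast

lemma c_sym: "g \<in> carrier G \<Longrightarrow> h \<in> carrier G \<Longrightarrow> c (g, h) = c (h, g)"
  by (rule cohomology.Z2S_sym[OF cocycle])

lemma c_cocycle: "f \<in> carrier G \<Longrightarrow> g \<in> carrier G \<Longrightarrow> h \<in> carrier G \<Longrightarrow>
    c (g, h) \<otimes>\<^bsub>K\<^esub> c (f, g \<otimes>\<^bsub>G\<^esub> h) = c (f \<otimes>\<^bsub>G\<^esub> g, h) \<otimes>\<^bsub>K\<^esub> c (f, g)"
  using cohomology.Z2S_cocycle[OF cocycle, of f g h] by (simp add: units_of_def)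

lemma c_one: "g \<in> carrier G \<Longrightarrow> c (\<one>\<^bsub>G\<^esub>, g) = c (\<one>\<^bsub>G\<^esub>, \<one>\<^bsub>G\<^esub>)"
  by (rule cohomology.Z2S_one_left[OF cocycle])

lemma carrier_F: "a \<in> carrier F \<longleftrightarrow> a \<in> carrier G \<rightarrow>\<^sub>E carrier K \<and> finite (supp a)"
  by (simp add: twisted_group_algebra_def twisted_carrier_def supp_def)

lemma F_closed [simp]: "a \<in> carrier F \<Longrightarrow> g \<in> carrier G \<Longrightarrow> a g \<in> carrier K"
  by (auto simp: carrier_F)

lemma F_eqI:
  assumes "a \<in> carrier F" "b \<in> carrier F" "\<And>g. g \<in> carrier G \<Longrightarrow> a g = b g"
  shows "a = b"
  using assms by (intro PiE_ext[of a "carrier G" "\<lambda>_. carrier K" b]) (auto simp: carrier_F)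

lemma supp_subset: "supp a \<subseteq> carrier G" by (auto simp: supp_def)

lemma finite_supp: "a \<in> carrier F \<Longrightarrow> finite (supp a)" by (simp add: carrier_F)

lemma notin_supp: "g \<in> carrier G \<Longrightarrow> g \<notin> supp a \<Longrightarrow> a g = \<zero>\<^bsub>K\<^esub>" by (simp add: supp_def)

lemma F_I:
  assumes "\<And>g. g \<in> carrier G \<Longrightarrow> f g \<in> carrier K" "finite U" "\<And>g. g \<in> carrier G \<Longrightarrow> g \<notin> U \<Longrightarrow> f g = \<zero>\<^bsub>K\<^esub>"
  shows "(\<lambda>g\<in>carrier G. f g) \<in> carrier F"
proof -
  have "supp (\<lambda>g\<in>carrier G. f g) \<subseteq> U" using assms(3) by (auto simp: supp_def)
  then show ?thesis using assms finite_subset by (auto simp: carrier_F)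
qed

lemma add_F: "a \<oplus>\<^bsub>F\<^esub> b = (\<lambda>g\<in>carrier G. a g \<oplus>\<^bsub>K\<^esub> b g)"
  and zero_F: "\<zero>\<^bsub>F\<^esub> = (\<lambda>g\<in>carrier G. \<zero>\<^bsub>K\<^esub>)"
  and smult_F: "s \<odot>\<^bsub>F\<^esub> a = (\<lambda>g\<in>carrier G. s \<otimes>\<^bsub>K\<^esub> a g)"
  and one_F: "\<one>\<^bsub>F\<^esub> = (\<lambda>g\<in>carrier G. if g = \<one>\<^bsub>G\<^esub> then inv\<^bsub>K\<^esub> c (\<one>\<^bsub>G\<^esub>, \<one>\<^bsub>G\<^esub>) else \<zero>\<^bsub>K\<^esub>)"
  by (simp_all add: twisted_group_algebra_def)

lemma mult_F_pairs:
  assumes "f \<in> carrier G"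
  shows "(a \<otimes>\<^bsub>F\<^esub> b) f = (\<Oplus>\<^bsub>K\<^esub>u \<in> {u \<in> carrier G \<times> carrier G.
      a (fst u) \<noteq> \<zero>\<^bsub>K\<^esub> \<and> b (snd u) \<noteq> \<zero>\<^bsub>K\<^esub> \<and> fst u \<otimes>\<^bsub>G\<^esub> snd u = f}. c u \<otimes>\<^bsub>K\<^esub> (a (fst u) \<otimes>\<^bsub>K\<^esub> b (snd u)))"
  using assms by (simp add: twisted_group_algebra_def)

text \<open>The defining sum over pairs is reindexed by its first entry, which determines the
  second. The freedom in choosing \<open>U\<close> allows sums for different arguments to run over
  the same index set.\<close>

lemma mult_F:
  assumes a: "a \<in> carrier F" and b: "b \<in> carrier F" and f: "f \<in> carrier G"
    and U: "finite U" "U \<subseteq> carrier G" "supp a \<subseteq> U"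
  shows "(a \<otimes>\<^bsub>F\<^esub> b) f = (\<Oplus>\<^bsub>K\<^esub>x\<in>U. c (x, inv\<^bsub>G\<^esub> x \<otimes>\<^bsub>G\<^esub> f) \<otimes>\<^bsub>K\<^esub> (a x \<otimes>\<^bsub>K\<^esub> b (inv\<^bsub>G\<^esub> x \<otimes>\<^bsub>G\<^esub> f)))"
proof -
  let ?h = "\<lambda>x. (x, inv\<^bsub>G\<^esub> x \<otimes>\<^bsub>G\<^esub> f)"
  let ?U = "{x \<in> U. a x \<noteq> \<zero>\<^bsub>K\<^esub> \<and> b (inv\<^bsub>G\<^esub> x \<otimes>\<^bsub>G\<^esub> f) \<noteq> \<zero>\<^bsub>K\<^esub>}"
  let ?P = "{u \<in> carrier G \<times> carrier G. a (fst u) \<noteq> \<zero>\<^bsub>K\<^esub> \<and> b (snd u) \<noteq> \<zero>\<^bsub>K\<^esub> \<and> fst u \<otimes>\<^bsub>G\<^esub> snd u = f}"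
  have "?P = ?h ` ?U"
  proof
    show "?h ` ?U \<subseteq> ?P" using U f by (auto simp: G.m_assoc[symmetric])
    show "?P \<subseteq> ?h ` ?U"
    proof
      fix u assume u: "u \<in> ?P"
      then obtain x y where xy: "u = (x, y)" "x \<in> carrier G" "y \<in> carrier G" "a x \<noteq> \<zero>\<^bsub>K\<^esub>" "b y \<noteq> \<zero>\<^bsub>K\<^esub>" "x \<otimes>\<^bsub>G\<^esub> y = f" by auto
      then have "y = inv\<^bsub>G\<^esub> x \<otimes>\<^bsub>G\<^esub> f" using G.inv_solve_left by blast
      moreover have "x \<in> U" using xy U by (auto simp: supp_def)
      ultimately show "u \<in> ?h ` ?U" using xy by auto
    qed
  qed
  then have "(a \<otimes>\<^bsub>F\<^esub> b) f = (\<Oplus>\<^bsub>K\<^esub>u\<in>?h ` ?U. c u \<otimes>\<^bsub>K\<^esub> (a (fst u) \<otimes>\<^bsub>K\<^esub> b (snd u)))"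
    unfolding mult_F_pairs[OF f] by simp
  also have "\<dots> = (\<Oplus>\<^bsub>K\<^esub>x\<in>?U. c (?h x) \<otimes>\<^bsub>K\<^esub> (a (fst (?h x)) \<otimes>\<^bsub>K\<^esub> b (snd (?h x))))"
    using U f a b c_closed by (intro K.finsum_reindex) (auto simp: inj_on_def subset_iff)
  also have "\<dots> = (\<Oplus>\<^bsub>K\<^esub>x\<in>U. c (x, inv\<^bsub>G\<^esub> x \<otimes>\<^bsub>G\<^esub> f) \<otimes>\<^bsub>K\<^esub> (a x \<otimes>\<^bsub>K\<^esub> b (inv\<^bsub>G\<^esub> x \<otimes>\<^bsub>G\<^esub> f)))"
    using U f a b c_closed by (intro K.add.finprod_mono_neutral_cong_left) (auto simp: subset_iff)
  finally show ?thesis .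
qed

lemma add_F_closed: "a \<in> carrier F \<Longrightarrow> b \<in> carrier F \<Longrightarrow> a \<oplus>\<^bsub>F\<^esub> b \<in> carrier F"
  unfolding add_F by (rule F_I[where U = "supp a \<union> supp b"]) (auto simp: finite_supp notin_supp)

lemma smult_F_closed: "s \<in> carrier K \<Longrightarrow> a \<in> carrier F \<Longrightarrow> s \<odot>\<^bsub>F\<^esub> a \<in> carrier F"
  unfolding smult_F by (rule F_I[where U = "supp a"]) (auto simp: finite_supp notin_supp)

lemma zero_F_closed: "\<zero>\<^bsub>F\<^esub> \<in> carrier F"
  unfolding zero_F by (rule F_I[where U = "{}"]) auto

lemma one_F_closed: "\<one>\<^bsub>F\<^esub> \<in> carrier F"
  unfolding one_F using c_Units by (intro F_I[where U = "{\<one>\<^bsub>G\<^esub>}"]) auto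

lemma mult_F_summand:
  assumes "a \<in> carrier F" "b \<in> carrier F" "x \<in> carrier G" "f \<in> carrier G"
  shows "c (x, inv\<^bsub>G\<^esub> x \<otimes>\<^bsub>G\<^esub> f) \<otimes>\<^bsub>K\<^esub> (a x \<otimes>\<^bsub>K\<^esub> b (inv\<^bsub>G\<^esub> x \<otimes>\<^bsub>G\<^esub> f)) \<in> carrier K"
  using assms c_closed by simp

lemma mult_F_notin:
  assumes a: "a \<in> carrier F" and b: "b \<in> carrier F" and f: "f \<in> carrier G"
    "f \<notin> (\<lambda>(x, y). x \<otimes>\<^bsub>G\<^esub> y) ` (supp a \<times> supp b)"
  shows "(a \<otimes>\<^bsub>F\<^esub> b) f = \<zero>\<^bsub>K\<^esub>"
  unfolding mult_F[OF a b f(1) finite_supp[OF a] supp_subset order_refl]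
proof (rule K.add.finprod_one_eqI)
  fix x assume x: "x \<in> supp a"
  then have xG: "x \<in> carrier G" using supp_subset by blast
  have "x \<otimes>\<^bsub>G\<^esub> (inv\<^bsub>G\<^esub> x \<otimes>\<^bsub>G\<^esub> f) = f" using xG f(1) by (simp flip: G.m_assoc)
  then have "inv\<^bsub>G\<^esub> x \<otimes>\<^bsub>G\<^esub> f \<notin> supp b" using f(2) x by force
  then have "b (inv\<^bsub>G\<^esub> x \<otimes>\<^bsub>G\<^esub> f) = \<zero>\<^bsub>K\<^esub>" using xG f(1) by (simp add: notin_supp)
  then show "c (x, inv\<^bsub>G\<^esub> x \<otimes>\<^bsub>G\<^esub> f) \<otimes>\<^bsub>K\<^esub> (a x \<otimes>\<^bsub>K\<^esub> b (inv\<^bsub>G\<^esub> x \<otimes>\<^bsub>G\<^esub> f)) = \<zero>\<^bsub>K\<^esub>"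
    using a xG f(1) c_closed by simp
qed

lemma mult_F_closed:
  assumes a: "a \<in> carrier F" and b: "b \<in> carrier F"
  shows "a \<otimes>\<^bsub>F\<^esub> b \<in> carrier F"
proof -
  have "a \<otimes>\<^bsub>F\<^esub> b = (\<lambda>f\<in>carrier G. (a \<otimes>\<^bsub>F\<^esub> b) f)"
    by (simp add: twisted_group_algebra_def restrict_def fun_eq_iff)
  also have "\<dots> \<in> carrier F"
  proof (rule F_I[where U = "(\<lambda>(x, y). x \<otimes>\<^bsub>G\<^esub> y) ` (supp a \<times> supp b)"])
    show "(a \<otimes>\<^bsub>F\<^esub> b) f \<in> carrier K" if "f \<in> carrier G" for f
      unfolding mult_F[OF a b that finite_supp[OF a] supp_subset order_refl]
      using that supp_subset mult_F_summand[OF a b] by (intro K.finsum_closed) blast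
  qed (use finite_supp a b mult_F_notin in auto)
  finally show ?thesis .
qed

lemma mult_F_comm:
  assumes a: "a \<in> carrier F" and b: "b \<in> carrier F"
  shows "a \<otimes>\<^bsub>F\<^esub> b = b \<otimes>\<^bsub>F\<^esub> a"
proof (rule F_eqI[OF mult_F_closed[OF a b] mult_F_closed[OF b a]])
  fix f assume f: "f \<in> carrier G"
  let ?P = "\<lambda>a b. {u \<in> carrier G \<times> carrier G. a (fst u) \<noteq> \<zero>\<^bsub>K\<^esub> \<and> b (snd u) \<noteq> \<zero>\<^bsub>K\<^esub> \<and> fst u \<otimes>\<^bsub>G\<^esub> snd u = f}"
  have "?P b a = prod.swap ` ?P a b" by (auto simp: G.m_comm image_iff)
  then have "(b \<otimes>\<^bsub>F\<^esub> a) f = (\<Oplus>\<^bsub>K\<^esub>u\<in>prod.swap ` ?P a b. c u \<otimes>\<^bsub>K\<^esub> (b (fst u) \<otimes>\<^bsub>K\<^esub> a (snd u)))"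
    unfolding mult_F_pairs[OF f] by simp
  also have "\<dots> = (\<Oplus>\<^bsub>K\<^esub>u\<in>?P a b. c (prod.swap u) \<otimes>\<^bsub>K\<^esub> (b (fst (prod.swap u)) \<otimes>\<^bsub>K\<^esub> a (snd (prod.swap u))))"
    using a b c_closed by (intro K.finsum_reindex) (auto simp: inj_on_def)
  also have "\<dots> = (a \<otimes>\<^bsub>F\<^esub> b) f"
    unfolding mult_F_pairs[OF f] using a b c_closed c_sym by (intro K.finsum_cong') (auto simp: K.m_comm)
  finally show "(a \<otimes>\<^bsub>F\<^esub> b) f = (b \<otimes>\<^bsub>F\<^esub> a) f" by simp
qed

text \<open>With \<open>w\<close> the product of the first two degrees, both sides become double
  sums over \<open>x\<close> in \<open>supp a\<close> and \<open>w\<close> in \<open>W\<close>. The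
  summands agree by the cocycle identity at the three degrees \<open>x\<close>,
  \<open>?i x w\<close>, \<open>?i w f\<close>, whose product is \<open>f\<close>.\<close>

lemma mult_F_assoc:
  assumes a: "a \<in> carrier F" and b: "b \<in> carrier F" and d: "d \<in> carrier F"
  shows "a \<otimes>\<^bsub>F\<^esub> b \<otimes>\<^bsub>F\<^esub> d = a \<otimes>\<^bsub>F\<^esub> (b \<otimes>\<^bsub>F\<^esub> d)"
proof (rule F_eqI)
  fix f assume f: "f \<in> carrier G"
  define W where "W = (\<lambda>(x, y). x \<otimes>\<^bsub>G\<^esub> y) ` (supp a \<times> supp b)"
  have W: "finite W" "W \<subseteq> carrier G" "supp (a \<otimes>\<^bsub>F\<^esub> b) \<subseteq> W"
    using finite_supp[OF a] finite_supp[OF b] supp_subset[of a] supp_subset[of b] mult_F_notin[OF a b]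
    unfolding W_def by (auto simp: supp_def[of "a \<otimes>\<^bsub>F\<^esub> b"])
  let ?i = "\<lambda>x y. inv\<^bsub>G\<^esub> x \<otimes>\<^bsub>G\<^esub> y"
  let ?t = "\<lambda>w x. c (x, ?i x f) \<otimes>\<^bsub>K\<^esub> (a x \<otimes>\<^bsub>K\<^esub> (c (?i x w, ?i w f) \<otimes>\<^bsub>K\<^esub> (b (?i x w) \<otimes>\<^bsub>K\<^esub> d (?i w f))))"
  have A: "supp a \<subseteq> carrier G" "finite (supp a)" using supp_subset finite_supp a by auto
  have B: "supp b \<subseteq> carrier G" "finite (supp b)" using supp_subset finite_supp b by auto
  have t: "?t w x \<in> carrier K" if "w \<in> carrier G" "x \<in> carrier G" for w x
    using that f a b d c_closed by simp
  have tW: "?t w x \<in> carrier K" if "w \<in> W" "x \<in> supp a" for w x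
    using t that W(2) A(1) by blast
  have "(a \<otimes>\<^bsub>F\<^esub> b \<otimes>\<^bsub>F\<^esub> d) f = (\<Oplus>\<^bsub>K\<^esub>w\<in>W. c (w, ?i w f) \<otimes>\<^bsub>K\<^esub> ((a \<otimes>\<^bsub>F\<^esub> b) w \<otimes>\<^bsub>K\<^esub> d (?i w f)))"
    by (rule mult_F[OF mult_F_closed[OF a b] d f W])
  also have "\<dots> = (\<Oplus>\<^bsub>K\<^esub>w\<in>W. \<Oplus>\<^bsub>K\<^esub>x\<in>supp a. ?t w x)"
  proof (rule K.finsum_cong')
    fix w assume "w \<in> W"
    then have w: "w \<in> carrier G" using W by blast
    let ?s = "\<lambda>x. c (x, ?i x w) \<otimes>\<^bsub>K\<^esub> (a x \<otimes>\<^bsub>K\<^esub> b (?i x w))"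
    have s: "?s x \<in> carrier K" if "x \<in> supp a" for x using mult_F_summand[OF a b _ w] that A by blast
    have "(a \<otimes>\<^bsub>F\<^esub> b) w = (\<Oplus>\<^bsub>K\<^esub>x\<in>supp a. ?s x)" by (rule mult_F[OF a b w A(2,1) order_refl])
    then have "c (w, ?i w f) \<otimes>\<^bsub>K\<^esub> ((a \<otimes>\<^bsub>F\<^esub> b) w \<otimes>\<^bsub>K\<^esub> d (?i w f))
        = (\<Oplus>\<^bsub>K\<^esub>x\<in>supp a. c (w, ?i w f) \<otimes>\<^bsub>K\<^esub> (?s x \<otimes>\<^bsub>K\<^esub> d (?i w f)))"
      using s w f d c_closed A by (simp add: K.finsum_ldistr K.finsum_rdistr Pi_def)
    also have "\<dots> = (\<Oplus>\<^bsub>K\<^esub>x\<in>supp a. ?t w x)"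
    proof (rule K.finsum_cong')
      fix x assume "x \<in> supp a"
      then have x: "x \<in> carrier G" using A by blast
      have cancel: "u \<otimes>\<^bsub>G\<^esub> ?i u v = v" if "u \<in> carrier G" "v \<in> carrier G" for u v
        using that by (simp flip: G.m_assoc)
      have i: "x \<otimes>\<^bsub>G\<^esub> ?i x w = w" "?i x w \<otimes>\<^bsub>G\<^esub> ?i w f = ?i x f"
        using x w f by (simp_all add: cancel G.m_assoc)
      have cc: "c (?i x w, ?i w f) \<otimes>\<^bsub>K\<^esub> c (x, ?i x f) = c (w, ?i w f) \<otimes>\<^bsub>K\<^esub> c (x, ?i x w)"
        using c_cocycle[of x "?i x w" "?i w f"] x w f i by simp
      have car: "c (w, ?i w f) \<in> carrier K" "c (x, ?i x w) \<in> carrier K" "c (?i x w, ?i w f) \<in> carrier K" "c (x, ?i x f) \<in> carrier K"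
        "a x \<in> carrier K" "b (?i x w) \<in> carrier K" "d (?i w f) \<in> carrier K"
        using x w f a b d c_closed by auto
      have "c (w, ?i w f) \<otimes>\<^bsub>K\<^esub> (?s x \<otimes>\<^bsub>K\<^esub> d (?i w f))
          = (c (w, ?i w f) \<otimes>\<^bsub>K\<^esub> c (x, ?i x w)) \<otimes>\<^bsub>K\<^esub> (a x \<otimes>\<^bsub>K\<^esub> b (?i x w) \<otimes>\<^bsub>K\<^esub> d (?i w f))"
        using car by (simp add: K.m_ac)
      also have "\<dots> = ?t w x" unfolding cc[symmetric] using car by (simp add: K.m_ac)
      finally show "c (w, ?i w f) \<otimes>\<^bsub>K\<^esub> (?s x \<otimes>\<^bsub>K\<^esub> d (?i w f)) = ?t w x" .
    qed (use t w A in auto)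
    finally show "c (w, ?i w f) \<otimes>\<^bsub>K\<^esub> ((a \<otimes>\<^bsub>F\<^esub> b) w \<otimes>\<^bsub>K\<^esub> d (?i w f)) = (\<Oplus>\<^bsub>K\<^esub>x\<in>supp a. ?t w x)" .
  qed (use tW in \<open>auto intro!: K.finsum_closed\<close>)
  also have "\<dots> = (\<Oplus>\<^bsub>K\<^esub>x\<in>supp a. \<Oplus>\<^bsub>K\<^esub>w\<in>W. ?t w x)"
    using W(1) A(2) tW by (rule K.finsum_swap)
  also have "\<dots> = (\<Oplus>\<^bsub>K\<^esub>x\<in>supp a. c (x, ?i x f) \<otimes>\<^bsub>K\<^esub> (a x \<otimes>\<^bsub>K\<^esub> (b \<otimes>\<^bsub>F\<^esub> d) (?i x f)))"
  proof (rule K.finsum_cong')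
    fix x assume xa: "x \<in> supp a"
    then have x: "x \<in> carrier G" using A by blast
    have xf: "?i x f \<in> carrier G" using x f by simp
    let ?u = "\<lambda>w. c (?i x w, ?i w f) \<otimes>\<^bsub>K\<^esub> (b (?i x w) \<otimes>\<^bsub>K\<^esub> d (?i w f))"
    have u: "?u w \<in> carrier K" if "w \<in> carrier G" for w using that x f b d c_closed by simp
    \<comment> \<open>The substitution \<open>w = x \<otimes> y\<close> turns the sum over
      \<open>supp b\<close> into one over \<open>?xB\<close>. Extending it by zero to
      \<open>W\<close> makes the range independent of \<open>x\<close>, as the exchange of sums
      requires.\<close>
    let ?xB = "(\<lambda>y. x \<otimes>\<^bsub>G\<^esub> y) ` supp b"
    have xB: "?xB \<subseteq> W" "?xB \<subseteq> carrier G" using xa x B unfolding W_def by auto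
    have "(b \<otimes>\<^bsub>F\<^esub> d) (?i x f) = (\<Oplus>\<^bsub>K\<^esub>y\<in>supp b. c (y, ?i y (?i x f)) \<otimes>\<^bsub>K\<^esub> (b y \<otimes>\<^bsub>K\<^esub> d (?i y (?i x f))))"
      by (rule mult_F[OF b d xf B(2,1) order_refl])
    also have "\<dots> = (\<Oplus>\<^bsub>K\<^esub>y\<in>supp b. ?u (x \<otimes>\<^bsub>G\<^esub> y))"
    proof (rule K.finsum_cong')
      fix y assume "y \<in> supp b"
      then have y: "y \<in> carrier G" using B by blast
      have "?i x (x \<otimes>\<^bsub>G\<^esub> y) = y" "?i (x \<otimes>\<^bsub>G\<^esub> y) f = ?i y (?i x f)"
        using x y f by (simp flip: G.m_assoc) (use x y f in \<open>simp add: G.inv_mult_group G.m_assoc\<close>)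
      then show "c (y, ?i y (?i x f)) \<otimes>\<^bsub>K\<^esub> (b y \<otimes>\<^bsub>K\<^esub> d (?i y (?i x f))) = ?u (x \<otimes>\<^bsub>G\<^esub> y)" by simp
    qed (use u x B in auto)
    also have "\<dots> = (\<Oplus>\<^bsub>K\<^esub>w\<in>?xB. ?u w)"
      using u x B xB by (intro K.finsum_reindex[symmetric]) (auto simp: inj_on_def subset_iff)
    also have "\<dots> = (\<Oplus>\<^bsub>K\<^esub>w\<in>W. ?u w)"
    proof (rule K.add.finprod_mono_neutral_cong_left)
      fix w assume w: "w \<in> W - ?xB"
      then have wG: "w \<in> carrier G" using W by blast
      have "?i x w \<notin> supp b"
      proof
        assume "?i x w \<in> supp b"
        moreover have "w = x \<otimes>\<^bsub>G\<^esub> ?i x w" using x wG by (simp flip: G.m_assoc)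
        ultimately show False using w by blast
      qed
      then have "b (?i x w) = \<zero>\<^bsub>K\<^esub>" using x wG by (simp add: notin_supp)
      then show "?u w = \<zero>\<^bsub>K\<^esub>" using x wG f d c_closed by simp
    qed (use W xB u in auto)
    finally have eq: "(b \<otimes>\<^bsub>F\<^esub> d) (?i x f) = (\<Oplus>\<^bsub>K\<^esub>w\<in>W. ?u w)" .
    have uW: "?u \<in> W \<rightarrow> carrier K" using u W by blast
    then have auW: "(\<lambda>w. a x \<otimes>\<^bsub>K\<^esub> ?u w) \<in> W \<rightarrow> carrier K" using a x by auto
    have "c (x, ?i x f) \<otimes>\<^bsub>K\<^esub> (a x \<otimes>\<^bsub>K\<^esub> (b \<otimes>\<^bsub>F\<^esub> d) (?i x f)) = c (x, ?i x f) \<otimes>\<^bsub>K\<^esub> (\<Oplus>\<^bsub>K\<^esub>w\<in>W. a x \<otimes>\<^bsub>K\<^esub> ?u w)"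
      unfolding eq using K.finsum_rdistr[OF W(1) _ uW] a x by simp
    also have "\<dots> = (\<Oplus>\<^bsub>K\<^esub>w\<in>W. c (x, ?i x f) \<otimes>\<^bsub>K\<^esub> (a x \<otimes>\<^bsub>K\<^esub> ?u w))"
      using K.finsum_rdistr[OF W(1) _ auW] c_closed[OF x xf] by simp
    finally show "(\<Oplus>\<^bsub>K\<^esub>w\<in>W. ?t w x) = c (x, ?i x f) \<otimes>\<^bsub>K\<^esub> (a x \<otimes>\<^bsub>K\<^esub> (b \<otimes>\<^bsub>F\<^esub> d) (?i x f))" by simp
  qed (use A a b d f mult_F_closed[OF b d] c_closed in auto)
  also have "\<dots> = (a \<otimes>\<^bsub>F\<^esub> (b \<otimes>\<^bsub>F\<^esub> d)) f"
    by (rule mult_F[OF a mult_F_closed[OF b d] f A(2,1) order_refl, symmetric])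
  finally show "(a \<otimes>\<^bsub>F\<^esub> b \<otimes>\<^bsub>F\<^esub> d) f = (a \<otimes>\<^bsub>F\<^esub> (b \<otimes>\<^bsub>F\<^esub> d)) f" .
qed (use a b d mult_F_closed in auto)

lemma mult_F_one:
  assumes a: "a \<in> carrier F"
  shows "\<one>\<^bsub>F\<^esub> \<otimes>\<^bsub>F\<^esub> a = a"
proof (rule F_eqI[OF mult_F_closed[OF one_F_closed a] a])
  fix f assume f: "f \<in> carrier G"
  have "(\<one>\<^bsub>F\<^esub> \<otimes>\<^bsub>F\<^esub> a) f = (\<Oplus>\<^bsub>K\<^esub>x\<in>{\<one>\<^bsub>G\<^esub>}. c (x, inv\<^bsub>G\<^esub> x \<otimes>\<^bsub>G\<^esub> f) \<otimes>\<^bsub>K\<^esub> (\<one>\<^bsub>F\<^esub> x \<otimes>\<^bsub>K\<^esub> a (inv\<^bsub>G\<^esub> x \<otimes>\<^bsub>G\<^esub> f)))"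
    by (rule mult_F[OF one_F_closed a f]) (auto simp: one_F supp_def split: if_splits)
  also have "\<dots> = c (\<one>\<^bsub>G\<^esub>, f) \<otimes>\<^bsub>K\<^esub> (inv\<^bsub>K\<^esub> c (\<one>\<^bsub>G\<^esub>, \<one>\<^bsub>G\<^esub>) \<otimes>\<^bsub>K\<^esub> a f)"
    using a f c_closed c_Units by (subst K.finsum_insert) (auto simp: one_F)
  also have "\<dots> = a f"
    unfolding c_one[OF f] using a f c_closed c_Units by (simp flip: K.m_assoc)
  finally show "(\<one>\<^bsub>F\<^esub> \<otimes>\<^bsub>F\<^esub> a) f = a f" .
qed

lemma mult_F_distrib:
  assumes a: "a \<in> carrier F" and b: "b \<in> carrier F" and d: "d \<in> carrier F"
  shows "a \<otimes>\<^bsub>F\<^esub> (b \<oplus>\<^bsub>F\<^esub> d) = a \<otimes>\<^bsub>F\<^esub> b \<oplus>\<^bsub>F\<^esub> a \<otimes>\<^bsub>F\<^esub> d"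
proof (rule F_eqI)
  fix f assume f: "f \<in> carrier G"
  let ?i = "\<lambda>x. inv\<^bsub>G\<^esub> x \<otimes>\<^bsub>G\<^esub> f"
  have A: "x \<in> carrier G" if "x \<in> supp a" for x using that supp_subset by blast
  note m = mult_F[OF a _ f finite_supp[OF a] supp_subset order_refl]
  have "(a \<otimes>\<^bsub>F\<^esub> (b \<oplus>\<^bsub>F\<^esub> d)) f = (\<Oplus>\<^bsub>K\<^esub>x\<in>supp a. c (x, ?i x) \<otimes>\<^bsub>K\<^esub> (a x \<otimes>\<^bsub>K\<^esub> b (?i x)) \<oplus>\<^bsub>K\<^esub> c (x, ?i x) \<otimes>\<^bsub>K\<^esub> (a x \<otimes>\<^bsub>K\<^esub> d (?i x)))"
    unfolding m[OF add_F_closed[OF b d]]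
  proof (rule K.finsum_cong')
    fix x assume "x \<in> supp a"
    then show "c (x, ?i x) \<otimes>\<^bsub>K\<^esub> (a x \<otimes>\<^bsub>K\<^esub> (b \<oplus>\<^bsub>F\<^esub> d) (?i x)) = c (x, ?i x) \<otimes>\<^bsub>K\<^esub> (a x \<otimes>\<^bsub>K\<^esub> b (?i x)) \<oplus>\<^bsub>K\<^esub> c (x, ?i x) \<otimes>\<^bsub>K\<^esub> (a x \<otimes>\<^bsub>K\<^esub> d (?i x))"
      using A f a b d c_closed by (simp add: add_F K.r_distr)
  qed (use A f a b d c_closed in auto)
  also have "\<dots> = (a \<otimes>\<^bsub>F\<^esub> b) f \<oplus>\<^bsub>K\<^esub> (a \<otimes>\<^bsub>F\<^esub> d) f"
    unfolding m[OF b] m[OF d] using A f a b d c_closed by (intro K.finsum_addf) auto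
  also have "\<dots> = (a \<otimes>\<^bsub>F\<^esub> b \<oplus>\<^bsub>F\<^esub> a \<otimes>\<^bsub>F\<^esub> d) f" using f by (simp add: add_F)
  finally show "(a \<otimes>\<^bsub>F\<^esub> (b \<oplus>\<^bsub>F\<^esub> d)) f = (a \<otimes>\<^bsub>F\<^esub> b \<oplus>\<^bsub>F\<^esub> a \<otimes>\<^bsub>F\<^esub> d) f" .
qed (use a b d mult_F_closed add_F_closed in auto)

lemma mult_F_smult:
  assumes s: "s \<in> carrier K" and a: "a \<in> carrier F" and b: "b \<in> carrier F"
  shows "(s \<odot>\<^bsub>F\<^esub> a) \<otimes>\<^bsub>F\<^esub> b = s \<odot>\<^bsub>F\<^esub> (a \<otimes>\<^bsub>F\<^esub> b)"
proof (rule F_eqI)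
  fix f assume f: "f \<in> carrier G"
  let ?i = "\<lambda>x. inv\<^bsub>G\<^esub> x \<otimes>\<^bsub>G\<^esub> f"
  have A: "x \<in> carrier G" if "x \<in> supp a" for x using that supp_subset by blast
  have "supp (s \<odot>\<^bsub>F\<^esub> a) \<subseteq> supp a" using s by (auto simp: supp_def smult_F)
  then have "((s \<odot>\<^bsub>F\<^esub> a) \<otimes>\<^bsub>F\<^esub> b) f = (\<Oplus>\<^bsub>K\<^esub>x\<in>supp a. c (x, ?i x) \<otimes>\<^bsub>K\<^esub> ((s \<odot>\<^bsub>F\<^esub> a) x \<otimes>\<^bsub>K\<^esub> b (?i x)))"
    by (rule mult_F[OF smult_F_closed[OF s a] b f finite_supp[OF a] supp_subset])
  also have "\<dots> = (\<Oplus>\<^bsub>K\<^esub>x\<in>supp a. s \<otimes>\<^bsub>K\<^esub> (c (x, ?i x) \<otimes>\<^bsub>K\<^esub> (a x \<otimes>\<^bsub>K\<^esub> b (?i x))))"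
    using A f a b s c_closed by (intro K.finsum_cong') (auto simp: smult_F K.m_ac)
  also have "\<dots> = s \<otimes>\<^bsub>K\<^esub> (a \<otimes>\<^bsub>F\<^esub> b) f"
    unfolding mult_F[OF a b f finite_supp[OF a] supp_subset order_refl]
    using A f a b s c_closed by (intro K.finsum_rdistr[symmetric] finite_supp) auto
  finally show "((s \<odot>\<^bsub>F\<^esub> a) \<otimes>\<^bsub>F\<^esub> b) f = (s \<odot>\<^bsub>F\<^esub> (a \<otimes>\<^bsub>F\<^esub> b)) f" using f by (simp add: smult_F)
qed (use s a b mult_F_closed smult_F_closed in auto)

lemma cring_F: "cring F"
proof (rule cringI)
  show "abelian_group F"
  proof (rule abelian_groupI)
    fix x assume x: "x \<in> carrier F"
    have "(\<lambda>g\<in>carrier G. \<ominus>\<^bsub>K\<^esub> x g) \<in> carrier F"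
      using x by (intro F_I[where U = "supp x"]) (auto simp: finite_supp notin_supp)
    moreover have "(\<lambda>g\<in>carrier G. \<ominus>\<^bsub>K\<^esub> x g) \<oplus>\<^bsub>F\<^esub> x = \<zero>\<^bsub>F\<^esub>"
      using x by (auto simp: add_F zero_F K.l_neg intro!: restrict_ext)
    ultimately show "\<exists>y\<in>carrier F. y \<oplus>\<^bsub>F\<^esub> x = \<zero>\<^bsub>F\<^esub>" by blast
  next
    fix x assume x: "x \<in> carrier F"
    show "\<zero>\<^bsub>F\<^esub> \<oplus>\<^bsub>F\<^esub> x = x"
      by (rule F_eqI) (use x in \<open>auto simp: add_F_closed zero_F_closed\<close>, simp add: add_F zero_F)
  qed (auto simp: add_F_closed zero_F_closed, auto simp: add_F K.a_ac intro!: restrict_ext)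
  show "comm_monoid F"
    by (rule comm_monoidI)
      (simp_all add: mult_F_closed one_F_closed mult_F_assoc mult_F_one, blast intro: mult_F_comm)
  show "(x \<oplus>\<^bsub>F\<^esub> y) \<otimes>\<^bsub>F\<^esub> z = x \<otimes>\<^bsub>F\<^esub> z \<oplus>\<^bsub>F\<^esub> y \<otimes>\<^bsub>F\<^esub> z"
    if "x \<in> carrier F" "y \<in> carrier F" "z \<in> carrier F" for x y z
    using that mult_F_comm[of "x \<oplus>\<^bsub>F\<^esub> y" z] mult_F_comm[of x z] mult_F_comm[of y z] mult_F_distrib[of z x y]
    by (simp add: add_F_closed)
qed

lemma algebra_F: "algebra K F"
proof (rule algebraI)
  show "cring K" by (rule K.is_cring)
  show "cring F" by (rule cring_F)
  show "\<one>\<^bsub>K\<^esub> \<odot>\<^bsub>F\<^esub> x = x" if "x \<in> carrier F" for x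
    by (rule F_eqI[OF smult_F_closed that]) (use that in \<open>auto simp: smult_F\<close>)
qed (auto simp: smult_F_closed mult_F_smult, auto simp: smult_F add_F K.l_distr K.r_distr K.m_assoc carrier_F
     intro!: restrict_ext)

end

section \<open>Homogeneous elements and the grading\<close>

context twisted_algebra
begin

sublocale F: cring F by (rule cring_F)

sublocale F: algebra K F by (rule algebra_F)

text \<open>This is the homogeneous element \<open>s x_g\<close> of the twisted group
  algebra.\<close>

definition single :: "'k \<Rightarrow> 'g \<Rightarrow> 'g \<Rightarrow> 'k"
  where "single s g = (\<lambda>h\<in>carrier G. if h = g then s else \<zero>\<^bsub>K\<^esub>)"

lemma single_closed: "s \<in> carrier K \<Longrightarrow> single s g \<in> carrier F"
  unfolding single_def by (rule F_I[where U = "{g}"]) auto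

lemma supp_single: "supp (single s g) \<subseteq> {g}"
  by (auto simp: supp_def single_def)

lemma component_F:
  assumes g: "g \<in> carrier G"
  shows "component F g = (\<lambda>s. single s g) ` carrier K"
proof
  show "component F g \<subseteq> (\<lambda>s. single s g) ` carrier K"
  proof
    fix a assume "a \<in> component F g"
    then have a: "a \<in> carrier F" "\<And>h. h \<in> carrier G \<Longrightarrow> h \<noteq> g \<Longrightarrow> a h = \<zero>\<^bsub>K\<^esub>"
      by (auto simp: twisted_group_algebra_def)
    then have "a = single (a g) g"
      using g by (intro F_eqI[OF _ single_closed]) (auto simp: single_def)
    then show "a \<in> (\<lambda>s. single s g) ` carrier K" using a(1) g by auto
  qed
  show "(\<lambda>s. single s g) ` carrier K \<subseteq> component F g"
    using single_closed by (auto simp: twisted_group_algebra_def single_def)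
qed

lemma single_mult:
  assumes s: "s \<in> carrier K" and g: "g \<in> carrier G" and b: "b \<in> carrier F" and f: "f \<in> carrier G"
  shows "(single s g \<otimes>\<^bsub>F\<^esub> b) f = c (g, inv\<^bsub>G\<^esub> g \<otimes>\<^bsub>G\<^esub> f) \<otimes>\<^bsub>K\<^esub> (s \<otimes>\<^bsub>K\<^esub> b (inv\<^bsub>G\<^esub> g \<otimes>\<^bsub>G\<^esub> f))"
proof -
  have "(single s g \<otimes>\<^bsub>F\<^esub> b) f = (\<Oplus>\<^bsub>K\<^esub>x\<in>{g}. c (x, inv\<^bsub>G\<^esub> x \<otimes>\<^bsub>G\<^esub> f) \<otimes>\<^bsub>K\<^esub> (single s g x \<otimes>\<^bsub>K\<^esub> b (inv\<^bsub>G\<^esub> x \<otimes>\<^bsub>G\<^esub> f)))"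
    by (rule mult_F[OF single_closed[OF s] b f]) (use g supp_single in auto)
  then show ?thesis using s g b f c_closed by (simp add: single_def)
qed

lemma single_mult_single:
  assumes s: "s \<in> carrier K" and g: "g \<in> carrier G" and t: "t \<in> carrier K" and h: "h \<in> carrier G"
  shows "single s g \<otimes>\<^bsub>F\<^esub> single t h = single (c (g, h) \<otimes>\<^bsub>K\<^esub> (s \<otimes>\<^bsub>K\<^esub> t)) (g \<otimes>\<^bsub>G\<^esub> h)"
proof (rule F_eqI)
  fix f assume f: "f \<in> carrier G"
  have "inv\<^bsub>G\<^esub> g \<otimes>\<^bsub>G\<^esub> f = h \<longleftrightarrow> f = g \<otimes>\<^bsub>G\<^esub> h"
    using g h f by (metis G.inv_solve_left)
  then show "(single s g \<otimes>\<^bsub>F\<^esub> single t h) f = single (c (g, h) \<otimes>\<^bsub>K\<^esub> (s \<otimes>\<^bsub>K\<^esub> t)) (g \<otimes>\<^bsub>G\<^esub> h) f"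
    using s t g h f c_closed by (auto simp: single_mult[OF s g single_closed[OF t] f]) (auto simp: single_def)
qed (use s t g h c_closed single_closed in auto)

lemma one_F_single: "\<one>\<^bsub>F\<^esub> = single (inv\<^bsub>K\<^esub> c (\<one>\<^bsub>G\<^esub>, \<one>\<^bsub>G\<^esub>)) \<one>\<^bsub>G\<^esub>"
  by (simp add: one_F single_def)

lemma single_zero: "single \<zero>\<^bsub>K\<^esub> g = \<zero>\<^bsub>F\<^esub>"
  by (auto simp: single_def zero_F)

lemma smult_single: "s \<in> carrier K \<Longrightarrow> t \<in> carrier K \<Longrightarrow> s \<odot>\<^bsub>F\<^esub> single t g = single (s \<otimes>\<^bsub>K\<^esub> t) g"
  by (auto simp: smult_F single_def intro!: restrict_ext)

lemma single_same: "g \<in> carrier G \<Longrightarrow> single s g g = s"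
  by (simp add: single_def)

lemma single_inj:
  assumes "g \<in> carrier G"
  shows "single s g = single t g \<longleftrightarrow> s = t"
proof
  assume "single s g = single t g"
  then have "single s g g = single t g g" by (rule fun_cong)
  then show "s = t" unfolding single_same[OF assms] .
qed simp

lemma finsum_F:
  assumes "finite I" "\<And>i. i \<in> I \<Longrightarrow> \<phi> i \<in> carrier F" "g \<in> carrier G"
  shows "(\<Oplus>\<^bsub>F\<^esub>i\<in>I. \<phi> i) g = (\<Oplus>\<^bsub>K\<^esub>i\<in>I. \<phi> i g)"
  using assms
proof (induction I)
  case empty
  then show ?case by (simp add: zero_F)
next
  case (insert i I)
  have "(\<Oplus>\<^bsub>F\<^esub>i\<in>insert i I. \<phi> i) = \<phi> i \<oplus>\<^bsub>F\<^esub> (\<Oplus>\<^bsub>F\<^esub>i\<in>I. \<phi> i)"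
    using insert by (intro F.finsum_insert) auto
  moreover have "(\<Oplus>\<^bsub>K\<^esub>i\<in>insert i I. \<phi> i g) = \<phi> i g \<oplus>\<^bsub>K\<^esub> (\<Oplus>\<^bsub>K\<^esub>i\<in>I. \<phi> i g)"
    using insert by (intro K.finsum_insert) auto
  ultimately show ?case using insert by (simp add: add_F)
qed

lemma single_Units:
  assumes s: "s \<in> Units K" and g: "g \<in> carrier G"
  shows "single s g \<in> Units F"
proof -
  \<comment> \<open>\<open>?t\<close> is the solution of \<open>c(g,-g) s t = c(0,0)^-1\<close>,
    where the right-hand side is the coefficient of the unit.\<close>
  let ?t = "inv\<^bsub>K\<^esub> (c (g, inv\<^bsub>G\<^esub> g) \<otimes>\<^bsub>K\<^esub> s) \<otimes>\<^bsub>K\<^esub> inv\<^bsub>K\<^esub> c (\<one>\<^bsub>G\<^esub>, \<one>\<^bsub>G\<^esub>)"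
  have u: "c (g, inv\<^bsub>G\<^esub> g) \<otimes>\<^bsub>K\<^esub> s \<in> Units K" using s g c_Units by simp
  have car: "s \<in> carrier K" "?t \<in> carrier K" "inv\<^bsub>K\<^esub> c (\<one>\<^bsub>G\<^esub>, \<one>\<^bsub>G\<^esub>) \<in> carrier K" "c (g, inv\<^bsub>G\<^esub> g) \<in> carrier K"
    "inv\<^bsub>K\<^esub> (c (g, inv\<^bsub>G\<^esub> g) \<otimes>\<^bsub>K\<^esub> s) \<in> carrier K"
    using s u c_Units g c_closed by auto
  have "c (g, inv\<^bsub>G\<^esub> g) \<otimes>\<^bsub>K\<^esub> (s \<otimes>\<^bsub>K\<^esub> ?t)
      = (c (g, inv\<^bsub>G\<^esub> g) \<otimes>\<^bsub>K\<^esub> s) \<otimes>\<^bsub>K\<^esub> inv\<^bsub>K\<^esub> (c (g, inv\<^bsub>G\<^esub> g) \<otimes>\<^bsub>K\<^esub> s) \<otimes>\<^bsub>K\<^esub> inv\<^bsub>K\<^esub> c (\<one>\<^bsub>G\<^esub>, \<one>\<^bsub>G\<^esub>)"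
    using car by (simp add: K.m_assoc)
  also have "\<dots> = inv\<^bsub>K\<^esub> c (\<one>\<^bsub>G\<^esub>, \<one>\<^bsub>G\<^esub>)" using u car by simp
  finally have "single s g \<otimes>\<^bsub>F\<^esub> single ?t (inv\<^bsub>G\<^esub> g) = \<one>\<^bsub>F\<^esub>"
    unfolding one_F_single using single_mult_single[OF car(1) g car(2), of "inv\<^bsub>G\<^esub> g"] g by simp
  then show ?thesis
    using single_closed car F.m_comm[of "single s g" "single ?t (inv\<^bsub>G\<^esub> g)"] unfolding Units_def by auto
qed

lemma F_decomposition:
  assumes x: "x \<in> carrier F"
  shows "x = (\<Oplus>\<^bsub>F\<^esub>g\<in>supp x. single (x g) g)"
proof (rule F_eqI[OF x])
  show "(\<Oplus>\<^bsub>F\<^esub>g\<in>supp x. single (x g) g) \<in> carrier F"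
    using x supp_subset[of x] by (intro F.finsum_closed) (auto intro!: single_closed)
  fix f assume f: "f \<in> carrier G"
  have "(\<Oplus>\<^bsub>F\<^esub>g\<in>supp x. single (x g) g) f = (\<Oplus>\<^bsub>K\<^esub>g\<in>supp x. single (x g) g f)"
    using x supp_subset[of x] f by (intro finsum_F finite_supp) (auto intro!: single_closed)
  also have "\<dots> = (\<Oplus>\<^bsub>K\<^esub>g\<in>{f}. x g)"
    using x supp_subset[of x] f finite_supp[OF x]
    by (intro K.add.finprod_mono_neutral_cong) (auto simp: single_def supp_def)
  finally show "x f = (\<Oplus>\<^bsub>F\<^esub>g\<in>supp x. single (x g) g) f" using x f by simp
qed

theorem graded_field_F: "graded_field G K F"
proof (intro graded_field.intro graded_field_axioms.intro)
  show "comm_group G" "field K" "algebra K F"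
    by (rule G.comm_group_axioms K.field_axioms algebra_F)+
next
  fix g assume g: "g \<in> carrier G"
  show "additive_subgroup (component F g) F"
  proof (intro additive_subgroup.intro F.add.subgroupI)
    show "component F g \<subseteq> carrier F" using single_closed by (auto simp: component_F[OF g])
    show "component F g \<noteq> {}" by (auto simp: component_F[OF g])
    show "\<ominus>\<^bsub>F\<^esub> a \<in> component F g" if a: "a \<in> component F g" for a
    proof -
      obtain s where s: "s \<in> carrier K" "a = single s g" using a by (auto simp: component_F[OF g])
      have "single (\<ominus>\<^bsub>K\<^esub> s) g \<oplus>\<^bsub>F\<^esub> a = \<zero>\<^bsub>F\<^esub>"
        using s by (auto simp: add_F zero_F single_def K.l_neg intro!: restrict_ext)
      then have "\<ominus>\<^bsub>F\<^esub> a = single (\<ominus>\<^bsub>K\<^esub> s) g" using s single_closed by (intro F.minus_equality) auto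
      then show ?thesis using s by (auto simp: component_F[OF g])
    qed
    show "a \<oplus>\<^bsub>F\<^esub> b \<in> component F g" if ab: "a \<in> component F g" "b \<in> component F g" for a b
    proof -
      obtain s t where s: "s \<in> carrier K" "a = single s g" "t \<in> carrier K" "b = single t g"
        using ab by (auto simp: component_F[OF g])
      then have "a \<oplus>\<^bsub>F\<^esub> b = single (s \<oplus>\<^bsub>K\<^esub> t) g" by (auto simp: add_F single_def intro!: restrict_ext)
      then show ?thesis using s by (auto simp: component_F[OF g])
    qed
  qed
  have "single \<one>\<^bsub>K\<^esub> g \<noteq> \<zero>\<^bsub>F\<^esub>" unfolding single_zero[of g, symmetric] single_inj[OF g] by simp
  then show "component F g \<noteq> {\<zero>\<^bsub>F\<^esub>}" using g by (auto simp: component_F)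
  fix x assume "x \<in> component F g" "x \<noteq> \<zero>\<^bsub>F\<^esub>"
  then show "x \<in> Units F" using g single_zero single_Units by (auto simp: component_F K.field_Units)
next
  fix g h x y assume "g \<in> carrier G" "h \<in> carrier G" "x \<in> component F g" "y \<in> component F h"
  then show "x \<otimes>\<^bsub>F\<^esub> y \<in> component F (g \<otimes>\<^bsub>G\<^esub> h)"
    using c_closed by (auto simp: component_F single_mult_single)
next
  have inv: "inv\<^bsub>K\<^esub> c (\<one>\<^bsub>G\<^esub>, \<one>\<^bsub>G\<^esub>) \<in> carrier K" "c (\<one>\<^bsub>G\<^esub>, \<one>\<^bsub>G\<^esub>) \<in> carrier K"
    "c (\<one>\<^bsub>G\<^esub>, \<one>\<^bsub>G\<^esub>) \<otimes>\<^bsub>K\<^esub> inv\<^bsub>K\<^esub> c (\<one>\<^bsub>G\<^esub>, \<one>\<^bsub>G\<^esub>) = \<one>\<^bsub>K\<^esub>" "inv\<^bsub>K\<^esub> c (\<one>\<^bsub>G\<^esub>, \<one>\<^bsub>G\<^esub>) \<otimes>\<^bsub>K\<^esub> c (\<one>\<^bsub>G\<^esub>, \<one>\<^bsub>G\<^esub>) = \<one>\<^bsub>K\<^esub>"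
    using c_Units by auto
  have smult_one: "s \<odot>\<^bsub>F\<^esub> \<one>\<^bsub>F\<^esub> = single (s \<otimes>\<^bsub>K\<^esub> inv\<^bsub>K\<^esub> c (\<one>\<^bsub>G\<^esub>, \<one>\<^bsub>G\<^esub>)) \<one>\<^bsub>G\<^esub>" if "s \<in> carrier K" for s
    using that inv by (simp add: one_F_single smult_single)
  show "bij_betw (\<lambda>s. s \<odot>\<^bsub>F\<^esub> \<one>\<^bsub>F\<^esub>) (carrier K) (component F \<one>\<^bsub>G\<^esub>)"
  \<comment> \<open>The unit has coefficient \<open>c(0,0)^-1\<close> in degree 0, so multiplication
    by \<open>c(0,0)\<close> turns a coefficient in that degree back into a scalar.\<close>
  proof (rule bij_betw_byWitness[where f' = "\<lambda>a. a \<one>\<^bsub>G\<^esub> \<otimes>\<^bsub>K\<^esub> c (\<one>\<^bsub>G\<^esub>, \<one>\<^bsub>G\<^esub>)"])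
    show "\<forall>s\<in>carrier K. (s \<odot>\<^bsub>F\<^esub> \<one>\<^bsub>F\<^esub>) \<one>\<^bsub>G\<^esub> \<otimes>\<^bsub>K\<^esub> c (\<one>\<^bsub>G\<^esub>, \<one>\<^bsub>G\<^esub>) = s"
      using inv by (simp add: smult_one single_def K.m_assoc)
    show "\<forall>a\<in>component F \<one>\<^bsub>G\<^esub>. (a \<one>\<^bsub>G\<^esub> \<otimes>\<^bsub>K\<^esub> c (\<one>\<^bsub>G\<^esub>, \<one>\<^bsub>G\<^esub>)) \<odot>\<^bsub>F\<^esub> \<one>\<^bsub>F\<^esub> = a"
      using inv by (auto simp: component_F single_def[of _ "\<one>\<^bsub>G\<^esub>"] smult_one K.m_assoc)
    show "(\<lambda>s. s \<odot>\<^bsub>F\<^esub> \<one>\<^bsub>F\<^esub>) ` carrier K \<subseteq> component F \<one>\<^bsub>G\<^esub>"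
      using inv by (auto simp: component_F smult_one)
    show "(\<lambda>a. a \<one>\<^bsub>G\<^esub> \<otimes>\<^bsub>K\<^esub> c (\<one>\<^bsub>G\<^esub>, \<one>\<^bsub>G\<^esub>)) ` component F \<one>\<^bsub>G\<^esub> \<subseteq> carrier K"
      using inv by (auto simp: component_F single_def)
  qed
next
  fix x assume x: "x \<in> carrier F"
  let ?S = "\<lambda>a. {g \<in> carrier G. a g \<noteq> \<zero>\<^bsub>F\<^esub>}"
  show "\<exists>!a. a \<in> (\<Pi>\<^sub>E g\<in>carrier G. component F g) \<and> finite (?S a) \<and> x = (\<Oplus>\<^bsub>F\<^esub>g\<in>?S a. a g)"
  proof (rule ex1I)
    let ?a = "\<lambda>g\<in>carrier G. single (x g) g"
    have S: "?S ?a = supp x"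
      using single_inj[of _ _ "\<zero>\<^bsub>K\<^esub>"] by (auto simp: supp_def single_zero)
    have "x = (\<Oplus>\<^bsub>F\<^esub>g\<in>supp x. single (x g) g)" by (rule F_decomposition[OF x])
    also have "\<dots> = (\<Oplus>\<^bsub>F\<^esub>g\<in>supp x. ?a g)"
      using x supp_subset[of x] by (intro F.finsum_cong') (auto intro!: single_closed)
    finally show "?a \<in> (\<Pi>\<^sub>E g\<in>carrier G. component F g) \<and> finite (?S ?a) \<and> x = (\<Oplus>\<^bsub>F\<^esub>g\<in>?S ?a. ?a g)"
      unfolding S using x finite_supp by (auto simp: component_F)
  next
    fix a assume a: "a \<in> (\<Pi>\<^sub>E g\<in>carrier G. component F g) \<and> finite (?S a) \<and> x = (\<Oplus>\<^bsub>F\<^esub>g\<in>?S a. a g)"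
    have ag: "a g \<in> component F g" if "g \<in> carrier G" for g using a that by auto
    have aF: "a g \<in> carrier F" if "g \<in> carrier G" for g
      using ag[OF that] single_closed by (auto simp: component_F[OF that])
    have off: "a g f = \<zero>\<^bsub>K\<^esub>" if "g \<in> carrier G" "f \<in> carrier G" "f \<noteq> g" for g f
      using ag[OF that(1)] that by (auto simp: component_F single_def)
    have "x g = a g g" if g: "g \<in> carrier G" for g
    proof -
      have "x g = (\<Oplus>\<^bsub>K\<^esub>h\<in>?S a. a h g)"
        using a aF g finsum_F[of "?S a" a g] by auto
      also have "\<dots> = (\<Oplus>\<^bsub>K\<^esub>h\<in>{g}. a h g)"
        using a aF g off by (intro K.add.finprod_mono_neutral_cong) (auto simp: zero_F)
      finally show ?thesis using aF[OF g] g by simp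
    qed
    then have "a g = single (x g) g" if "g \<in> carrier G" for g
      using ag[OF that] that by (auto simp: component_F single_def)
    then have "restrict a (carrier G) = (\<lambda>g\<in>carrier G. single (x g) g)" by (rule restrict_ext)
    moreover have "restrict a (carrier G) = a" using a by (auto simp: PiE_def extensional_restrict)
    ultimately show "a = (\<lambda>g\<in>carrier G. single (x g) g)" by simp
  qed
qed

end

section \<open>Subalgebras supported on multiples\<close>

text \<open>Up to the coboundary of \<open>\<nu>\<close>, the cocycle \<open>c'\<close> is the
  pullback of \<open>c\<close> along multiplication by \<open>r\<close>. The case
  \<open>r = 1\<close> covers cohomologous cocycles.\<close>

locale twisted_algebra_pullback = twisted_algebra G K c + C': twisted_algebra G K c'
  for G :: "('g, 'a) monoid_scheme" and K :: "('k, 'b) ring_scheme" and c c' +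
  fixes r :: int and \<nu> :: "'g \<Rightarrow> 'k"
  assumes torsion_free: "torsion_free G" and r: "r \<noteq> 0"
    and \<nu>: "\<And>g. g \<in> carrier G \<Longrightarrow> \<nu> g \<in> Units K"
    and pullback: "\<And>g h. g \<in> carrier G \<Longrightarrow> h \<in> carrier G \<Longrightarrow>
      c (g [^]\<^bsub>G\<^esub> r, h [^]\<^bsub>G\<^esub> r) \<otimes>\<^bsub>K\<^esub> \<nu> (g \<otimes>\<^bsub>G\<^esub> h) = c' (g, h) \<otimes>\<^bsub>K\<^esub> \<nu> g \<otimes>\<^bsub>K\<^esub> \<nu> h"
begin

abbreviation "p g \<equiv> g [^]\<^bsub>G\<^esub> r"
abbreviation "rG \<equiv> p ` carrier G"
abbreviation "F' \<equiv> twisted_group_algebra G K c'"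

text \<open>\<open>R\<close> is the underlying ring of the \<open>r\<close>-th graded power. The map
  \<open>\<rho>\<close> defined next sends \<open>x_{rg}\<close> to \<open>\<nu>(g) x_g\<close>; the
  equation \<open>pullback\<close> says that this is multiplicative.\<close>

definition R where "R = {a \<in> carrier F. supp a \<subseteq> rG}"
definition \<rho> where "\<rho> b = (\<lambda>g\<in>carrier G. \<nu> g \<otimes>\<^bsub>K\<^esub> b (p g))"

lemma \<nu>_closed: "g \<in> carrier G \<Longrightarrow> \<nu> g \<in> carrier K"
  using \<nu> K.Units_closed by blast

lemma p_inj: "g \<in> carrier G \<Longrightarrow> h \<in> carrier G \<Longrightarrow> p g = p h \<Longrightarrow> g = h"
  using G.torsion_free_cancel_int_pow[OF torsion_free _ _ r] .

lemma p_mult: "g \<in> carrier G \<Longrightarrow> h \<in> carrier G \<Longrightarrow> p (g \<otimes>\<^bsub>G\<^esub> h) = p g \<otimes>\<^bsub>G\<^esub> p h"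
  by (simp add: G.int_pow_distrib)

lemma p_inv: "g \<in> carrier G \<Longrightarrow> p (inv\<^bsub>G\<^esub> g) = inv\<^bsub>G\<^esub> (p g)"
  by (simp add: G.int_pow_inv)

lemma rG_subgroup: "subgroup rG G"
proof -
  have "p \<in> hom G G" by (rule homI) (auto simp: p_mult)
  then interpret p: group_hom G G p by (simp add: group_hom.intro group_hom_axioms.intro G.is_group)
  show ?thesis using p.subgroup_img_is_subgroup[OF G.subgroup_self] .
qed

lemma R_zero: "a \<in> R \<Longrightarrow> g \<in> carrier G \<Longrightarrow> g \<notin> rG \<Longrightarrow> a g = \<zero>\<^bsub>K\<^esub>"
  by (auto simp: R_def supp_def)

lemma R_carrier: "a \<in> R \<Longrightarrow> a \<in> carrier F" by (simp add: R_def)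

lemma R_I: "a \<in> carrier F \<Longrightarrow> (\<And>g. g \<in> carrier G \<Longrightarrow> g \<notin> rG \<Longrightarrow> a g = \<zero>\<^bsub>K\<^esub>) \<Longrightarrow> a \<in> R"
  by (auto simp: R_def supp_def)

lemma uminus_F:
  assumes "a \<in> carrier F" "g \<in> carrier G"
  shows "(\<ominus>\<^bsub>F\<^esub> a) g = \<ominus>\<^bsub>K\<^esub> a g"
proof -
  have "(\<ominus>\<^bsub>F\<^esub> a \<oplus>\<^bsub>F\<^esub> a) g = \<zero>\<^bsub>F\<^esub> g" using F.l_neg[OF assms(1)] by simp
  then have "(\<ominus>\<^bsub>F\<^esub> a) g \<oplus>\<^bsub>K\<^esub> a g = \<zero>\<^bsub>K\<^esub>" using assms(2) by (simp add: add_F zero_F)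
  then show ?thesis using assms F.a_inv_closed by (intro K.minus_equality[symmetric]) auto
qed

lemma R_subring: "subring R F"
proof (rule F.subringI)
  show "R \<subseteq> carrier F" by (auto simp: R_def)
  have "\<one>\<^bsub>G\<^esub> \<in> rG" using subgroup.one_closed[OF rG_subgroup] .
  then show "\<one>\<^bsub>F\<^esub> \<in> R" by (intro R_I one_F_closed) (auto simp: one_F)
  show "\<ominus>\<^bsub>F\<^esub> a \<in> R" if "a \<in> R" for a
    using R_carrier[OF that] R_zero[OF that] by (intro R_I) (auto simp: uminus_F)
  show "a \<oplus>\<^bsub>F\<^esub> b \<in> R" if "a \<in> R" "b \<in> R" for a b
    using R_carrier[OF that(1)] R_carrier[OF that(2)] R_zero[OF that(1)] R_zero[OF that(2)]
    by (intro R_I add_F_closed) (auto simp: add_F)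
  show "a \<otimes>\<^bsub>F\<^esub> b \<in> R" if "a \<in> R" "b \<in> R" for a b
  proof (rule R_I[OF mult_F_closed[OF R_carrier[OF that(1)] R_carrier[OF that(2)]]])
    fix g assume g: "g \<in> carrier G" "g \<notin> rG"
    have "supp a \<subseteq> rG" "supp b \<subseteq> rG" using that by (auto simp: R_def)
    then have "x \<otimes>\<^bsub>G\<^esub> y \<in> rG" if "x \<in> supp a" "y \<in> supp b" for x y
      using that by (intro subgroup.m_closed[OF rG_subgroup]) (rule subsetD, assumption+)+
    then have "g \<noteq> x \<otimes>\<^bsub>G\<^esub> y" if "x \<in> supp a" "y \<in> supp b" for x y
      using that g(2) by metis
    then have "g \<notin> (\<lambda>(x, y). x \<otimes>\<^bsub>G\<^esub> y) ` (supp a \<times> supp b)" by auto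
    then show "(a \<otimes>\<^bsub>F\<^esub> b) g = \<zero>\<^bsub>K\<^esub>"
      by (rule mult_F_notin[OF R_carrier[OF that(1)] R_carrier[OF that(2)] g(1)])
  qed
qed

text \<open>Multiplication by the units \<open>\<nu> g\<close> does not change where a coefficient
  vanishes, so supports correspond under \<open>p\<close>.\<close>

lemma supp_\<rho>:
  assumes "b \<in> R"
  shows "supp b = p ` C'.supp (\<rho> b)" "C'.supp (\<rho> b) = {g \<in> carrier G. b (p g) \<noteq> \<zero>\<^bsub>K\<^esub>}"
proof -
  have "\<nu> g \<otimes>\<^bsub>K\<^esub> b (p g) = \<zero>\<^bsub>K\<^esub> \<longleftrightarrow> b (p g) = \<zero>\<^bsub>K\<^esub>" if "g \<in> carrier G" for g
    using \<nu>[OF that] R_carrier[OF assms] that by (simp add: K.integral_iff K.field_Units)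
  then show *: "C'.supp (\<rho> b) = {g \<in> carrier G. b (p g) \<noteq> \<zero>\<^bsub>K\<^esub>}"
    by (auto simp: C'.supp_def \<rho>_def)
  have "supp b \<subseteq> rG" using assms by (simp add: R_def)
  then show "supp b = p ` C'.supp (\<rho> b)"
    unfolding * by (auto simp: supp_def)
qed

lemma \<rho>_closed:
  assumes b: "b \<in> R"
  shows "\<rho> b \<in> carrier F'"
proof -
  have "finite (p ` C'.supp (\<rho> b))" using finite_supp[OF R_carrier[OF b]] supp_\<rho>(1)[OF b] by simp
  moreover have "inj_on p (C'.supp (\<rho> b))" using p_inj C'.supp_subset by (auto simp: inj_on_def)
  ultimately have "finite (C'.supp (\<rho> b))" using finite_imageD by blast
  then show ?thesis
    unfolding C'.carrier_F using R_carrier[OF b] \<nu>_closed by (auto simp: \<rho>_def)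
qed

text \<open>The support of an element of \<open>R\<close> is an image under the injective map
  \<open>p\<close>, so the convolution sum can be reindexed along \<open>p\<close>. The equation
  \<open>pullback\<close> then converts it summand by summand into the convolution with respect to
  \<open>c'\<close>.\<close>

lemma \<rho>_mult:
  assumes a: "a \<in> R" and b: "b \<in> R"
  shows "\<rho> (a \<otimes>\<^bsub>F\<^esub> b) = \<rho> a \<otimes>\<^bsub>F'\<^esub> \<rho> b"
proof (rule C'.F_eqI)
  fix f assume f: "f \<in> carrier G"
  let ?S = "C'.supp (\<rho> a)"
  have S: "finite ?S" "?S \<subseteq> carrier G" using C'.finite_supp[OF \<rho>_closed[OF a]] C'.supp_subset by auto
  have pf: "p f \<in> carrier G" using f by simp
  note aF = R_carrier[OF a] and bF = R_carrier[OF b]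
  let ?t = "\<lambda>x. c (x, inv\<^bsub>G\<^esub> x \<otimes>\<^bsub>G\<^esub> p f) \<otimes>\<^bsub>K\<^esub> (a x \<otimes>\<^bsub>K\<^esub> b (inv\<^bsub>G\<^esub> x \<otimes>\<^bsub>G\<^esub> p f))"
  have t: "?t (p s) \<in> carrier K" if "s \<in> carrier G" for s
    by (rule mult_F_summand[OF aF bF _ pf]) (use that in simp)
  have pS: "p ` ?S \<subseteq> carrier G" using S(2) by auto
  have "(a \<otimes>\<^bsub>F\<^esub> b) (p f) = (\<Oplus>\<^bsub>K\<^esub>x\<in>p ` ?S. ?t x)"
    by (rule mult_F[OF aF bF pf finite_imageI[OF S(1)] pS equalityD1[OF supp_\<rho>(1)[OF a]]])
  then have "\<rho> (a \<otimes>\<^bsub>F\<^esub> b) f = \<nu> f \<otimes>\<^bsub>K\<^esub> (\<Oplus>\<^bsub>K\<^esub>x\<in>p ` ?S. ?t x)"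
    using f by (simp only: \<rho>_def restrict_apply' if_True)
  also have "(\<Oplus>\<^bsub>K\<^esub>x\<in>p ` ?S. ?t x) = (\<Oplus>\<^bsub>K\<^esub>s\<in>?S. ?t (p s))"
    using t S p_inj by (intro K.finsum_reindex) (auto simp: inj_on_def subset_iff)
  also have "\<nu> f \<otimes>\<^bsub>K\<^esub> \<dots> = (\<Oplus>\<^bsub>K\<^esub>s\<in>?S. \<nu> f \<otimes>\<^bsub>K\<^esub> ?t (p s))"
    using t S \<nu>_closed[OF f] by (intro K.finsum_rdistr) auto
  also have "\<dots> = (\<Oplus>\<^bsub>K\<^esub>s\<in>?S. c' (s, inv\<^bsub>G\<^esub> s \<otimes>\<^bsub>G\<^esub> f) \<otimes>\<^bsub>K\<^esub> (\<rho> a s \<otimes>\<^bsub>K\<^esub> \<rho> b (inv\<^bsub>G\<^esub> s \<otimes>\<^bsub>G\<^esub> f)))"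
  proof (rule K.finsum_cong')
    fix s assume "s \<in> ?S"
    then have s: "s \<in> carrier G" using S by blast
    let ?w = "inv\<^bsub>G\<^esub> s \<otimes>\<^bsub>G\<^esub> f"
    have w: "?w \<in> carrier G" "s \<otimes>\<^bsub>G\<^esub> ?w = f" using s f by (auto simp flip: G.m_assoc)
    have pw: "inv\<^bsub>G\<^esub> (p s) \<otimes>\<^bsub>G\<^esub> p f = p ?w" using s f by (simp add: p_mult p_inv)
    have car: "c (p s, p ?w) \<in> carrier K" "c' (s, ?w) \<in> carrier K" "a (p s) \<in> carrier K" "b (p ?w) \<in> carrier K"
      "\<nu> s \<in> carrier K" "\<nu> ?w \<in> carrier K" "\<nu> f \<in> carrier K"
      using s w f aF bF c_closed C'.c_closed \<nu>_closed by auto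
    have "\<nu> f \<otimes>\<^bsub>K\<^esub> ?t (p s) = (c (p s, p ?w) \<otimes>\<^bsub>K\<^esub> \<nu> (s \<otimes>\<^bsub>G\<^esub> ?w)) \<otimes>\<^bsub>K\<^esub> (a (p s) \<otimes>\<^bsub>K\<^esub> b (p ?w))"
      unfolding pw w(2) using car by (simp add: K.m_ac)
    also have "\<dots> = (c' (s, ?w) \<otimes>\<^bsub>K\<^esub> \<nu> s \<otimes>\<^bsub>K\<^esub> \<nu> ?w) \<otimes>\<^bsub>K\<^esub> (a (p s) \<otimes>\<^bsub>K\<^esub> b (p ?w))"
      using pullback[OF s w(1)] by simp
    also have "\<dots> = c' (s, ?w) \<otimes>\<^bsub>K\<^esub> ((\<nu> s \<otimes>\<^bsub>K\<^esub> a (p s)) \<otimes>\<^bsub>K\<^esub> (\<nu> ?w \<otimes>\<^bsub>K\<^esub> b (p ?w)))"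
      using car by (simp add: K.m_ac)
    also have "\<dots> = c' (s, ?w) \<otimes>\<^bsub>K\<^esub> (\<rho> a s \<otimes>\<^bsub>K\<^esub> \<rho> b ?w)" using s w by (simp add: \<rho>_def)
    finally show "\<nu> f \<otimes>\<^bsub>K\<^esub> ?t (p s) = c' (s, ?w) \<otimes>\<^bsub>K\<^esub> (\<rho> a s \<otimes>\<^bsub>K\<^esub> \<rho> b ?w)" .
  next
    show "(\<lambda>s. c' (s, inv\<^bsub>G\<^esub> s \<otimes>\<^bsub>G\<^esub> f) \<otimes>\<^bsub>K\<^esub> (\<rho> a s \<otimes>\<^bsub>K\<^esub> \<rho> b (inv\<^bsub>G\<^esub> s \<otimes>\<^bsub>G\<^esub> f))) \<in> ?S \<rightarrow> carrier K"
      using C'.mult_F_summand[OF \<rho>_closed[OF a] \<rho>_closed[OF b] _ f] S(2) by blast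
  qed simp
  also have "\<dots> = (\<rho> a \<otimes>\<^bsub>F'\<^esub> \<rho> b) f"
    by (rule C'.mult_F[OF \<rho>_closed[OF a] \<rho>_closed[OF b] f S order_refl, symmetric])
  finally show "\<rho> (a \<otimes>\<^bsub>F\<^esub> b) f = (\<rho> a \<otimes>\<^bsub>F'\<^esub> \<rho> b) f" .
qed (use a b \<rho>_closed subringE(6)[OF R_subring] C'.mult_F_closed in auto)

lemma \<rho>_single:
  assumes "g \<in> carrier G" "s \<in> carrier K"
  shows "single s (p g) \<in> R" "\<rho> (single s (p g)) = C'.single (\<nu> g \<otimes>\<^bsub>K\<^esub> s) g"
  using assms single_closed[of s "p g"] p_inj \<nu>_closed
  by (auto intro!: R_I restrict_ext simp: single_def \<rho>_def C'.single_def)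

lemma \<rho>_surj:
  assumes a: "a \<in> carrier F'"
  shows "\<exists>b\<in>R. \<rho> b = a"
proof
  define root where "root = inv_into (carrier G) p"
  have root: "root (p g) = g" if "g \<in> carrier G" for g
    unfolding root_def using inv_into_f_f[of p "carrier G" g] p_inj that by (auto simp: inj_on_def)
  let ?f = "\<lambda>h. if h \<in> rG then inv\<^bsub>K\<^esub> \<nu> (root h) \<otimes>\<^bsub>K\<^esub> a (root h) else \<zero>\<^bsub>K\<^esub>"
  have f_p: "?f (p g) = inv\<^bsub>K\<^esub> \<nu> g \<otimes>\<^bsub>K\<^esub> a g" if "g \<in> carrier G" for g using that root by simp
  have "(\<lambda>h\<in>carrier G. ?f h) \<in> carrier F"
  proof (rule F_I[where U = "p ` C'.supp a"])
    show "?f h \<in> carrier K" if "h \<in> carrier G" for h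
      using a \<nu> root by auto
    show "?f h = \<zero>\<^bsub>K\<^esub>" if "h \<in> carrier G" "h \<notin> p ` C'.supp a" for h
    proof (cases "h \<in> rG")
      case True
      then obtain g where g: "g \<in> carrier G" "h = p g" by blast
      then have "g \<notin> C'.supp a" using that(2) by blast
      then show ?thesis using f_p[OF g(1)] g \<nu>[OF g(1)] C'.notin_supp[of g a] by simp
    qed simp
  qed (use C'.finite_supp[OF a] in simp)
  then show "(\<lambda>h\<in>carrier G. ?f h) \<in> R" by (rule R_I) simp
  then show "\<rho> (\<lambda>h\<in>carrier G. ?f h) = a"
  proof (intro C'.F_eqI \<rho>_closed a)
    fix g assume g: "g \<in> carrier G"
    then have "\<rho> (\<lambda>h\<in>carrier G. ?f h) g = \<nu> g \<otimes>\<^bsub>K\<^esub> (inv\<^bsub>K\<^esub> \<nu> g \<otimes>\<^bsub>K\<^esub> a g)"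
      unfolding \<rho>_def using f_p[OF g] by simp
    also have "\<dots> = (\<nu> g \<otimes>\<^bsub>K\<^esub> inv\<^bsub>K\<^esub> \<nu> g) \<otimes>\<^bsub>K\<^esub> a g"
      using g a \<nu>[OF g] by (intro K.m_assoc[symmetric]) auto
    also have "\<dots> = a g" using g a \<nu>[OF g] by simp
    finally show "\<rho> (\<lambda>h\<in>carrier G. ?f h) g = a g" .
  qed
qed

theorem \<rho>_iso: "\<rho> \<in> ring_iso (F\<lparr>carrier := R\<rparr>) F'"
proof (rule ring_iso_memI)
  show "\<rho> x \<in> carrier F'" if "x \<in> carrier (F\<lparr>carrier := R\<rparr>)" for x using that \<rho>_closed by simp
  show "\<rho> (x \<otimes>\<^bsub>F\<lparr>carrier := R\<rparr>\<^esub> y) = \<rho> x \<otimes>\<^bsub>F'\<^esub> \<rho> y"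
    if "x \<in> carrier (F\<lparr>carrier := R\<rparr>)" "y \<in> carrier (F\<lparr>carrier := R\<rparr>)" for x y
    using that \<rho>_mult by simp
  show "\<rho> (x \<oplus>\<^bsub>F\<lparr>carrier := R\<rparr>\<^esub> y) = \<rho> x \<oplus>\<^bsub>F'\<^esub> \<rho> y"
    if "x \<in> carrier (F\<lparr>carrier := R\<rparr>)" "y \<in> carrier (F\<lparr>carrier := R\<rparr>)" for x y
    using that \<nu>_closed R_carrier by (auto simp: \<rho>_def add_F C'.add_F K.r_distr intro!: restrict_ext)
  have "\<rho> a = \<rho> b \<Longrightarrow> a = b" if "a \<in> R" "b \<in> R" for a b
  proof (rule F_eqI[OF R_carrier[OF that(1)] R_carrier[OF that(2)]])
    fix h assume eq: "\<rho> a = \<rho> b" and h: "h \<in> carrier G"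
    show "a h = b h"
    proof (cases "h \<in> rG")
      case True
      then obtain g where g: "g \<in> carrier G" "h = p g" by blast
      have "\<rho> a g = \<rho> b g" using eq by simp
      then show ?thesis using g \<nu>[OF g(1)] R_carrier that by (simp add: \<rho>_def K.m_lcancel K.field_Units)
    next
      case False
      then show ?thesis using R_zero[OF that(1) h] R_zero[OF that(2) h] by simp
    qed
  qed
  then show "bij_betw \<rho> (carrier (F\<lparr>carrier := R\<rparr>)) (carrier F')"
    unfolding bij_betw_def inj_on_def using \<rho>_closed \<rho>_surj by (auto simp: image_iff) metis
  interpret R: ring "F\<lparr>carrier := R\<rparr>" by (rule F.subring_is_ring[OF R_subring])
  have one: "\<one>\<^bsub>F\<^esub> \<in> R" using subringE(3)[OF R_subring] .
  \<comment> \<open>Preservation of the unit is deduced from multiplicativity and surjectivity,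
    which spares a comparison of \<open>c\<close> and \<open>c'\<close> at the identity.\<close>
  obtain e where e: "e \<in> R" "\<rho> e = \<one>\<^bsub>F'\<^esub>" using \<rho>_surj C'.one_F_closed by blast
  have "\<rho> e = \<rho> e \<otimes>\<^bsub>F'\<^esub> \<rho> \<one>\<^bsub>F\<^esub>" using \<rho>_mult[OF e(1) one] R_carrier[OF e(1)] by simp
  then show "\<rho> \<one>\<^bsub>F\<lparr>carrier := R\<rparr>\<^esub> = \<one>\<^bsub>F'\<^esub>" using e \<rho>_closed[OF one] C'.F.l_one by simp
qed

definition \<pi> where "\<pi> x = (\<lambda>g\<in>carrier G. if g \<in> rG then x g else \<zero>\<^bsub>K\<^esub>)"

lemma \<pi>_closed:
  assumes "x \<in> carrier F"
  shows "\<pi> x \<in> R"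
proof (rule R_I)
  show "\<pi> x \<in> carrier F" unfolding \<pi>_def
    using assms by (intro F_I[where U = "supp x"]) (auto simp: finite_supp notin_supp)
qed (simp add: \<pi>_def)

text \<open>For \<open>u\<close> in the subgroup \<open>rG\<close>, the degree obtained by dividing
  \<open>f\<close> by \<open>u\<close> lies in \<open>rG\<close> exactly if \<open>f\<close> does.
  Truncation to degrees in \<open>rG\<close> thus commutes with multiplication by elements supported
  there.\<close>

lemma \<pi>_mult:
  assumes a: "a \<in> R" and x: "x \<in> carrier F"
  shows "\<pi> (a \<otimes>\<^bsub>F\<^esub> x) = a \<otimes>\<^bsub>F\<^esub> \<pi> x"
proof (rule F_eqI)
  note aF = R_carrier[OF a]
  have px: "\<pi> x \<in> carrier F" using \<pi>_closed[OF x] R_carrier by blast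
  show "\<pi> (a \<otimes>\<^bsub>F\<^esub> x) \<in> carrier F" using \<pi>_closed R_carrier mult_F_closed[OF aF x] by blast
  show "a \<otimes>\<^bsub>F\<^esub> \<pi> x \<in> carrier F" using mult_F_closed[OF aF px] .
  fix f assume f: "f \<in> carrier G"
  have supp: "u \<in> carrier G" "u \<in> rG" if "u \<in> supp a" for u using that a supp_subset by (auto simp: R_def)
  note m = mult_F[OF aF _ f finite_supp[OF aF] supp_subset order_refl]
  have "(a \<otimes>\<^bsub>F\<^esub> \<pi> x) f = (\<Oplus>\<^bsub>K\<^esub>u\<in>supp a. c (u, inv\<^bsub>G\<^esub> u \<otimes>\<^bsub>G\<^esub> f) \<otimes>\<^bsub>K\<^esub> (a u \<otimes>\<^bsub>K\<^esub> \<pi> x (inv\<^bsub>G\<^esub> u \<otimes>\<^bsub>G\<^esub> f)))"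
    by (rule m[OF px])
  also have "\<dots> = (if f \<in> rG then (a \<otimes>\<^bsub>F\<^esub> x) f else \<zero>\<^bsub>K\<^esub>)"
  proof (cases "f \<in> rG")
    case True
    have "inv\<^bsub>G\<^esub> u \<otimes>\<^bsub>G\<^esub> f \<in> rG" if "u \<in> supp a" for u
      using supp(2)[OF that] True subgroup.m_closed[OF rG_subgroup] subgroup.m_inv_closed[OF rG_subgroup] by blast
    then have eq: "\<pi> x (inv\<^bsub>G\<^esub> u \<otimes>\<^bsub>G\<^esub> f) = x (inv\<^bsub>G\<^esub> u \<otimes>\<^bsub>G\<^esub> f)" if "u \<in> supp a" for u
      using that supp(1)[OF that] f by (simp add: \<pi>_def)
    have "(\<Oplus>\<^bsub>K\<^esub>u\<in>supp a. c (u, inv\<^bsub>G\<^esub> u \<otimes>\<^bsub>G\<^esub> f) \<otimes>\<^bsub>K\<^esub> (a u \<otimes>\<^bsub>K\<^esub> \<pi> x (inv\<^bsub>G\<^esub> u \<otimes>\<^bsub>G\<^esub> f))) = (a \<otimes>\<^bsub>F\<^esub> x) f"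
      unfolding m[OF x] using eq mult_F_summand[OF aF x _ f] supp(1) by (intro K.finsum_cong') auto
    then show ?thesis using True by simp
  next
    case False
    have "inv\<^bsub>G\<^esub> u \<otimes>\<^bsub>G\<^esub> f \<notin> rG" if "u \<in> supp a" for u
    proof
      assume "inv\<^bsub>G\<^esub> u \<otimes>\<^bsub>G\<^esub> f \<in> rG"
      then have "u \<otimes>\<^bsub>G\<^esub> (inv\<^bsub>G\<^esub> u \<otimes>\<^bsub>G\<^esub> f) \<in> rG" using subgroup.m_closed[OF rG_subgroup] supp(2)[OF that] by blast
      moreover have "u \<otimes>\<^bsub>G\<^esub> (inv\<^bsub>G\<^esub> u \<otimes>\<^bsub>G\<^esub> f) = f" using supp(1)[OF that] f by (simp flip: G.m_assoc)
      ultimately show False using False by simp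
    qed
    then have "\<pi> x (inv\<^bsub>G\<^esub> u \<otimes>\<^bsub>G\<^esub> f) = \<zero>\<^bsub>K\<^esub>" if "u \<in> supp a" for u
      using that supp(1)[OF that] f by (simp add: \<pi>_def)
    then have "(\<Oplus>\<^bsub>K\<^esub>u\<in>supp a. c (u, inv\<^bsub>G\<^esub> u \<otimes>\<^bsub>G\<^esub> f) \<otimes>\<^bsub>K\<^esub> (a u \<otimes>\<^bsub>K\<^esub> \<pi> x (inv\<^bsub>G\<^esub> u \<otimes>\<^bsub>G\<^esub> f))) = \<zero>\<^bsub>K\<^esub>"
      using supp(1) aF f c_closed by (intro K.add.finprod_one_eqI) auto
    then show ?thesis using False by simp
  qed
  also have "\<dots> = \<pi> (a \<otimes>\<^bsub>F\<^esub> x) f" using f by (simp add: \<pi>_def)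
  finally show "\<pi> (a \<otimes>\<^bsub>F\<^esub> x) f = (a \<otimes>\<^bsub>F\<^esub> \<pi> x) f" by simp
qed

lemma finite_over_R:
  assumes "finite_rank G"
  obtains Y where "finite Y" "Y \<subseteq> carrier F"
    "\<And>x. x \<in> carrier F \<Longrightarrow> \<exists>a\<in>Y \<rightarrow> R. x = (\<Oplus>\<^bsub>F\<^esub>y\<in>Y. a y \<otimes>\<^bsub>F\<^esub> y)"
proof -
  obtain Y where Y: "Y \<subseteq> carrier G" "finite Y"
    and Y_reps: "\<forall>g\<in>carrier G. \<exists>y\<in>Y. \<exists>h\<in>carrier G. g = p h \<otimes>\<^bsub>G\<^esub> y"
    using G.finite_index[OF torsion_free assms r] by (elim exE conjE)
  have "\<exists>y\<in>Y. g \<otimes>\<^bsub>G\<^esub> inv\<^bsub>G\<^esub> y \<in> rG" if g: "g \<in> carrier G" for g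
  proof -
    obtain y h where y: "y \<in> Y" "h \<in> carrier G" "g = p h \<otimes>\<^bsub>G\<^esub> y" using bspec[OF Y_reps g] by blast
    then have "g \<otimes>\<^bsub>G\<^esub> inv\<^bsub>G\<^esub> y = p h" using Y by (auto simp: G.m_assoc)
    then show ?thesis using y by blast
  qed
  \<comment> \<open>\<open>Y\<close> may contain several representatives of one coset. The choice of
    \<open>rep\<close> makes sure that each degree of an element is produced exactly once.\<close>
  then obtain rep where rep: "\<And>g. g \<in> carrier G \<Longrightarrow> rep g \<in> Y" "\<And>g. g \<in> carrier G \<Longrightarrow> g \<otimes>\<^bsub>G\<^esub> inv\<^bsub>G\<^esub> rep g \<in> rG"
    by metis
  let ?X = "\<lambda>y. single \<one>\<^bsub>K\<^esub> y"
  have X_inj: "inj_on ?X Y"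
  proof (rule inj_onI)
    fix y z assume yz: "y \<in> Y" "z \<in> Y" "?X y = ?X z"
    then have "?X z y = \<one>\<^bsub>K\<^esub>" using single_same[of y "\<one>\<^bsub>K\<^esub>"] Y by (metis subsetD)
    then show "y = z" using yz Y by (auto simp: single_def split: if_splits)
  qed
  show thesis
  proof
    show "finite (?X ` Y)" using Y by simp
    show "?X ` Y \<subseteq> carrier F" using single_closed by auto
    fix x assume x: "x \<in> carrier F"
    \<comment> \<open>The coefficient of the generator in degree \<open>y\<close> collects the
      degrees whose chosen representative is \<open>y\<close>, shifted into \<open>rG\<close>. The
      factor \<open>inv c (y, h)\<close> cancels the one that arises when the generator is
      multiplied back.\<close>
    define a where "a y = (\<lambda>h\<in>carrier G. if h \<in> rG \<and> rep (h \<otimes>\<^bsub>G\<^esub> y) = y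
      then inv\<^bsub>K\<^esub> c (y, h) \<otimes>\<^bsub>K\<^esub> x (h \<otimes>\<^bsub>G\<^esub> y) else \<zero>\<^bsub>K\<^esub>)" for y
    have a: "a y \<in> R" if y: "y \<in> Y" for y
    proof (rule R_I)
      have yG: "y \<in> carrier G" using y Y by blast
      show "a y \<in> carrier F"
        unfolding a_def
      proof (rule F_I[where U = "(\<lambda>g. g \<otimes>\<^bsub>G\<^esub> inv\<^bsub>G\<^esub> y) ` supp x"])
        fix h assume h: "h \<in> carrier G" "h \<notin> (\<lambda>g. g \<otimes>\<^bsub>G\<^esub> inv\<^bsub>G\<^esub> y) ` supp x"
        have "h = (h \<otimes>\<^bsub>G\<^esub> y) \<otimes>\<^bsub>G\<^esub> inv\<^bsub>G\<^esub> y" using h yG by (simp add: G.m_assoc)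
        then have "h \<otimes>\<^bsub>G\<^esub> y \<notin> supp x" using h(2) by blast
        then have "x (h \<otimes>\<^bsub>G\<^esub> y) = \<zero>\<^bsub>K\<^esub>" using h yG by (simp add: notin_supp)
        then show "(if h \<in> rG \<and> rep (h \<otimes>\<^bsub>G\<^esub> y) = y then inv\<^bsub>K\<^esub> c (y, h) \<otimes>\<^bsub>K\<^esub> x (h \<otimes>\<^bsub>G\<^esub> y) else \<zero>\<^bsub>K\<^esub>) = \<zero>\<^bsub>K\<^esub>"
          using c_Units[OF yG h(1)] by simp
      qed (use x yG c_Units finite_supp[OF x] in auto)
    qed (simp add: a_def)
    let ?b = "\<lambda>z. a (inv_into Y ?X z)"
    have b: "?b (?X y) = a y" if "y \<in> Y" for y using inv_into_f_f[OF X_inj that] by simp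
    have summand: "a y \<otimes>\<^bsub>F\<^esub> ?X y \<in> carrier F" if "y \<in> Y" for y
      using R_carrier[OF a[OF that]] single_closed by (intro mult_F_closed) auto
    have "x = (\<Oplus>\<^bsub>F\<^esub>y\<in>Y. a y \<otimes>\<^bsub>F\<^esub> ?X y)"
    proof (rule F_eqI[OF x])
      show "(\<Oplus>\<^bsub>F\<^esub>y\<in>Y. a y \<otimes>\<^bsub>F\<^esub> ?X y) \<in> carrier F" using summand by (intro F.finsum_closed) auto
      fix f assume f: "f \<in> carrier G"
      have eval: "(a y \<otimes>\<^bsub>F\<^esub> ?X y) f = (if rep f = y then x f else \<zero>\<^bsub>K\<^esub>)" if y: "y \<in> Y" for y
      proof -
        have yG: "y \<in> carrier G" using y Y by blast
        let ?h = "inv\<^bsub>G\<^esub> y \<otimes>\<^bsub>G\<^esub> f"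
        have h: "?h \<in> carrier G" "?h = f \<otimes>\<^bsub>G\<^esub> inv\<^bsub>G\<^esub> y"
          using yG f by (auto intro: G.m_comm)
        have hy: "?h \<otimes>\<^bsub>G\<^esub> y = f" unfolding h(2) using yG f by (simp add: G.m_assoc)
        have "(a y \<otimes>\<^bsub>F\<^esub> ?X y) f = (?X y \<otimes>\<^bsub>F\<^esub> a y) f"
          using R_carrier[OF a[OF y]] single_closed F.m_comm by simp
        also have "\<dots> = c (y, ?h) \<otimes>\<^bsub>K\<^esub> (\<one>\<^bsub>K\<^esub> \<otimes>\<^bsub>K\<^esub> a y ?h)"
          using yG f R_carrier[OF a[OF y]] by (intro single_mult) auto
        also have "\<dots> = (if rep f = y then x f else \<zero>\<^bsub>K\<^esub>)"
        proof (cases "rep f = y")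
          case True
          then have "?h \<in> rG" using rep(2)[OF f] h(2) by simp
          then have "a y ?h = inv\<^bsub>K\<^esub> c (y, ?h) \<otimes>\<^bsub>K\<^esub> x f" using True h(1) hy by (simp add: a_def)
          moreover have "c (y, ?h) \<otimes>\<^bsub>K\<^esub> (inv\<^bsub>K\<^esub> c (y, ?h) \<otimes>\<^bsub>K\<^esub> x f) = x f"
            using c_Units[OF yG h(1)] x f by (subst K.m_assoc[symmetric]) auto
          ultimately show ?thesis using True c_Units[OF yG h(1)] x f by simp
        next
          case False
          then have "a y ?h = \<zero>\<^bsub>K\<^esub>" using h(1) hy by (simp add: a_def)
          then show ?thesis using False c_closed[OF yG h(1)] by simp
        qed
        finally show ?thesis .
      qed
      have "(\<Oplus>\<^bsub>F\<^esub>y\<in>Y. a y \<otimes>\<^bsub>F\<^esub> ?X y) f = (\<Oplus>\<^bsub>K\<^esub>y\<in>Y. (a y \<otimes>\<^bsub>F\<^esub> ?X y) f)"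
        using summand Y f by (intro finsum_F) auto
      also have "\<dots> = (\<Oplus>\<^bsub>K\<^esub>y\<in>Y. if rep f = y then x f else \<zero>\<^bsub>K\<^esub>)"
        using eval x f by (intro K.finsum_cong') auto
      also have "\<dots> = x f" using K.finsum_singleton[OF rep(1)[OF f] Y(2), of "\<lambda>_. x f"] x f by simp
      finally show "x f = (\<Oplus>\<^bsub>F\<^esub>y\<in>Y. a y \<otimes>\<^bsub>F\<^esub> ?X y) f" by simp
    qed
    also have "\<dots> = (\<Oplus>\<^bsub>F\<^esub>y\<in>Y. ?b (?X y) \<otimes>\<^bsub>F\<^esub> ?X y)"
      using b summand by (intro F.finsum_cong') auto
    also have "\<dots> = (\<Oplus>\<^bsub>F\<^esub>z\<in>?X ` Y. ?b z \<otimes>\<^bsub>F\<^esub> z)"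
      using b summand X_inj by (intro F.finsum_reindex[symmetric]) auto
    finally have "x = (\<Oplus>\<^bsub>F\<^esub>z\<in>?X ` Y. ?b z \<otimes>\<^bsub>F\<^esub> z)" .
    moreover have "?b \<in> ?X ` Y \<rightarrow> R" using a b by auto
    ultimately show "\<exists>a\<in>?X ` Y \<rightarrow> R. x = (\<Oplus>\<^bsub>F\<^esub>y\<in>?X ` Y. a y \<otimes>\<^bsub>F\<^esub> y)"
      by (intro bexI[of _ ?b])
  qed
qed

theorem noetherian_pullback_iff:
  assumes "finite_rank G"
  shows "noetherian_ring F' \<longleftrightarrow> noetherian_ring F"
proof
  interpret R: ring "F\<lparr>carrier := R\<rparr>" by (rule F.subring_is_ring[OF R_subring])
  assume "noetherian_ring F'"
  then have R: "noetherian_ring (F\<lparr>carrier := R\<rparr>)"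
    using noetherian_ring_iso R.ring_axioms ring_iso_set_sym[OF R.ring_axioms \<rho>_iso] by blast

  obtain Y where Y: "finite Y" "Y \<subseteq> carrier F"
    "\<And>x. x \<in> carrier F \<Longrightarrow> \<exists>a\<in>Y \<rightarrow> R. x = (\<Oplus>\<^bsub>F\<^esub>y\<in>Y. a y \<otimes>\<^bsub>F\<^esub> y)"
    using finite_over_R[OF assms] by blast
  show "noetherian_ring F"
    by (rule noetherian_finite_extension[OF F.is_cring R_subring R Y])
next
  assume "noetherian_ring F"
  then have "noetherian_ring (F\<lparr>carrier := R\<rparr>)"
  proof (rule noetherian_retract[OF _ F.is_cring R_subring])
    show "\<pi> (x \<oplus>\<^bsub>F\<^esub> y) = \<pi> x \<oplus>\<^bsub>F\<^esub> \<pi> y" if "x \<in> carrier F" "y \<in> carrier F" for x y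
      using that by (auto simp: \<pi>_def add_F intro!: restrict_ext)
    show "\<pi> a = a" if "a \<in> R" for a
      using R_carrier[OF that] R_zero[OF that] R_carrier[OF \<pi>_closed] by (intro F_eqI) (auto simp: \<pi>_def)
  qed (auto intro: \<pi>_closed \<pi>_mult)
  then show "noetherian_ring F'"
    using noetherian_ring_iso C'.F.ring_axioms \<rho>_iso by blast
qed

end

section \<open>Noetherian group algebras and finite generation\<close>

context twisted_algebra
begin

text \<open>For the trivial cocycle this is the coefficient at the coset \<open>gH\<close> of the
  image of \<open>a\<close> in \<open>k[G/H]\<close>.\<close>

definition coset_sum :: "'g set \<Rightarrow> 'g \<Rightarrow> ('g \<Rightarrow> 'k) \<Rightarrow> 'k"
  where "coset_sum H g a = (\<Oplus>\<^bsub>K\<^esub>x\<in>{x \<in> supp a. inv\<^bsub>G\<^esub> g \<otimes>\<^bsub>G\<^esub> x \<in> H}. a x)"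

lemma coset_sum_eq:
  assumes "a \<in> carrier F" "finite U" "U \<subseteq> carrier G" "supp a \<subseteq> U"
  shows "coset_sum H g a = (\<Oplus>\<^bsub>K\<^esub>x\<in>{x \<in> U. inv\<^bsub>G\<^esub> g \<otimes>\<^bsub>G\<^esub> x \<in> H}. a x)"
  unfolding coset_sum_def using assms
  by (intro K.add.finprod_mono_neutral_cong_left) (auto simp: notin_supp subset_iff)

lemma coset_sum_add:
  assumes a: "a \<in> carrier F" and b: "b \<in> carrier F"
  shows "coset_sum H g (a \<oplus>\<^bsub>F\<^esub> b) = coset_sum H g a \<oplus>\<^bsub>K\<^esub> coset_sum H g b"
proof -
  let ?U = "supp a \<union> supp b"
  let ?C = "{x \<in> ?U. inv\<^bsub>G\<^esub> g \<otimes>\<^bsub>G\<^esub> x \<in> H}"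
  have U: "finite ?U" "?U \<subseteq> carrier G" using a b finite_supp supp_subset by auto
  have "supp (a \<oplus>\<^bsub>F\<^esub> b) \<subseteq> ?U" by (auto simp: supp_def add_F)
  then have "coset_sum H g (a \<oplus>\<^bsub>F\<^esub> b) = (\<Oplus>\<^bsub>K\<^esub>x\<in>?C. (a \<oplus>\<^bsub>F\<^esub> b) x)"
    by (rule coset_sum_eq[OF add_F_closed[OF a b] U])
  also have "\<dots> = (\<Oplus>\<^bsub>K\<^esub>x\<in>?C. a x \<oplus>\<^bsub>K\<^esub> b x)"
    using U a b by (intro K.finsum_cong') (auto simp: add_F subset_iff)
  also have "\<dots> = (\<Oplus>\<^bsub>K\<^esub>x\<in>?C. a x) \<oplus>\<^bsub>K\<^esub> (\<Oplus>\<^bsub>K\<^esub>x\<in>?C. b x)"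
    using U a b by (intro K.finsum_addf) (auto simp: subset_iff)
  also have "(\<Oplus>\<^bsub>K\<^esub>x\<in>?C. a x) = coset_sum H g a" by (rule coset_sum_eq[OF a U, symmetric]) simp
  also have "(\<Oplus>\<^bsub>K\<^esub>x\<in>?C. b x) = coset_sum H g b" by (rule coset_sum_eq[OF b U, symmetric]) simp
  finally show ?thesis .
qed

text \<open>The kernel of \<open>k[G] \<rightarrow> k[G/H]\<close>.\<close>

definition coset_ideal :: "'g set \<Rightarrow> ('g \<Rightarrow> 'k) set"
  where "coset_ideal H = {a \<in> carrier F. \<forall>g\<in>carrier G. coset_sum H g a = \<zero>\<^bsub>K\<^esub>}"

text \<open>The coset sum of a product at \<open>g\<close> is the sum over \<open>x\<close> of
  \<open>b x\<close> times the coset sum of \<open>a\<close> at \<open>g\<close> divided by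
  \<open>x\<close>, and each of these vanishes.\<close>

lemma coset_sum_mult:
  assumes trivial: "\<And>g h. g \<in> carrier G \<Longrightarrow> h \<in> carrier G \<Longrightarrow> c (g, h) = \<one>\<^bsub>K\<^esub>"
    and b: "b \<in> carrier F" and a: "a \<in> coset_ideal H" and g: "g \<in> carrier G"
  shows "coset_sum H g (b \<otimes>\<^bsub>F\<^esub> a) = \<zero>\<^bsub>K\<^esub>"
proof -
  have aF: "a \<in> carrier F" and a0: "\<And>g. g \<in> carrier G \<Longrightarrow> coset_sum H g a = \<zero>\<^bsub>K\<^esub>"
    using a by (auto simp: coset_ideal_def)
  define W where "W = (\<lambda>(x, y). x \<otimes>\<^bsub>G\<^esub> y) ` (supp b \<times> supp a)"
  have W: "finite W" "W \<subseteq> carrier G" "supp (b \<otimes>\<^bsub>F\<^esub> a) \<subseteq> W"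
    using finite_supp[OF aF] finite_supp[OF b] supp_subset[of a] supp_subset[of b] mult_F_notin[OF b aF]
    unfolding W_def by (auto simp: supp_def[of "b \<otimes>\<^bsub>F\<^esub> a"])
  let ?C = "{f \<in> W. inv\<^bsub>G\<^esub> g \<otimes>\<^bsub>G\<^esub> f \<in> H}"
  have C: "finite ?C" "f \<in> carrier G" if "f \<in> ?C" for f using W that by auto
  have C_fin: "finite ?C" using W by auto
  have B: "x \<in> carrier G" if "x \<in> supp b" for x using that supp_subset by blast
  have t: "b x \<otimes>\<^bsub>K\<^esub> a (inv\<^bsub>G\<^esub> x \<otimes>\<^bsub>G\<^esub> f) \<in> carrier K" if "x \<in> supp b" "f \<in> ?C" for x f
    using B[OF that(1)] C(2)[OF that(2)] aF b by simp
  have "coset_sum H g (b \<otimes>\<^bsub>F\<^esub> a) = (\<Oplus>\<^bsub>K\<^esub>f\<in>?C. (b \<otimes>\<^bsub>F\<^esub> a) f)"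
    by (rule coset_sum_eq[OF mult_F_closed[OF b aF] W])
  also have "\<dots> = (\<Oplus>\<^bsub>K\<^esub>f\<in>?C. \<Oplus>\<^bsub>K\<^esub>x\<in>supp b. b x \<otimes>\<^bsub>K\<^esub> a (inv\<^bsub>G\<^esub> x \<otimes>\<^bsub>G\<^esub> f))"
  proof (rule K.finsum_cong')
    fix f assume f: "f \<in> ?C"
    have "(b \<otimes>\<^bsub>F\<^esub> a) f = (\<Oplus>\<^bsub>K\<^esub>x\<in>supp b. c (x, inv\<^bsub>G\<^esub> x \<otimes>\<^bsub>G\<^esub> f) \<otimes>\<^bsub>K\<^esub> (b x \<otimes>\<^bsub>K\<^esub> a (inv\<^bsub>G\<^esub> x \<otimes>\<^bsub>G\<^esub> f)))"
      by (rule mult_F[OF b aF C(2)[OF f] finite_supp[OF b] supp_subset order_refl])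
    also have "\<dots> = (\<Oplus>\<^bsub>K\<^esub>x\<in>supp b. b x \<otimes>\<^bsub>K\<^esub> a (inv\<^bsub>G\<^esub> x \<otimes>\<^bsub>G\<^esub> f))"
      using t[OF _ f] B C(2)[OF f] trivial by (intro K.finsum_cong') auto
    finally show "(b \<otimes>\<^bsub>F\<^esub> a) f = (\<Oplus>\<^bsub>K\<^esub>x\<in>supp b. b x \<otimes>\<^bsub>K\<^esub> a (inv\<^bsub>G\<^esub> x \<otimes>\<^bsub>G\<^esub> f))" .
  qed (use t in \<open>auto intro!: K.finsum_closed\<close>)
  also have "\<dots> = (\<Oplus>\<^bsub>K\<^esub>x\<in>supp b. \<Oplus>\<^bsub>K\<^esub>f\<in>?C. b x \<otimes>\<^bsub>K\<^esub> a (inv\<^bsub>G\<^esub> x \<otimes>\<^bsub>G\<^esub> f))"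
    using C_fin finite_supp[OF b] by (rule K.finsum_swap) (rule t)
  also have "\<dots> = \<zero>\<^bsub>K\<^esub>"
  proof (rule K.add.finprod_one_eqI)
    fix x assume xb: "x \<in> supp b"
    note x = B[OF xb]
    let ?g = "inv\<^bsub>G\<^esub> x \<otimes>\<^bsub>G\<^esub> g"
    let ?D = "{y \<in> supp a. inv\<^bsub>G\<^esub> ?g \<otimes>\<^bsub>G\<^esub> y \<in> H}"
    have a_car: "a (inv\<^bsub>G\<^esub> x \<otimes>\<^bsub>G\<^esub> f) \<in> carrier K" if "f \<in> ?C" for f using x C(2)[OF that] aF by simp
    have cancel: "inv\<^bsub>G\<^esub> x \<otimes>\<^bsub>G\<^esub> (x \<otimes>\<^bsub>G\<^esub> y) = y" "x \<otimes>\<^bsub>G\<^esub> (inv\<^bsub>G\<^esub> x \<otimes>\<^bsub>G\<^esub> y) = y" if "y \<in> carrier G" for y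
      using x that by (simp_all flip: G.m_assoc)
    \<comment> \<open>Translation by \<open>x\<close> carries the coset of \<open>?g\<close> onto
      the coset of \<open>g\<close>. The inner sum over \<open>?C\<close> is therefore the coset sum
      of \<open>a\<close> at \<open>?g\<close>, the degrees outside the translated support
      contributing zero.\<close>
    have g_shift: "inv\<^bsub>G\<^esub> ?g \<otimes>\<^bsub>G\<^esub> y = inv\<^bsub>G\<^esub> g \<otimes>\<^bsub>G\<^esub> (x \<otimes>\<^bsub>G\<^esub> y)" if "y \<in> carrier G" for y
      using x g that by (simp add: G.inv_mult_group G.m_assoc)
    have D_C: "x \<otimes>\<^bsub>G\<^esub> y \<in> ?C" if "y \<in> ?D" for y
      using that g_shift[of y] supp_subset[of a] xb unfolding W_def by auto
    have "(\<Oplus>\<^bsub>K\<^esub>f\<in>?C. a (inv\<^bsub>G\<^esub> x \<otimes>\<^bsub>G\<^esub> f)) = (\<Oplus>\<^bsub>K\<^esub>f\<in>(\<lambda>y. x \<otimes>\<^bsub>G\<^esub> y) ` ?D. a (inv\<^bsub>G\<^esub> x \<otimes>\<^bsub>G\<^esub> f))"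
    proof (rule K.add.finprod_mono_neutral_cong_right[OF C_fin])
      show "(\<lambda>y. x \<otimes>\<^bsub>G\<^esub> y) ` ?D \<subseteq> ?C" using D_C by blast
      show "(\<lambda>f. a (inv\<^bsub>G\<^esub> x \<otimes>\<^bsub>G\<^esub> f)) \<in> ?C \<rightarrow> carrier K" using a_car by simp
      fix f assume f: "f \<in> ?C - (\<lambda>y. x \<otimes>\<^bsub>G\<^esub> y) ` ?D"
      then have fG: "f \<in> carrier G" using C(2) by blast
      have "inv\<^bsub>G\<^esub> x \<otimes>\<^bsub>G\<^esub> f \<notin> supp a"
      proof
        assume "inv\<^bsub>G\<^esub> x \<otimes>\<^bsub>G\<^esub> f \<in> supp a"
        then have "inv\<^bsub>G\<^esub> x \<otimes>\<^bsub>G\<^esub> f \<in> ?D" using f g_shift[of "inv\<^bsub>G\<^esub> x \<otimes>\<^bsub>G\<^esub> f"] x fG cancel(2)[OF fG] by auto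
        then have "x \<otimes>\<^bsub>G\<^esub> (inv\<^bsub>G\<^esub> x \<otimes>\<^bsub>G\<^esub> f) \<in> (\<lambda>y. x \<otimes>\<^bsub>G\<^esub> y) ` ?D" by (rule imageI)
        then show False using f cancel(2)[OF fG] by simp
      qed
      then show "a (inv\<^bsub>G\<^esub> x \<otimes>\<^bsub>G\<^esub> f) = \<zero>\<^bsub>K\<^esub>" using x fG by (simp add: notin_supp)
    qed simp
    also have "\<dots> = (\<Oplus>\<^bsub>K\<^esub>y\<in>?D. a (inv\<^bsub>G\<^esub> x \<otimes>\<^bsub>G\<^esub> (x \<otimes>\<^bsub>G\<^esub> y)))"
    proof (rule K.finsum_reindex)
      show "(\<lambda>f. a (inv\<^bsub>G\<^esub> x \<otimes>\<^bsub>G\<^esub> f)) \<in> (\<lambda>y. x \<otimes>\<^bsub>G\<^esub> y) ` ?D \<rightarrow> carrier K" using a_car D_C by blast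
      show "inj_on (\<lambda>y. x \<otimes>\<^bsub>G\<^esub> y) ?D" using x supp_subset[of a] by (auto simp: inj_on_def subset_iff)
    qed
    also have "\<dots> = coset_sum H ?g a"
      unfolding coset_sum_def using cancel(1) supp_subset[of a] aF by (intro K.finsum_cong') auto
    also have "\<dots> = \<zero>\<^bsub>K\<^esub>" using a0 x g by simp
    finally have "(\<Oplus>\<^bsub>K\<^esub>f\<in>?C. a (inv\<^bsub>G\<^esub> x \<otimes>\<^bsub>G\<^esub> f)) = \<zero>\<^bsub>K\<^esub>" .
    moreover have "(\<Oplus>\<^bsub>K\<^esub>f\<in>?C. b x \<otimes>\<^bsub>K\<^esub> a (inv\<^bsub>G\<^esub> x \<otimes>\<^bsub>G\<^esub> f)) = b x \<otimes>\<^bsub>K\<^esub> (\<Oplus>\<^bsub>K\<^esub>f\<in>?C. a (inv\<^bsub>G\<^esub> x \<otimes>\<^bsub>G\<^esub> f))"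
      using a_car b x C_fin by (intro K.finsum_rdistr[symmetric]) auto
    ultimately show "(\<Oplus>\<^bsub>K\<^esub>f\<in>?C. b x \<otimes>\<^bsub>K\<^esub> a (inv\<^bsub>G\<^esub> x \<otimes>\<^bsub>G\<^esub> f)) = \<zero>\<^bsub>K\<^esub>" using b x by simp
  qed
  finally show ?thesis .
qed

lemma coset_ideal_ideal:
  assumes trivial: "\<And>g h. g \<in> carrier G \<Longrightarrow> h \<in> carrier G \<Longrightarrow> c (g, h) = \<one>\<^bsub>K\<^esub>"
  shows "ideal (coset_ideal H) F"
proof (rule idealI[OF F.ring_axioms])
  have mult: "b \<otimes>\<^bsub>F\<^esub> a \<in> coset_ideal H" if "b \<in> carrier F" "a \<in> coset_ideal H" for a b
    using coset_sum_mult[OF trivial that] that mult_F_closed by (auto simp: coset_ideal_def)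
  show "subgroup (coset_ideal H) (add_monoid F)"
  proof (rule F.add.subgroupI)
    show "coset_ideal H \<subseteq> carrier F" by (auto simp: coset_ideal_def)
    have "supp \<zero>\<^bsub>F\<^esub> = {}" by (auto simp: supp_def zero_F)
    then have "\<zero>\<^bsub>F\<^esub> \<in> coset_ideal H" by (simp add: coset_ideal_def coset_sum_def zero_F_closed)
    then show "coset_ideal H \<noteq> {}" by blast
    show "\<ominus>\<^bsub>F\<^esub> a \<in> coset_ideal H" if "a \<in> coset_ideal H" for a
      using mult[OF _ that, of "\<ominus>\<^bsub>F\<^esub> \<one>\<^bsub>F\<^esub>"] that F.l_minus[of "\<one>\<^bsub>F\<^esub>" a] by (simp add: coset_ideal_def)
    show "a \<oplus>\<^bsub>F\<^esub> b \<in> coset_ideal H" if "a \<in> coset_ideal H" "b \<in> coset_ideal H" for a b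
      using that by (auto simp: coset_ideal_def coset_sum_add add_F_closed)
  qed
  show "x \<otimes>\<^bsub>F\<^esub> a \<in> coset_ideal H" "a \<otimes>\<^bsub>F\<^esub> x \<in> coset_ideal H" if "a \<in> coset_ideal H" "x \<in> carrier F" for a x
    using mult[OF that(2,1)] F.m_comm[of x a] that by (auto simp: coset_ideal_def)
qed

text \<open>Let \<open>H\<close> be generated by the supports of finitely many generators of the
  augmentation ideal. These generators die in \<open>k[G/H]\<close>, hence so does the whole
  augmentation ideal. It contains \<open>x_g - x_0\<close> for every \<open>g\<close>, which dies
  only if \<open>g\<close> is in \<open>H\<close>.\<close>

theorem finitely_generated_if_noetherian:
  assumes trivial: "\<And>g h. g \<in> carrier G \<Longrightarrow> h \<in> carrier G \<Longrightarrow> c (g, h) = \<one>\<^bsub>K\<^esub>"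
    and noeth: "noetherian_ring F"
  shows "finitely_generated G"
proof -
  have "ideal (coset_ideal (carrier G)) F" by (rule coset_ideal_ideal[OF trivial])
  then obtain A where A: "A \<subseteq> carrier F" "finite A" "coset_ideal (carrier G) = Idl\<^bsub>F\<^esub> A"
    using noetherian_ring.finetely_gen[OF noeth] by metis
  define T where "T = (\<Union>a\<in>A. supp a)"
  have T: "finite T" "T \<subseteq> carrier G"
    unfolding T_def using A(1,2) finite_supp by (blast, intro UN_least supp_subset)
  define H where "H = generate G T"
  have H: "subgroup H G" unfolding H_def by (rule G.generate_is_subgroup[OF T(2)])
  have "A \<subseteq> coset_ideal H"
  proof
    fix a assume a: "a \<in> A"
    have "a \<in> coset_ideal (carrier G)" unfolding A(3) using F.genideal_self[OF A(1)] a by blast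
    then have aF: "a \<in> carrier F" and "coset_sum (carrier G) \<one>\<^bsub>G\<^esub> a = \<zero>\<^bsub>K\<^esub>" by (auto simp: coset_ideal_def)
    moreover have "{x \<in> supp a. inv\<^bsub>G\<^esub> \<one>\<^bsub>G\<^esub> \<otimes>\<^bsub>G\<^esub> x \<in> carrier G} = supp a" using supp_subset[of a] by auto
    ultimately have sum: "(\<Oplus>\<^bsub>K\<^esub>x\<in>supp a. a x) = \<zero>\<^bsub>K\<^esub>" unfolding coset_sum_def by simp
    have suppH: "x \<in> H" if "x \<in> supp a" for x
      unfolding H_def T_def using a that by (intro generate.incl) blast
    \<comment> \<open>The support of \<open>a\<close> is contained in \<open>H\<close>, so the sum
      over a coset is either empty or the sum of all coefficients, which is zero by the choice of
      \<open>a\<close>.\<close>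
    have "coset_sum H g a = \<zero>\<^bsub>K\<^esub>" if g: "g \<in> carrier G" for g
    proof (cases "g \<in> H")
      case True
      have "inv\<^bsub>G\<^esub> g \<otimes>\<^bsub>G\<^esub> x \<in> H" if "x \<in> supp a" for x
        using subgroup.m_closed[OF H subgroup.m_inv_closed[OF H True] suppH[OF that]] .
      then have "{x \<in> supp a. inv\<^bsub>G\<^esub> g \<otimes>\<^bsub>G\<^esub> x \<in> H} = supp a" by blast
      then show ?thesis unfolding coset_sum_def by (simp only: sum)
    next
      case False
      have "inv\<^bsub>G\<^esub> g \<otimes>\<^bsub>G\<^esub> x \<notin> H" if "x \<in> supp a" for x
      proof
        assume "inv\<^bsub>G\<^esub> g \<otimes>\<^bsub>G\<^esub> x \<in> H"
        then have "x \<otimes>\<^bsub>G\<^esub> inv\<^bsub>G\<^esub> (inv\<^bsub>G\<^esub> g \<otimes>\<^bsub>G\<^esub> x) \<in> H"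
          by (intro subgroup.m_closed[OF H suppH[OF that]] subgroup.m_inv_closed[OF H])
        moreover have "x \<in> carrier G" using that supp_subset by blast
        then have "x \<otimes>\<^bsub>G\<^esub> inv\<^bsub>G\<^esub> (inv\<^bsub>G\<^esub> g \<otimes>\<^bsub>G\<^esub> x) = g" using g by (simp add: G.inv_mult_group flip: G.m_assoc)
        ultimately show False using False by simp
      qed
      then have "{x \<in> supp a. inv\<^bsub>G\<^esub> g \<otimes>\<^bsub>G\<^esub> x \<in> H} = {}" by blast
      then show ?thesis unfolding coset_sum_def by (simp only: K.finsum_empty)
    qed
    then show "a \<in> coset_ideal H" using aF by (simp add: coset_ideal_def)
  qed
  then have sub: "coset_ideal (carrier G) \<subseteq> coset_ideal H"
    unfolding A(3) using F.genideal_minimal[OF coset_ideal_ideal[OF trivial]] by blast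
  have "g \<in> H" if g: "g \<in> carrier G" for g
  proof (rule ccontr)
    assume "g \<notin> H"
    then have ne: "g \<noteq> \<one>\<^bsub>G\<^esub>" using subgroup.one_closed[OF H] by blast
    \<comment> \<open>This is \<open>x_g - x_0\<close>. Its coefficients cancel in \<open>G\<close>
      as a whole, but for \<open>g\<close> outside \<open>H\<close> the coset sum at the identity is
      \<open>\<ominus> \<one>\<close>.\<close>
    define d where "d = (\<lambda>x\<in>carrier G. if x = g then \<one>\<^bsub>K\<^esub> else if x = \<one>\<^bsub>G\<^esub> then \<ominus>\<^bsub>K\<^esub> \<one>\<^bsub>K\<^esub> else \<zero>\<^bsub>K\<^esub>)"
    have d: "d \<in> carrier F" unfolding d_def by (rule F_I[where U = "{g, \<one>\<^bsub>G\<^esub>}"]) auto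
    have sum: "coset_sum H' h d = (\<Oplus>\<^bsub>K\<^esub>x\<in>{x \<in> {g, \<one>\<^bsub>G\<^esub>}. inv\<^bsub>G\<^esub> h \<otimes>\<^bsub>G\<^esub> x \<in> H'}. d x)" for H' h
      by (rule coset_sum_eq[OF d]) (use g in \<open>auto simp: supp_def d_def\<close>)
    have vals: "d g = \<one>\<^bsub>K\<^esub>" "d \<one>\<^bsub>G\<^esub> = \<ominus>\<^bsub>K\<^esub> \<one>\<^bsub>K\<^esub>" using g ne by (auto simp: d_def)
    have "coset_sum (carrier G) h d = \<zero>\<^bsub>K\<^esub>" if h: "h \<in> carrier G" for h
    proof -
      have "{x \<in> {g, \<one>\<^bsub>G\<^esub>}. inv\<^bsub>G\<^esub> h \<otimes>\<^bsub>G\<^esub> x \<in> carrier G} = {g, \<one>\<^bsub>G\<^esub>}" using h g by auto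
      then have "coset_sum (carrier G) h d = (\<Oplus>\<^bsub>K\<^esub>x\<in>{g, \<one>\<^bsub>G\<^esub>}. d x)" unfolding sum by simp
      also have "\<dots> = \<one>\<^bsub>K\<^esub> \<oplus>\<^bsub>K\<^esub> \<ominus>\<^bsub>K\<^esub> \<one>\<^bsub>K\<^esub>" using ne vals by (simp add: K.finsum_insert)
      finally show ?thesis by (simp add: K.r_neg)
    qed
    then have "d \<in> coset_ideal H" using d sub by (auto simp: coset_ideal_def)
    then have "coset_sum H \<one>\<^bsub>G\<^esub> d = \<zero>\<^bsub>K\<^esub>" by (simp add: coset_ideal_def)
    moreover have "{x \<in> {g, \<one>\<^bsub>G\<^esub>}. inv\<^bsub>G\<^esub> \<one>\<^bsub>G\<^esub> \<otimes>\<^bsub>G\<^esub> x \<in> H} = {\<one>\<^bsub>G\<^esub>}"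
      using g \<open>g \<notin> H\<close> subgroup.one_closed[OF H] by auto
    ultimately have "d \<one>\<^bsub>G\<^esub> = \<zero>\<^bsub>K\<^esub>" unfolding sum using vals by (simp add: K.finsum_insert)
    then have "\<ominus>\<^bsub>K\<^esub> \<one>\<^bsub>K\<^esub> = \<zero>\<^bsub>K\<^esub>" using vals by simp
    then have "\<one>\<^bsub>K\<^esub> = \<zero>\<^bsub>K\<^esub>" using K.minus_minus[of "\<one>\<^bsub>K\<^esub>"] by simp
    then show False by simp
  qed
  then have "H = carrier G" using subgroup.subset[OF H] by blast
  then show ?thesis unfolding finitely_generated_def H_def using T by blast
qed

end

text \<open>It reduces linear and bilinear identities to homogeneous elements, where they become
  identities for the cocycle.\<close>

lemma (in twisted_algebra) F_induct [consumes 1, case_names single add]: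
  assumes "a \<in> carrier F"
    and single: "\<And>s g. s \<in> carrier K \<Longrightarrow> g \<in> carrier G \<Longrightarrow> P (single s g)"
    and add: "\<And>a b. a \<in> carrier F \<Longrightarrow> b \<in> carrier F \<Longrightarrow> P a \<Longrightarrow> P b \<Longrightarrow> P (a \<oplus>\<^bsub>F\<^esub> b)"
  shows "P a"
proof -
  have s: "single (a g) g \<in> carrier F" "P (single (a g) g)" if "g \<in> supp a" for g
    using assms(1) that supp_subset[of a] by (auto intro!: single_closed single)
  have "P (\<Oplus>\<^bsub>F\<^esub>g\<in>S. single (a g) g)" if "finite S" "S \<subseteq> supp a" for S
    using that
  proof (induction S)
    case empty
    have "P (single \<zero>\<^bsub>K\<^esub> \<one>\<^bsub>G\<^esub>)" by (rule single) auto
    then show ?case by (simp add: single_zero)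
  next
    case (insert g S)
    have "(\<Oplus>\<^bsub>F\<^esub>g\<in>insert g S. single (a g) g) = single (a g) g \<oplus>\<^bsub>F\<^esub> (\<Oplus>\<^bsub>F\<^esub>g\<in>S. single (a g) g)"
      using insert s by (intro F.finsum_insert) auto
    moreover have "(\<Oplus>\<^bsub>F\<^esub>g\<in>S. single (a g) g) \<in> carrier F" using insert s by (intro F.finsum_closed) auto
    ultimately show ?case using add[OF s(1) _ s(2)] insert by auto
  qed
  from this[OF finite_supp[OF assms(1)] order_refl] show ?thesis
    unfolding F_decomposition[OF assms(1), symmetric] .
qed

section \<open>Graded fields as twisted group algebras\<close>

context graded_field
begin

lemma component_closed: "g \<in> carrier G \<Longrightarrow> x \<in> component F g \<Longrightarrow> x \<in> carrier F"
  using additive_subgroup.a_subset[OF component_subgroup] by blast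

lemma scalar_component: "s \<in> carrier K \<Longrightarrow> s \<odot>\<^bsub>F\<^esub> \<one>\<^bsub>F\<^esub> \<in> component F \<one>\<^bsub>G\<^esub>"
  using component_zero by (auto simp: bij_betw_def)

lemma scalar_inj: "s \<in> carrier K \<Longrightarrow> t \<in> carrier K \<Longrightarrow> s \<odot>\<^bsub>F\<^esub> \<one>\<^bsub>F\<^esub> = t \<odot>\<^bsub>F\<^esub> \<one>\<^bsub>F\<^esub> \<Longrightarrow> s = t"
  using component_zero by (auto simp: bij_betw_def inj_on_def)

lemma scalar_ex: "x \<in> component F \<one>\<^bsub>G\<^esub> \<Longrightarrow> \<exists>s\<in>carrier K. x = s \<odot>\<^bsub>F\<^esub> \<one>\<^bsub>F\<^esub>"
  using component_zero by (auto simp: bij_betw_def)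

lemma smult_eq_mult: "s \<in> carrier K \<Longrightarrow> x \<in> carrier F \<Longrightarrow> s \<odot>\<^bsub>F\<^esub> x = (s \<odot>\<^bsub>F\<^esub> \<one>\<^bsub>F\<^esub>) \<otimes>\<^bsub>F\<^esub> x"
  by (simp add: smult_assoc2)

lemma smult_component:
  assumes "s \<in> carrier K" "g \<in> carrier G" "x \<in> component F g"
  shows "s \<odot>\<^bsub>F\<^esub> x \<in> component F g"
  using component_mult[OF G.one_closed assms(2) scalar_component[OF assms(1)] assms(3)]
    smult_eq_mult[OF assms(1) component_closed[OF assms(2,3)]] assms(2) by simp

lemma one_neq_zero: "\<one>\<^bsub>F\<^esub> \<noteq> \<zero>\<^bsub>F\<^esub>"
proof
  assume "\<one>\<^bsub>F\<^esub> = \<zero>\<^bsub>F\<^esub>"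
  then have "\<one>\<^bsub>K\<^esub> \<odot>\<^bsub>F\<^esub> \<one>\<^bsub>F\<^esub> = \<zero>\<^bsub>K\<^esub> \<odot>\<^bsub>F\<^esub> \<one>\<^bsub>F\<^esub>" by simp
  then have "\<one>\<^bsub>K\<^esub> = \<zero>\<^bsub>K\<^esub>" by (intro scalar_inj) auto
  then show False by simp
qed

lemma Units_nonzero: "x \<in> Units F \<Longrightarrow> x \<noteq> \<zero>\<^bsub>F\<^esub>"
  using one_neq_zero unfolding Units_def by auto

lemma Units_lcancel:
  assumes "z \<in> Units F" "x \<in> carrier F" "y \<in> carrier F" "z \<otimes>\<^bsub>F\<^esub> x = z \<otimes>\<^bsub>F\<^esub> y"
  shows "x = y"
  using Units_l_cancel[OF assms(1-3)] assms(4) by blast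

definition basis :: "'g \<Rightarrow> 'f"
  where "basis g = (SOME x. x \<in> component F g \<and> x \<noteq> \<zero>\<^bsub>F\<^esub>)"

lemma basis:
  assumes g: "g \<in> carrier G"
  shows "basis g \<in> component F g" "basis g \<noteq> \<zero>\<^bsub>F\<^esub>" "basis g \<in> Units F" "basis g \<in> carrier F"
proof -
  have "\<zero>\<^bsub>F\<^esub> \<in> component F g" using additive_subgroup.zero_closed[OF component_subgroup[OF g]] .
  then have "\<exists>x. x \<in> component F g \<and> x \<noteq> \<zero>\<^bsub>F\<^esub>" using component_nonzero[OF g] by blast
  then have *: "basis g \<in> component F g \<and> basis g \<noteq> \<zero>\<^bsub>F\<^esub>" unfolding basis_def by (rule someI_ex)
  then show "basis g \<in> component F g" "basis g \<noteq> \<zero>\<^bsub>F\<^esub>" by auto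
  then show "basis g \<in> Units F" "basis g \<in> carrier F"
    using homogeneous_invertible[OF g] component_closed[OF g] by auto
qed

lemma smult_basis_inj:
  assumes g: "g \<in> carrier G" and s: "s \<in> carrier K" "t \<in> carrier K" and eq: "s \<odot>\<^bsub>F\<^esub> basis g = t \<odot>\<^bsub>F\<^esub> basis g"
  shows "s = t"
proof -
  have eq': "basis g \<otimes>\<^bsub>F\<^esub> (s \<odot>\<^bsub>F\<^esub> \<one>\<^bsub>F\<^esub>) = basis g \<otimes>\<^bsub>F\<^esub> (t \<odot>\<^bsub>F\<^esub> \<one>\<^bsub>F\<^esub>)"
    using eq smult_eq_mult[OF s(1) basis(4)[OF g]] smult_eq_mult[OF s(2) basis(4)[OF g]] s basis(4)[OF g]
    by (simp add: m_comm[of "basis g"])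
  have "s \<odot>\<^bsub>F\<^esub> \<one>\<^bsub>F\<^esub> = t \<odot>\<^bsub>F\<^esub> \<one>\<^bsub>F\<^esub>"
    by (rule Units_lcancel[OF basis(3)[OF g] _ _ eq']) (use s in simp_all)
  then show ?thesis by (rule scalar_inj[OF s])
qed

text \<open>Multiplication by a nonzero element of degree \<open>inv g\<close> moves component
  \<open>g\<close> into component \<open>\<one>\<close>, which consists of scalars. There any
  element is a scalar multiple of the nonzero image of \<open>basis g\<close>, and the invertible
  factor can be cancelled.\<close>

lemma component_eq:
  assumes g: "g \<in> carrier G"
  shows "component F g = (\<lambda>s. s \<odot>\<^bsub>F\<^esub> basis g) ` carrier K"
proof
  show "(\<lambda>s. s \<odot>\<^bsub>F\<^esub> basis g) ` carrier K \<subseteq> component F g"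
    using smult_component[OF _ g basis(1)[OF g]] by auto
  show "component F g \<subseteq> (\<lambda>s. s \<odot>\<^bsub>F\<^esub> basis g) ` carrier K"
  proof
    fix y assume y: "y \<in> component F g"
    have yF: "y \<in> carrier F" using component_closed[OF g y] .
    have g': "inv\<^bsub>G\<^esub> g \<in> carrier G" using g by simp
    let ?z = "basis (inv\<^bsub>G\<^esub> g)"
    have "?z \<otimes>\<^bsub>F\<^esub> y \<in> component F \<one>\<^bsub>G\<^esub>" "?z \<otimes>\<^bsub>F\<^esub> basis g \<in> component F \<one>\<^bsub>G\<^esub>"
      using component_mult[OF g' g basis(1)[OF g']] y basis(1)[OF g] g by force+
    then obtain s t where st: "s \<in> carrier K" "?z \<otimes>\<^bsub>F\<^esub> y = s \<odot>\<^bsub>F\<^esub> \<one>\<^bsub>F\<^esub>" "t \<in> carrier K" "?z \<otimes>\<^bsub>F\<^esub> basis g = t \<odot>\<^bsub>F\<^esub> \<one>\<^bsub>F\<^esub>"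
      using scalar_ex by meson
    have "?z \<otimes>\<^bsub>F\<^esub> basis g \<noteq> \<zero>\<^bsub>F\<^esub>" using basis(3)[OF g] basis(3)[OF g'] by (intro Units_nonzero Units_m_closed)
    then have "t \<noteq> \<zero>\<^bsub>K\<^esub>" using st by auto
    then have t: "t \<in> Units K" using st K.field_Units by blast
    define q where "q = s \<otimes>\<^bsub>K\<^esub> inv\<^bsub>K\<^esub> t"
    have q: "q \<in> carrier K" "q \<otimes>\<^bsub>K\<^esub> t = s" using st t by (auto simp: q_def K.m_assoc)
    have "?z \<otimes>\<^bsub>F\<^esub> (q \<odot>\<^bsub>F\<^esub> basis g) = (q \<odot>\<^bsub>F\<^esub> basis g) \<otimes>\<^bsub>F\<^esub> ?z"
      using q basis(4)[OF g] basis(4)[OF g'] by (intro m_comm) auto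
    also have "\<dots> = q \<odot>\<^bsub>F\<^esub> (basis g \<otimes>\<^bsub>F\<^esub> ?z)" using q basis(4)[OF g] basis(4)[OF g'] by (intro smult_assoc2)
    also have "\<dots> = q \<odot>\<^bsub>F\<^esub> (t \<odot>\<^bsub>F\<^esub> \<one>\<^bsub>F\<^esub>)" using st(4) basis(4)[OF g] basis(4)[OF g'] by (simp add: m_comm)
    also have "\<dots> = s \<odot>\<^bsub>F\<^esub> \<one>\<^bsub>F\<^esub>" using q st by (simp flip: smult_assoc1)
    finally have "?z \<otimes>\<^bsub>F\<^esub> y = ?z \<otimes>\<^bsub>F\<^esub> (q \<odot>\<^bsub>F\<^esub> basis g)" using st(2) by simp
    then have "y = q \<odot>\<^bsub>F\<^esub> basis g"
      by (rule Units_lcancel[OF basis(3)[OF g'] yF, rotated]) (use q basis(4)[OF g] in simp)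
    then show "y \<in> (\<lambda>s. s \<odot>\<^bsub>F\<^esub> basis g) ` carrier K" using q by blast
  qed
qed

definition structure_cocycle :: "'g \<times> 'g \<Rightarrow> 'k"
  where "structure_cocycle = (\<lambda>(g, h)\<in>carrier G \<times> carrier G.
    SOME s. s \<in> carrier K \<and> basis g \<otimes>\<^bsub>F\<^esub> basis h = s \<odot>\<^bsub>F\<^esub> basis (g \<otimes>\<^bsub>G\<^esub> h))"

lemma structure_cocycle:
  assumes gh: "g \<in> carrier G" "h \<in> carrier G"
  shows "structure_cocycle (g, h) \<in> Units K"
    "basis g \<otimes>\<^bsub>F\<^esub> basis h = structure_cocycle (g, h) \<odot>\<^bsub>F\<^esub> basis (g \<otimes>\<^bsub>G\<^esub> h)"
proof -
  let ?P = "\<lambda>s. s \<in> carrier K \<and> basis g \<otimes>\<^bsub>F\<^esub> basis h = s \<odot>\<^bsub>F\<^esub> basis (g \<otimes>\<^bsub>G\<^esub> h)"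
  have "basis g \<otimes>\<^bsub>F\<^esub> basis h \<in> component F (g \<otimes>\<^bsub>G\<^esub> h)"
    using component_mult[OF gh basis(1)[OF gh(1)] basis(1)[OF gh(2)]] .
  then have "\<exists>s. ?P s" using component_eq[OF G.m_closed[OF gh]] by blast
  then have "?P (SOME s. ?P s)" by (rule someI_ex)
  then have P: "?P (structure_cocycle (g, h))" unfolding structure_cocycle_def using gh by simp
  then show "basis g \<otimes>\<^bsub>F\<^esub> basis h = structure_cocycle (g, h) \<odot>\<^bsub>F\<^esub> basis (g \<otimes>\<^bsub>G\<^esub> h)" by blast
  have "basis g \<otimes>\<^bsub>F\<^esub> basis h \<noteq> \<zero>\<^bsub>F\<^esub>" using basis(3) gh by (intro Units_nonzero Units_m_closed) auto
  then have "structure_cocycle (g, h) \<noteq> \<zero>\<^bsub>K\<^esub>" using P basis(4)[OF G.m_closed[OF gh]] by auto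
  then show "structure_cocycle (g, h) \<in> Units K" using P K.field_Units by blast
qed

text \<open>The cocycle identity and symmetry express associativity and commutativity of
  \<open>F\<close> on basis elements; the coefficients are compared in a component with a single
  basis vector.\<close>

lemma structure_cocycle_Z2S: "structure_cocycle \<in> Z2S G (units_of K)"
proof -
  interpret U: group_cohomology G "units_of K"
    by (intro group_cohomology.intro G.comm_group_axioms K.units_comm_group)
  let ?c = structure_cocycle
  have c: "?c (g, h) \<in> carrier K" if "g \<in> carrier G" "h \<in> carrier G" for g h
    using structure_cocycle(1)[OF that] K.Units_closed by blast
  have "?c (g, h) \<otimes>\<^bsub>K\<^esub> ?c (f, g \<otimes>\<^bsub>G\<^esub> h) = ?c (f \<otimes>\<^bsub>G\<^esub> g, h) \<otimes>\<^bsub>K\<^esub> ?c (f, g)"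
    if fgh: "f \<in> carrier G" "g \<in> carrier G" "h \<in> carrier G" for f g h
  proof (rule smult_basis_inj)
    let ?b = "basis (f \<otimes>\<^bsub>G\<^esub> (g \<otimes>\<^bsub>G\<^esub> h))"
    have b: "basis f \<in> carrier F" "basis g \<in> carrier F" "basis h \<in> carrier F" "?b \<in> carrier F"
      "basis (f \<otimes>\<^bsub>G\<^esub> g) \<in> carrier F" "basis (g \<otimes>\<^bsub>G\<^esub> h) \<in> carrier F"
      using basis(4) fgh by auto
    have "(?c (g, h) \<otimes>\<^bsub>K\<^esub> ?c (f, g \<otimes>\<^bsub>G\<^esub> h)) \<odot>\<^bsub>F\<^esub> ?b = ?c (g, h) \<odot>\<^bsub>F\<^esub> (basis f \<otimes>\<^bsub>F\<^esub> basis (g \<otimes>\<^bsub>G\<^esub> h))"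
      using fgh b c by (simp add: smult_assoc1 structure_cocycle(2))
    also have "\<dots> = basis f \<otimes>\<^bsub>F\<^esub> (?c (g, h) \<odot>\<^bsub>F\<^esub> basis (g \<otimes>\<^bsub>G\<^esub> h))"
      using fgh b c smult_assoc2[of "?c (g, h)" "basis (g \<otimes>\<^bsub>G\<^esub> h)" "basis f"] by (simp add: m_comm)
    also have "\<dots> = (basis f \<otimes>\<^bsub>F\<^esub> basis g) \<otimes>\<^bsub>F\<^esub> basis h"
      using fgh b by (simp add: m_assoc flip: structure_cocycle(2))
    also have "\<dots> = ?c (f, g) \<odot>\<^bsub>F\<^esub> (basis (f \<otimes>\<^bsub>G\<^esub> g) \<otimes>\<^bsub>F\<^esub> basis h)"
      using fgh b c by (simp add: structure_cocycle(2)[of f g] smult_assoc2)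
    also have "\<dots> = (?c (f, g) \<otimes>\<^bsub>K\<^esub> ?c (f \<otimes>\<^bsub>G\<^esub> g, h)) \<odot>\<^bsub>F\<^esub> ?b"
      using fgh b c by (simp add: structure_cocycle(2)[of "f \<otimes>\<^bsub>G\<^esub> g" h] smult_assoc1 G.m_assoc)
    also have "?c (f, g) \<otimes>\<^bsub>K\<^esub> ?c (f \<otimes>\<^bsub>G\<^esub> g, h) = ?c (f \<otimes>\<^bsub>G\<^esub> g, h) \<otimes>\<^bsub>K\<^esub> ?c (f, g)"
      using fgh c by (intro K.m_comm) auto
    finally show "(?c (g, h) \<otimes>\<^bsub>K\<^esub> ?c (f, g \<otimes>\<^bsub>G\<^esub> h)) \<odot>\<^bsub>F\<^esub> ?b = (?c (f \<otimes>\<^bsub>G\<^esub> g, h) \<otimes>\<^bsub>K\<^esub> ?c (f, g)) \<odot>\<^bsub>F\<^esub> ?b" .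
  qed (use fgh c in auto)
  moreover have "?c (g, h) = ?c (h, g)" if gh: "g \<in> carrier G" "h \<in> carrier G" for g h
  proof (rule smult_basis_inj[OF G.m_closed[OF gh] c[OF gh] c[OF gh(2,1)]])
    have "basis g \<otimes>\<^bsub>F\<^esub> basis h = basis h \<otimes>\<^bsub>F\<^esub> basis g" using basis(4) gh by (intro m_comm) auto
    then show "?c (g, h) \<odot>\<^bsub>F\<^esub> basis (g \<otimes>\<^bsub>G\<^esub> h) = ?c (h, g) \<odot>\<^bsub>F\<^esub> basis (g \<otimes>\<^bsub>G\<^esub> h)"
      using structure_cocycle(2)[OF gh] structure_cocycle(2)[OF gh(2,1)] G.m_comm[OF gh] by simp
  qed
  moreover have "?c \<in> carrier G \<times> carrier G \<rightarrow>\<^sub>E carrier (units_of K)"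
    using structure_cocycle(1) by (auto simp: PiE_iff structure_cocycle_def[unfolded restrict_def] units_of_carrier extensional_def)
  ultimately show ?thesis unfolding U.Z2S_iff by (simp add: units_of_mult)
qed

sublocale T: twisted_algebra G K structure_cocycle
  by (intro twisted_algebra.intro twisted_algebra_axioms.intro structure_cocycle_Z2S G.comm_group_axioms K.field_axioms)

definition \<theta> :: "('g \<Rightarrow> 'k) \<Rightarrow> 'f"
  where "\<theta> a = (\<Oplus>\<^bsub>F\<^esub>g\<in>T.supp a. a g \<odot>\<^bsub>F\<^esub> basis g)"

lemma smult_basis_closed: "a \<in> carrier T.F \<Longrightarrow> g \<in> carrier G \<Longrightarrow> a g \<odot>\<^bsub>F\<^esub> basis g \<in> carrier F"
  using basis(4) by auto

lemma \<theta>_eq: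
  assumes a: "a \<in> carrier T.F" and U: "finite U" "U \<subseteq> carrier G" "T.supp a \<subseteq> U"
  shows "\<theta> a = (\<Oplus>\<^bsub>F\<^esub>g\<in>U. a g \<odot>\<^bsub>F\<^esub> basis g)"
  unfolding \<theta>_def using U smult_basis_closed[OF a] basis(4)
  by (intro add.finprod_mono_neutral_cong_left) (auto simp: T.notin_supp subset_iff)

lemma \<theta>_closed: "a \<in> carrier T.F \<Longrightarrow> \<theta> a \<in> carrier F"
  unfolding \<theta>_def using smult_basis_closed T.supp_subset by (intro finsum_closed) blast

lemma \<theta>_add:
  assumes a: "a \<in> carrier T.F" and b: "b \<in> carrier T.F"
  shows "\<theta> (a \<oplus>\<^bsub>T.F\<^esub> b) = \<theta> a \<oplus>\<^bsub>F\<^esub> \<theta> b"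
proof -
  let ?U = "T.supp a \<union> T.supp b"
  have U: "finite ?U" "?U \<subseteq> carrier G" using a b T.finite_supp T.supp_subset by auto
  have "T.supp (a \<oplus>\<^bsub>T.F\<^esub> b) \<subseteq> ?U" by (auto simp: T.supp_def T.add_F)
  then have "\<theta> (a \<oplus>\<^bsub>T.F\<^esub> b) = (\<Oplus>\<^bsub>F\<^esub>g\<in>?U. (a \<oplus>\<^bsub>T.F\<^esub> b) g \<odot>\<^bsub>F\<^esub> basis g)"
    by (rule \<theta>_eq[OF T.add_F_closed[OF a b] U])
  also have "\<dots> = (\<Oplus>\<^bsub>F\<^esub>g\<in>?U. a g \<odot>\<^bsub>F\<^esub> basis g \<oplus>\<^bsub>F\<^esub> b g \<odot>\<^bsub>F\<^esub> basis g)"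
  proof (rule finsum_cong')
    fix g assume "g \<in> ?U"
    then have "g \<in> carrier G" using U by blast
    then show "(a \<oplus>\<^bsub>T.F\<^esub> b) g \<odot>\<^bsub>F\<^esub> basis g = a g \<odot>\<^bsub>F\<^esub> basis g \<oplus>\<^bsub>F\<^esub> b g \<odot>\<^bsub>F\<^esub> basis g"
      using a b basis(4) by (simp add: T.add_F smult_l_distr)
  qed (use U smult_basis_closed a b in blast)+
  also have "\<dots> = (\<Oplus>\<^bsub>F\<^esub>g\<in>?U. a g \<odot>\<^bsub>F\<^esub> basis g) \<oplus>\<^bsub>F\<^esub> (\<Oplus>\<^bsub>F\<^esub>g\<in>?U. b g \<odot>\<^bsub>F\<^esub> basis g)"
    by (rule finsum_addf) (use U smult_basis_closed a b in blast)+
  also have "(\<Oplus>\<^bsub>F\<^esub>g\<in>?U. a g \<odot>\<^bsub>F\<^esub> basis g) = \<theta> a" by (rule \<theta>_eq[OF a U, symmetric]) simp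
  also have "(\<Oplus>\<^bsub>F\<^esub>g\<in>?U. b g \<odot>\<^bsub>F\<^esub> basis g) = \<theta> b" by (rule \<theta>_eq[OF b U, symmetric]) simp
  finally show ?thesis .
qed

lemma \<theta>_single:
  assumes "s \<in> carrier K" "g \<in> carrier G"
  shows "\<theta> (T.single s g) = s \<odot>\<^bsub>F\<^esub> basis g"
proof -
  have "\<theta> (T.single s g) = (\<Oplus>\<^bsub>F\<^esub>h\<in>{g}. T.single s g h \<odot>\<^bsub>F\<^esub> basis h)"
    by (rule \<theta>_eq[OF T.single_closed]) (use assms T.supp_single in auto)
  then show ?thesis using assms basis(4) by (simp add: T.single_same)
qed

lemma \<theta>_smult:
  assumes s: "s \<in> carrier K" and a: "a \<in> carrier T.F"
  shows "\<theta> (s \<odot>\<^bsub>T.F\<^esub> a) = s \<odot>\<^bsub>F\<^esub> \<theta> a"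
  using a
proof (induction a rule: T.F_induct)
  case (single t g)
  then show ?case using s basis(4) by (simp add: T.smult_single \<theta>_single smult_assoc1)
next
  case (add a b)
  then show ?case
    using s \<theta>_closed by (simp add: T.F.smult_r_distr \<theta>_add T.smult_F_closed smult_r_distr)
qed

lemma \<theta>_mult:
  assumes a: "a \<in> carrier T.F" and b: "b \<in> carrier T.F"
  shows "\<theta> (a \<otimes>\<^bsub>T.F\<^esub> b) = \<theta> a \<otimes>\<^bsub>F\<^esub> \<theta> b"
  using a
proof (induction a rule: T.F_induct)
  case (single s g)
  note sg = single
  show ?case
    using b
  proof (induction b rule: T.F_induct)
    case (single t h)
    have c: "structure_cocycle (g, h) \<in> carrier K" using T.c_closed sg single by simp
    have "\<theta> (T.single s g \<otimes>\<^bsub>T.F\<^esub> T.single t h) = (structure_cocycle (g, h) \<otimes>\<^bsub>K\<^esub> (s \<otimes>\<^bsub>K\<^esub> t)) \<odot>\<^bsub>F\<^esub> basis (g \<otimes>\<^bsub>G\<^esub> h)"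
      using sg single c by (simp add: T.single_mult_single \<theta>_single)
    also have "\<dots> = (s \<otimes>\<^bsub>K\<^esub> t) \<odot>\<^bsub>F\<^esub> (basis g \<otimes>\<^bsub>F\<^esub> basis h)"
      using sg single c basis(4) by (simp add: structure_cocycle(2) K.m_comm[of _ "s \<otimes>\<^bsub>K\<^esub> t"] flip: smult_assoc1)
    also have "\<dots> = s \<odot>\<^bsub>F\<^esub> (t \<odot>\<^bsub>F\<^esub> (basis h \<otimes>\<^bsub>F\<^esub> basis g))"
      using sg single basis(4) by (simp add: smult_assoc1 m_comm)
    also have "\<dots> = s \<odot>\<^bsub>F\<^esub> (basis g \<otimes>\<^bsub>F\<^esub> (t \<odot>\<^bsub>F\<^esub> basis h))"
      using sg single basis(4) smult_assoc2[of t "basis h" "basis g"] by (simp add: m_comm)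
    also have "\<dots> = \<theta> (T.single s g) \<otimes>\<^bsub>F\<^esub> \<theta> (T.single t h)"
      using sg single basis(4) by (simp add: \<theta>_single smult_assoc2)
    finally show ?case .
  next
    case (add b b')
    have "T.single s g \<in> carrier T.F" using sg T.single_closed by simp
    then show ?case using add \<theta>_closed by (simp add: T.F.r_distr \<theta>_add T.mult_F_closed r_distr)
  qed
next
  case (add a a')
  then show ?case using b \<theta>_closed by (simp add: T.F.l_distr \<theta>_add T.mult_F_closed l_distr)
qed

text \<open>Coefficient functions \<open>a\<close> correspond to the families of homogeneous
  components in \<open>direct_sum\<close>, through \<open>a g \<odot> basis g\<close>. Uniqueness of
  the family gives injectivity, and its existence surjectivity.\<close>

lemma \<theta>_bij: "bij_betw \<theta> (carrier T.F) (carrier F)"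
proof -
  let ?S = "\<lambda>e. {g \<in> carrier G. e g \<noteq> \<zero>\<^bsub>F\<^esub>}"
  let ?Q = "\<lambda>x e. e \<in> (\<Pi>\<^sub>E g\<in>carrier G. component F g) \<and> finite (?S e) \<and> x = (\<Oplus>\<^bsub>F\<^esub>g\<in>?S e. e g)"
  have smult_zero_iff: "s \<odot>\<^bsub>F\<^esub> basis g = \<zero>\<^bsub>F\<^esub> \<longleftrightarrow> s = \<zero>\<^bsub>K\<^esub>" if "g \<in> carrier G" "s \<in> carrier K" for s g
    using smult_basis_inj[OF that K.zero_closed] basis(4)[OF that(1)] by auto
  have Q: "?Q (\<theta> a) (\<lambda>g\<in>carrier G. a g \<odot>\<^bsub>F\<^esub> basis g)" if a: "a \<in> carrier T.F" for a
  proof (intro conjI)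
    have S: "?S (\<lambda>g\<in>carrier G. a g \<odot>\<^bsub>F\<^esub> basis g) = T.supp a"
      using smult_zero_iff a by (auto simp: T.supp_def)
    show "(\<lambda>g\<in>carrier G. a g \<odot>\<^bsub>F\<^esub> basis g) \<in> (\<Pi>\<^sub>E g\<in>carrier G. component F g)"
      using a by (auto simp: component_eq)
    show "finite (?S (\<lambda>g\<in>carrier G. a g \<odot>\<^bsub>F\<^esub> basis g))" unfolding S using T.finite_supp[OF a] .
    show "\<theta> a = (\<Oplus>\<^bsub>F\<^esub>g\<in>?S (\<lambda>g\<in>carrier G. a g \<odot>\<^bsub>F\<^esub> basis g). (\<lambda>g\<in>carrier G. a g \<odot>\<^bsub>F\<^esub> basis g) g)"
      unfolding S \<theta>_def using T.supp_subset[of a] smult_basis_closed[OF a] by (intro finsum_cong') (auto simp: subset_iff)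
  qed
  have "inj_on \<theta> (carrier T.F)"
  proof (rule inj_onI)
    fix a b assume a: "a \<in> carrier T.F" and b: "b \<in> carrier T.F" and eq: "\<theta> a = \<theta> b"
    from direct_sum[OF \<theta>_closed[OF a]] obtain e where e: "\<forall>e'. ?Q (\<theta> a) e' \<longrightarrow> e' = e" by (elim ex1E)
    have *: "(\<lambda>g\<in>carrier G. a g \<odot>\<^bsub>F\<^esub> basis g) = (\<lambda>g\<in>carrier G. b g \<odot>\<^bsub>F\<^esub> basis g)"
      using mp[OF spec[OF e] Q[OF a]] mp[OF spec[OF e] Q[OF b, folded eq]] by (rule trans[OF _ sym])
    show "a = b"
    proof (rule T.F_eqI[OF a b])
      fix g assume g: "g \<in> carrier G"
      have "a g \<odot>\<^bsub>F\<^esub> basis g = b g \<odot>\<^bsub>F\<^esub> basis g" using fun_cong[OF *, of g] g by simp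
      then show "a g = b g" using a b g by (intro smult_basis_inj) auto
    qed
  qed
  moreover have "\<exists>a\<in>carrier T.F. x = \<theta> a" if x: "x \<in> carrier F" for x
  proof -
    obtain e where e: "?Q x e" using ex1_implies_ex[OF direct_sum[OF x]] by (elim exE)
    have "\<exists>s\<in>carrier K. e g = s \<odot>\<^bsub>F\<^esub> basis g" if "g \<in> carrier G" for g
    proof -
      have "e g \<in> component F g" using e that by auto
      then show ?thesis unfolding component_eq[OF that] by blast
    qed
    then obtain s where s: "\<And>g. g \<in> carrier G \<Longrightarrow> s g \<in> carrier K \<and> e g = s g \<odot>\<^bsub>F\<^esub> basis g" by metis
    let ?a = "\<lambda>g\<in>carrier G. s g"
    have S: "T.supp ?a = ?S e" using s smult_zero_iff by (auto simp: T.supp_def)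
    have "?a \<in> carrier T.F" unfolding T.carrier_F S using s e by auto
    moreover have "x = \<theta> ?a"
    proof -
      have "x = (\<Oplus>\<^bsub>F\<^esub>g\<in>?S e. e g)" using e by blast
      also have "\<dots> = \<theta> ?a" unfolding \<theta>_def S using s basis(4) by (intro finsum_cong') auto
      finally show ?thesis .
    qed
    ultimately show ?thesis by blast
  qed
  ultimately show ?thesis unfolding bij_betw_def using \<theta>_closed by blast
qed

theorem \<theta>_iso: "\<theta> \<in> graded_algebra_iso G K T.F F"
proof -
  obtain e where e: "e \<in> carrier T.F" "\<theta> e = \<one>\<^bsub>F\<^esub>"
    using \<theta>_bij one_closed unfolding bij_betw_def by (metis imageE)
  have "\<theta> e = \<theta> e \<otimes>\<^bsub>F\<^esub> \<theta> \<one>\<^bsub>T.F\<^esub>" using \<theta>_mult[OF e(1) T.one_F_closed] e(1) by simp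
  then have "\<theta> \<one>\<^bsub>T.F\<^esub> = \<one>\<^bsub>F\<^esub>" using e \<theta>_closed[OF T.one_F_closed] by simp
  then have "\<theta> \<in> ring_iso T.F F"
    by (intro ring_iso_memI) (auto intro: \<theta>_closed \<theta>_mult \<theta>_add \<theta>_bij)
  moreover have "\<theta> ` component T.F g = component F g" if "g \<in> carrier G" for g
    using \<theta>_single that by (auto simp: component_eq T.component_F image_iff)
  ultimately show ?thesis unfolding graded_algebra_iso_def using \<theta>_smult by blast
qed

end

section \<open>Graded powers of twisted group algebras\<close>

context twisted_algebra_pullback
begin

text \<open>Homogeneous summands of degree in \<open>rG\<close> have no coefficients elsewhere, and
  conversely an element supported in \<open>rG\<close> is the sum of its homogeneous parts. This
  lets \<open>\<rho>\<close> act as an isomorphism of the graded power.\<close>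

lemma carrier_graded_power: "carrier (graded_power G r F) = R"
proof -
  let ?B = "\<lambda>S a. finite S \<and> S \<subseteq> rG \<and> a \<in> (\<Pi> g\<in>S. component F g)"
  have "(\<Oplus>\<^bsub>F\<^esub>g\<in>S. a g) \<in> R" if S: "?B S a" for S a
  proof (rule R_I)
    have SG: "g \<in> carrier G" if "g \<in> S" for g using S that by auto
    have ag: "a g \<in> (\<lambda>s. single s g) ` carrier K" if "g \<in> S" for g
      using S that component_F[OF SG[OF that]] by auto
    have aF: "a g \<in> carrier F" if "g \<in> S" for g using ag[OF that] single_closed by auto
    show "(\<Oplus>\<^bsub>F\<^esub>g\<in>S. a g) \<in> carrier F" using aF by (intro F.finsum_closed) auto
    fix h assume h: "h \<in> carrier G" "h \<notin> rG"
    have "a g h = \<zero>\<^bsub>K\<^esub>" if "g \<in> S" for g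
    proof -
      have "h \<noteq> g" using h(2) S that by blast
      then show ?thesis using ag[OF that] h(1) by (auto simp: single_def)
    qed
    then show "(\<Oplus>\<^bsub>F\<^esub>g\<in>S. a g) h = \<zero>\<^bsub>K\<^esub>"
      using finsum_F[of S a h] S aF h(1) by (simp add: K.add.finprod_one_eqI)
  qed
  moreover have "\<exists>S a. x = (\<Oplus>\<^bsub>F\<^esub>g\<in>S. a g) \<and> ?B S a" if x: "x \<in> R" for x
  proof (intro exI conjI)
    show "x = (\<Oplus>\<^bsub>F\<^esub>g\<in>supp x. single (x g) g)" by (rule F_decomposition[OF R_carrier[OF x]])
    show "finite (supp x)" "supp x \<subseteq> rG" using finite_supp[OF R_carrier[OF x]] x by (auto simp: R_def)
    show "(\<lambda>g. single (x g) g) \<in> (\<Pi> g\<in>supp x. component F g)"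
      using R_carrier[OF x] supp_subset[of x] by (auto simp: component_F subset_iff)
  qed
  ultimately show ?thesis unfolding graded_power_def by auto
qed

lemma \<rho>_graded_iso: "\<rho> \<in> graded_algebra_iso G K (graded_power G r F) F'"
proof -
  have fields: "monoid.mult (graded_power G r F) = monoid.mult F" "add (graded_power G r F) = add F"
    "one (graded_power G r F) = one F" "module.smult (graded_power G r F) = module.smult F"
    "component (graded_power G r F) = (\<lambda>g. component F (p g))"
    by (simp_all add: graded_power_def)
  have "\<rho> \<in> ring_iso (graded_power G r F) F'"
    using \<rho>_iso unfolding ring_iso_def ring_hom_def carrier_graded_power fields by simp
  moreover have "\<rho> (s \<odot>\<^bsub>F\<^esub> x) = s \<odot>\<^bsub>F'\<^esub> \<rho> x" if "s \<in> carrier K" "x \<in> R" for s x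
    using that R_carrier \<nu>_closed by (auto simp: \<rho>_def smult_F C'.smult_F K.m_lcomm intro!: restrict_ext)
  moreover have "\<rho> ` component F (p g) = component F' g" if g: "g \<in> carrier G" for g
  proof -
    have "\<rho> ` component F (p g) = (\<lambda>s. C'.single (\<nu> g \<otimes>\<^bsub>K\<^esub> s) g) ` carrier K"
      using \<rho>_single(2)[OF g] g unfolding component_F[OF G.int_pow_closed[OF g]] image_image by (intro image_cong) auto
    also have "\<dots> = (\<lambda>s. C'.single s g) ` ((\<lambda>s. \<nu> g \<otimes>\<^bsub>K\<^esub> s) ` carrier K)" by (simp add: image_image)
    also have "(\<lambda>s. \<nu> g \<otimes>\<^bsub>K\<^esub> s) ` carrier K = carrier K"
    proof
      show "carrier K \<subseteq> (\<lambda>s. \<nu> g \<otimes>\<^bsub>K\<^esub> s) ` carrier K"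
      proof
        fix s assume s: "s \<in> carrier K"
        then have "s = \<nu> g \<otimes>\<^bsub>K\<^esub> (inv\<^bsub>K\<^esub> \<nu> g \<otimes>\<^bsub>K\<^esub> s)" using \<nu>[OF g] by (subst K.m_assoc[symmetric]) auto
        then show "s \<in> (\<lambda>s. \<nu> g \<otimes>\<^bsub>K\<^esub> s) ` carrier K" using s \<nu>[OF g] by blast
      qed
    qed (use \<nu>_closed[OF g] in auto)
    finally show ?thesis unfolding C'.component_F[OF g] .
  qed
  ultimately show ?thesis unfolding graded_algebra_iso_def carrier_graded_power fields by blast
qed

end

lemma graded_algebra_iso_trans:
  assumes \<phi>: "\<phi> \<in> graded_algebra_iso G K A B" and \<psi>: "\<psi> \<in> graded_algebra_iso G K B C"
  shows "\<psi> \<circ> \<phi> \<in> graded_algebra_iso G K A C"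
proof -
  have iso: "\<phi> \<in> ring_iso A B" "\<psi> \<in> ring_iso B C"
    and smult: "\<And>s x. s \<in> carrier K \<Longrightarrow> x \<in> carrier A \<Longrightarrow> \<phi> (s \<odot>\<^bsub>A\<^esub> x) = s \<odot>\<^bsub>B\<^esub> \<phi> x"
      "\<And>s x. s \<in> carrier K \<Longrightarrow> x \<in> carrier B \<Longrightarrow> \<psi> (s \<odot>\<^bsub>B\<^esub> x) = s \<odot>\<^bsub>C\<^esub> \<psi> x"
    and image: "\<And>g. g \<in> carrier G \<Longrightarrow> \<phi> ` component A g = component B g"
      "\<And>g. g \<in> carrier G \<Longrightarrow> \<psi> ` component B g = component C g"
    using \<phi> \<psi> by (simp_all add: graded_algebra_iso_def)
  have closed: "\<phi> x \<in> carrier B" if "x \<in> carrier A" for x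
    using ring_iso_memE(1)[OF iso(1) that] .
  have "(\<psi> \<circ> \<phi>) ` component A g = component C g" if "g \<in> carrier G" for g
    unfolding image_comp[symmetric] image(1)[OF that] by (rule image(2)[OF that])
  then show ?thesis
    unfolding graded_algebra_iso_def using ring_iso_set_trans[OF iso] smult closed by simp
qed

section \<open>Noetherian classes\<close>

lemma noetherian_iff_of_pullback:
  assumes G: "comm_group G" "torsion_free G" "finite_rank G" and K: "field K"
    and c: "c \<in> Z2S G (units_of K)" and c': "c' \<in> Z2S G (units_of K)" and r: "(r::int) \<noteq> 0"
    and \<mu>: "\<mu> \<in> carrier G \<rightarrow> carrier (units_of K)"
    and eq: "\<And>g h. g \<in> carrier G \<Longrightarrow> h \<in> carrier G \<Longrightarrow>
      c' (g, h) \<otimes>\<^bsub>units_of K\<^esub> \<mu> (g \<otimes>\<^bsub>G\<^esub> h) = c (g [^]\<^bsub>G\<^esub> r, h [^]\<^bsub>G\<^esub> r) \<otimes>\<^bsub>units_of K\<^esub> \<mu> g \<otimes>\<^bsub>units_of K\<^esub> \<mu> h"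
  shows "noetherian_ring (twisted_group_algebra G K c') \<longleftrightarrow> noetherian_ring (twisted_group_algebra G K c)"
proof -
  interpret G: comm_group G by fact
  interpret K: field K by fact
  interpret A: comm_group "units_of K" by (rule K.units_comm_group)
  interpret C: group_cohomology G "units_of K" ..
  \<comment> \<open>The locale wants the correcting cochain at the sum \<open>g \<otimes> h\<close>
    on the side of \<open>c\<close>, whereas \<open>eq\<close> has it on the side of
    \<open>c'\<close>; passing to inverses exchanges the two.\<close>
  define \<nu> where "\<nu> g = inv\<^bsub>units_of K\<^esub> \<mu> g" for g
  have \<mu>_car: "\<mu> g \<in> carrier (units_of K)" if "g \<in> carrier G" for g using \<mu> that by blast
  have solve: "y \<otimes>\<^bsub>units_of K\<^esub> inv\<^bsub>units_of K\<^esub> m = x \<otimes>\<^bsub>units_of K\<^esub> inv\<^bsub>units_of K\<^esub> a \<otimes>\<^bsub>units_of K\<^esub> inv\<^bsub>units_of K\<^esub> b"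
    if xm: "x \<otimes>\<^bsub>units_of K\<^esub> m = y \<otimes>\<^bsub>units_of K\<^esub> a \<otimes>\<^bsub>units_of K\<^esub> b"
      and car: "x \<in> carrier (units_of K)" "y \<in> carrier (units_of K)" "m \<in> carrier (units_of K)" "a \<in> carrier (units_of K)" "b \<in> carrier (units_of K)"
    for x y m a b
  proof -
    have "x = (y \<otimes>\<^bsub>units_of K\<^esub> a \<otimes>\<^bsub>units_of K\<^esub> b) \<otimes>\<^bsub>units_of K\<^esub> inv\<^bsub>units_of K\<^esub> m"
      unfolding xm[symmetric] using car by (simp add: A.m_assoc)
    also have "\<dots> = (y \<otimes>\<^bsub>units_of K\<^esub> inv\<^bsub>units_of K\<^esub> m) \<otimes>\<^bsub>units_of K\<^esub> (a \<otimes>\<^bsub>units_of K\<^esub> b)"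
      using car by (simp add: A.m_ac)
    finally have x: "x = (y \<otimes>\<^bsub>units_of K\<^esub> inv\<^bsub>units_of K\<^esub> m) \<otimes>\<^bsub>units_of K\<^esub> (a \<otimes>\<^bsub>units_of K\<^esub> b)" .
    have "x \<otimes>\<^bsub>units_of K\<^esub> inv\<^bsub>units_of K\<^esub> a \<otimes>\<^bsub>units_of K\<^esub> inv\<^bsub>units_of K\<^esub> b = x \<otimes>\<^bsub>units_of K\<^esub> inv\<^bsub>units_of K\<^esub> (a \<otimes>\<^bsub>units_of K\<^esub> b)"
      using car by (simp add: A.m_assoc A.inv_mult)
    also have "\<dots> = y \<otimes>\<^bsub>units_of K\<^esub> inv\<^bsub>units_of K\<^esub> m"
      by (rule A.inv_solve_right[THEN iffD2, symmetric, OF _ _ _ x]) (use car in auto)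
    finally show ?thesis by simp
  qed
  interpret P: twisted_algebra_pullback G K c c' r \<nu>
  proof
    show "c \<in> Z2S G (units_of K)" "c' \<in> Z2S G (units_of K)" "torsion_free G" "r \<noteq> 0" by fact+
    show "\<nu> g \<in> Units K" if "g \<in> carrier G" for g
      using A.inv_closed[OF \<mu>_car[OF that]] unfolding \<nu>_def units_of_carrier .
    show "c (g [^]\<^bsub>G\<^esub> r, h [^]\<^bsub>G\<^esub> r) \<otimes>\<^bsub>K\<^esub> \<nu> (g \<otimes>\<^bsub>G\<^esub> h) = c' (g, h) \<otimes>\<^bsub>K\<^esub> \<nu> g \<otimes>\<^bsub>K\<^esub> \<nu> h"
      if "g \<in> carrier G" "h \<in> carrier G" for g h
      using solve[OF eq[OF that] C.Z2S_closed[OF c' that] C.Z2S_closed[OF c G.int_pow_closed G.int_pow_closed]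
          \<mu>_car[OF G.m_closed[OF that]] \<mu>_car[OF that(1)] \<mu>_car[OF that(2)]] that
      unfolding \<nu>_def units_of_mult by blast
  qed
  show ?thesis by (rule P.noetherian_pullback_iff[OF G(3)])
qed

context
  fixes G :: "('g, 'a) monoid_scheme" and K :: "('k, 'b) ring_scheme"
  assumes G: "comm_group G" "torsion_free G" "finite_rank G" and K: "field K"
begin

interpretation G: comm_group G by (rule G)
interpretation K: field K by (rule K)
interpretation group_cohomology G "units_of K"
  by (intro group_cohomology.intro G K.units_comm_group)

text \<open>Independence of the representative: comparing cohomologous cocycles is the case
  \<open>r = 1\<close> of the pullback criterion.\<close>

lemma noetherian_classes_iff:
  assumes c: "c \<in> Z2S G (units_of K)"
  shows "coclass c \<in> noetherian_classes G K \<longleftrightarrow> noetherian_ring (twisted_group_algebra G K c)"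
proof
  assume "coclass c \<in> noetherian_classes G K"
  then obtain d where d: "d \<in> coclass c" "noetherian_ring (twisted_group_algebra G K d)"
    unfolding noetherian_classes_def by blast
  have dZ: "d \<in> Z2S G (units_of K)" using coclass_subset[OF c] d(1) by blast
  have "coclass c = coclass d"
    using Z.repr_independence[OF d(1) _ subgroup_B2S] c by simp
  then have "cohomologous c d" using coclass_eq_iff[OF c dZ] by blast
  then obtain \<mu> where \<mu>: "\<mu> \<in> carrier G \<rightarrow> carrier (units_of K)"
    "\<And>g h. g \<in> carrier G \<Longrightarrow> h \<in> carrier G \<Longrightarrow>
      c (g, h) \<otimes>\<^bsub>units_of K\<^esub> \<mu> (g \<otimes>\<^bsub>G\<^esub> h) = d (g, h) \<otimes>\<^bsub>units_of K\<^esub> \<mu> g \<otimes>\<^bsub>units_of K\<^esub> \<mu> h"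
    unfolding cohomologous_def by blast
  have "noetherian_ring (twisted_group_algebra G K c) \<longleftrightarrow> noetherian_ring (twisted_group_algebra G K d)"
    by (rule noetherian_iff_of_pullback[OF G K dZ c, of 1 \<mu>]) (use \<mu> in simp_all)
  then show "noetherian_ring (twisted_group_algebra G K c)" using d(2) by simp
next
  assume "noetherian_ring (twisted_group_algebra G K c)"
  then show "coclass c \<in> noetherian_classes G K"
    unfolding noetherian_classes_def carrier_H2S using c coclass_self[OF c] by blast
qed

text \<open>Negative exponents are included, so a class and its inverse are Noetherian together;
  this is why full lines arise and not half-lines.\<close>

lemma noetherian_classes_pow_iff:
  assumes C: "C \<in> carrier (H2S G (units_of K))" and r: "(r::int) \<noteq> 0"
  shows "C [^]\<^bsub>H2S G (units_of K)\<^esub> r \<in> noetherian_classes G K \<longleftrightarrow> C \<in> noetherian_classes G K"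
proof -
  obtain c where c: "c \<in> Z2S G (units_of K)" "C = coclass c" using C unfolding carrier_H2S by blast
  obtain D :: "(('k list \<times> nat) multiset \<Rightarrow> 'k) monoid" and \<iota>
    where "comm_group D" "divisible_group D" "\<iota> \<in> hom (units_of K) D" "inj_on \<iota> (carrier (units_of K))"
    using K.ex_divisible_hull_of_units .
  then interpret D: divisible_coefficients G "units_of K" D \<iota>
    by (intro divisible_coefficients.intro divisible_coefficients_axioms.intro group_cohomology_axioms)
  obtain \<mu> where \<mu>: "\<mu> \<in> carrier G \<rightarrow> carrier (units_of K)"
    "\<And>g h. g \<in> carrier G \<Longrightarrow> h \<in> carrier G \<Longrightarrow> cocycle_pow c r (g, h) \<otimes>\<^bsub>units_of K\<^esub> \<mu> (g \<otimes>\<^bsub>G\<^esub> h)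
      = c (g [^]\<^bsub>G\<^esub> r, h [^]\<^bsub>G\<^esub> r) \<otimes>\<^bsub>units_of K\<^esub> \<mu> g \<otimes>\<^bsub>units_of K\<^esub> \<mu> h"
    using D.cocycle_pow_pullback[OF c(1)] by blast
  show ?thesis
    unfolding c(2) H2S_int_pow[OF c(1)] noetherian_classes_iff[OF cocycle_pow_closed[OF c(1)]] noetherian_classes_iff[OF c(1)]
    by (rule noetherian_iff_of_pullback[OF G K c(1) cocycle_pow_closed[OF c(1)] r \<mu>])
qed

lemma one_notin_noetherian_classes:
  assumes "\<not> finitely_generated G"
  shows "\<one>\<^bsub>H2S G (units_of K)\<^esub> \<notin> noetherian_classes G K"
proof
  \<comment> \<open>The neutral class is represented by the constant cocycle, whose twisted algebra
    is the ordinary group algebra.\<close>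
  let ?c = "\<one>\<^bsub>ZS\<^esub>"
  have c: "?c \<in> Z2S G (units_of K)" using Z.one_closed by simp
  assume "\<one>\<^bsub>H2S G (units_of K)\<^esub> \<in> noetherian_classes G K"
  moreover have "\<one>\<^bsub>H2S G (units_of K)\<^esub> = coclass ?c"
    unfolding H2S_def one_FactGroup by (rule Z.coset_mult_one[symmetric]) (use B2S_subset in simp)
  ultimately have noeth: "noetherian_ring (twisted_group_algebra G K ?c)" using noetherian_classes_iff[OF c] by simp
  interpret T: twisted_algebra G K ?c
    by (intro twisted_algebra.intro twisted_algebra_axioms.intro G K c)
  have "?c (g, h) = \<one>\<^bsub>K\<^esub>" if "g \<in> carrier G" "h \<in> carrier G" for g h
    using that by (simp add: one_cochains2 units_of_one)
  then have "finitely_generated G" using noeth by (rule T.finitely_generated_if_noetherian)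
  then show False using assms by blast
qed

text \<open>\<open>F\<close> is isomorphic, through \<open>\<theta>\<close>, to the twisted algebra
  of its structure cocycle. A cocycle \<open>d\<close> whose pullback along \<open>r\<close> is that
  cocycle defines \<open>F'\<close>, and \<open>\<rho>\<close> followed by \<open>\<theta>\<close>
  is the required isomorphism.\<close>

lemma ex_graded_root:
  fixes F :: "('k, 'f, 'g) graded_algebra"
  assumes F: "graded_field G K F" and r: "(r::int) \<noteq> 0"
  shows "\<exists>F' :: ('k, 'g \<Rightarrow> 'k, 'g) graded_algebra.
    graded_field G K F' \<and> graded_algebra_iso G K (graded_power G r F') F \<noteq> {}"
proof -
  interpret F: graded_field G K F by (rule F)
  obtain D :: "(('k list \<times> nat) multiset \<Rightarrow> 'k) monoid" and \<iota>
    where "comm_group D" "divisible_group D" "\<iota> \<in> hom (units_of K) D" "inj_on \<iota> (carrier (units_of K))"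
    using K.ex_divisible_hull_of_units .
  then interpret D: divisible_coefficients G "units_of K" D \<iota>
    by (intro divisible_coefficients.intro divisible_coefficients_axioms.intro group_cohomology_axioms)
  obtain d where d: "d \<in> Z2S G (units_of K)"
    "\<And>g h. g \<in> carrier G \<Longrightarrow> h \<in> carrier G \<Longrightarrow> d (g [^]\<^bsub>G\<^esub> r, h [^]\<^bsub>G\<^esub> r) = F.structure_cocycle (g, h)"
    using D.ex_pullback_root[OF G(2) r F.structure_cocycle_Z2S] by blast
  interpret P: twisted_algebra_pullback G K d F.structure_cocycle r "\<lambda>_. \<one>\<^bsub>K\<^esub>"
  proof
    show "d (g [^]\<^bsub>G\<^esub> r, h [^]\<^bsub>G\<^esub> r) \<otimes>\<^bsub>K\<^esub> \<one>\<^bsub>K\<^esub> = F.structure_cocycle (g, h) \<otimes>\<^bsub>K\<^esub> \<one>\<^bsub>K\<^esub> \<otimes>\<^bsub>K\<^esub> \<one>\<^bsub>K\<^esub>"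
      if "g \<in> carrier G" "h \<in> carrier G" for g h
      using d(2)[OF that] F.T.c_closed[OF that] by simp
  qed (use d(1) F.structure_cocycle_Z2S G(2) r in auto)
  have "F.\<theta> \<circ> P.\<rho> \<in> graded_algebra_iso G K (graded_power G r (twisted_group_algebra G K d)) F"
    by (rule graded_algebra_iso_trans[OF P.\<rho>_graded_iso F.\<theta>_iso])
  then show ?thesis using P.graded_field_F by blast
qed

end

theorem theorem6p13:
  fixes G :: "('g, 'a) monoid_scheme"
    and K :: "('k, 'b) ring_scheme"
    and F :: "('k, 'f, 'g) graded_algebra"
    and r :: nat
  defines "H \<equiv> H2S G (units_of K)"
  defines "Q \<equiv> H Mod torsion H"
  assumes "comm_group G" and "torsion_free G" and "finite_rank G"
    and "field K"
    and "graded_field G K F"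
    and "r > 0"
  shows "(\<exists>F' :: ('k, 'g \<Rightarrow> 'k, 'g) graded_algebra.
            graded_field G K F' \<and> graded_algebra_iso G K (graded_power G (int r) F') F \<noteq> {})
    \<and> (\<forall>C\<in>carrier H. divisible_by H r C)
    \<and> (\<exists>\<phi>. vector_space_action Q \<phi>)
    \<and> (\<not> finitely_generated G \<longrightarrow>
         (\<exists>\<C> \<subseteq> rcosets\<^bsub>H\<^esub> torsion H. noetherian_classes G K = \<Union>\<C>)
         \<and> (\<forall>\<phi>. vector_space_action Q \<phi> \<longrightarrow>
              (\<exists>\<L>. (\<forall>L\<in>\<L>. line (module_of_action Q \<phi>) L) \<and>
                   (\<lambda>C. torsion H #>\<^bsub>H\<^esub> C) ` noetherian_classes G K
                     = (\<Union>L\<in>\<L>. L - {\<one>\<^bsub>Q\<^esub>}))))"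
proof -
  interpret G: comm_group G by fact
  interpret K: field K by fact
  interpret C: group_cohomology G "units_of K"
    by (intro group_cohomology.intro G.comm_group_axioms K.units_comm_group)
  note G = \<open>comm_group G\<close> \<open>torsion_free G\<close> \<open>finite_rank G\<close>
  obtain D :: "(('k list \<times> nat) multiset \<Rightarrow> 'k) monoid" and \<iota>
    where "comm_group D" "divisible_group D" "\<iota> \<in> hom (units_of K) D" "inj_on \<iota> (carrier (units_of K))"
    using K.ex_divisible_hull_of_units .
  then interpret D: divisible_coefficients G "units_of K" D \<iota>
    by (intro divisible_coefficients.intro divisible_coefficients_axioms.intro C.group_cohomology_axioms)
  have divisible: "divisible_group H" unfolding H_def by (rule D.H2S_divisible[OF G(2)])
  have comm: "comm_group H" unfolding H_def by (rule C.H.comm_group_axioms)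
  interpret H: comm_group H by (rule comm)
  have N: "noetherian_classes G K \<subseteq> carrier H" unfolding noetherian_classes_def H_def by blast
  have N_pow: "x [^]\<^bsub>H\<^esub> n \<in> noetherian_classes G K \<longleftrightarrow> x \<in> noetherian_classes G K"
    if "x \<in> carrier H" "n \<noteq> 0" for x and n :: int
    using noetherian_classes_pow_iff[OF G \<open>field K\<close>] that unfolding H_def by blast
  have "\<exists>F' :: ('k, 'g \<Rightarrow> 'k, 'g) graded_algebra.
      graded_field G K F' \<and> graded_algebra_iso G K (graded_power G (int r) F') F \<noteq> {}"
    using ex_graded_root[OF G \<open>field K\<close> \<open>graded_field G K F\<close>, of "int r"] \<open>r > 0\<close> by simp
  moreover have "\<forall>C\<in>carrier H. divisible_by H r C"
    using divisible \<open>r > 0\<close> unfolding divisible_group_def by blast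
  moreover have "vector_space_action Q (\<lambda>q. \<lambda>x\<in>carrier Q. rat_pow Q q x)"
    unfolding Q_def
    by (intro vector_space_action_rat_pow H.abelian_FactGroup H.subgroup_torsion
        H.torsion_free_Mod_torsion H.divisible_Mod divisible)
  moreover have "\<exists>\<C> \<subseteq> rcosets\<^bsub>H\<^esub> torsion H. noetherian_classes G K = \<Union>\<C>"
    by (rule union_of_torsion_cosets[OF comm N N_pow])
  moreover have "\<exists>\<L>. (\<forall>L\<in>\<L>. line (module_of_action Q \<phi>) L) \<and>
      (\<lambda>C. torsion H #>\<^bsub>H\<^esub> C) ` noetherian_classes G K = (\<Union>L\<in>\<L>. L - {\<one>\<^bsub>Q\<^esub>})"
    if "\<not> finitely_generated G" "vector_space_action Q \<phi>" for \<phi>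
    using union_of_punctured_lines[OF comm N N_pow] one_notin_noetherian_classes[OF G \<open>field K\<close> that(1)] that(2)
    unfolding Q_def H_def by blast
  ultimately show ?thesis by blast
qed

end
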